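(* Let $M$ be an $n$-dimensional Hadamard manifold and let $p\in M$. Let $y_1,\ldots,y_m\in M$ and $a_1,\ldots,a_m\in\mathbb{R}$, and define $$f(z):=\max_{1\le i\le m}\{H_p(z,y_i)-a_i\},\qquad z\in M.$$ Then $\partial B^p f(x)\neq\varnothing$ for every $x\in M$. More precisely, for every $x\in M$, every active index $i\in\operatorname*{argmax}_{1\le j\le m}\{H_p(x,y_j)-a_j\}$ determines a $B^p$-subgradient $V_p(x,y_i)\in\partial B^p f(x)$.
   Context: A Hadamard manifold is a complete, simply connected Riemannian manifold of nonpositive sectional curvature; $d$ is its Riemannian distance and $\exp$ its exponential map (each $\exp_p$ is a diffeomorphism). Here $m\ge1$. For $q\in M$ and a unit vector $u\in T_qM$, $\gamma_{(q,u)}(t)=\exp_q(tu)$, $t\ge 0$, is the unit-speed geodesic ray from $q$ in direction $u$, and $B_u^q(x)=\lim_{t\to+\infty}\bigl(d(x,\gamma_{(q,u)}(t))-t\bigr)$ is the Busemann function. For a nonzero $u\in T_qM$, $B_u^q:=B_{u/\|u\|}^q$. Two unit-speed rays $\gamma,\sigma$ are asymptotic if $t\mapsto d(\gamma(t),\sigma(t))$ is bounded on $[0,\infty)$; for each ray and each point $q$ there is exactly one ray from $q$ asymptotic to it. Busemann coupling with base point $p$: $H_p:M\times M\to\mathbb{R}$, $H_p(z,y)=d(p,z)\,B^p_{-\exp_p^{-1}z}(y)$ if $z\ne p$, and $H_p(p,y)=0$. For $x\in M$ and $v\in T_xM\setminus\{0\}$, $\eta_{p,x}(v)\in T_pM$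 is the unique unit vector such that $\gamma_{(p,\eta_{p,x}(v))}$ and $\gamma_{(x,-v/\|v\|)}$ are asymptotic; $Y_p(x,v):=\exp_p(-\|v\|\,\eta_{p,x}(v))$ for $v\neq 0$ and $Y_p(x,0):=p$. For $y\ne p$, let $\eta_p(y):=-\exp_p^{-1}y/d(p,y)$ and let $u_{x,y}\in T_xM$ be the unique unit vector such that $\gamma_{(p,\eta_p(y))}$ and $\gamma_{(x,-u_{x,y})}$ are asymptotic; $V_p(x,y):=d(p,y)\,u_{x,y}\in T_xM$ for $y\ne p$ and $V_p(x,p):=0$. $B^p$-subdifferential: $\partial B^p f(x)$ is the set of all $v\in T_xM$ (called $B^p$-subgradients) such that $f(z)\ge f(x)+H_p(z,Y_p(x,v))-H_p(x,Y_p(x,v))$ for all $z\in M$. *)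

theory Defs
  imports "HOL-Analysis.Analysis"
begin

section \<open>Smooth manifolds\<close>

text \<open>
  The underlying space is the whole of a type \<open>'a\<close>; the model space is a Euclidean space \<open>'e\<close>, so
  the dimension of the manifold is \<open>DIM('e)\<close>. A chart is a pair of its domain and its coordinate
  map; the values of the coordinate map outside the domain are irrelevant.
\<close>

type_synonym ('a, 'e) chart = "'a set \<times> ('a \<Rightarrow> 'e)"

fun ck_on :: "nat \<Rightarrow> 'e::real_normed_vector set \<Rightarrow> ('e \<Rightarrow> 'f::real_normed_vector) \<Rightarrow> bool" where
  "ck_on 0 S f \<longleftrightarrow> continuous_on S f"
| "ck_on (Suc k) S f \<longleftrightarrow> (\<forall>x\<in>S. f differentiable (at x)) \<and>
     (\<forall>v. ck_on k S (\<lambda>x. frechet_derivative f (at x) v))"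

text \<open>Only used for open \<open>S\<close> in finite-dimensional spaces.\<close>

definition smooth_on :: "'e::real_normed_vector set \<Rightarrow> ('e \<Rightarrow> 'f::real_normed_vector) \<Rightarrow> bool" where
  "smooth_on S f \<longleftrightarrow> (\<forall>k. ck_on k S f)"

definition chart_inv :: "('a, 'e) chart \<Rightarrow> 'e \<Rightarrow> 'a" where
  "chart_inv c = inv_into (fst c) (snd c)"

definition is_chart :: "('a::topological_space, 'e::euclidean_space) chart \<Rightarrow> bool" where
  "is_chart c \<longleftrightarrow> open (fst c) \<and> open (snd c ` fst c) \<and>
     homeomorphism (fst c) (snd c ` fst c) (snd c) (chart_inv c)"

definition transition :: "('a, 'e) chart \<Rightarrow> ('a, 'e) chart \<Rightarrow> 'e \<Rightarrow> 'e" where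
  "transition c c' = snd c' \<circ> chart_inv c"

definition smooth_atlas :: "('a::topological_space, 'e::euclidean_space) chart set \<Rightarrow> bool" where
  "smooth_atlas A \<longleftrightarrow> (\<forall>c\<in>A. is_chart c) \<and> (\<Union>c\<in>A. fst c) = UNIV \<and>
     (\<forall>c\<in>A. \<forall>c'\<in>A. smooth_on (snd c ` (fst c \<inter> fst c')) (transition c c'))"


section \<open>Tangent vectors\<close>

text \<open>
  A tangent vector at \<open>x\<close> is the family of its coordinate vectors in all charts of the atlas around
  \<open>x\<close>, related by the derivatives of the transition maps; the family is \<open>0\<close> at all other indices,
  which makes the representation unique.
\<close>

type_synonym ('a, 'e) tvec = "('a, 'e) chart \<Rightarrow> 'e"

definition tangent_space ::
    "('a::topological_space, 'e::euclidean_space) chart set \<Rightarrow> 'a \<Rightarrow> ('a, 'e) tvec set" where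
  "tangent_space A x = {v.
     (\<forall>c. \<not> (c \<in> A \<and> x \<in> fst c) \<longrightarrow> v c = 0) \<and>
     (\<forall>c\<in>A. \<forall>c'\<in>A. x \<in> fst c \<and> x \<in> fst c' \<longrightarrow>
        v c' = frechet_derivative (transition c c') (at (snd c x)) (v c))}"

definition tzero :: "('a, 'e::real_vector) tvec" where
  "tzero = (\<lambda>c. 0)"

definition tadd :: "('a, 'e::real_vector) tvec \<Rightarrow> ('a, 'e) tvec \<Rightarrow> ('a, 'e) tvec" where
  "tadd v w = (\<lambda>c. v c + w c)"

definition tscale :: "real \<Rightarrow> ('a, 'e::real_vector) tvec \<Rightarrow> ('a, 'e) tvec" where
  "tscale r v = (\<lambda>c. r *\<^sub>R v c)"

text \<open>The tangent vector at \<open>x\<close> whose coordinate vector in the chart \<open>c\<close> is \<open>w\<close>.\<close>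

definition tvec_of :: "('a::topological_space, 'e::euclidean_space) chart set \<Rightarrow>
    ('a, 'e) chart \<Rightarrow> 'a \<Rightarrow> 'e \<Rightarrow> ('a, 'e) tvec" where
  "tvec_of A c x w = (\<lambda>c'. if c' \<in> A \<and> x \<in> fst c'
     then frechet_derivative (transition c c') (at (snd c x)) w else 0)"

definition velocity :: "('a::topological_space, 'e::euclidean_space) chart set \<Rightarrow>
    (real \<Rightarrow> 'a) \<Rightarrow> real \<Rightarrow> ('a, 'e) tvec" where
  "velocity A \<gamma> t = (\<lambda>c. if c \<in> A \<and> \<gamma> t \<in> fst c
     then vector_derivative (snd c \<circ> \<gamma>) (at t) else 0)"


section \<open>Riemannian metrics, lengths and the Riemannian distance\<close>

type_synonym ('a, 'e) metric = "'a \<Rightarrow> ('a, 'e) tvec \<Rightarrow> ('a, 'e) tvec \<Rightarrow> real"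

definition metric_coord :: "('a::topological_space, 'e::euclidean_space) chart set \<Rightarrow>
    ('a, 'e) metric \<Rightarrow> ('a, 'e) chart \<Rightarrow> 'e \<Rightarrow> 'e \<Rightarrow> 'e \<Rightarrow> real" where
  "metric_coord A g c y u w =
     g (chart_inv c y) (tvec_of A c (chart_inv c y) u) (tvec_of A c (chart_inv c y) w)"

definition riemannian_metric :: "('a::topological_space, 'e::euclidean_space) chart set \<Rightarrow>
    ('a, 'e) metric \<Rightarrow> bool" where
  "riemannian_metric A g \<longleftrightarrow>
     (\<forall>x. \<forall>u\<in>tangent_space A x. \<forall>v\<in>tangent_space A x. \<forall>w\<in>tangent_space A x. \<forall>r.
        g x u v = g x v u \<and>
        g x (tadd u v) w = g x u w + g x v w \<and>
        g x (tscale r u) v = r * g x u v) \<and>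
     (\<forall>x. \<forall>u\<in>tangent_space A x. u \<noteq> tzero \<longrightarrow> 0 < g x u u) \<and>
     (\<forall>c\<in>A. \<forall>u w. smooth_on (snd c ` fst c) (\<lambda>y. metric_coord A g c y u w))"

definition tnorm :: "('a, 'e) metric \<Rightarrow> 'a \<Rightarrow> ('a, 'e) tvec \<Rightarrow> real" where
  "tnorm g x v = sqrt (g x v v)"

text \<open>\<open>C\<^sup>1\<close> on a closed interval, with one-sided derivatives at the end points.\<close>

definition c1_curve :: "('a::topological_space, 'e::euclidean_space) chart set \<Rightarrow>
    real \<Rightarrow> real \<Rightarrow> (real \<Rightarrow> 'a) \<Rightarrow> bool" where
  "c1_curve A a b \<gamma> \<longleftrightarrow> continuous_on {a..b} \<gamma> \<and>
     (\<forall>c\<in>A. (\<forall>t\<in>{a..b} \<inter> \<gamma> -` fst c. (snd c \<circ> \<gamma>) differentiable (at t within {a..b})) \<and>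
        continuous_on ({a..b} \<inter> \<gamma> -` fst c)
          (\<lambda>t. vector_derivative (snd c \<circ> \<gamma>) (at t within {a..b})))"

definition piecewise_c1_curve :: "('a::topological_space, 'e::euclidean_space) chart set \<Rightarrow>
    (real \<Rightarrow> 'a) \<Rightarrow> bool" where
  "piecewise_c1_curve A \<gamma> \<longleftrightarrow> continuous_on {0..1} \<gamma> \<and>
     (\<exists>S. finite S \<and>
        (\<forall>a b. 0 \<le> a \<and> a < b \<and> b \<le> 1 \<and> {a<..<b} \<inter> S = {} \<longrightarrow> c1_curve A a b \<gamma>))"

definition curve_length :: "('a::topological_space, 'e::euclidean_space) chart set \<Rightarrow>
    ('a, 'e) metric \<Rightarrow> (real \<Rightarrow> 'a) \<Rightarrow> real" where
  "curve_length A g \<gamma> = integral {0..1} (\<lambda>t. tnorm g (\<gamma> t) (velocity A \<gamma> t))"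

definition riemannian_distance :: "('a::topological_space, 'e::euclidean_space) chart set \<Rightarrow>
    ('a, 'e) metric \<Rightarrow> 'a \<Rightarrow> 'a \<Rightarrow> real" where
  "riemannian_distance A g x y =
     Inf {curve_length A g \<gamma> | \<gamma>. piecewise_c1_curve A \<gamma> \<and> \<gamma> 0 = x \<and> \<gamma> 1 = y}"


section \<open>Levi-Civita connection, sectional curvature, geodesics\<close>

text \<open>
  In the chart \<open>c\<close>, \<open>christoffel A g c y u w\<close> is the coordinate vector with components
  \<open>\<Sum> i j. \<Gamma>\<^sup>k\<^sub>i\<^sub>j(y) u\<^sup>i w\<^sup>j\<close>, characterised by the Koszul formula for constant coordinate
  vector fields.
\<close>

definition christoffel :: "('a::topological_space, 'e::euclidean_space) chart set \<Rightarrow>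
    ('a, 'e) metric \<Rightarrow> ('a, 'e) chart \<Rightarrow> 'e \<Rightarrow> 'e \<Rightarrow> 'e \<Rightarrow> 'e" where
  "christoffel A g c y u w = (THE k. \<forall>z. 2 * metric_coord A g c y k z =
       frechet_derivative (\<lambda>y. metric_coord A g c y w z) (at y) u
     + frechet_derivative (\<lambda>y. metric_coord A g c y u z) (at y) w
     - frechet_derivative (\<lambda>y. metric_coord A g c y u w) (at y) z)"

text \<open>
  Coordinate form of \<open>R(u,w)z = \<nabla>\<^sub>u\<nabla>\<^sub>w z - \<nabla>\<^sub>w\<nabla>\<^sub>u z - \<nabla>\<^bsub>[u,w]\<^esub> z\<close> for constant coordinate fields,
  using \<open>\<nabla>\<^sub>u z = D\<^sub>u z + \<Gamma>(u,z)\<close>.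
\<close>

definition curvature_coord :: "('a::topological_space, 'e::euclidean_space) chart set \<Rightarrow>
    ('a, 'e) metric \<Rightarrow> ('a, 'e) chart \<Rightarrow> 'e \<Rightarrow> 'e \<Rightarrow> 'e \<Rightarrow> 'e \<Rightarrow> 'e" where
  "curvature_coord A g c y u w z =
       frechet_derivative (\<lambda>y. christoffel A g c y w z) (at y) u
     - frechet_derivative (\<lambda>y. christoffel A g c y u z) (at y) w
     + christoffel A g c y u (christoffel A g c y w z)
     - christoffel A g c y w (christoffel A g c y u z)"

definition sectional_curvature :: "('a::topological_space, 'e::euclidean_space) chart set \<Rightarrow>
    ('a, 'e) metric \<Rightarrow> ('a, 'e) chart \<Rightarrow> 'e \<Rightarrow> 'e \<Rightarrow> 'e \<Rightarrow> real" where
  "sectional_curvature A g c y u w =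
     metric_coord A g c y (curvature_coord A g c y u w w) u /
     (metric_coord A g c y u u * metric_coord A g c y w w - (metric_coord A g c y u w)\<^sup>2)"

definition nonpositive_curvature :: "('a::topological_space, 'e::euclidean_space) chart set \<Rightarrow>
    ('a, 'e) metric \<Rightarrow> bool" where
  "nonpositive_curvature A g \<longleftrightarrow> (\<forall>c\<in>A. \<forall>y\<in>snd c ` fst c. \<forall>u w.
     u \<noteq> w \<and> independent {u, w} \<longrightarrow> sectional_curvature A g c y u w \<le> 0)"

definition geodesic_on :: "('a::topological_space, 'e::euclidean_space) chart set \<Rightarrow>
    ('a, 'e) metric \<Rightarrow> real set \<Rightarrow> (real \<Rightarrow> 'a) \<Rightarrow> bool" where
  "geodesic_on A g J \<gamma> \<longleftrightarrow> continuous_on J \<gamma> \<and>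
     (\<forall>c\<in>A. \<forall>t\<in>J. \<gamma> t \<in> fst c \<longrightarrow>
        (snd c \<circ> \<gamma>) differentiable (at t) \<and>
        ((\<lambda>s. vector_derivative (snd c \<circ> \<gamma>) (at s)) has_vector_derivative
           - christoffel A g c (snd c (\<gamma> t))
               (vector_derivative (snd c \<circ> \<gamma>) (at t)) (vector_derivative (snd c \<circ> \<gamma>) (at t)))
          (at t))"

definition exp_map :: "('a::topological_space, 'e::euclidean_space) chart set \<Rightarrow>
    ('a, 'e) metric \<Rightarrow> 'a \<Rightarrow> ('a, 'e) tvec \<Rightarrow> 'a" where
  "exp_map A g x v = (THE y. \<exists>J \<gamma>. open J \<and> connected J \<and> {0..1} \<subseteq> J \<and> geodesic_on A g J \<gamma> \<and>
     \<gamma> 0 = x \<and> velocity A \<gamma> 0 = v \<and> \<gamma> 1 = y)"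

definition exp_inv :: "('a::topological_space, 'e::euclidean_space) chart set \<Rightarrow>
    ('a, 'e) metric \<Rightarrow> 'a \<Rightarrow> 'a \<Rightarrow> ('a, 'e) tvec" where
  "exp_inv A g x = inv_into (tangent_space A x) (exp_map A g x)"


section \<open>Hadamard manifolds\<close>

text \<open>
  The metric of the type \<open>'a\<close> is required to be the Riemannian distance, so that completeness is
  provided by the type class, and the topology of \<open>'a\<close> is the one induced by that distance.
\<close>

definition hadamard_manifold :: "('a::polish_space, 'e::euclidean_space) chart set \<Rightarrow>
    ('a, 'e) metric \<Rightarrow> bool" where
  "hadamard_manifold A g \<longleftrightarrow>
     smooth_atlas A \<and> riemannian_metric A g \<and>
     (\<forall>x y. dist x y = riemannian_distance A g x y) \<and>
     simply_connected (UNIV :: 'a set) \<and>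
     nonpositive_curvature A g"


section \<open>Rays, Busemann functions and the Busemann coupling\<close>

definition ray :: "('a::topological_space, 'e::euclidean_space) chart set \<Rightarrow>
    ('a, 'e) metric \<Rightarrow> 'a \<Rightarrow> ('a, 'e) tvec \<Rightarrow> real \<Rightarrow> 'a" where
  "ray A g q u t = exp_map A g q (tscale t u)"

definition asymptotic :: "(real \<Rightarrow> 'a::metric_space) \<Rightarrow> (real \<Rightarrow> 'a) \<Rightarrow> bool" where
  "asymptotic \<gamma> \<sigma> \<longleftrightarrow> bounded ((\<lambda>t. dist (\<gamma> t) (\<sigma> t)) ` {0..})"

definition unit_vectors :: "('a::topological_space, 'e::euclidean_space) chart set \<Rightarrow>
    ('a, 'e) metric \<Rightarrow> 'a \<Rightarrow> ('a, 'e) tvec set" where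
  "unit_vectors A g x = {u \<in> tangent_space A x. tnorm g x u = 1}"

definition normalized :: "('a, 'e::real_vector) metric \<Rightarrow> 'a \<Rightarrow> ('a, 'e) tvec \<Rightarrow> ('a, 'e) tvec" where
  "normalized g x v = tscale (1 / tnorm g x v) v"

definition busemann :: "('a::metric_space, 'e::euclidean_space) chart set \<Rightarrow>
    ('a, 'e) metric \<Rightarrow> 'a \<Rightarrow> ('a, 'e) tvec \<Rightarrow> 'a \<Rightarrow> real" where
  "busemann A g q u x = Lim at_top (\<lambda>t. dist x (ray A g q (normalized g q u) t) - t)"

definition coupling :: "('a::metric_space, 'e::euclidean_space) chart set \<Rightarrow>
    ('a, 'e) metric \<Rightarrow> 'a \<Rightarrow> 'a \<Rightarrow> 'a \<Rightarrow> real" where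
  "coupling A g p z y =
     (if z = p then 0 else dist p z * busemann A g p (tscale (- 1) (exp_inv A g p z)) y)"


section \<open>The subdifferential\<close>

definition eta_dir :: "('a::metric_space, 'e::euclidean_space) chart set \<Rightarrow>
    ('a, 'e) metric \<Rightarrow> 'a \<Rightarrow> 'a \<Rightarrow> ('a, 'e) tvec \<Rightarrow> ('a, 'e) tvec" where
  "eta_dir A g p x v = (THE e. e \<in> unit_vectors A g p \<and>
     asymptotic (ray A g p e) (ray A g x (tscale (- 1) (normalized g x v))))"

definition Y_point :: "('a::metric_space, 'e::euclidean_space) chart set \<Rightarrow>
    ('a, 'e) metric \<Rightarrow> 'a \<Rightarrow> 'a \<Rightarrow> ('a, 'e) tvec \<Rightarrow> 'a" where
  "Y_point A g p x v =
     (if v = tzero then p else exp_map A g p (tscale (- tnorm g x v) (eta_dir A g p x v)))"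

definition eta_point :: "('a::metric_space, 'e::euclidean_space) chart set \<Rightarrow>
    ('a, 'e) metric \<Rightarrow> 'a \<Rightarrow> 'a \<Rightarrow> ('a, 'e) tvec" where
  "eta_point A g p y = tscale (- (1 / dist p y)) (exp_inv A g p y)"

definition u_dir :: "('a::metric_space, 'e::euclidean_space) chart set \<Rightarrow>
    ('a, 'e) metric \<Rightarrow> 'a \<Rightarrow> 'a \<Rightarrow> 'a \<Rightarrow> ('a, 'e) tvec" where
  "u_dir A g p x y = (THE u. u \<in> unit_vectors A g x \<and>
     asymptotic (ray A g p (eta_point A g p y)) (ray A g x (tscale (- 1) u)))"

definition V_vec :: "('a::metric_space, 'e::euclidean_space) chart set \<Rightarrow>
    ('a, 'e) metric \<Rightarrow> 'a \<Rightarrow> 'a \<Rightarrow> 'a \<Rightarrow> ('a, 'e) tvec" where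
  "V_vec A g p x y = (if y = p then tzero else tscale (dist p y) (u_dir A g p x y))"

definition subdifferential :: "('a::metric_space, 'e::euclidean_space) chart set \<Rightarrow>
    ('a, 'e) metric \<Rightarrow> 'a \<Rightarrow> ('a \<Rightarrow> real) \<Rightarrow> 'a \<Rightarrow> ('a, 'e) tvec set" where
  "subdifferential A g p f x = {v \<in> tangent_space A x. \<forall>z.
     f z \<ge> f x + coupling A g p z (Y_point A g p x v) - coupling A g p x (Y_point A g p x v)}"

end

theory Submission
  imports Defs
begin

text \<open>
  Everything reduces to \<open>Y\<^sub>p(x, V\<^sub>p(x, y)) = y\<close>: then \<open>H\<^sub>p(\<cdot>, y\<^sub>i) - a\<^sub>i\<close>, which lies below \<open>f\<close> and touches it
  at \<open>x\<close> when \<open>i\<close> is active, is exactly the support function demanded of the subgradient \<open>V\<^sub>p(x, y\<^sub>i)\<close>, and no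
  property of Busemann functions is needed. The identity says that each ray has exactly one asymptotic ray from
  every point. This follows from three facts: \<open>exp\<^sub>x\<close> is bijective, it does not decrease distances, and
  \<open>d(exp\<^sub>x(su), exp\<^sub>x(sv)) \<le> s d(exp\<^sub>x u, exp\<^sub>x v)\<close> for \<open>0 \<le> s \<le> 1\<close>.

  In a chart, the length of the difference of two nearby geodesics is convex in time up to an error of smaller
  order than their distance, by nonpositive curvature. Interpolating many geodesics between two given short ones
  and summing removes the error, so the distance between short geodesics is convex. Hence the third fact holds for
  \<open>u\<close> near \<open>v\<close>, and letting \<open>s\<close> tend to 0 shows that \<open>exp\<^sub>x\<close> is locally expanding. A locally expanding open map onto a
  simply connected manifold lifts Lipschitz paths, so it is a covering and therefore bijective; the local
  inequality then integrates along almost minimizing curves. Minimizing geodesics (Hopf-Rinow) and Jacobi fields are not used.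
\<close>

section \<open>Calculus\<close>

text \<open>Jacobi fields would require differentiating geodesics with respect to their initial
  data. Subtracting two geodesics in coordinates needs only existence, uniqueness and Lipschitz
  dependence on the data. The price is an error \<open>\<epsilon> * \<kappa>\<close>, where
  \<open>\<kappa>\<close> bounds the gap between the two geodesics. With N interpolated geodesics
  each gap is of order 1/N, so the N errors add up to a fixed multiple of \<open>\<epsilon>\<close>,
  and \<open>\<epsilon>\<close> is arbitrary.

  The distance is an infimum of lengths, so a comparison of \<open>dist\<close> with a coordinate
  norm has to be proved for all piecewise C1 curves, including those that leave the chart.

  Openness of the exponential map comes from invariance of domain, applied to a continuous locally
  injective map, rather than from inverting a derivative.

  For the existence of an asymptotic ray from x, the contraction is centred at a far point of the
  given ray: this point is the common start of the reversed geodesics to the origin of the ray and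
  to x.\<close>

lemma real_induct [consumes 1, case_names base step lim]:
  fixes a b :: real
  assumes "a \<le> b" and base: "P a"
    and step: "\<And>t. a \<le> t \<Longrightarrow> t < b \<Longrightarrow> (\<And>s. s \<in> {a..t} \<Longrightarrow> P s) \<Longrightarrow> \<exists>e>t. \<forall>s. t < s \<and> s < e \<and> s \<le> b \<longrightarrow> P s"
    and lim: "\<And>t. a < t \<Longrightarrow> t \<le> b \<Longrightarrow> (\<And>s. s \<in> {a..<t} \<Longrightarrow> P s) \<Longrightarrow> P t"
    and t: "t \<in> {a..b}"
  shows "P t"
proof (rule ccontr)
  assume "\<not> P t"
  define B where "B = {s \<in> {a..b}. \<not> P s}"
  have ne: "B \<noteq> {}" "bdd_below B" using t \<open>\<not> P t\<close> by (auto simp: B_def bdd_below_def)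
  \<comment> \<open>The infimum of the failures. By \<open>base\<close> or \<open>lim\<close> the
    property holds at it, and \<open>step\<close> then pushes the property past it, which
    contradicts the infimum.\<close>
  define t0 where "t0 = Inf B"
  have t0: "a \<le> t0" "t0 \<le> b"
    using ne by (auto simp: t0_def B_def intro!: cInf_greatest cInf_lower2)
  have below: "P s" if "s \<in> {a..<t0}" for s
    using that t0 cInf_lower[OF _ ne(2), of s] by (force simp: t0_def B_def)
  have "P t0"
  proof (cases "t0 = a")
    case False with lim[of t0] below t0 show ?thesis by auto
  qed (use base in simp)
  then have upto: "P s" if "s \<in> {a..t0}" for s using below that by (cases "s = t0") auto
  have "t0 \<noteq> b" using upto t \<open>\<not> P t\<close> by auto
  then obtain e where e: "e > t0" "\<forall>s. t0 < s \<and> s < e \<and> s \<le> b \<longrightarrow> P s"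
    using step[of t0] upto t0 by auto
  have "e \<le> t0"
    unfolding t0_def
  proof (rule cInf_greatest[OF ne(1)])
    fix s assume "s \<in> B"
    then show "e \<le> s" using e(2) upto[of s] by (force simp: B_def)
  qed
  with e(1) show False by simp
qed

text \<open>Continuity of the derivative is asked for one direction at a time, which is the form
  that \<open>smooth_on\<close> delivers. On a finite-dimensional domain this amounts to continuity
  in operator norm, recovered in \<open>c1_fun_blinfun_derivative\<close>.\<close>

definition c1_fun :: "'e::euclidean_space set \<Rightarrow> ('e \<Rightarrow> 'f::real_normed_vector) \<Rightarrow> bool" where
  "c1_fun U f \<longleftrightarrow> (\<exists>f'. (\<forall>x\<in>U. (f has_derivative f' x) (at x)) \<and> (\<forall>v. continuous_on U (\<lambda>x. f' x v)))"

lemma c1_funI: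
  assumes "\<And>x. x \<in> U \<Longrightarrow> (f has_derivative f' x) (at x)" "\<And>v. continuous_on U (\<lambda>x. f' x v)"
  shows "c1_fun U f"
  using assms unfolding c1_fun_def by blast

lemma c1_fun_has_derivative:
  assumes "c1_fun U f" "x \<in> U"
  shows "(f has_derivative frechet_derivative f (at x)) (at x)"
  using assms unfolding c1_fun_def by (metis differentiable_def frechet_derivative_works)

lemma c1_fun_continuous_derivative:
  assumes "c1_fun U f"
  shows "continuous_on U (\<lambda>x. frechet_derivative f (at x) v)"
proof -
  obtain f' where f': "\<forall>x\<in>U. (f has_derivative f' x) (at x)" "\<forall>v. continuous_on U (\<lambda>x. f' x v)"
    using assms unfolding c1_fun_def by blast
  show ?thesis
    by (rule continuous_on_eq[OF f'(2)[rule_format, of v]]) (use f'(1) frechet_derivative_at in fastforce)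
qed

lemma smooth_on_c1_fun: "smooth_on U f \<Longrightarrow> c1_fun U f" for f :: "'e::euclidean_space \<Rightarrow> 'f::real_normed_vector"
proof (rule c1_funI)
  assume s: "smooth_on U f"
  then have "ck_on (Suc 0) U f" by (auto simp: smooth_on_def)
  then show "continuous_on U (\<lambda>x. frechet_derivative f (at x) v)" for v by simp
  show "(f has_derivative frechet_derivative f (at x)) (at x)" if "x \<in> U" for x
    using \<open>ck_on (Suc 0) U f\<close> that by (simp add: frechet_derivative_works[symmetric])
qed

lemma smooth_on_derivative:
  assumes "smooth_on U f" shows "smooth_on U (\<lambda>x. frechet_derivative f (at x) v)"
  unfolding smooth_on_def
proof
  fix k have "ck_on (Suc k) U f" using assms by (auto simp: smooth_on_def)
  then show "ck_on k U (\<lambda>x. frechet_derivative f (at x) v)" by simp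
qed

lemma c1_fun_continuous: "c1_fun U f \<Longrightarrow> continuous_on U f"
  unfolding c1_fun_def by (meson continuous_at_imp_continuous_on has_derivative_continuous)

lemma c1_fun_const: "c1_fun U (\<lambda>_. c)"
  by (rule c1_funI[where f'="\<lambda>_ _. 0"]) auto

lemma c1_fun_linear:
  assumes f: "c1_fun U f" and "bounded_linear L"
  shows "c1_fun U (\<lambda>x. L (f x))"
  by (rule c1_funI[OF bounded_linear.has_derivative[OF assms(2) c1_fun_has_derivative[OF f]]])
     (auto intro!: bounded_linear.continuous_on[OF assms(2)] c1_fun_continuous_derivative f)

lemma c1_fun_bilinear:
  assumes f: "c1_fun U f" and g: "c1_fun U g" and "bounded_bilinear pr"
  shows "c1_fun U (\<lambda>x. pr (f x) (g x))"
  by (rule c1_funI[OF bounded_bilinear.FDERIV[OF assms(3) c1_fun_has_derivative[OF f] c1_fun_has_derivative[OF g]]])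
    (auto intro!: continuous_on_add bounded_bilinear.continuous_on[OF assms(3)] c1_fun_continuous_derivative
        c1_fun_continuous[OF f] c1_fun_continuous[OF g] f g)

lemma c1_fun_add:
  assumes f: "c1_fun U f" and g: "c1_fun U g"
  shows "c1_fun U (\<lambda>x. f x + g x)"
  by (rule c1_funI[OF has_derivative_add[OF c1_fun_has_derivative[OF f] c1_fun_has_derivative[OF g]]])
    (auto intro!: continuous_on_add c1_fun_continuous_derivative f g)

lemma c1_fun_uminus: "c1_fun U f \<Longrightarrow> c1_fun U (\<lambda>x. - f x)"
  by (erule c1_fun_linear) (auto intro: bounded_linear_minus bounded_linear_ident)

lemma c1_fun_diff:
  assumes f: "c1_fun U f" and g: "c1_fun U g"
  shows "c1_fun U (\<lambda>x. f x - g x)"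
  using c1_fun_add[OF f c1_fun_uminus[OF g]] by simp

lemma c1_fun_sum: "(\<And>i. i \<in> I \<Longrightarrow> c1_fun U (f i)) \<Longrightarrow> c1_fun U (\<lambda>x. \<Sum>i\<in>I. f i x)"
  by (induction I rule: infinite_finite_induct) (auto intro!: c1_fun_const c1_fun_add)

lemma c1_fun_cong:
  assumes f: "c1_fun U f" and "open U" "\<And>x. x \<in> U \<Longrightarrow> f x = g x"
  shows "c1_fun U g"
proof (rule c1_funI)
  show "(g has_derivative frechet_derivative f (at x)) (at x)" if "x \<in> U" for x
    by (rule has_derivative_transform_within_open[OF c1_fun_has_derivative[OF f that] assms(2) that assms(3)])
qed (rule c1_fun_continuous_derivative[OF f])

lemma c1_fun_blinfun_derivative:
  fixes f :: "'e::euclidean_space \<Rightarrow> 'f::real_normed_vector"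
  assumes f: "c1_fun U f"
  obtains f' where "\<And>x. x \<in> U \<Longrightarrow> (f has_derivative blinfun_apply (f' x)) (at x)" "continuous_on U f'"
proof
  let ?f' = "\<lambda>x. Blinfun (frechet_derivative f (at x))"
  have ap: "blinfun_apply (?f' x) = frechet_derivative f (at x)" if "x \<in> U" for x
    using c1_fun_has_derivative[OF f that] has_derivative_bounded_linear bounded_linear_Blinfun_apply by blast
  show "(f has_derivative blinfun_apply (?f' x)) (at x)" if "x \<in> U" for x
    using ap[OF that] c1_fun_has_derivative[OF f that] by simp
  show "continuous_on U ?f'"
    by (rule continuous_on_blinfun_componentwise, rule continuous_on_eq[OF c1_fun_continuous_derivative[OF f]])
      (simp add: ap)
qed

section \<open>Families of linear and bilinear maps as operator-valued functions\<close>

lemma blinfun_scaleR_inner_sum: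
  fixes T :: "'e::euclidean_space \<Rightarrow> 'f::real_normed_vector"
  assumes "linear T"
  shows "blinfun_apply (\<Sum>i\<in>Basis. blinfun_scaleR_left (T i) o\<^sub>L blinfun_inner_left i) u = T u"
proof -
  have "T u = T (\<Sum>i\<in>Basis. (u \<bullet> i) *\<^sub>R i)" by (simp add: euclidean_representation)
  also have "\<dots> = (\<Sum>i\<in>Basis. (u \<bullet> i) *\<^sub>R T i)" by (simp add: linear_sum[OF assms] linear_cmul[OF assms])
  finally show ?thesis by (simp add: blinfun.sum_left)
qed

text \<open>The expansion over the basis writes the operator as a finite sum whose terms depend on
  \<open>y\<close> only through the values \<open>T y i\<close>, so regularity for each fixed vector
  suffices.\<close>

lemma c1_fun_blinfunI:
  fixes T :: "'e::euclidean_space \<Rightarrow> 'g::euclidean_space \<Rightarrow> 'f::real_normed_vector"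
  assumes "\<And>y. y \<in> U \<Longrightarrow> linear (T y)" and T: "\<And>u. c1_fun U (\<lambda>y. T y u)"
  obtains B :: "'e \<Rightarrow> 'g \<Rightarrow>\<^sub>L 'f" where "c1_fun U B" "\<And>y u. y \<in> U \<Longrightarrow> blinfun_apply (B y) u = T y u"
proof
  let ?B = "\<lambda>y. \<Sum>i\<in>Basis. blinfun_scaleR_left (T y i) o\<^sub>L blinfun_inner_left i"
  show "c1_fun U ?B"
    by (intro c1_fun_sum c1_fun_linear[OF T] bounded_linear_compose[OF bounded_bilinear.bounded_linear_left[OF bounded_bilinear_blinfun_compose] bounded_linear_blinfun_scaleR_left])
  show "blinfun_apply (?B y) u = T y u" if "y \<in> U" for y u
    using blinfun_scaleR_inner_sum assms(1)[OF that] by blast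
qed

text \<open>Currying: the linear case is applied to the last argument for fixed \<open>u\<close>,
  and then once more to \<open>u\<close> with values in the operator space.\<close>

lemma c1_fun_blinfun2I:
  fixes T :: "'e::euclidean_space \<Rightarrow> 'g::euclidean_space \<Rightarrow> 'h::euclidean_space \<Rightarrow> 'f::real_normed_vector"
  assumes l1: "\<And>y u. y \<in> U \<Longrightarrow> linear (T y u)" and l2: "\<And>y w. y \<in> U \<Longrightarrow> linear (\<lambda>u. T y u w)"
    and "open U" and T: "\<And>u w. c1_fun U (\<lambda>y. T y u w)"
  obtains B :: "'e \<Rightarrow> 'g \<Rightarrow>\<^sub>L 'h \<Rightarrow>\<^sub>L 'f" where "c1_fun U B" "\<And>y u w. y \<in> U \<Longrightarrow> blinfun_apply (blinfun_apply (B y) u) w = T y u w"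
proof -
  have "\<exists>B. c1_fun U B \<and> (\<forall>y\<in>U. \<forall>w. blinfun_apply (B y) w = T y u w)" for u
    using c1_fun_blinfunI[of U "\<lambda>y. T y u"] l1 T by metis
  then obtain B where B: "\<And>u. c1_fun U (B u)" "\<And>u y w. y\<in>U \<Longrightarrow> blinfun_apply (B u y) w = T y u w"
    by metis
  have lin: "linear (\<lambda>u. B u y)" if "y \<in> U" for y
    by (rule linearI; rule blinfun_eqI)
      (auto simp: B[OF] that blinfun.add_left blinfun.scaleR_left linear_add[OF l2[OF that]] linear_cmul[OF l2[OF that]])
  obtain C where "c1_fun U C" "\<And>y u. y \<in> U \<Longrightarrow> blinfun_apply (C y) u = B u y"
    using c1_fun_blinfunI[of U "\<lambda>y u. B u y"] lin B(1) by blast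
  then show ?thesis using that B(2) by metis
qed

text \<open>Uniform continuity of the derivative on a compact set makes the first-order remainder
  small uniformly in the base point; convexity keeps the segments inside. Applied to the Christoffel
  symbols, this bounds the deviation of a difference of geodesics from a Jacobi field.\<close>

lemma c1_fun_uniform_remainder:
  fixes f :: "'e::euclidean_space \<Rightarrow> 'f::real_normed_vector"
  assumes der: "\<And>x. x \<in> K \<Longrightarrow> (f has_derivative blinfun_apply (f' x)) (at x)"
    and cont: "continuous_on K f'" and K: "compact K" "convex K" and "\<epsilon> > 0"
  obtains \<eta> where "\<eta> > 0"
    "\<And>x y. x \<in> K \<Longrightarrow> y \<in> K \<Longrightarrow> norm (y - x) \<le> \<eta> \<Longrightarrow> norm (f y - f x - blinfun_apply (f' x) (y - x)) \<le> \<epsilon> * norm (y - x)"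
proof -
  have "uniformly_continuous_on K f'" using cont K by (simp add: compact_uniformly_continuous)
  then obtain d where d: "d > 0" "\<And>x y. x \<in> K \<Longrightarrow> y \<in> K \<Longrightarrow> dist y x < d \<Longrightarrow> dist (f' y) (f' x) < \<epsilon>"
    unfolding uniformly_continuous_on_def using \<open>\<epsilon> > 0\<close> by metis
  show ?thesis
  proof (rule that[of "d/2"])
    fix x y assume xy: "x \<in> K" "y \<in> K" "norm (y - x) \<le> d/2"
    have seg: "closed_segment x y \<subseteq> K" using K(2) xy by (simp add: closed_segment_subset)
    have "norm (f y - f x - blinfun_apply (f' x) (y - x)) \<le> norm (y - x) * \<epsilon>"
    proof (rule differentiable_bound_linearization[where S="closed_segment x y"])
      show "(f has_derivative blinfun_apply (f' z)) (at z within closed_segment x y)" if "z \<in> closed_segment x y" for z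
        using der seg that has_derivative_at_withinI by blast
      show "onorm (blinfun_apply (f' z) - blinfun_apply (f' x)) \<le> \<epsilon>" if "z \<in> closed_segment x y" for z
      proof -
        have "dist z x \<le> norm (y - x)" using that
          by (metis dist_commute dist_in_closed_segment(1) dist_norm norm_minus_commute)
        then have "dist (f' z) (f' x) < \<epsilon>" using d xy that seg by force
        then have "norm (f' z - f' x) \<le> \<epsilon>" by (simp add: dist_norm)
        then show ?thesis by (simp add: norm_blinfun.rep_eq minus_blinfun.rep_eq fun_diff_def)
      qed
      show "x \<in> closed_segment x y" by simp
      show "x + t *\<^sub>R (y - x) \<in> closed_segment x y" if "t \<in> {0..1}" for t
        using that by (auto simp: closed_segment_def intro!: exI[of _ t] simp: algebra_simps)
    qed
    then show "norm (f y - f x - blinfun_apply (f' x) (y - x)) \<le> \<epsilon> * norm (y - x)" by (simp add: mult.commute)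
  qed (use d in simp)
qed

lemma c1_fun_lipschitz:
  fixes f :: "'e::euclidean_space \<Rightarrow> 'f::real_normed_vector"
  assumes f: "c1_fun U f" and K: "compact K" "convex K" "K \<subseteq> U"
  obtains L where "L \<ge> 0" "\<And>x y. x \<in> K \<Longrightarrow> y \<in> K \<Longrightarrow> norm (f y - f x) \<le> L * norm (y - x)"
proof -
  obtain f' where f': "\<And>x. x \<in> U \<Longrightarrow> (f has_derivative blinfun_apply (f' x)) (at x)" "continuous_on U f'"
    using c1_fun_blinfun_derivative[OF f] by blast
  have "bounded (f' ` K)" using f'(2) K by (meson compact_continuous_image compact_imp_bounded continuous_on_subset)
  then obtain L where L: "\<And>x. x \<in> K \<Longrightarrow> norm (f' x) \<le> L" by (auto simp: bounded_iff)
  have "onorm (blinfun_apply (f' x)) \<le> max L 0" if "x \<in> K" for x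
    using L[OF that] by (simp add: norm_blinfun.rep_eq)
  then have "norm (f y - f x) \<le> max L 0 * norm (y - x)" if "x \<in> K" "y \<in> K" for x y
    using that K f'(1) by (intro differentiable_bound[of K f "\<lambda>x. blinfun_apply (f' x)"])
      (auto intro: has_derivative_at_withinI)
  then show ?thesis using that[of "max L 0"] by simp
qed

text \<open>Two applications of the mean value theorem express the same symmetric second difference
  by either mixed derivative, at points that tend to \<open>x\<close>; continuity of both
  derivatives finishes the proof.\<close>

lemma mixed_derivative_commute_real:
  fixes f :: "'e::euclidean_space \<Rightarrow> real"
  assumes S: "open S" "x \<in> S" and f: "c1_fun S f"
    and fu: "c1_fun S (\<lambda>x. frechet_derivative f (at x) u)" and fv: "c1_fun S (\<lambda>x. frechet_derivative f (at x) v)"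
  shows "frechet_derivative (\<lambda>x. frechet_derivative f (at x) u) (at x) v =
         frechet_derivative (\<lambda>x. frechet_derivative f (at x) v) (at x) u"
proof -
  let ?D = "\<lambda>f x v. frechet_derivative f (at x) v"
  obtain r where r: "r > 0" "cball x r \<subseteq> S" using S open_contains_cball by blast
  \<comment> \<open>The parallelogram with sides \<open>s0 *\<^sub>R u\<close> and
    \<open>s0 *\<^sub>R v\<close> then lies in the ball of radius \<open>r\<close>; the summand 1
    keeps the denominator positive.\<close>
  define s0 where "s0 = r / (norm u + norm v + 1)"
  have s0: "s0 > 0" using r by (auto simp: s0_def intro!: divide_pos_pos add_nonneg_pos)
  have inS: "x + a *\<^sub>R u + b *\<^sub>R v \<in> S" if "0 \<le> a" "a \<le> s0" "0 \<le> b" "b \<le> s0" for a b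
  proof -
    have "norm (a *\<^sub>R u + b *\<^sub>R v) \<le> a * norm u + b * norm v"
      using that by (metis abs_of_nonneg norm_scaleR norm_triangle_ineq)
    also have "\<dots> \<le> s0 * norm u + s0 * norm v" using that by (intro add_mono mult_right_mono) auto
    also have "\<dots> \<le> s0 * (norm u + norm v + 1)" using s0 by (simp add: algebra_simps)
    also have "\<dots> = r" by (simp add: s0_def add_nonneg_eq_0_iff)
    finally have "x + (a *\<^sub>R u + b *\<^sub>R v) \<in> cball x r"
      by (metis add_diff_cancel_left' dist_commute dist_norm mem_cball)
    then show ?thesis using r by (auto simp: add.assoc)
  qed
  \<comment> \<open>Stated for arbitrary directions, so that it can be applied a second time with
    \<open>u\<close> and \<open>v\<close> exchanged.\<close>
  have key: "\<exists>a b. 0 \<le> a \<and> a \<le> s \<and> 0 \<le> b \<and> b \<le> s \<and>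
     f (x + s *\<^sub>R u + s *\<^sub>R v) - f (x + s *\<^sub>R u) - (f (x + s *\<^sub>R v) - f x) = s * s * ?D (\<lambda>x. ?D f x u) (x + a *\<^sub>R u + b *\<^sub>R v) v"
    if s: "0 < s" "s \<le> s0" and f: "c1_fun S f" "c1_fun S (\<lambda>x. ?D f x u)"
      and inS: "\<And>a b. 0 \<le> a \<Longrightarrow> a \<le> s0 \<Longrightarrow> 0 \<le> b \<Longrightarrow> b \<le> s0 \<Longrightarrow> x + a *\<^sub>R u + b *\<^sub>R v \<in> S" for s u v
  proof -
    define \<phi> where "\<phi> t = f (x + t *\<^sub>R u + s *\<^sub>R v) - f (x + t *\<^sub>R u)" for t
    have d: "((\<lambda>t. f (x + t *\<^sub>R u + b *\<^sub>R v)) has_real_derivative ?D f (x + t *\<^sub>R u + b *\<^sub>R v) u) (at t)"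
      if "0 \<le> t" "t \<le> s" "0 \<le> b" "b \<le> s" for t b
    proof -
      have D: "(f has_derivative ?D f (x + t *\<^sub>R u + b *\<^sub>R v)) (at (x + t *\<^sub>R u + b *\<^sub>R v))"
        using that s by (intro c1_fun_has_derivative[OF f(1)] inS) auto
      have "((\<lambda>t. f (x + t *\<^sub>R u + b *\<^sub>R v)) has_derivative (\<lambda>t'. ?D f (x + t *\<^sub>R u + b *\<^sub>R v) (t' *\<^sub>R u))) (at t)"
        by (rule has_derivative_compose[where g=f and f="\<lambda>t. x + t *\<^sub>R u + b *\<^sub>R v", OF _ D]) (auto intro!: derivative_eq_intros)
      then show ?thesis
        by (simp add: has_field_derivative_def linear_cmul[OF has_derivative_linear[OF D]] mult_commute_abs)
    qed
    have d\<phi>: "(\<phi> has_real_derivative ?D f (x + t *\<^sub>R u + s *\<^sub>R v) u - ?D f (x + t *\<^sub>R u) u) (at t)"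
      if "0 \<le> t" "t \<le> s" for t
      using d[of t s] d[of t 0] that s unfolding \<phi>_def by (auto intro!: derivative_eq_intros)
    obtain a where a: "0 < a" "a < s" "\<phi> s - \<phi> 0 = (s - 0) * (?D f (x + a *\<^sub>R u + s *\<^sub>R v) u - ?D f (x + a *\<^sub>R u) u)"
      using MVT2[OF s(1) d\<phi>] by blast
    let ?g = "\<lambda>b. ?D f (x + a *\<^sub>R u + b *\<^sub>R v) u"
    have dg: "(?g has_real_derivative ?D (\<lambda>x. ?D f x u) (x + a *\<^sub>R u + b *\<^sub>R v) v) (at b)"
      if "0 \<le> b" "b \<le> s" for b
    proof -
      have D: "((\<lambda>x. ?D f x u) has_derivative ?D (\<lambda>x. ?D f x u) (x + a *\<^sub>R u + b *\<^sub>R v)) (at (x + a *\<^sub>R u + b *\<^sub>R v))"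
        using that s a by (intro c1_fun_has_derivative[OF f(2)] inS) auto
      have "(?g has_derivative (\<lambda>t'. ?D (\<lambda>x. ?D f x u) (x + a *\<^sub>R u + b *\<^sub>R v) (t' *\<^sub>R v))) (at b)"
        by (rule has_derivative_compose[where g="\<lambda>x. ?D f x u" and f="\<lambda>b. x + a *\<^sub>R u + b *\<^sub>R v", OF _ D]) (auto intro!: derivative_eq_intros)
      then show ?thesis
        by (simp add: has_field_derivative_def linear_cmul[OF has_derivative_linear[OF D]] mult_commute_abs)
    qed
    obtain b where b: "0 < b" "b < s" "?g s - ?g 0 = (s - 0) * ?D (\<lambda>x. ?D f x u) (x + a *\<^sub>R u + b *\<^sub>R v) v"
      using MVT2[OF s(1) dg] by blast
    have "f (x + s *\<^sub>R u + s *\<^sub>R v) - f (x + s *\<^sub>R u) - (f (x + s *\<^sub>R v) - f x) = \<phi> s - \<phi> 0"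
      by (simp add: \<phi>_def)
    also have "\<dots> = s * s * ?D (\<lambda>x. ?D f x u) (x + a *\<^sub>R u + b *\<^sub>R v) v"
      using a(3) b(3) by simp
    finally show ?thesis using a b by (intro exI[of _ a] exI[of _ b]) auto
  qed
  define sn where "sn n = s0 / real (Suc n)" for n
  have sn: "0 < sn n" "sn n \<le> s0" for n using s0 by (auto simp: sn_def divide_le_eq)
  have sn0: "sn \<longlonglongrightarrow> 0" unfolding sn_def
    using LIMSEQ_Suc[OF lim_const_over_n[of s0]] by simp
  have "\<exists>a b. 0 \<le> a \<and> a \<le> sn n \<and> 0 \<le> b \<and> b \<le> sn n \<and>
     f (x + sn n *\<^sub>R u + sn n *\<^sub>R v) - f (x + sn n *\<^sub>R u) - (f (x + sn n *\<^sub>R v) - f x)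
     = sn n * sn n * ?D (\<lambda>x. ?D f x u) (x + a *\<^sub>R u + b *\<^sub>R v) v" for n
    by (rule key[OF sn f fu inS])
  then obtain a b where ab: "\<And>n. 0 \<le> a n" "\<And>n. a n \<le> sn n" "\<And>n. 0 \<le> b n" "\<And>n. b n \<le> sn n"
    "\<And>n. f (x + sn n *\<^sub>R u + sn n *\<^sub>R v) - f (x + sn n *\<^sub>R u) - (f (x + sn n *\<^sub>R v) - f x)
     = sn n * sn n * ?D (\<lambda>x. ?D f x u) (x + a n *\<^sub>R u + b n *\<^sub>R v) v"
    by metis
  have "\<exists>a b. 0 \<le> a \<and> a \<le> sn n \<and> 0 \<le> b \<and> b \<le> sn n \<and>
     f (x + sn n *\<^sub>R v + sn n *\<^sub>R u) - f (x + sn n *\<^sub>R v) - (f (x + sn n *\<^sub>R u) - f x)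
     = sn n * sn n * ?D (\<lambda>x. ?D f x v) (x + a *\<^sub>R v + b *\<^sub>R u) u" for n
    by (rule key[OF sn f fv]) (use inS in \<open>simp add: add.assoc add.commute[of "_ *\<^sub>R v"]\<close>)
  then obtain c d where cd: "\<And>n. 0 \<le> c n" "\<And>n. c n \<le> sn n" "\<And>n. 0 \<le> d n" "\<And>n. d n \<le> sn n"
    "\<And>n. f (x + sn n *\<^sub>R v + sn n *\<^sub>R u) - f (x + sn n *\<^sub>R v) - (f (x + sn n *\<^sub>R u) - f x)
     = sn n * sn n * ?D (\<lambda>x. ?D f x v) (x + c n *\<^sub>R v + d n *\<^sub>R u) u"
    by metis
  have z: "a \<longlonglongrightarrow> 0" "b \<longlonglongrightarrow> 0" "c \<longlonglongrightarrow> 0" "d \<longlonglongrightarrow> 0"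
    using tendsto_sandwich[OF _ _ tendsto_const sn0] ab cd by (auto simp: eventually_sequentially)
  have eq: "?D (\<lambda>x. ?D f x u) (x + a n *\<^sub>R u + b n *\<^sub>R v) v = ?D (\<lambda>x. ?D f x v) (x + c n *\<^sub>R v + d n *\<^sub>R u) u" for n
  proof -
    have "sn n * sn n * ?D (\<lambda>x. ?D f x u) (x + a n *\<^sub>R u + b n *\<^sub>R v) v
        = sn n * sn n * ?D (\<lambda>x. ?D f x v) (x + c n *\<^sub>R v + d n *\<^sub>R u) u"
      unfolding ab(5)[symmetric] cd(5)[symmetric] by (simp add: algebra_simps)
    then show ?thesis using sn(1)[of n] by simp
  qed
  have ix: "isCont (\<lambda>x. ?D (\<lambda>x. ?D f x u) x v) x" "isCont (\<lambda>x. ?D (\<lambda>x. ?D f x v) x u) x"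
    using c1_fun_continuous_derivative[OF fu] c1_fun_continuous_derivative[OF fv] S continuous_on_eq_continuous_at by blast+
  have "(\<lambda>n. x + a n *\<^sub>R u + b n *\<^sub>R v) \<longlonglongrightarrow> x + 0 *\<^sub>R u + 0 *\<^sub>R v" "(\<lambda>n. x + c n *\<^sub>R v + d n *\<^sub>R u) \<longlonglongrightarrow> x + 0 *\<^sub>R v + 0 *\<^sub>R u"
    by (intro tendsto_intros z)+
  then have "(\<lambda>n. x + a n *\<^sub>R u + b n *\<^sub>R v) \<longlonglongrightarrow> x" "(\<lambda>n. x + c n *\<^sub>R v + d n *\<^sub>R u) \<longlonglongrightarrow> x" by simp_all
  from isCont_tendsto_compose[OF ix(1) this(1)] isCont_tendsto_compose[OF ix(2) this(2)] show ?thesis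
    unfolding eq using LIMSEQ_unique by blast
qed

lemma mixed_derivative_commute:
  fixes f :: "'e::euclidean_space \<Rightarrow> 'f::euclidean_space"
  assumes S: "open S" "x \<in> S" and f: "smooth_on S f"
  shows "frechet_derivative (\<lambda>x. frechet_derivative f (at x) u) (at x) v =
         frechet_derivative (\<lambda>x. frechet_derivative f (at x) v) (at x) u"
proof (rule euclidean_eqI)
  fix i :: 'f assume "i \<in> Basis"
  have c1: "c1_fun S f" "\<And>v. c1_fun S (\<lambda>x. frechet_derivative f (at x) v)"
    using f smooth_on_c1_fun smooth_on_derivative by blast+
  have inner: "frechet_derivative (\<lambda>x. h x \<bullet> i) (at x) w = frechet_derivative h (at x) w \<bullet> i"
    if "c1_fun S h" "x \<in> S" for h :: "'e \<Rightarrow> 'f" and x w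
    using has_derivative_inner_left[OF c1_fun_has_derivative[OF that], of i] frechet_derivative_at by (metis (no_types, lifting))
  have fi: "c1_fun S (\<lambda>x. f x \<bullet> i)"
    by (rule c1_fun_linear[OF c1(1)]) (rule bounded_linear_inner_left)
  have fvi: "c1_fun S (\<lambda>x. frechet_derivative f (at x) v \<bullet> i)" for v
    by (rule c1_fun_linear[OF c1(2)]) (rule bounded_linear_inner_left)
  have fvi': "c1_fun S (\<lambda>x. frechet_derivative (\<lambda>x. f x \<bullet> i) (at x) v)" for v
    by (rule c1_fun_cong[OF fvi S(1)]) (simp add: inner c1)
  have "frechet_derivative (\<lambda>x. frechet_derivative (\<lambda>x. f x \<bullet> i) (at x) u) (at x) v =
        frechet_derivative (\<lambda>x. frechet_derivative f (at x) u) (at x) v \<bullet> i" for u v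
  proof -
    have "((\<lambda>x. frechet_derivative (\<lambda>x. f x \<bullet> i) (at x) u) has_derivative
        (\<lambda>v. frechet_derivative (\<lambda>x. frechet_derivative f (at x) u) (at x) v \<bullet> i)) (at x)"
      by (rule has_derivative_transform_within_open[OF has_derivative_inner_left[OF c1_fun_has_derivative[OF c1(2) S(2)]] S])
         (simp add: inner c1)
    then show ?thesis using frechet_derivative_at by metis
  qed
  then show "frechet_derivative (\<lambda>x. frechet_derivative f (at x) u) (at x) v \<bullet> i =
         frechet_derivative (\<lambda>x. frechet_derivative f (at x) v) (at x) u \<bullet> i"
    using mixed_derivative_commute_real[OF S fi fvi' fvi', of u v] by simp
qed

text \<open>Adding \<open>M / 2 * t^2\<close> makes the function convex, and on the unit interval
  this correction costs at most \<open>M\<close>.\<close>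

lemma almost_convex_of_second_derivative:
  fixes f :: "real \<Rightarrow> real"
  assumes d: "\<And>t. t \<in> {0..1} \<Longrightarrow> (f has_real_derivative f' t) (at t)"
    "\<And>t. t \<in> {0..1} \<Longrightarrow> (f' has_real_derivative f'' t) (at t)"
    and M: "\<And>t. t \<in> {0..1} \<Longrightarrow> f'' t \<ge> - M" "M \<ge> 0" and t: "t \<in> {0..1}"
  shows "f t \<le> (1 - t) * f 0 + t * f 1 + M"
proof -
  have cv: "convex_on {0..1} (\<lambda>t. f t + M / 2 * t^2)"
  proof (rule f''_ge0_imp_convex[where f'="\<lambda>t. f' t + M * t" and f''="\<lambda>t. f'' t + M"])
    show "((\<lambda>t. f t + M / 2 * t^2) has_real_derivative f' t + M * t) (at t)" if "t \<in> {0..1}" for t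
      using d(1)[OF that] by (auto intro!: derivative_eq_intros)
    show "((\<lambda>t. f' t + M * t) has_real_derivative f'' t + M) (at t)" if "t \<in> {0..1}" for t
      using d(2)[OF that] by (auto intro!: derivative_eq_intros)
  qed (use M in \<open>auto simp: add_increasing\<close>, force)
  have "f t + M / 2 * t^2 \<le> (1 - t) * (f 0 + M / 2 * 0^2) + t * (f 1 + M / 2 * 1^2)"
    using convex_onD[OF cv, of t 0 1] t by simp
  then have "f t + M / 2 * t^2 \<le> (1 - t) * f 0 + t * f 1 + t * (M / 2)" by (simp add: algebra_simps)
  moreover have "t * (M/2) \<le> M" using t M(2) mult_left_le_one_le[of M t] by auto
  moreover have "M / 2 * t^2 \<ge> 0" using M(2) by simp
  ultimately show ?thesis by linarith
qed

text \<open>A Gronwall estimate by absorption: the maximum S of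
  \<open>norm (h t) + norm (h' t)\<close> is bounded by the data at 0 plus
  \<open>2 * \<theta> * S\<close>, and \<open>\<theta> \<le> 1/4\<close> makes the last term at most
  half of S.\<close>

lemma second_order_estimate:
  fixes h h' h'' :: "real \<Rightarrow> 'f::real_normed_vector"
  assumes h: "\<And>t. t \<in> {0..1} \<Longrightarrow> (h has_vector_derivative h' t) (at t within {0..1})"
    and h': "\<And>t. t \<in> {0..1} \<Longrightarrow> (h' has_vector_derivative h'' t) (at t within {0..1})"
    and le: "\<And>t. t \<in> {0..1} \<Longrightarrow> norm (h'' t) \<le> \<theta> * (norm (h t) + norm (h' t))"
    and \<theta>: "0 \<le> \<theta>" "\<theta> \<le> 1/4" and t: "t \<in> {0..1}"
  shows "norm (h' t - h' 0) \<le> 2 * \<theta> * (norm (h 0) + 2 * norm (h' 0))"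
    "norm (h t - h 0 - t *\<^sub>R h' 0) \<le> 2 * \<theta> * (norm (h 0) + 2 * norm (h' 0))"
proof -
  have "continuous_on {0..1} h" "continuous_on {0..1} h'"
    using h h' by (meson continuous_on_vector_derivative)+
  then have "continuous_on {0..1} (\<lambda>t. norm (h t) + norm (h' t))" by (intro continuous_intros)
  then obtain s where s: "s \<in> {0..1}" "\<And>t. t \<in> {0..1} \<Longrightarrow> norm (h t) + norm (h' t) \<le> norm (h s) + norm (h' s)"
    using continuous_attains_sup[of "{0..1::real}" "\<lambda>t. norm (h t) + norm (h' t)"] by auto
  define S where "S = norm (h s) + norm (h' s)"
  have mean: "norm (f t - f 0) \<le> m" if "\<And>t. t \<in> {0..1} \<Longrightarrow> (f has_vector_derivative f' t) (at t within {0..1})"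
     "\<And>t. t \<in> {0..1} \<Longrightarrow> norm (f' t) \<le> m" "t \<in> {0..1}" for f f' :: "real \<Rightarrow> 'f" and m t
  proof -
    have "norm (f t - f 0) \<le> m * norm (t - 0)"
    proof (rule differentiable_bound[of "{0..1}" f "\<lambda>t s. s *\<^sub>R f' t"])
      show "onorm (\<lambda>s. s *\<^sub>R f' x) \<le> m" if "x \<in> {0..1}" for x
        by (rule onorm_le) (use \<open>\<And>t. t \<in> {0..1} \<Longrightarrow> norm (f' t) \<le> m\<close>[OF that] in
          \<open>simp add: mult.commute[of m] mult_left_mono\<close>)
    qed (use that in \<open>auto simp: has_vector_derivative_def\<close>)
    also have "\<dots> \<le> m"
      using that(3) order_trans[OF norm_ge_zero that(2)[OF that(3)]] mult_left_le[of "norm (t - 0)" m] by simp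
    finally show ?thesis .
  qed
  have b2: "norm (h'' t) \<le> \<theta> * S" if "t \<in> {0..1}" for t
    by (rule order_trans[OF le[OF that] mult_left_mono[OF s(2)[OF that, folded S_def] \<theta>(1)]])
  have b1: "norm (h' t - h' 0) \<le> \<theta> * S" if "t \<in> {0..1}" for t
    by (rule mean[OF h' b2 that]) 
  have b0: "norm (h t - h 0 - t *\<^sub>R h' 0) \<le> \<theta> * S" if "t \<in> {0..1}" for t
  proof -
    have "norm ((h t - t *\<^sub>R h' 0) - (h 0 - 0 *\<^sub>R h' 0)) \<le> \<theta> * S"
      by (rule mean[of "\<lambda>t. h t - t *\<^sub>R h' 0" "\<lambda>t. h' t - h' 0"])
        (use h b1 that in \<open>auto intro!: derivative_eq_intros\<close>)
    then show ?thesis by (simp add: algebra_simps)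
  qed
  have "norm (h s) \<le> norm (h 0) + norm (h' 0) + \<theta> * S"
  proof -
    have "norm (h s) = norm ((h s - h 0 - s *\<^sub>R h' 0) + (h 0 + s *\<^sub>R h' 0))" by simp
    also have "\<dots> \<le> \<theta> * S + norm (h 0 + s *\<^sub>R h' 0)" using b0[OF s(1)] norm_triangle_mono by blast
    also have "norm (h 0 + s *\<^sub>R h' 0) \<le> norm (h 0) + s * norm (h' 0)"
      using s(1) by (metis abs_of_nonneg atLeastAtMost_iff norm_scaleR norm_triangle_ineq)
    also have "s * norm (h' 0) \<le> norm (h' 0)" using s(1) by (simp add: mult_left_le_one_le)
    finally show ?thesis by simp
  qed
  moreover have "norm (h' s) \<le> norm (h' 0) + \<theta> * S"
    using b1[OF s(1)] norm_triangle_sub[of "h' s" "h' 0"] by linarith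
  moreover have "2 * (\<theta> * S) \<le> S / 2" using \<theta> mult_right_mono[of \<theta> "1/4" S] by (simp add: S_def)
  ultimately have "S \<le> 2 * (norm (h 0) + 2 * norm (h' 0))" using S_def by (smt (verit) field_sum_of_halves)
  then have "\<theta> * S \<le> \<theta> * (2 * (norm (h 0) + 2 * norm (h' 0)))" using \<theta>(1) by (rule mult_left_mono)
  then have "\<theta> * S \<le> 2 * \<theta> * (norm (h 0) + 2 * norm (h' 0))" by (simp add: mult_ac)
  then show "norm (h' t - h' 0) \<le> 2 * \<theta> * (norm (h 0) + 2 * norm (h' 0))"
    "norm (h t - h 0 - t *\<^sub>R h' 0) \<le> 2 * \<theta> * (norm (h 0) + 2 * norm (h' 0))"
    using b0[OF t] b1[OF t] by linarith+
qed

text \<open>The fixed point is taken in the complete space of bounded continuous functions on the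
  whole line. The solution runs in both time directions, as the two-sided derivatives in
  \<open>geodesic_on\<close> demand.\<close>

lemma picard:
  fixes F :: "'z::euclidean_space \<Rightarrow> 'z"
  assumes R: "R > 0" and lip: "\<And>x y. x \<in> cball z0 R \<Longrightarrow> y \<in> cball z0 R \<Longrightarrow> norm (F x - F y) \<le> L * norm (x - y)"
    and M: "\<And>x. x \<in> cball z0 R \<Longrightarrow> norm (F x) \<le> M"
    and \<tau>: "\<tau> > 0" "\<tau> * M \<le> R / 2" "\<tau> * L \<le> 1 / 2" and L: "L \<ge> 0" and z1: "z1 \<in> cball z0 (R / 2)"
  obtains z where "z 0 = z1" "\<And>t. t \<in> {-\<tau><..<\<tau>} \<Longrightarrow> z t \<in> cball z0 R"
    "\<And>t. t \<in> {-\<tau><..<\<tau>} \<Longrightarrow> (z has_vector_derivative F (z t)) (at t)"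
proof -
  \<comment> \<open>\<open>F\<close> is controlled on the ball only. Composition with the
    nearest-point projection yields a bounded, globally Lipschitz field, and the bounds on
    \<open>\<tau>\<close> keep the solution in the ball, where both fields agree.\<close>
  define P where "P = closest_point (cball z0 R)"
  define K where "K x = F (P x)" for x
  have Pin: "P x \<in> cball z0 R" for x
    unfolding P_def using R by (intro closest_point_in_set) auto
  have Pid: "x \<in> cball z0 R \<Longrightarrow> P x = x" for x
    unfolding P_def by (rule closest_point_self)
  have KL: "norm (K x - K y) \<le> L * norm (x - y)" for x y
  proof -
    have "dist (P x) (P y) \<le> dist x y"
      unfolding P_def using R by (intro closest_point_lipschitz) auto
    then have "L * norm (P x - P y) \<le> L * norm (x - y)" using L by (simp add: dist_norm mult_left_mono)
    then show ?thesis unfolding K_def using lip[OF Pin Pin, of x y] by linarith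
  qed
  have KM: "norm (K x) \<le> M" for x using M Pin unfolding K_def by blast
  have "L-lipschitz_on UNIV K" using KL L by (intro lipschitz_onI) (auto simp: dist_norm)
  then have Kc: "continuous_on UNIV K" by (rule lipschitz_on_continuous_on)
  \<comment> \<open>The integral based at 0 is written as a difference of integrals from
    \<open>-\<tau>\<close>, so that one formula covers both signs of time. Clamping time by
    \<open>c\<close> extends each iterate to the line.\<close>
  define I where "I u t = z1 + (integral {-\<tau>..t} (\<lambda>s. K (u s)) - integral {-\<tau>..0} (\<lambda>s. K (u s)))" for u t
  define c where "c t = max (-\<tau>) (min \<tau> t)" for t :: real
  have cin: "c t \<in> {-\<tau>..\<tau>}" for t using \<tau> by (auto simp: c_def)
  have cc: "continuous_on UNIV c" unfolding c_def by (intro continuous_intros)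
  have Kcu: "continuous_on S (\<lambda>s. K (u s))" if "continuous_on S u" for u and S :: "real set"
    by (rule continuous_on_compose2[OF Kc that]) auto
  have dI: "(I u has_vector_derivative K (u t)) (at t within {-\<tau>..\<tau>})"
    if "continuous_on UNIV u" "t \<in> {-\<tau>..\<tau>}" for u t
    unfolding I_def
    by (auto intro!: derivative_eq_intros integral_has_vector_derivative that Kcu continuous_on_subset[OF that(1)])
  have I0: "I u 0 = z1" for u by (simp add: I_def)
  have mean: "norm (f t - f 0) \<le> m * \<tau>"
    if "\<And>t. t \<in> {-\<tau>..\<tau>} \<Longrightarrow> (f has_vector_derivative f' t) (at t within {-\<tau>..\<tau>})"
     "\<And>t. t \<in> {-\<tau>..\<tau>} \<Longrightarrow> norm (f' t) \<le> m" "t \<in> {-\<tau>..\<tau>}" for f f' :: "real \<Rightarrow> 'z" and m t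
  proof -
    have "norm (f t - f 0) \<le> m * norm (t - 0)"
    proof (rule differentiable_bound[of "{-\<tau>..\<tau>}" f "\<lambda>t s. s *\<^sub>R f' t"])
      show "onorm (\<lambda>s. s *\<^sub>R f' x) \<le> m" if "x \<in> {-\<tau>..\<tau>}" for x
        by (rule onorm_le) (use \<open>\<And>t. t \<in> {-\<tau>..\<tau>} \<Longrightarrow> norm (f' t) \<le> m\<close>[OF that] in
          \<open>simp add: mult.commute[of m] mult_left_mono\<close>)
    qed (use that \<tau> in \<open>auto simp: has_vector_derivative_def\<close>)
    also have "\<dots> \<le> m * \<tau>" using that(3) order_trans[OF norm_ge_zero that(2)[OF that(3)]]
      by (auto intro!: mult_left_mono)
    finally show ?thesis .
  qed
  have Ic: "(\<lambda>t. I (apply_bcontfun u) (c t)) \<in> bcontfun" for u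
  proof (rule bcontfun_normI[where b="norm z1 + M * \<tau>"])
    have "continuous_on {-\<tau>..\<tau>} (I u)" using dI[OF continuous_on_apply_bcontfun]
      by (meson continuous_on_vector_derivative)
    then show "continuous_on UNIV (\<lambda>t. I u (c t))"
      by (rule continuous_on_compose2[OF _ cc]) (use cin in auto)
    show "norm (I u (c t)) \<le> norm z1 + M * \<tau>" for t
    proof -
      have "norm (I u (c t) - I u 0) \<le> M * \<tau>"
        by (rule mean[OF dI]) (use cin KM in auto)
      then show ?thesis using norm_triangle_sub[of "I u (c t)" z1] by (simp add: I0)
    qed
  qed
  define \<Phi> where "\<Phi> u = Bcontfun (\<lambda>t. I (apply_bcontfun u) (c t))" for u
  have ap: "apply_bcontfun (\<Phi> u) t = I (apply_bcontfun u) (c t)" for u t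
    unfolding \<Phi>_def using Ic[of u] by (simp add: Bcontfun_inverse)
  have contr: "dist (\<Phi> u) (\<Phi> v) \<le> 1 / 2 * dist u v" for u v
  proof (rule dist_bound)
    fix t
    have "norm ((I u (c t) - I v (c t)) - (I u 0 - I v 0)) \<le> L * dist u v * \<tau>"
    proof (rule mean[where f="\<lambda>t. I u t - I v t"])
      show "((\<lambda>t. I u t - I v t) has_vector_derivative K (u t) - K (v t)) (at t within {-\<tau>..\<tau>})"
        if "t \<in> {-\<tau>..\<tau>}" for t
        by (intro has_vector_derivative_diff dI continuous_on_apply_bcontfun that)
      show "norm (K (u t) - K (v t)) \<le> L * dist u v" for t
        using KL[of "u t" "v t"] dist_bounded[of u t v] L
        by (metis (no_types, lifting) dist_norm mult_left_mono order_trans)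
    qed (use cin in auto)
    also have "\<dots> = (\<tau> * L) * dist u v" by simp
    also have "\<dots> \<le> 1 / 2 * dist u v" using \<tau>(3) by (rule mult_right_mono) simp
    finally show "dist (apply_bcontfun (\<Phi> u) t) (apply_bcontfun (\<Phi> v) t) \<le> 1 / 2 * dist u v"
      by (simp add: ap dist_norm I0)
  qed
  then obtain u where u: "\<Phi> u = u" using banach_fix_type[of "1/2" \<Phi>] by auto
  have ut: "apply_bcontfun u t = I (apply_bcontfun u) t" if "t \<in> {-\<tau>..\<tau>}" for t
  proof -
    have "c t = t" using that by (auto simp: c_def)
    then show ?thesis using ap[of u t] u by simp
  qed
  have ball: "apply_bcontfun u t \<in> cball z0 R" if "t \<in> {-\<tau>..\<tau>}" for t
  proof -
    have "norm (I u t - I u 0) \<le> M * \<tau>"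
      by (rule mean[OF dI]) (use that KM in auto)
    then have "norm (u t - z1) \<le> M * \<tau>" using ut[OF that] by (simp add: I0)
    then have "dist (u t) z1 \<le> R / 2" using \<tau>(2) by (simp add: dist_norm mult.commute)
    then show ?thesis using z1 dist_triangle[of z0 "u t" z1] by (simp add: dist_commute)
  qed
  show ?thesis
  proof (rule that[of "apply_bcontfun u"])
    show "u 0 = z1" using \<tau> by (simp add: ut I0)
    fix t assume t: "t \<in> {-\<tau><..<\<tau>}"
    then show "u t \<in> cball z0 R" using ball by auto
    have "(I u has_vector_derivative K (u t)) (at t within {-\<tau><..<\<tau>})"
      using dI[OF continuous_on_apply_bcontfun, of t u] t
      by (rule_tac has_vector_derivative_within_subset) auto
    then have "(I u has_vector_derivative K (u t)) (at t)"
      using t by (metis at_within_open open_greaterThanLessThan)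
    then have "(u has_vector_derivative K (u t)) (at t)"
      by (rule has_vector_derivative_transform_within_open[OF _ open_greaterThanLessThan t]) (use ut in auto)
    then show "(u has_vector_derivative F (u t)) (at t)"
      using Pid[OF ball, of t] t by (simp add: K_def)
  qed
qed

section \<open>Geodesics in a coordinate domain\<close>

text \<open>Positivity is applied to \<open>u\<close> minus its projection onto \<open>w\<close>.
  The strict form makes the denominator of the sectional curvature positive for independent
  vectors.\<close>

lemma pos_bilinear_Cauchy_Schwarz:
  fixes B :: "'e::real_vector \<Rightarrow> 'e \<Rightarrow> real"
  assumes sym: "\<And>u w. B u w = B w u" and add: "\<And>u v w. B (u + v) w = B u w + B v w"
    and sc: "\<And>r u w. B (r *\<^sub>R u) w = r * B u w" and pos: "\<And>u. u \<noteq> 0 \<Longrightarrow> B u u > 0"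
  shows "(B u w)\<^sup>2 \<le> B u u * B w w" and "w \<noteq> 0 \<Longrightarrow> (\<forall>r. u \<noteq> r *\<^sub>R w) \<Longrightarrow> (B u w)\<^sup>2 < B u u * B w w"
proof -
  have B0: "B 0 w = 0" for w using sc[of 0 0 w] by simp
  have ex: "B w w * B (u - (B u w / B w w) *\<^sub>R w) (u - (B u w / B w w) *\<^sub>R w) = B u u * B w w - (B u w)\<^sup>2" if "w \<noteq> 0"
  proof -
    have addr: "B w (u + v) = B w u + B w v" for u v w using add[of u v w] sym by simp
    have scr: "B w (r *\<^sub>R u) = r * B w u" for r u w using sc[of r u w] sym by simp
    define k where "k = - (B u w / B w w)"
    have "B (u + k *\<^sub>R w) (u + k *\<^sub>R w) = B u u + 2 * k * B u w + k * k * B w w"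
      using sym[of w u] by (simp add: add addr sc scr algebra_simps)
    moreover have "k * B w w = - B u w" using pos[OF that] by (simp add: k_def)
    then have "k * k * B w w = - k * B u w" by (simp add: mult.assoc)
    ultimately have "B w w * B (u + k *\<^sub>R w) (u + k *\<^sub>R w) = B w w * B u u + (k * B w w) * B u w"
      by (simp add: algebra_simps)
    then show ?thesis using \<open>k * B w w = - B u w\<close> by (simp add: k_def power2_eq_square)
  qed
  have nn: "B u u \<ge> 0" for u using pos[of u] B0 by (cases "u = 0") auto
  show "(B u w)\<^sup>2 \<le> B u u * B w w"
  proof (cases "w = 0")
    case True then show ?thesis using B0 sym[of u 0] by simp
  next
    case False
    then show ?thesis using ex[OF False] nn mult_nonneg_nonneg[OF nn nn] by (metis diff_ge_0_iff_ge)
  qed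
  show "(B u w)\<^sup>2 < B u u * B w w" if "w \<noteq> 0" "\<forall>r. u \<noteq> r *\<^sub>R w"
    using ex[OF that(1)] that pos mult_pos_pos by (metis diff_gt_0_iff_gt right_minus_eq)
qed

lemma positive_on_compact_bounded_below:
  fixes f :: "'e::euclidean_space \<Rightarrow> real"
  assumes "compact K" "K \<noteq> {}" "continuous_on K f" "\<And>x. x \<in> K \<Longrightarrow> f x > 0"
  obtains m where "m > 0" "\<And>x. x \<in> K \<Longrightarrow> m \<le> f x"
  using continuous_attains_inf[OF assms(1-3)] assms(4) by metis

text \<open>Riemannian geometry in one coordinate domain, with operator-valued metric and
  Christoffel symbols so that the calculus of bounded bilinear maps applies. \<open>compat\<close>
  and \<open>\<Gamma>_sym\<close> characterize the Levi-Civita connection. \<open>curv\<close>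
  states that \<open>R(h,v)v\<close> has nonpositive product with \<open>h\<close>, with the sign
  moved into the curvature expression; it includes dependent pairs, where that expression
  vanishes.\<close>

locale local_geometry =
  fixes U :: "'e::euclidean_space set"
    and G :: "'e \<Rightarrow> 'e \<Rightarrow>\<^sub>L 'e \<Rightarrow>\<^sub>L real" and DG :: "'e \<Rightarrow> 'e \<Rightarrow>\<^sub>L 'e \<Rightarrow>\<^sub>L 'e \<Rightarrow>\<^sub>L real"
    and \<Gamma> :: "'e \<Rightarrow> 'e \<Rightarrow>\<^sub>L 'e \<Rightarrow>\<^sub>L 'e" and D\<Gamma> :: "'e \<Rightarrow> 'e \<Rightarrow>\<^sub>L 'e \<Rightarrow>\<^sub>L 'e \<Rightarrow>\<^sub>L 'e"
  assumes openU: "open U"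
    and G_sym: "y \<in> U \<Longrightarrow> G y u w = G y w u"
    and G_pos: "y \<in> U \<Longrightarrow> u \<noteq> 0 \<Longrightarrow> G y u u > 0"
    and G_der: "y \<in> U \<Longrightarrow> (G has_derivative blinfun_apply (DG y)) (at y)"
    and compat: "y \<in> U \<Longrightarrow> DG y z u w = G y (\<Gamma> y z u) w + G y u (\<Gamma> y z w)"
    and \<Gamma>_sym: "y \<in> U \<Longrightarrow> \<Gamma> y u w = \<Gamma> y w u"
    and \<Gamma>_der: "y \<in> U \<Longrightarrow> (\<Gamma> has_derivative blinfun_apply (D\<Gamma> y)) (at y)"
    and D\<Gamma>_cont: "continuous_on U D\<Gamma>"
    and curv: "y \<in> U \<Longrightarrow> G y (D\<Gamma> y v v h - D\<Gamma> y h v v + \<Gamma> y v (\<Gamma> y h v) - \<Gamma> y h (\<Gamma> y v v)) h \<ge> 0"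
begin

text \<open>The derivatives are two-sided also at the ends of a closed \<open>J\<close>, so
  \<open>sol {0..1}\<close> constrains the functions slightly beyond the interval.\<close>

definition sol :: "real set \<Rightarrow> (real \<Rightarrow> 'e) \<Rightarrow> (real \<Rightarrow> 'e) \<Rightarrow> bool" where
  "sol J \<gamma> v \<longleftrightarrow> (\<forall>t\<in>J. \<gamma> t \<in> U \<and> (\<gamma> has_vector_derivative v t) (at t) \<and>
     (v has_vector_derivative - \<Gamma> (\<gamma> t) (v t) (v t)) (at t))"

definition N :: "'e \<Rightarrow> 'e \<Rightarrow> real" where "N y u = sqrt (G y u u)"

lemma G_nonneg: "y \<in> U \<Longrightarrow> G y u u \<ge> 0"
  using G_pos[of y u] by (cases "u = 0") auto

lemma N_nonneg [simp]: "y \<in> U \<Longrightarrow> N y u \<ge> 0"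
  by (simp add: N_def G_nonneg)

lemma N_sq: "y \<in> U \<Longrightarrow> (N y u)\<^sup>2 = G y u u"
  by (simp add: N_def G_nonneg)

lemma N_scale: "N y (r *\<^sub>R u) = \<bar>r\<bar> * N y u"
proof -
  have "G y (r *\<^sub>R u) (r *\<^sub>R u) = r\<^sup>2 * G y u u" by (simp add: blinfun.bilinear_simps power2_eq_square)
  then show ?thesis by (simp add: N_def real_sqrt_mult)
qed

lemma Cauchy_Schwarz:
  assumes "y \<in> U" shows "(G y u w)\<^sup>2 \<le> G y u u * G y w w"
  by (rule pos_bilinear_Cauchy_Schwarz(1)) (use assms G_sym G_pos in \<open>auto simp: blinfun.bilinear_simps\<close>)

lemma G_le_N: assumes "y \<in> U" shows "\<bar>G y u w\<bar> \<le> N y u * N y w"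
proof -
  have "\<bar>G y u w\<bar>\<^sup>2 \<le> (N y u * N y w)\<^sup>2"
    using Cauchy_Schwarz[OF assms] by (simp add: power_mult_distrib N_sq assms)
  then show ?thesis by (rule power2_le_imp_le) (simp add: assms)
qed

lemma N_triangle: assumes "y \<in> U" shows "N y (u + w) \<le> N y u + N y w"
proof -
  have "(N y (u + w))\<^sup>2 = (N y u)\<^sup>2 + 2 * G y u w + (N y w)\<^sup>2"
    using G_sym[OF assms, of u w] by (simp add: N_sq assms blinfun.bilinear_simps)
  also have "\<dots> \<le> (N y u)\<^sup>2 + 2 * (N y u * N y w) + (N y w)\<^sup>2"
    using G_le_N[OF assms, of u w] by linarith
  also have "\<dots> = (N y u + N y w)\<^sup>2" by (simp add: power2_sum)
  finally show ?thesis by (rule power2_le_imp_le) (simp add: assms)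
qed

lemma N_zero_iff: "y \<in> U \<Longrightarrow> N y u = 0 \<longleftrightarrow> u = 0"
  using G_pos[of y u] by (cases "u = 0") (auto simp: N_def)

lemma G_cont: "continuous_on U G"
  using G_der by (meson continuous_at_imp_continuous_on has_derivative_continuous)

lemma \<Gamma>_cont: "continuous_on U \<Gamma>"
  using \<Gamma>_der by (meson continuous_at_imp_continuous_on has_derivative_continuous)

lemma derivative_along:
  assumes F: "(F has_derivative blinfun_apply D) (at (\<gamma> t))"
    and g: "(\<gamma> has_vector_derivative v) (at t)"
    and a: "(a has_vector_derivative a') (at t)" and b: "(b has_vector_derivative b') (at t)"
  shows "((\<lambda>t. blinfun_apply (blinfun_apply (F (\<gamma> t)) (a t)) (b t)) has_vector_derivative
    blinfun_apply (blinfun_apply (blinfun_apply D v) (a t)) (b t) + F (\<gamma> t) a' (b t) + F (\<gamma> t) (a t) b') (at t)"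
proof -
  have 1: "((\<lambda>t. F (\<gamma> t)) has_vector_derivative blinfun_apply D v) (at t)"
    using has_derivative_compose[OF g[unfolded has_vector_derivative_def] F]
    by (simp add: has_vector_derivative_def blinfun.scaleR_right)
  note 2 = bounded_bilinear.has_vector_derivative[OF bounded_bilinear_blinfun_apply 1 a]
  note 3 = bounded_bilinear.has_vector_derivative[OF bounded_bilinear_blinfun_apply 2 b]
  show ?thesis using 3 by (simp add: blinfun.bilinear_simps algebra_simps)
qed

text \<open>Metric compatibility as a product rule: the two vectors in the result are the covariant
  derivatives of \<open>a\<close> and \<open>b\<close> along the curve.\<close>

lemma G_along:
  assumes "\<gamma> t \<in> U" "(\<gamma> has_vector_derivative v) (at t)"
    "(a has_vector_derivative a') (at t)" "(b has_vector_derivative b') (at t)"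
  shows "((\<lambda>t. G (\<gamma> t) (a t) (b t)) has_real_derivative
    G (\<gamma> t) (a' + \<Gamma> (\<gamma> t) v (a t)) (b t) + G (\<gamma> t) (a t) (b' + \<Gamma> (\<gamma> t) v (b t))) (at t)"
  using derivative_along[OF G_der[OF assms(1)] assms(2-4)]
  by (simp add: has_real_derivative_iff_has_vector_derivative compat assms(1) blinfun.bilinear_simps algebra_simps)

lemma sol_speed_derivative:
  assumes "sol J \<gamma> v" "t \<in> J"
  shows "((\<lambda>t. G (\<gamma> t) (v t) (v t)) has_real_derivative 0) (at t)"
proof -
  have s: "\<gamma> t \<in> U" "(\<gamma> has_vector_derivative v t) (at t)"
     "(v has_vector_derivative - \<Gamma> (\<gamma> t) (v t) (v t)) (at t)"
    using assms by (auto simp: sol_def)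
  show ?thesis using G_along[OF s s(3)] by simp
qed

lemma sol_scale:
  assumes "sol J \<gamma> v" "\<And>t. t \<in> I \<Longrightarrow> c * t + s \<in> J"
  shows "sol I (\<lambda>t. \<gamma> (c * t + s)) (\<lambda>t. c *\<^sub>R v (c * t + s))"
  unfolding sol_def
proof
  fix t assume "t \<in> I"
  then have s: "\<gamma> (c * t + s) \<in> U" "(\<gamma> has_vector_derivative v (c * t + s)) (at (c * t + s))"
     "(v has_vector_derivative - \<Gamma> (\<gamma> (c * t + s)) (v (c * t + s)) (v (c * t + s))) (at (c * t + s))"
    using assms by (auto simp: sol_def)
  have l: "((\<lambda>t. c * t + s) has_vector_derivative c) (at t)" by (auto intro!: derivative_eq_intros)
  have "((\<lambda>t. c *\<^sub>R v (c * t + s)) has_vector_derivative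
     c *\<^sub>R (c *\<^sub>R (- \<Gamma> (\<gamma> (c * t + s)) (v (c * t + s)) (v (c * t + s))))) (at t)"
    using bounded_linear.has_vector_derivative[OF bounded_linear_scaleR_right vector_diff_chain_at[OF l s(3)]]
    by (simp add: o_def)
  with s show "\<gamma> (c * t + s) \<in> U \<and> ((\<lambda>t. \<gamma> (c * t + s)) has_vector_derivative c *\<^sub>R v (c * t + s)) (at t) \<and>
      ((\<lambda>t. c *\<^sub>R v (c * t + s)) has_vector_derivative
       - \<Gamma> (\<gamma> (c * t + s)) (c *\<^sub>R v (c * t + s)) (c *\<^sub>R v (c * t + s))) (at t)"
    using vector_diff_chain_at[OF l s(2)]
    by (simp add: o_def blinfun.bilinear_simps)
qed

lemma norm_\<Gamma>: "norm (\<Gamma> y u w) \<le> norm (\<Gamma> y) * norm u * norm w"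
  by (meson mult_right_mono norm_blinfun norm_ge_zero order_trans)

text \<open>All constants of the local estimates are merged into one, so that every smallness
  condition on velocities takes the form \<open>32 * C * \<rho> \<le> 1\<close>.\<close>

definition bounds :: "'e set \<Rightarrow> real \<Rightarrow> bool" where
  "bounds K C \<longleftrightarrow> C \<ge> 1 \<and> compact K \<and> convex K \<and> K \<subseteq> U \<and> (\<forall>y\<in>K. norm (\<Gamma> y) \<le> C) \<and>
     (\<forall>x\<in>K. \<forall>y\<in>K. norm (\<Gamma> y - \<Gamma> x) \<le> C * norm (y - x)) \<and>
     (\<forall>y\<in>K. \<forall>u. N y u \<le> C * norm u \<and> norm u \<le> C * N y u)"

lemma bounds_exist:
  assumes K: "compact K" "convex K" "K \<subseteq> U"
  obtains C where "bounds K C"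
proof -
  have "c1_fun U \<Gamma>"
    by (rule c1_funI[OF \<Gamma>_der]) (auto intro!: continuous_intros D\<Gamma>_cont)
  then obtain L where L: "L \<ge> 0" "\<And>x y. x \<in> K \<Longrightarrow> y \<in> K \<Longrightarrow> norm (\<Gamma> y - \<Gamma> x) \<le> L * norm (y - x)"
    using c1_fun_lipschitz[OF _ K] by blast
  have "bounded (\<Gamma> ` K)" "bounded (G ` K)"
    using \<Gamma>_cont G_cont K by (meson compact_continuous_image compact_imp_bounded continuous_on_subset)+
  then obtain B1 B2 where B: "\<And>x. x \<in> K \<Longrightarrow> norm (\<Gamma> x) \<le> B1" "\<And>x. x \<in> K \<Longrightarrow> norm (G x) \<le> B2"
    by (auto simp: bounded_iff)
  \<comment> \<open>The minimum of the metric over the compact unit sphere bundle of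
    \<open>K\<close>; homogeneity turns it into the bound of the Euclidean by the Riemannian norm,
    with constant \<open>1 / sqrt m\<close>.\<close>
  have "\<exists>m>0. \<forall>y\<in>K. \<forall>u. norm u = 1 \<longrightarrow> m \<le> G y u u"
  proof (cases "K = {}")
    case False
    have "continuous_on (K \<times> sphere 0 1) (\<lambda>z. G (fst z) (snd z) (snd z))"
      using K(3) by (auto intro!: continuous_intros continuous_on_compose2[OF G_cont])
    moreover have "compact (K \<times> sphere (0::'e) 1)" "K \<times> sphere (0::'e) 1 \<noteq> {}"
      using K False by (auto intro!: compact_Times)
    moreover have "G (fst z) (snd z) (snd z) > 0" if "z \<in> K \<times> sphere (0::'e) 1" for z
      using that K by (intro G_pos) auto
    ultimately obtain m where "m > 0" "\<And>z. z \<in> K \<times> sphere (0::'e) 1 \<Longrightarrow> m \<le> G (fst z) (snd z) (snd z)"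
      using positive_on_compact_bounded_below[of "K \<times> sphere (0::'e) 1" "\<lambda>z. G (fst z) (snd z) (snd z)"] by blast
    then show ?thesis by (intro exI[of _ m]) (auto simp: mem_sphere_0)
  qed (auto intro: exI[of _ 1])
  then obtain m where m: "m > 0" "\<And>y u. y \<in> K \<Longrightarrow> norm u = 1 \<Longrightarrow> m \<le> G y u u" by blast
  define C where "C = Max {1, L, B1, B2, 1 / sqrt m}"
  have C: "C \<ge> 1" "L \<le> C" "B1 \<le> C" "B2 \<le> C" "1 / sqrt m \<le> C" by (auto simp: C_def)
  have N: "N y u \<le> C * norm u \<and> norm u \<le> C * N y u" if "y \<in> K" for y u
  proof
    have "G y u u \<le> norm (G y) * norm u * norm u"
      using norm_blinfun[of "G y u" u] norm_blinfun[of "G y" u] by (smt (verit) mult_right_mono norm_ge_zero real_norm_def)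
    also have "\<dots> \<le> (C * C) * norm u * norm u"
    proof (intro mult_right_mono norm_ge_zero)
      have "C * 1 \<le> C * C" using C(1) by (intro mult_left_mono) auto
      then show "norm (G y) \<le> C * C" using B(2)[OF that] C by linarith
    qed
    finally have "G y u u \<le> (C * norm u)\<^sup>2" by (simp add: power2_eq_square mult_ac)
    then have "sqrt (G y u u) \<le> sqrt ((C * norm u)\<^sup>2)" by (rule real_sqrt_le_mono)
    then show "N y u \<le> C * norm u" using C(1) by (simp add: N_def abs_mult)
    show "norm u \<le> C * N y u"
    proof (cases "u = 0")
      case False
      let ?w = "(1 / norm u) *\<^sub>R u"
      have "sqrt m \<le> N y ?w" unfolding N_def using m(2)[OF that, of ?w] False by simp
      also have "N y ?w = N y u / norm u" using N_scale[of y "1 / norm u" u] by simp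
      finally have "sqrt m * norm u \<le> N y u" using False by (simp add: pos_le_divide_eq)
      then have "norm u \<le> (1 / sqrt m) * N y u" using m(1) by (simp add: field_simps)
      also have "\<dots> \<le> C * N y u" using C that K by (intro mult_right_mono) auto
      finally show ?thesis .
    qed (use that K C in auto)
  qed
  have "norm (\<Gamma> y - \<Gamma> x) \<le> C * norm (y - x)" if "x \<in> K" "y \<in> K" for x y
    using L(2)[OF that] C(2) by (meson mult_right_mono norm_ge_zero order_trans)
  moreover have "norm (\<Gamma> y) \<le> C" if "y \<in> K" for y using B(1)[OF that] C(3) by simp
  ultimately have "bounds K C" unfolding bounds_def using C(1) K N by blast
  then show ?thesis by (rule that)
qed

section \<open>Geodesics of small velocity and the difference of two of them\<close>

definition small_sol :: "'e set \<Rightarrow> real \<Rightarrow> (real \<Rightarrow> 'e) \<Rightarrow> (real \<Rightarrow> 'e) \<Rightarrow> bool" where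
  "small_sol K \<rho> \<gamma> v \<longleftrightarrow> sol {0..1} \<gamma> v \<and> (\<forall>t\<in>{0..1}. \<gamma> t \<in> K \<and> norm (v t) \<le> \<rho>)"

lemma small_sol_const: "a \<in> K \<Longrightarrow> a \<in> U \<Longrightarrow> \<rho> \<ge> 0 \<Longrightarrow> small_sol K \<rho> (\<lambda>_. a) (\<lambda>_. 0)"
  by (auto simp: small_sol_def sol_def)

text \<open>The acceleration is quadratic in the velocity, hence its Lipschitz constant is of the
  order of the velocity bound \<open>\<rho>\<close>. This supplies the small \<open>\<theta>\<close>
  of \<open>second_order_estimate\<close>.\<close>

lemma acceleration_difference:
  assumes b: "bounds K C" and "x \<in> K" "y \<in> K" "norm v \<le> \<rho>" "norm w \<le> \<rho>" "\<rho> \<le> 1"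
  shows "norm (\<Gamma> y w w - \<Gamma> x v v) \<le> 2 * C * \<rho> * (norm (y - x) + norm (w - v))"
proof -
  have C: "C \<ge> 1" "norm (\<Gamma> x) \<le> C" "norm (\<Gamma> y - \<Gamma> x) \<le> C * norm (y - x)"
    using assms by (auto simp: bounds_def)
  have \<rho>: "0 \<le> \<rho>" using assms(4) norm_ge_zero order_trans by blast
  have eq: "\<Gamma> y w w - \<Gamma> x v v = (\<Gamma> y - \<Gamma> x) w w + (\<Gamma> x (w - v) w + \<Gamma> x v (w - v))"
    by (simp add: blinfun.bilinear_simps)
  have "norm ((\<Gamma> y - \<Gamma> x) w w) \<le> norm (\<Gamma> y - \<Gamma> x) * norm w * norm w"
    by (meson mult_right_mono norm_blinfun norm_ge_zero order_trans)
  also have "\<dots> \<le> C * norm (y - x) * \<rho> * 1"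
    using C assms \<rho> by (intro mult_mono) auto
  finally have 1: "norm ((\<Gamma> y - \<Gamma> x) w w) \<le> C * \<rho> * norm (y - x)" by (simp add: mult_ac)
  have "norm (\<Gamma> x (w - v) w) \<le> C * norm (w - v) * \<rho>"
    by (rule order_trans[OF norm_\<Gamma>]) (use C assms \<rho> in \<open>intro mult_mono, auto\<close>)
  moreover have "norm (\<Gamma> x v (w - v)) \<le> C * \<rho> * norm (w - v)"
    by (rule order_trans[OF norm_\<Gamma>]) (use C assms \<rho> in \<open>intro mult_mono, auto\<close>)
  ultimately have "norm (\<Gamma> y w w - \<Gamma> x v v) \<le> C * \<rho> * norm (y - x) + (C * norm (w - v) * \<rho> + C * \<rho> * norm (w - v))"
    unfolding eq using 1 by (intro norm_triangle_mono)
  also have "\<dots> = C * \<rho> * (norm (y - x) + 2 * norm (w - v))" by (simp add: algebra_simps)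
  also have "\<dots> \<le> C * \<rho> * (2 * (norm (y - x) + norm (w - v)))" using C \<rho> by (intro mult_left_mono) auto
  finally show ?thesis by (simp add: mult_ac)
qed

text \<open>The first bound says that the end point depends on the initial velocity almost like a
  translation, which is what shooting needs. The second controls the difference by its end values
  and serves the interpolating geodesics. The third controls it by the initial data and gives
  uniqueness and continuous dependence.\<close>

lemma small_sol_difference:
  assumes b: "bounds K C" and \<rho>: "\<rho> \<le> 1" "32 * C * \<rho> \<le> 1"
    and s: "small_sol K \<rho> \<gamma> v" "small_sol K \<rho> \<sigma> w"
  defines "h \<equiv> \<lambda>t. \<sigma> t - \<gamma> t" and "h' \<equiv> \<lambda>t. w t - v t"
  shows "norm (h 1 - h 0 - h' 0) \<le> 4 * C * \<rho> * (norm (h 0) + 2 * norm (h' 0))"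
    and "t \<in> {0..1} \<Longrightarrow> norm (h t) + norm (h' t) \<le> 8 * (norm (h 0) + norm (h 1))"
    and "t \<in> {0..1} \<Longrightarrow> norm (h t) + norm (h' t) \<le> 4 * (norm (h 0) + norm (h' 0))"
proof -
  have C: "C \<ge> 1" using b by (simp add: bounds_def)
  have "norm (v 0) \<le> \<rho>" using s by (auto simp: small_sol_def)
  then have \<rho>0: "0 \<le> \<rho>" using norm_ge_zero order_trans by blast
  define \<theta> where "\<theta> = 2 * C * \<rho>"
  have \<theta>: "0 \<le> \<theta>" "\<theta> \<le> 1/16" using C \<rho> \<rho>0 by (auto simp: \<theta>_def)
  have sg: "(\<gamma> has_vector_derivative v t) (at t)" "(v has_vector_derivative - \<Gamma> (\<gamma> t) (v t) (v t)) (at t)"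
    "(\<sigma> has_vector_derivative w t) (at t)" "(w has_vector_derivative - \<Gamma> (\<sigma> t) (w t) (w t)) (at t)"
    if "t \<in> {0..1}" for t using s that by (simp_all add: small_sol_def sol_def)
  have d1: "(h has_vector_derivative h' t) (at t within {0..1})" if "t \<in> {0..1}" for t
    unfolding h_def h'_def
    by (rule has_vector_derivative_at_within[OF has_vector_derivative_diff[OF sg(3)[OF that] sg(1)[OF that]]])
  have d2: "(h' has_vector_derivative (- \<Gamma> (\<sigma> t) (w t) (w t) - - \<Gamma> (\<gamma> t) (v t) (v t))) (at t within {0..1})"
    if "t \<in> {0..1}" for t
    unfolding h'_def
    by (rule has_vector_derivative_at_within[OF has_vector_derivative_diff[OF sg(4)[OF that] sg(2)[OF that]]])
  have le: "norm (- \<Gamma> (\<sigma> t) (w t) (w t) - - \<Gamma> (\<gamma> t) (v t) (v t)) \<le> \<theta> * (norm (h t) + norm (h' t))"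
    if "t \<in> {0..1}" for t
  proof -
    have "norm (\<Gamma> (\<sigma> t) (w t) (w t) - \<Gamma> (\<gamma> t) (v t) (v t)) \<le> \<theta> * (norm (h t) + norm (h' t))"
      unfolding \<theta>_def h_def h'_def
      by (rule acceleration_difference[OF b]) (use s that \<rho> in \<open>auto simp: small_sol_def\<close>)
    then show ?thesis by (simp add: norm_minus_commute)
  qed
  have e: "norm (h' t - h' 0) \<le> 2 * \<theta> * (norm (h 0) + 2 * norm (h' 0))"
     "norm (h t - h 0 - t *\<^sub>R h' 0) \<le> 2 * \<theta> * (norm (h 0) + 2 * norm (h' 0))" if "t \<in> {0..1}" for t
    using second_order_estimate[OF d1 d2 le _ _ that] \<theta> by auto
  show A: "norm (h 1 - h 0 - h' 0) \<le> 4 * C * \<rho> * (norm (h 0) + 2 * norm (h' 0))"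
    using e(2)[of 1] by (simp add: \<theta>_def)
  define a b c where "a = norm (h 0)" and "b = norm (h' 0)" and "c = norm (h 1)"
  have nn: "a \<ge> 0" "b \<ge> 0" "c \<ge> 0" by (auto simp: a_def b_def c_def)
  define X where "X = 2 * \<theta> * (a + 2 * b)"
  have q: "X \<le> (a + 2 * b) / 8"
    using mult_right_mono[of "2 * \<theta>" "1/8" "a + 2 * b"] \<theta> nn by (simp add: X_def)
  have e': "norm (h' t - h' 0) \<le> X" "norm (h t - h 0 - t *\<^sub>R h' 0) \<le> X" if "t \<in> {0..1}" for t
    using e[OF that] by (simp_all add: X_def a_def b_def)
  have t1: "norm (h t) + norm (h' t) \<le> a + 2 * b + (a + 2 * b) / 4" if "t \<in> {0..1}" for t
  proof -
    have "norm (h t) \<le> norm (h t - h 0 - t *\<^sub>R h' 0) + norm (h 0 + t *\<^sub>R h' 0)"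
      using norm_triangle_ineq[of "h t - h 0 - t *\<^sub>R h' 0" "h 0 + t *\<^sub>R h' 0"] by simp
    moreover have "norm (h 0 + t *\<^sub>R h' 0) \<le> a + t * b"
      using norm_triangle_ineq[of "h 0" "t *\<^sub>R h' 0"] that by (simp add: a_def b_def)
    moreover have "t * b \<le> b" using that nn by (simp add: mult_left_le_one_le)
    moreover have "norm (h' t) \<le> norm (h' t - h' 0) + b"
      using norm_triangle_sub[of "h' t" "h' 0"] by (simp add: b_def)
    ultimately show ?thesis using e'[OF that] q by (simp add: field_simps)
  qed
  \<comment> \<open>The end values determine the initial velocity difference up to the error
    \<open>X\<close>, which is itself a small multiple of \<open>a + 2 * b\<close> and can be
    absorbed.\<close>
  have "b \<le> norm (h 1 - h 0 - h' 0) + (c + a)"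
    using norm_triangle_ineq4[of "h 1 - h 0 - h' 0" "h 1 - h 0"] norm_triangle_ineq4[of "h 1" "h 0"]
    by (simp add: a_def b_def c_def)
  then have b2: "b \<le> 2 * (a + c)" using e'(2)[of 1] q nn by (simp add: field_simps)
  show "norm (h t) + norm (h' t) \<le> 8 * (norm (h 0) + norm (h 1))" if "t \<in> {0..1}"
    using t1[OF that] b2 nn unfolding a_def[symmetric] c_def[symmetric] by (simp add: field_simps)
  show "norm (h t) + norm (h' t) \<le> 4 * (norm (h 0) + norm (h' 0))" if "t \<in> {0..1}"
    using t1[OF that] nn unfolding a_def[symmetric] b_def[symmetric] by (simp add: field_simps)
qed

text \<open>Picard iteration gives a short time interval for velocities of moderate size. The
  geodesic equation is homogeneous, so slowing down the parameter trades speed for time and reaches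
  an open interval around \<open>{0..1}\<close>.\<close>

lemma initial_value_problem:
  assumes \<epsilon>: "cball x0 \<epsilon> \<subseteq> U" "\<epsilon> > 0"
  obtains r \<rho> where "r > 0" "\<rho> > 0"
    "\<And>a v0. a \<in> cball x0 r \<Longrightarrow> norm v0 \<le> \<rho> \<Longrightarrow> \<exists>\<gamma> v. sol {-2<..<2} \<gamma> v \<and> \<gamma> 0 = a \<and> v 0 = v0 \<and>
      (\<forall>t\<in>{-2<..<2}. \<gamma> t \<in> cball x0 \<epsilon> \<and> norm (v t) \<le> \<epsilon>)"
proof -
  \<comment> \<open>The geodesic equation as an autonomous first-order system for position and
    velocity.\<close>
  define F where "F z = (snd z, - \<Gamma> (fst z) (snd z) (snd z))" for z :: "'e \<times> 'e"
  have b: "fst z \<in> cball x0 \<epsilon>" "norm (snd z) \<le> \<epsilon>" if "z \<in> cball (x0, 0) \<epsilon>" for z :: "'e \<times> 'e"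
    using that dist_fst_le[of "(x0, 0)" z] dist_snd_le[of "(x0, 0)" z] by (auto simp: dist_norm)
  have c1: "c1_fun (U \<times> UNIV) F"
  proof (rule c1_funI)
    fix z :: "'e \<times> 'e" assume "z \<in> U \<times> UNIV"
    then have "fst z \<in> U" by auto
    have 1: "((\<lambda>z. \<Gamma> (fst z)) has_derivative (\<lambda>d. D\<Gamma> (fst z) (fst d))) (at z)"
      by (rule has_derivative_compose[where f=fst and g=\<Gamma>, OF _ \<Gamma>_der[OF \<open>fst z \<in> U\<close>]]) (auto intro!: derivative_eq_intros)
    have 2: "((\<lambda>z. snd z) has_derivative (\<lambda>d. snd d)) (at z)" by (auto intro!: derivative_eq_intros)
    note 3 = bounded_bilinear.FDERIV[OF bounded_bilinear_blinfun_apply 1 2]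
    note 4 = bounded_bilinear.FDERIV[OF bounded_bilinear_blinfun_apply 3 2]
    show "(F has_derivative (\<lambda>d. (snd d, - (\<Gamma> (fst z) (snd z) (snd d) +
       (\<Gamma> (fst z) (snd d) + D\<Gamma> (fst z) (fst d) (snd z)) (snd z))))) (at z)"
    proof -
      have "F = (\<lambda>z. (snd z, - \<Gamma> (fst z) (snd z) (snd z)))" by (simp add: F_def fun_eq_iff)
      then show ?thesis using has_derivative_Pair[OF 2 has_derivative_minus[OF 4]] by simp
    qed
  next
    fix d :: "'e \<times> 'e"
    show "continuous_on (U \<times> UNIV) (\<lambda>z. (snd d, - (\<Gamma> (fst z) (snd z) (snd d) +
       (\<Gamma> (fst z) (snd d) + D\<Gamma> (fst z) (fst d) (snd z)) (snd z))))"
      by (intro continuous_intros continuous_on_compose2[OF \<Gamma>_cont] continuous_on_compose2[OF D\<Gamma>_cont]) auto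
  qed
  have sub: "cball (x0, 0::'e) \<epsilon> \<subseteq> U \<times> UNIV" using b \<epsilon> by force
  obtain L where L: "L \<ge> 0" "\<And>x y. x \<in> cball (x0, 0::'e) \<epsilon> \<Longrightarrow> y \<in> cball (x0, 0) \<epsilon> \<Longrightarrow> norm (F y - F x) \<le> L * norm (y - x)"
    using c1_fun_lipschitz[OF c1 compact_cball convex_cball sub] by blast
  have "bounded (F ` cball (x0, 0) \<epsilon>)"
    using c1_fun_continuous[OF c1] sub by (meson compact_cball compact_continuous_image compact_imp_bounded continuous_on_subset)
  then obtain M where M: "\<And>x. x \<in> cball (x0, 0) \<epsilon> \<Longrightarrow> norm (F x) \<le> M"
    unfolding bounded_iff by blast
  have "(x0, 0) \<in> cball (x0, 0::'e) \<epsilon>" using \<epsilon>(2) by simp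
  from order_trans[OF norm_ge_zero M[OF this]] have "M \<ge> 0" .
  define \<tau> where "\<tau> = min 1 (min (\<epsilon> / (2 * (M + 1))) (1 / (2 * (L + 1))))"
  have "0 < \<epsilon> / (2 * (M + 1))" "0 < 1 / (2 * (L + 1))"
    using \<epsilon>(2) \<open>M \<ge> 0\<close> L(1) by (auto intro!: divide_pos_pos mult_pos_pos add_nonneg_pos)
  then have \<tau>: "\<tau> > 0" "\<tau> \<le> 1" "\<tau> \<le> \<epsilon> / (2 * (M + 1))" "\<tau> \<le> 1 / (2 * (L + 1))"
    unfolding \<tau>_def by linarith+
  have \<tau>M: "\<tau> * M \<le> \<epsilon> / 2"
  proof -
    have "\<tau> * (2 * (M + 1)) \<le> \<epsilon>" using \<tau>(3) \<open>M \<ge> 0\<close> by (simp add: pos_le_divide_eq)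
    then show ?thesis using \<tau>(1) by (simp add: algebra_simps)
  qed
  have \<tau>L: "\<tau> * L \<le> 1 / 2"
  proof -
    have "\<tau> * (2 * (L + 1)) \<le> 1" using \<tau>(4) L(1) by (simp add: pos_le_divide_eq)
    then show ?thesis using \<tau>(1) by (simp add: algebra_simps)
  qed
  \<comment> \<open>The slowdown factor: \<open>{-2<..<2}\<close> is mapped into
    \<open>{-\<tau><..<\<tau>}\<close>.\<close>
  define c where "c = \<tau> / 2"
  have c: "0 < c" "c \<le> 1" using \<tau> by (auto simp: c_def)
  show ?thesis
  proof (rule that[of "\<epsilon> / 4" "c * (\<epsilon> / 4)"])
    show "\<epsilon> / 4 > 0" "c * (\<epsilon> / 4) > 0" using \<epsilon> c by auto
    fix a v0 :: 'e assume a: "a \<in> cball x0 (\<epsilon> / 4)" and v0: "norm v0 \<le> c * (\<epsilon> / 4)"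
    define z1 where "z1 = (a, (1 / c) *\<^sub>R v0)"
    have "norm ((1 / c) *\<^sub>R v0) \<le> \<epsilon> / 4" using v0 c by (simp add: field_simps)
    then have "norm (0 - (1 / c) *\<^sub>R v0) \<le> \<epsilon> / 4" by (metis norm_minus_commute diff_zero)
    moreover have "norm (x0 - a) \<le> \<epsilon> / 4" using a by (simp add: dist_norm)
    ultimately have "norm (x0 - a, 0 - (1 / c) *\<^sub>R v0) \<le> \<epsilon> / 2"
      using norm_Pair_le[of "x0 - a" "0 - (1 / c) *\<^sub>R v0"] by linarith
    then have z1: "z1 \<in> cball (x0, 0) (\<epsilon> / 2)" by (simp add: z1_def dist_norm)
    obtain z where z: "z 0 = z1" "\<And>t. t \<in> {-\<tau><..<\<tau>} \<Longrightarrow> z t \<in> cball (x0, 0) \<epsilon>"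
      "\<And>t. t \<in> {-\<tau><..<\<tau>} \<Longrightarrow> (z has_vector_derivative F (z t)) (at t)"
      using picard[OF \<epsilon>(2) L(2) M \<tau>(1) \<tau>M \<tau>L L(1) z1] by blast
    have "sol {-\<tau><..<\<tau>} (\<lambda>t. fst (z t)) (\<lambda>t. snd (z t))"
      unfolding sol_def
    proof (intro ballI conjI)
      fix t assume t: "t \<in> {-\<tau><..<\<tau>}"
      show "fst (z t) \<in> U" using z(2)[OF t] b \<epsilon> by blast
      show "((\<lambda>t. fst (z t)) has_vector_derivative snd (z t)) (at t)"
        using bounded_linear.has_vector_derivative[OF bounded_linear_fst z(3)[OF t]] by (simp add: F_def)
      show "((\<lambda>t. snd (z t)) has_vector_derivative - \<Gamma> (fst (z t)) (snd (z t)) (snd (z t))) (at t)"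
        using bounded_linear.has_vector_derivative[OF bounded_linear_snd z(3)[OF t]] by (simp add: F_def)
    qed
    moreover have inI: "c * t + 0 \<in> {-\<tau><..<\<tau>}" if "t \<in> {-2<..<2}" for t
      using that \<tau>(1) mult_strict_left_mono[of "-2" t "\<tau>"] mult_strict_left_mono[of t 2 "\<tau>"] by (auto simp: c_def)
    ultimately have s: "sol {-2<..<2} (\<lambda>t. fst (z (c * t + 0))) (\<lambda>t. c *\<^sub>R snd (z (c * t + 0)))"
      by (rule sol_scale)
    have "norm (c *\<^sub>R snd (z (c * t + 0))) \<le> \<epsilon>" if "t \<in> {-2<..<2}" for t
      using b(2)[OF z(2)[OF inI[OF that]]] c mult_left_le_one_le[of "norm (snd (z (c * t + 0)))" c] by simp
    then show "\<exists>\<gamma> v. sol {-2<..<2} \<gamma> v \<and> \<gamma> 0 = a \<and> v 0 = v0 \<and> (\<forall>t\<in>{-2<..<2}. \<gamma> t \<in> cball x0 \<epsilon> \<and> norm (v t) \<le> \<epsilon>)"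
      using s b(1)[OF z(2)[OF inI]] c
      by (intro exI[of _ "\<lambda>t. fst (z (c * t + 0))"] exI[of _ "\<lambda>t. c *\<^sub>R snd (z (c * t + 0))"])
        (auto simp: z(1) z1_def)
  qed
qed

text \<open>Shooting: the map from initial velocity to end point is a translation up to a
  perturbation with Lipschitz constant 1/4, so Banach's theorem finds the velocity that hits the
  prescribed end point.\<close>

lemma boundary_value_problem:
  assumes b: "bounds K C" and \<rho>: "0 < \<rho>" "\<rho> \<le> 1" "32 * C * \<rho> \<le> 1" and K: "cball x0 \<epsilon> \<subseteq> K" "\<epsilon> > 0"
  obtains r where "r > 0" "r \<le> \<epsilon>"
    "\<And>a b. a \<in> cball x0 r \<Longrightarrow> b \<in> cball x0 r \<Longrightarrow> \<exists>\<gamma> v. sol {-2<..<2} \<gamma> v \<and> \<gamma> 0 = a \<and> \<gamma> 1 = b \<and> small_sol K \<rho> \<gamma> v"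
proof -
  have KU: "K \<subseteq> U" using b by (simp add: bounds_def)
  define \<epsilon>' where "\<epsilon>' = min \<epsilon> \<rho>"
  have \<epsilon>': "\<epsilon>' > 0" "cball x0 \<epsilon>' \<subseteq> U" "cball x0 \<epsilon>' \<subseteq> K" "\<epsilon>' \<le> \<rho>"
    using K KU \<rho> by (auto simp: \<epsilon>'_def)
  obtain r1 \<rho>1 where r1: "r1 > 0" "\<rho>1 > 0" and ivp: "\<And>a v0. a \<in> cball x0 r1 \<Longrightarrow> norm v0 \<le> \<rho>1 \<Longrightarrow>
      \<exists>\<gamma> v. sol {-2<..<2} \<gamma> v \<and> \<gamma> 0 = a \<and> v 0 = v0 \<and> (\<forall>t\<in>{-2<..<2}. \<gamma> t \<in> cball x0 \<epsilon>' \<and> norm (v t) \<le> \<epsilon>')"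
    using initial_value_problem[OF \<epsilon>'(2,1)] by metis
  have ivp': "\<exists>\<gamma> v. sol {-2<..<2} \<gamma> v \<and> \<gamma> 0 = a \<and> v 0 = v0 \<and> small_sol K \<rho> \<gamma> v"
    if a: "a \<in> cball x0 r1" "norm v0 \<le> \<rho>1" for a v0
  proof -
    obtain \<gamma> v where g: "sol {-2<..<2} \<gamma> v" "\<gamma> 0 = a" "v 0 = v0" "\<forall>t\<in>{-2<..<2}. \<gamma> t \<in> cball x0 \<epsilon>' \<and> norm (v t) \<le> \<epsilon>'"
      using ivp[OF a] by blast
    have "sol {0..1} \<gamma> v" using g(1) by (auto simp: sol_def)
    moreover have "\<gamma> t \<in> K \<and> norm (v t) \<le> \<rho>" if "t \<in> {0..1}" for t
      using g(4) \<epsilon>' that by (auto dest!: bspec[of _ _ t])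
    ultimately have "small_sol K \<rho> \<gamma> v" by (simp add: small_sol_def)
    then show ?thesis using g by blast
  qed
  \<comment> \<open>With \<open>\<rho>1 / 4\<close> the points \<open>p\<close> and \<open>q\<close>
    are at most \<open>\<rho>1 / 2\<close> apart, so \<open>\<Psi>\<close> maps the ball of radius
    \<open>\<rho>1\<close> into itself: a quarter of the radius from the contraction, half from
    \<open>\<Psi> 0\<close>.\<close>
  define r where "r = Min {r1, \<epsilon>, \<rho>1 / 4}"
  have r: "r > 0" "r \<le> r1" "r \<le> \<epsilon>" "r \<le> \<rho>1 / 4" using r1 K by (auto simp: r_def)
  have est: "norm (\<sigma> 1 - \<gamma> 1 - (w 0 - v 0)) \<le> norm (w 0 - v 0) / 4"
    if "small_sol K \<rho> \<gamma> v" "small_sol K \<rho> \<sigma> w" "\<sigma> 0 = \<gamma> 0" for \<gamma> \<sigma> v w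
  proof -
    have "norm (\<sigma> 1 - \<gamma> 1 - (w 0 - v 0)) \<le> 4 * C * \<rho> * (2 * norm (w 0 - v 0))"
      using small_sol_difference(1)[OF b \<rho>(2,3) that(1,2)] that(3) by simp
    also have "\<dots> = (32 * C * \<rho>) * (norm (w 0 - v 0) / 4)" by simp
    also have "\<dots> \<le> 1 * (norm (w 0 - v 0) / 4)" using \<rho>(3) by (intro mult_right_mono) auto
    finally show ?thesis by simp
  qed
  show ?thesis
  proof (rule that[OF r(1,3)])
    fix p q assume p: "p \<in> cball x0 r" and q: "q \<in> cball x0 r"
    have p': "p \<in> cball x0 r1" "p \<in> K" using p r K by auto
    obtain g gv where g: "\<And>v0. norm v0 \<le> \<rho>1 \<Longrightarrow> sol {-2<..<2} (g v0) (gv v0) \<and> g v0 0 = p \<and> gv v0 0 = v0 \<and> small_sol K \<rho> (g v0) (gv v0)"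
      using ivp'[OF p'(1)] by metis
    define \<Psi> where "\<Psi> v0 = v0 - (g v0 1 - q)" for v0
    have lip: "norm (\<Psi> w - \<Psi> v) \<le> norm (w - v) / 4" if "norm v \<le> \<rho>1" "norm w \<le> \<rho>1" for v w
    proof -
      have "norm (g w 1 - g v 1 - (w - v)) \<le> norm (w - v) / 4"
        using est[of "g v" "gv v" "g w" "gv w"] g[OF that(1)] g[OF that(2)] by simp
      moreover have "\<Psi> w - \<Psi> v = - (g w 1 - g v 1 - (w - v))" by (simp add: \<Psi>_def)
      ultimately show ?thesis by (metis norm_minus_cancel)
    qed
    have g0: "g 0 0 = p" "gv 0 0 = 0" "small_sol K \<rho> (g 0) (gv 0)"
      using g[of 0] r1(2) by simp_all
    have "p \<in> U" using p' KU by blast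
    \<comment> \<open>Comparison with the constant solution shows that the geodesic with zero
      velocity stays at \<open>p\<close>.\<close>
    from est[OF g0(3) small_sol_const[OF p'(2) this, of \<rho>]] have "g 0 1 = p"
      using g0 \<rho>(1) by simp
    then have "\<Psi> 0 = q - p" by (simp add: \<Psi>_def)
    then have \<Psi>0: "norm (\<Psi> 0) \<le> \<rho>1 / 2"
      using p q r(4) dist_triangle2[of q p x0] by (simp add: dist_norm norm_minus_commute)
    have "\<exists>!v\<in>cball 0 \<rho>1. \<Psi> v = v"
    proof (rule Banach_fix[where c="1/4"])
      show "complete (cball (0::'e) \<rho>1)" "cball (0::'e) \<rho>1 \<noteq> {}" using r1 by (auto simp: complete_eq_closed)
      show "\<Psi> ` cball 0 \<rho>1 \<subseteq> cball 0 \<rho>1"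
      proof clarify
        fix v :: 'e assume "v \<in> cball 0 \<rho>1"
        then have v: "norm v \<le> \<rho>1" by simp
        have "norm (\<Psi> v) \<le> norm (\<Psi> v - \<Psi> 0) + norm (\<Psi> 0)" using norm_triangle_sub by (metis add.commute)
        then show "\<Psi> v \<in> cball 0 \<rho>1" using lip[OF _ v, of 0] \<Psi>0 v r1 by simp
      qed
      show "dist (\<Psi> x) (\<Psi> y) \<le> 1 / 4 * dist x y" if "x \<in> cball 0 \<rho>1" "y \<in> cball 0 \<rho>1" for x y
        using lip[of y x] that by (simp add: dist_norm)
    qed auto
    then obtain v where v: "norm v \<le> \<rho>1" "\<Psi> v = v" by (auto simp: Ex1_def)
    then have "g v 1 = q" by (simp add: \<Psi>_def)
    then show "\<exists>\<gamma> v. sol {-2<..<2} \<gamma> v \<and> \<gamma> 0 = p \<and> \<gamma> 1 = q \<and> small_sol K \<rho> \<gamma> v"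
      using g[OF v(1)] by blast
  qed
qed

section \<open>Almost convexity of the norm of a difference of geodesics\<close>

lemma \<Gamma>_remainder:
  assumes K: "compact K" "convex K" "K \<subseteq> U" and "\<epsilon> > 0"
  obtains \<eta> where "\<eta> > 0" "\<And>x y. x \<in> K \<Longrightarrow> y \<in> K \<Longrightarrow> norm (y - x) \<le> \<eta> \<Longrightarrow> norm (\<Gamma> y - \<Gamma> x - D\<Gamma> x (y - x)) \<le> \<epsilon> * norm (y - x)"
  using c1_fun_uniform_remainder[of K \<Gamma> D\<Gamma>, OF _ _ K(1,2) \<open>\<epsilon> > 0\<close>] \<Gamma>_der D\<Gamma>_cont K(3)
  by (metis continuous_on_subset subset_iff)

text \<open>The quantity estimated here is the second derivative of \<^term>\<open>N (\<gamma> t) (\<sigma> t - \<gamma> t)\<close>. For a genuine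
  Jacobi field the error term vanishes and the norm is convex because of the curvature condition.\<close>

lemma almost_convex_difference:
  assumes b: "bounds K C" and "\<epsilon> > 0"
  shows "\<exists>\<eta>>0. \<forall>\<gamma> v \<sigma> w \<rho> \<kappa> t. small_sol K \<rho> \<gamma> v \<longrightarrow> small_sol K \<rho> \<sigma> w \<longrightarrow> \<rho> \<le> 1 \<longrightarrow> \<kappa> \<le> \<eta> \<longrightarrow>
       (\<forall>t\<in>{0..1}. norm (\<sigma> t - \<gamma> t) + norm (w t - v t) \<le> \<kappa>) \<longrightarrow> t \<in> {0..1} \<longrightarrow>
       N (\<gamma> t) (\<sigma> t - \<gamma> t) \<le> (1 - t) * N (\<gamma> 0) (\<sigma> 0 - \<gamma> 0) + t * N (\<gamma> 1) (\<sigma> 1 - \<gamma> 1) + \<epsilon> * \<kappa>"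
proof -
  have K: "compact K" "convex K" "K \<subseteq> U" and C: "C \<ge> 1" using b by (auto simp: bounds_def)
  \<comment> \<open>The final error factor is \<open>C * (\<epsilon>1 + 3 * C * \<kappa>)\<close>;
    this choice gives its first term a quarter of \<open>\<epsilon>\<close>, and the second entry of
    \<open>\<eta>\<close> leaves three quarters to the other.\<close>
  define \<epsilon>1 where "\<epsilon>1 = \<epsilon> / (4 * C)"
  have "\<epsilon>1 > 0" using \<open>\<epsilon> > 0\<close> C by (simp add: \<epsilon>1_def)
  then obtain \<eta>1 where \<eta>1: "\<eta>1 > 0" "\<And>x y. x \<in> K \<Longrightarrow> y \<in> K \<Longrightarrow> norm (y - x) \<le> \<eta>1 \<Longrightarrow> norm (\<Gamma> y - \<Gamma> x - D\<Gamma> x (y - x)) \<le> \<epsilon>1 * norm (y - x)"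
    using \<Gamma>_remainder[OF K] by blast
  define \<eta> where "\<eta> = min \<eta>1 (\<epsilon> / (4 * C * C))"
  have \<eta>: "\<eta> > 0" "\<eta> \<le> \<eta>1" "\<eta> \<le> \<epsilon> / (4 * C * C)" using \<eta>1 \<open>\<epsilon> > 0\<close> C by (auto simp: \<eta>_def)
  show ?thesis
  proof (rule exI[of _ \<eta>], intro conjI \<eta>(1) allI impI)
    fix \<gamma> v \<sigma> w \<rho> \<kappa> and t :: real
    assume s: "small_sol K \<rho> \<gamma> v" "small_sol K \<rho> \<sigma> w" and \<rho>: "\<rho> \<le> 1" and \<kappa>: "\<kappa> \<le> \<eta>"
      and le0: "\<forall>t\<in>{0..1}. norm (\<sigma> t - \<gamma> t) + norm (w t - v t) \<le> \<kappa>" and t: "t \<in> {0..1}"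
    note le = le0[rule_format]
    have \<kappa>0: "\<kappa> \<ge> 0" using le[OF t] norm_ge_zero[of "\<sigma> t - \<gamma> t"] norm_ge_zero[of "w t - v t"] by linarith
    define h where "h t = \<sigma> t - \<gamma> t" for t
    define h' where "h' t = w t - v t" for t
    \<comment> \<open>\<open>V\<close> is the covariant derivative of \<open>h\<close> along
      \<open>\<gamma>\<close>. \<open>W\<close> is its second covariant derivative, with the second
      derivatives of both curves already replaced through the geodesic equation.\<close>
    define V where "V t = h' t + \<Gamma> (\<gamma> t) (v t) (h t)" for t
    define W where "W t = (- \<Gamma> (\<sigma> t) (w t) (w t) + \<Gamma> (\<gamma> t) (v t) (v t)) + (D\<Gamma> (\<gamma> t) (v t) (v t) (h t)
       - \<Gamma> (\<gamma> t) (\<Gamma> (\<gamma> t) (v t) (v t)) (h t) + \<Gamma> (\<gamma> t) (v t) (h' t)) + \<Gamma> (\<gamma> t) (v t) (V t)" for t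
    have S: "\<gamma> t \<in> K" "\<sigma> t \<in> K" "\<gamma> t \<in> U" "\<sigma> t \<in> U" "norm (v t) \<le> 1" "norm (h t) \<le> \<kappa>" "norm (h' t) \<le> \<kappa>"
      "norm (h t) + norm (h' t) \<le> \<kappa>"
      "(\<gamma> has_vector_derivative v t) (at t)" "(v has_vector_derivative - \<Gamma> (\<gamma> t) (v t) (v t)) (at t)"
      "(h has_vector_derivative h' t) (at t)"
      "(h' has_vector_derivative - \<Gamma> (\<sigma> t) (w t) (w t) + \<Gamma> (\<gamma> t) (v t) (v t)) (at t)" if "t \<in> {0..1}" for t
    proof -
      show "\<gamma> t \<in> K" "\<sigma> t \<in> K" "\<gamma> t \<in> U" "\<sigma> t \<in> U" "norm (v t) \<le> 1"
        using s that \<rho> K by (auto simp: small_sol_def sol_def dest!: bspec[of _ _ t])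
      show n: "norm (h t) + norm (h' t) \<le> \<kappa>" using le[OF that] by (simp add: h_def h'_def)
      show "norm (h t) \<le> \<kappa>" "norm (h' t) \<le> \<kappa>" using n norm_ge_zero[of "h t"] norm_ge_zero[of "h' t"] by linarith+
      show g: "(\<gamma> has_vector_derivative v t) (at t)" "(v has_vector_derivative - \<Gamma> (\<gamma> t) (v t) (v t)) (at t)"
        using s that by (auto simp: small_sol_def sol_def)
      have g': "(\<sigma> has_vector_derivative w t) (at t)" "(w has_vector_derivative - \<Gamma> (\<sigma> t) (w t) (w t)) (at t)"
        using s that by (auto simp: small_sol_def sol_def)
      show "(h has_vector_derivative h' t) (at t)" unfolding h_def h'_def
        by (rule has_vector_derivative_diff[OF g'(1) g(1)])
      show "(h' has_vector_derivative - \<Gamma> (\<sigma> t) (w t) (w t) + \<Gamma> (\<gamma> t) (v t) (v t)) (at t)"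
        unfolding h'_def using has_vector_derivative_diff[OF g'(2) g(2)] by simp
    qed
    have dV: "(V has_vector_derivative W t - \<Gamma> (\<gamma> t) (v t) (V t)) (at t)" if "t \<in> {0..1}" for t
      unfolding V_def[abs_def]
      using has_vector_derivative_add[OF S(12)[OF that] derivative_along[OF \<Gamma>_der[OF S(3)[OF that]] S(9)[OF that] S(10)[OF that] S(11)[OF that]]]
      by (simp add: W_def V_def blinfun.bilinear_simps algebra_simps)
    \<comment> \<open>The subtracted expression is the curvature term of the Jacobi equation. What
      remains is a Taylor remainder of the Christoffel symbols, bounded by
      \<open>\<epsilon>1 * \<kappa>\<close>, and three products of two small differences, each
      bounded by \<open>C * \<kappa> * \<kappa>\<close>.\<close>
    have err: "N (\<gamma> t) (W t - (D\<Gamma> (\<gamma> t) (v t) (v t) (h t) - D\<Gamma> (\<gamma> t) (h t) (v t) (v t)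
       + \<Gamma> (\<gamma> t) (v t) (\<Gamma> (\<gamma> t) (h t) (v t)) - \<Gamma> (\<gamma> t) (h t) (\<Gamma> (\<gamma> t) (v t) (v t)))) \<le> \<epsilon> * \<kappa>" (is "N _ ?E \<le> _")
      if "t \<in> {0..1}" for t
    proof -
      note S = S[OF that]
      let ?R = "\<Gamma> (\<sigma> t) - \<Gamma> (\<gamma> t)"
      have w: "w t = v t + h' t" by (simp add: h'_def)
      have "?E = - ((?R - D\<Gamma> (\<gamma> t) (h t)) (v t) (v t) + (?R (v t) (h' t) + ?R (h' t) (v t)) + \<Gamma> (\<sigma> t) (h' t) (h' t))"
        unfolding W_def V_def w
        using \<Gamma>_sym[OF S(3), of "h' t" "v t"] \<Gamma>_sym[OF S(3), of "h t" "v t"]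
          \<Gamma>_sym[OF S(3), of "h t" "\<Gamma> (\<gamma> t) (v t) (v t)"]
        by (simp add: blinfun.bilinear_simps algebra_simps)
      then have "norm ?E = norm ((?R - D\<Gamma> (\<gamma> t) (h t)) (v t) (v t) + (?R (v t) (h' t) + ?R (h' t) (v t)) + \<Gamma> (\<sigma> t) (h' t) (h' t))"
        by (metis norm_minus_cancel)
      also have "\<dots> \<le> \<epsilon>1 * \<kappa> + (C * \<kappa> * \<kappa> + C * \<kappa> * \<kappa>) + C * \<kappa> * \<kappa>"
      proof (intro norm_triangle_mono)
        have two: "norm (blinfun_apply (blinfun_apply B x) y) \<le> norm B * norm x * norm y" for B :: "'e \<Rightarrow>\<^sub>L 'e \<Rightarrow>\<^sub>L 'e" and x y
          by (meson mult_right_mono norm_blinfun norm_ge_zero order_trans)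
        have three: "norm (blinfun_apply (blinfun_apply B x) y) \<le> b * c * d"
          if "norm B \<le> b" "norm x \<le> c" "norm y \<le> d" for B :: "'e \<Rightarrow>\<^sub>L 'e \<Rightarrow>\<^sub>L 'e" and x y b c d
        proof -
          have "0 \<le> b" "0 \<le> c" "0 \<le> d" using that norm_ge_zero order_trans by blast+
          then show ?thesis using that by (intro order_trans[OF two] mult_mono) auto
        qed
        have "norm (?R - D\<Gamma> (\<gamma> t) (h t)) \<le> \<epsilon>1 * norm (h t)"
          using \<eta>1(2)[OF S(1,2)] S(6) \<kappa> \<eta> by (simp add: h_def)
        also have "\<dots> \<le> \<epsilon>1 * \<kappa>" using S(6) \<open>\<epsilon>1 > 0\<close> by simp
        finally show "norm ((?R - D\<Gamma> (\<gamma> t) (h t)) (v t) (v t)) \<le> \<epsilon>1 * \<kappa>"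
          using three[of _ "\<epsilon>1 * \<kappa>" "v t" 1 "v t" 1] S(5) by simp
        have "norm ?R \<le> C * norm (h t)" using b S(1,2) by (simp add: bounds_def h_def)
        also have "\<dots> \<le> C * \<kappa>" using S(6) C by simp
        finally have R: "norm ?R \<le> C * \<kappa>" .
        show "norm (?R (v t) (h' t)) \<le> C * \<kappa> * \<kappa>" using three[OF R S(5) S(7)] by simp
        show "norm (?R (h' t) (v t)) \<le> C * \<kappa> * \<kappa>" using three[OF R S(7) S(5)] by simp
        show "norm (\<Gamma> (\<sigma> t) (h' t) (h' t)) \<le> C * \<kappa> * \<kappa>"
          using three[OF _ S(7) S(7)] b S(2) by (auto simp: bounds_def)
      qed
      finally have "norm ?E \<le> (\<epsilon>1 + 3 * C * \<kappa>) * \<kappa>" by (simp add: algebra_simps)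
      then have "C * norm ?E \<le> C * ((\<epsilon>1 + 3 * C * \<kappa>) * \<kappa>)" by (rule mult_left_mono) (use C in simp)
      moreover have "N (\<gamma> t) ?E \<le> C * norm ?E" using b S(1) by (auto simp: bounds_def)
      ultimately have "N (\<gamma> t) ?E \<le> C * ((\<epsilon>1 + 3 * C * \<kappa>) * \<kappa>)" by (rule order_trans[rotated])
      also have "\<dots> = (C * \<epsilon>1 + 3 * (C * C * \<kappa>)) * \<kappa>" by (simp add: algebra_simps)
      also have "\<dots> \<le> \<epsilon> * \<kappa>"
      proof (intro mult_right_mono \<kappa>0)
        have "C * C * \<kappa> \<le> C * C * (\<epsilon> / (4 * C * C))" using \<kappa> \<eta>(3) C by (intro mult_left_mono) auto
        also have "\<dots> = \<epsilon> / 4" using C by simp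
        finally show "C * \<epsilon>1 + 3 * (C * C * \<kappa>) \<le> \<epsilon>" using C by (simp add: \<epsilon>1_def)
      qed
      finally show ?thesis .
    qed
    define q where "q t = G (\<gamma> t) (h t) (h t)" for t
    have dq: "(q has_real_derivative 2 * G (\<gamma> t) (h t) (V t)) (at t)" if "t \<in> {0..1}" for t
      unfolding q_def[abs_def]
      using G_along[of \<gamma> t "v t" h "h' t" h "h' t"] S[OF that] G_sym[OF S(3)[OF that], of "V t" "h t"] by (simp add: V_def)
    have dGV: "((\<lambda>t. G (\<gamma> t) (h t) (V t)) has_real_derivative G (\<gamma> t) (V t) (V t) + G (\<gamma> t) (h t) (W t)) (at t)"
      if "t \<in> {0..1}" for t
      using G_along[of \<gamma> t "v t" h "h' t" V "W t - \<Gamma> (\<gamma> t) (v t) (V t)"] S[OF that] dV[OF that] by (simp add: V_def)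
    have main: "N (\<gamma> t) (h t) \<le> (1 - t) * N (\<gamma> 0) (h 0) + t * N (\<gamma> 1) (h 1) + \<epsilon> * \<kappa> + \<delta>" if "\<delta> > 0" for \<delta>
    proof -
      \<comment> \<open>The norm is not differentiable where \<open>h\<close> vanishes; the summand
        \<open>\<delta>\<^sup>2\<close> smooths it, and \<open>\<delta>\<close> is removed at the
        end.\<close>
      define \<phi> where "\<phi> t = sqrt (q t + \<delta>\<^sup>2)" for t
      have qnn: "q t \<ge> 0" if "t \<in> {0..1}" for t using S[OF that] by (simp add: q_def G_nonneg)
      have \<phi>pos: "\<phi> t > 0" "(\<phi> t)\<^sup>2 = q t + \<delta>\<^sup>2" if "t \<in> {0..1}" for t
        using qnn[OF that] \<open>\<delta> > 0\<close> by (auto simp: \<phi>_def add_nonneg_pos)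
      have d\<phi>: "(\<phi> has_real_derivative G (\<gamma> t) (h t) (V t) / \<phi> t) (at t)" if "t \<in> {0..1}" for t
      proof -
        have "q t + \<delta>\<^sup>2 > 0" using qnn[OF that] \<open>\<delta> > 0\<close> by (simp add: add_nonneg_pos)
        then show ?thesis unfolding \<phi>_def[abs_def]
          using dq[OF that] by (auto intro!: derivative_eq_intros simp: divide_simps)
      qed
      have d2\<phi>: "((\<lambda>t. G (\<gamma> t) (h t) (V t) / \<phi> t) has_real_derivative
        ((G (\<gamma> t) (V t) (V t) + G (\<gamma> t) (h t) (W t)) * \<phi> t - G (\<gamma> t) (h t) (V t) * (G (\<gamma> t) (h t) (V t) / \<phi> t)) / (\<phi> t * \<phi> t)) (at t)"
        if "t \<in> {0..1}" for t
        using DERIV_divide[OF dGV[OF that] d\<phi>[OF that]] \<phi>pos(1)[OF that] by (simp add: power2_eq_square)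
      \<comment> \<open>Cauchy-Schwarz lets the term with \<open>V\<close> compensate the negative
        square, the curvature condition disposes of the Jacobi part of \<open>W\<close>, and only
        the error term survives.\<close>
      have lb: "((G (\<gamma> t) (V t) (V t) + G (\<gamma> t) (h t) (W t)) * \<phi> t - G (\<gamma> t) (h t) (V t) * (G (\<gamma> t) (h t) (V t) / \<phi> t)) / (\<phi> t * \<phi> t)
          \<ge> - (\<epsilon> * \<kappa>)" (is "?L \<ge> _") if "t \<in> {0..1}" for t
      proof -
        note S = S[OF that] and \<phi> = \<phi>pos[OF that]
        let ?X = "D\<Gamma> (\<gamma> t) (v t) (v t) (h t) - D\<Gamma> (\<gamma> t) (h t) (v t) (v t)
            + \<Gamma> (\<gamma> t) (v t) (\<Gamma> (\<gamma> t) (h t) (v t)) - \<Gamma> (\<gamma> t) (h t) (\<Gamma> (\<gamma> t) (v t) (v t))"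
        define gv where "gv = G (\<gamma> t) (V t) (V t)"
        define gh where "gh = G (\<gamma> t) (h t) (V t)"
        define gw where "gw = G (\<gamma> t) (h t) (W t)"
        have "G (\<gamma> t) (h t) ?X \<ge> 0" using curv[OF S(3), of "v t" "h t"] G_sym[OF S(3)] by simp
        moreover have "G (\<gamma> t) (h t) (W t - ?X) \<ge> - (\<phi> t * (\<epsilon> * \<kappa>))"
        proof -
          have "N (\<gamma> t) (h t) \<le> \<phi> t" unfolding N_def \<phi>_def q_def by simp
          then have "N (\<gamma> t) (h t) * N (\<gamma> t) (W t - ?X) \<le> \<phi> t * (\<epsilon> * \<kappa>)"
            using err[OF that] S \<phi> by (intro mult_mono) auto
          then show ?thesis using G_le_N[OF S(3), of "h t" "W t - ?X"] by linarith
        qed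
        ultimately have gw: "gw \<ge> - (\<phi> t * (\<epsilon> * \<kappa>))"
          unfolding gw_def by (simp add: blinfun.bilinear_simps)
        have gv: "gv \<ge> 0" unfolding gv_def using S by (simp add: G_nonneg)
        have "gh\<^sup>2 \<le> q t * gv" unfolding gh_def gv_def q_def using Cauchy_Schwarz[OF S(3)] by blast
        also have "\<dots> \<le> (\<phi> t)\<^sup>2 * gv" using \<phi>(2) gv by (intro mult_right_mono) auto
        finally have gh: "gh\<^sup>2 / \<phi> t \<le> gv * \<phi> t" using \<phi>(1) by (simp add: divide_le_eq power2_eq_square mult_ac)
        have "- (\<phi> t * (\<epsilon> * \<kappa>)) * \<phi> t \<le> gw * \<phi> t" using gw \<phi>(1) by (intro mult_right_mono) auto
        moreover have "- (\<phi> t * (\<epsilon> * \<kappa>)) * \<phi> t = - (\<epsilon> * \<kappa>) * (\<phi> t * \<phi> t)" by simp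
        ultimately have "- (\<epsilon> * \<kappa>) * (\<phi> t * \<phi> t) \<le> gw * \<phi> t" by linarith
        also have "\<dots> \<le> (gv + gw) * \<phi> t - gh * (gh / \<phi> t)" using gh by (simp add: power2_eq_square distrib_right)
        finally have "- (\<epsilon> * \<kappa>) \<le> ((gv + gw) * \<phi> t - gh * (gh / \<phi> t)) / (\<phi> t * \<phi> t)"
          using \<phi>(1) by (subst pos_le_divide_eq) auto
        then show ?thesis unfolding gv_def gh_def gw_def .
      qed
      have "\<phi> t \<le> (1 - t) * \<phi> 0 + t * \<phi> 1 + \<epsilon> * \<kappa>"
        by (rule almost_convex_of_second_derivative[OF d\<phi> d2\<phi> lb _ t]) (use \<open>\<epsilon> > 0\<close> \<kappa>0 in auto)
      moreover have up: "\<phi> s \<le> N (\<gamma> s) (h s) + \<delta>" if "s \<in> {0..1}" for s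
        unfolding \<phi>_def N_def q_def[symmetric] using sqrt_add_le_add_sqrt[OF qnn[OF that], of "\<delta>\<^sup>2"] \<open>\<delta> > 0\<close> by simp
      have "(1 - t) * \<phi> 0 \<le> (1 - t) * (N (\<gamma> 0) (h 0) + \<delta>)" "t * \<phi> 1 \<le> t * (N (\<gamma> 1) (h 1) + \<delta>)"
        using up t by (auto intro!: mult_left_mono)
      moreover have "N (\<gamma> t) (h t) \<le> \<phi> t" unfolding N_def \<phi>_def q_def by simp
      ultimately show ?thesis by (simp add: algebra_simps)
    qed
    show "N (\<gamma> t) (\<sigma> t - \<gamma> t) \<le> (1 - t) * N (\<gamma> 0) (\<sigma> 0 - \<gamma> 0) + t * N (\<gamma> 1) (\<sigma> 1 - \<gamma> 1) + \<epsilon> * \<kappa>"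
      by (rule field_le_epsilon) (use main in \<open>simp add: h_def\<close>)
  qed
qed

end

section \<open>Inverting a differentiable family of linear maps\<close>

text \<open>Where the second factor vanishes it is of first order, so its product with the increment
  of a merely continuous first factor is of smaller order. This permits differentiating an identity
  in which one factor is not yet known to be differentiable.\<close>

lemma has_derivative_bilinear_zero:
  assumes "bounded_bilinear pr" and P: "continuous (at x) P" and Q: "(Q has_derivative Q') (at x)" "Q x = 0"
  shows "((\<lambda>y. pr (P y) (Q y)) has_derivative (\<lambda>h. pr (P x) (Q' h))) (at x)"
proof -
  interpret bounded_bilinear pr by fact
  obtain K where K: "K \<ge> 0" "\<And>a b. norm (pr a b) \<le> norm a * norm b * K" using nonneg_bounded by blast
  have Qd: "((\<lambda>y. norm ((Q y - Q x) - Q' (y - x)) / norm (y - x)) \<longlongrightarrow> 0) (at x)" and Q'b: "bounded_linear Q'"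
    using Q(1) unfolding has_derivative_iff_norm by auto
  obtain B where B: "B \<ge> 0" "\<And>h. norm (Q' h) \<le> norm h * B" using bounded_linear.nonneg_bounded[OF Q'b] by blast
  have P0: "((\<lambda>y. norm (P y - P x)) \<longlongrightarrow> 0) (at x)"
    using P unfolding continuous_at by (simp add: LIM_zero tendsto_norm_zero)
  have lim: "((\<lambda>y. norm (P y - P x) * (norm ((Q y - Q x) - Q' (y - x)) / norm (y - x) + B) * K) \<longlongrightarrow> 0) (at x)"
    using tendsto_mult[OF tendsto_mult[OF P0 tendsto_add[OF Qd tendsto_const[of B]]] tendsto_const[of K]] by simp
  have "((\<lambda>y. pr (P y - P x) (Q y)) has_derivative (\<lambda>h. 0)) (at x)"
  proof (rule has_derivativeI_sandwich[of 1, OF _ _ _ lim])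
    fix y assume "y \<noteq> x"
    then have n: "norm (y - x) > 0" by simp
    have "norm (Q y) \<le> norm ((Q y - Q x) - Q' (y - x)) + norm (Q' (y - x))"
      using norm_triangle_ineq[of "(Q y - Q x) - Q' (y - x)" "Q' (y - x)"] by (simp add: Q(2))
    also have "\<dots> \<le> (norm ((Q y - Q x) - Q' (y - x)) / norm (y - x) + B) * norm (y - x)"
      using B(2)[of "y - x"] n by (simp add: field_simps)
    finally have "norm (pr (P y - P x) (Q y)) \<le> norm (P y - P x) * ((norm ((Q y - Q x) - Q' (y - x)) / norm (y - x) + B) * norm (y - x)) * K"
      using K by (meson mult_left_mono mult_right_mono norm_ge_zero order_trans)
    then show "norm ((pr (P y - P x) (Q y) - pr (P x - P x) (Q x)) - 0) / norm (y - x)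
      \<le> norm (P y - P x) * (norm ((Q y - Q x) - Q' (y - x)) / norm (y - x) + B) * K"
      using n by (simp add: zero_left divide_le_eq mult_ac)
  qed auto
  then have "((\<lambda>y. pr (P y - P x) (Q y) + pr (P x) (Q y)) has_derivative (\<lambda>h. 0 + pr (P x) (Q' h))) (at x)"
    by (intro has_derivative_add bounded_linear.has_derivative[OF bounded_linear_right] Q)
  then show ?thesis by (simp add: diff_left)
qed

text \<open>The resolvent identity \<open>id\<close> expresses \<open>M y\<close> through
  \<open>M y\<close> times a factor that vanishes at \<open>x\<close>. It first bounds and thereby
  proves continuous the inverse, and then yields its derivative by
  \<open>has_derivative_bilinear_zero\<close>.\<close>

lemma c1_fun_blinfun_inverse:
  fixes L :: "'e::euclidean_space \<Rightarrow> 'g::euclidean_space \<Rightarrow>\<^sub>L 'g"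
  assumes "open U" and L: "c1_fun U L" and inj: "\<And>y. y \<in> U \<Longrightarrow> inj (blinfun_apply (L y))"
  obtains M where "c1_fun U M" "\<And>y u. y \<in> U \<Longrightarrow> blinfun_apply (M y) (L y u) = u"
    "\<And>y u. y \<in> U \<Longrightarrow> blinfun_apply (L y) (M y u) = u"
proof -
  have "\<exists>M::'g \<Rightarrow>\<^sub>L 'g. \<forall>u. M (L y u) = u \<and> L y (M u) = u" if y: "y \<in> U" for y
  proof -
    have "linear (blinfun_apply (L y))" using blinfun.bounded_linear_right by (rule bounded_linear.linear)
    then obtain f where f: "linear f" "\<forall>x. f (L y x) = x" "\<forall>x. L y (f x) = x"
      using linear_injective_isomorphism inj[OF y] by blast
    then have "blinfun_apply (Blinfun f) = f" by (simp add: bounded_linear_Blinfun_apply linear_conv_bounded_linear)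
    then show ?thesis using f by (intro exI[of _ "Blinfun f"]) auto
  qed
  then obtain M :: "'e \<Rightarrow> 'g \<Rightarrow>\<^sub>L 'g" where M: "\<And>y u. y \<in> U \<Longrightarrow> M y (L y u) = u" "\<And>y u. y \<in> U \<Longrightarrow> L y (M y u) = u"
    by metis
  have id: "M y = M x - (M y o\<^sub>L ((L y - L x) o\<^sub>L M x))" if "x \<in> U" "y \<in> U" for x y
    by (rule blinfun_eqI) (simp add: that M blinfun.bilinear_simps)
  have cont: "continuous (at x) M" if x: "x \<in> U" for x
  proof -
    let ?m = "norm (M x)"
    have Lc: "((\<lambda>y. norm (L y - L x)) \<longlongrightarrow> 0) (at x)"
      using has_derivative_continuous[OF c1_fun_has_derivative[OF L x]]
      unfolding continuous_at by (simp add: LIM_zero tendsto_norm_zero)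
    have "?m + 1 > 0" by (simp add: add_nonneg_pos)
    have "\<forall>\<^sub>F y in at x. norm (L y - L x) < 1 / (2 * (?m + 1))"
      by (rule order_tendstoD(2)[OF Lc]) (use \<open>?m + 1 > 0\<close> in simp)
    moreover have "\<forall>\<^sub>F y in at x. y \<in> U" using assms(1) x by (simp add: eventually_at_topological) blast
    ultimately have "\<forall>\<^sub>F y in at x. norm (M y - M x) \<le> 2 * ?m * ?m * norm (L y - L x)"
    proof eventually_elim
      case (elim y)
      define X where "X = M y o\<^sub>L ((L y - L x) o\<^sub>L M x)"
      have "norm X \<le> norm (M y) * (norm (L y - L x) * ?m)"
        unfolding X_def by (meson mult_left_mono norm_blinfun_compose norm_ge_zero order_trans)
      moreover have "M y = M x - X" unfolding X_def by (rule id[OF x elim(2)])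
      ultimately have d: "norm (M y - M x) \<le> norm (M y) * (norm (L y - L x) * ?m)" by simp
      \<comment> \<open>For \<open>y\<close> near \<open>x\<close> this product is at most 1/2, so
        half of \<open>norm (M y)\<close> can be absorbed and
        \<open>norm (M y) \<le> 2 * ?m\<close>; the bound \<open>d\<close> then becomes linear in
        \<open>norm (L y - L x)\<close>.\<close>
      have "norm (L y - L x) * ?m \<le> 1 / (2 * (?m + 1)) * (?m + 1)"
        using elim(1) by (intro mult_mono) auto
      also have "\<dots> = 1 / 2" using \<open>?m + 1 > 0\<close> by (simp add: field_simps)
      finally have "norm (M y) * (norm (L y - L x) * ?m) \<le> norm (M y) * (1 / 2)"
        by (intro mult_left_mono) auto
      then have "norm (M y) \<le> 2 * ?m"
        using d norm_triangle_sub[of "M y" "M x"] by simp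
      then have "norm (M y) * (norm (L y - L x) * ?m) \<le> (2 * ?m) * (norm (L y - L x) * ?m)"
        by (intro mult_right_mono) auto
      with d show ?case by (simp add: mult_ac)
    qed
    moreover have "((\<lambda>y. 2 * ?m * ?m * norm (L y - L x)) \<longlongrightarrow> 0) (at x)"
      using tendsto_mult[OF tendsto_const Lc, of "2 * ?m * ?m"] by simp
    ultimately have "((\<lambda>y. M y - M x) \<longlongrightarrow> 0) (at x)" by (rule Lim_null_comparison)
    then show ?thesis unfolding continuous_at by (simp add: LIM_zero_iff)
  qed
  show ?thesis
  proof (rule that[OF _ M])
    show "c1_fun U M"
    proof (rule c1_funI)
      fix x assume x: "x \<in> U"
      have 1: "((\<lambda>y. (L y - L x) o\<^sub>L M x) has_derivative (\<lambda>h. frechet_derivative L (at x) h o\<^sub>L M x)) (at x)"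
        by (rule bounded_linear.has_derivative[OF bounded_bilinear.bounded_linear_left[OF bounded_bilinear_blinfun_compose]])
          (auto intro!: derivative_eq_intros c1_fun_has_derivative[OF L x])
      have 2: "((\<lambda>y. M x - (M y o\<^sub>L ((L y - L x) o\<^sub>L M x))) has_derivative
          (\<lambda>h. 0 - (M x o\<^sub>L (frechet_derivative L (at x) h o\<^sub>L M x)))) (at x)"
        by (intro has_derivative_diff has_derivative_const
            has_derivative_bilinear_zero[OF bounded_bilinear_blinfun_compose cont[OF x] 1]) simp
      show "(M has_derivative (\<lambda>h. 0 - (M x o\<^sub>L (frechet_derivative L (at x) h o\<^sub>L M x)))) (at x)"
        by (rule has_derivative_transform_within_open[OF 2 assms(1) x]) (simp add: id[OF x, symmetric])
    next
      fix h
      have "continuous_on U M" using cont by (simp add: continuous_at_imp_continuous_on)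
      then show "continuous_on U (\<lambda>x. 0 - (M x o\<^sub>L (frechet_derivative L (at x) h o\<^sub>L M x)))"
        by (intro continuous_intros c1_fun_continuous_derivative[OF L])
    qed
  qed
qed

section \<open>Charts, tangent vectors and the metric\<close>

locale hadamard =
  fixes A :: "('a::polish_space, 'e::euclidean_space) chart set" and g :: "('a, 'e) metric"
  assumes hadamard: "hadamard_manifold A g"
begin

abbreviation dom :: "('a, 'e) chart \<Rightarrow> 'e set" where "dom c \<equiv> snd c ` fst c"

lemma chart_open: "c \<in> A \<Longrightarrow> open (fst c)" "c \<in> A \<Longrightarrow> open (dom c)"
  and chart_homeo: "c \<in> A \<Longrightarrow> homeomorphism (fst c) (dom c) (snd c) (chart_inv c)"
  using hadamard by (auto simp: hadamard_manifold_def smooth_atlas_def is_chart_def)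

lemma chart_at: obtains c where "c \<in> A" "x \<in> fst c"
  using hadamard unfolding hadamard_manifold_def smooth_atlas_def by (metis UN_E UNIV_I)

lemma chart_inv_chart [simp]: "c \<in> A \<Longrightarrow> x \<in> fst c \<Longrightarrow> chart_inv c (snd c x) = x"
  using chart_homeo by (meson homeomorphism_apply1)

lemma chart_chart_inv [simp]: "c \<in> A \<Longrightarrow> y \<in> dom c \<Longrightarrow> snd c (chart_inv c y) = y"
  using chart_homeo by (meson homeomorphism_apply2)

lemma chart_inv_in [simp]: "c \<in> A \<Longrightarrow> y \<in> dom c \<Longrightarrow> chart_inv c y \<in> fst c"
  by auto

lemma chart_cont: "c \<in> A \<Longrightarrow> continuous_on (fst c) (snd c)" "c \<in> A \<Longrightarrow> continuous_on (dom c) (chart_inv c)"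
  using chart_homeo by (meson homeomorphism_cont1 homeomorphism_cont2)+

lemma open_overlap:
  assumes "c \<in> A" "open V" "V \<subseteq> fst c" shows "open (snd c ` V)"
proof -
  have "snd c ` V = dom c \<inter> chart_inv c -` V" using assms by (auto simp: image_iff)
  then show ?thesis using continuous_open_preimage[OF chart_cont(2)] chart_open assms by metis
qed

lemma transition_apply: "c \<in> A \<Longrightarrow> x \<in> fst c \<Longrightarrow> transition c c' (snd c x) = snd c' x"
  by (simp add: transition_def)

lemma transition_smooth: "c \<in> A \<Longrightarrow> c' \<in> A \<Longrightarrow> smooth_on (snd c ` (fst c \<inter> fst c')) (transition c c')"
  using hadamard by (simp add: hadamard_manifold_def smooth_atlas_def)

lemma overlap_open: "c \<in> A \<Longrightarrow> c' \<in> A \<Longrightarrow> open (snd c ` (fst c \<inter> fst c'))"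
  by (rule open_overlap) (auto simp: chart_open open_Int)

definition DT :: "('a, 'e) chart \<Rightarrow> ('a, 'e) chart \<Rightarrow> 'a \<Rightarrow> 'e \<Rightarrow> 'e" where
  "DT c c' x = frechet_derivative (transition c c') (at (snd c x))"

lemma DT_derivative:
  assumes "c \<in> A" "c' \<in> A" "x \<in> fst c" "x \<in> fst c'"
  shows "(transition c c' has_derivative DT c c' x) (at (snd c x))"
  unfolding DT_def using assms
  by (intro c1_fun_has_derivative[OF smooth_on_c1_fun[OF transition_smooth]]) auto

lemma DT_linear:
  assumes "c \<in> A" "c' \<in> A" "x \<in> fst c" "x \<in> fst c'" shows "linear (DT c c' x)"
  using DT_derivative[OF assms] by (rule has_derivative_linear)

lemma DT_compose:
  assumes c: "c \<in> A" "c' \<in> A" "c'' \<in> A" and x: "x \<in> fst c" "x \<in> fst c'" "x \<in> fst c''"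
  shows "DT c' c'' x (DT c c' x u) = DT c c'' x u"
proof -
  let ?W = "snd c ` (fst c \<inter> fst c' \<inter> fst c'')"
  have "((\<lambda>y. transition c' c'' (transition c c' y)) has_derivative (\<lambda>u. DT c' c'' x (DT c c' x u))) (at (snd c x))"
    by (rule has_derivative_compose[OF DT_derivative[OF c(1,2) x(1,2)]])
       (simp add: transition_apply c x DT_derivative)
  moreover have "open ?W" by (rule open_overlap) (auto simp: c chart_open open_Int)
  ultimately have "(transition c c'' has_derivative (\<lambda>u. DT c' c'' x (DT c c' x u))) (at (snd c x))"
    by (rule has_derivative_transform_within_open) (use c x in \<open>auto simp: transition_apply\<close>)
  then show ?thesis using DT_derivative[OF c(1,3) x(1,3)] has_derivative_unique by metis
qed

lemma DT_same [simp]: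
  assumes c: "c \<in> A" and x: "x \<in> fst c" shows "DT c c x u = u"
proof -
  have "((\<lambda>y. y) has_derivative (\<lambda>u. u)) (at (snd c x))" by (rule has_derivative_ident)
  then have "(transition c c has_derivative (\<lambda>u. u)) (at (snd c x))"
    by (rule has_derivative_transform_within_open[OF _ chart_open(2)[OF c]]) (use c x in \<open>auto simp: transition_apply\<close>)
  then show ?thesis using DT_derivative[OF c c x x] has_derivative_unique by metis
qed

lemma DT_inverse:
  assumes "c \<in> A" "c' \<in> A" "x \<in> fst c" "x \<in> fst c'"
  shows "DT c' c x (DT c c' x u) = u"
  using DT_compose[of c c' c x u] assms by simp

abbreviation T :: "'a \<Rightarrow> ('a, 'e) tvec set" where "T \<equiv> tangent_space A"

lemma tangent_chart:
  assumes "v \<in> T x" "c \<in> A" "c' \<in> A" "x \<in> fst c" "x \<in> fst c'" shows "v c' = DT c c' x (v c)"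
  using assms unfolding tangent_space_def DT_def by blast

lemma tangent_eqI:
  assumes v: "v \<in> T x" "w \<in> T x" and c: "c \<in> A" "x \<in> fst c" and eq: "v c = w c" shows "v = w"
proof
  fix c'
  show "v c' = w c'"
  proof (cases "c' \<in> A \<and> x \<in> fst c'")
    case True
    then show ?thesis using tangent_chart[OF v(1) c(1) _ c(2)] tangent_chart[OF v(2) c(1) _ c(2)] eq by simp
  next
    case False
    then have "v c' = 0" "w c' = 0" using v unfolding tangent_space_def by blast+
    then show ?thesis by simp
  qed
qed

lemma tvec_of_apply: "c' \<in> A \<Longrightarrow> x \<in> fst c' \<Longrightarrow> tvec_of A c x w c' = DT c c' x w"
  by (simp add: tvec_of_def DT_def)

lemma tvec_of_tangent [simp]:
  assumes "c \<in> A" "x \<in> fst c" shows "tvec_of A c x w \<in> T x"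
  unfolding tangent_space_def
proof (intro CollectI conjI allI impI ballI)
  fix c1 c2 assume "c1 \<in> A" "c2 \<in> A" "x \<in> fst c1 \<and> x \<in> fst c2"
  then show "tvec_of A c x w c2 = frechet_derivative (transition c1 c2) (at (snd c1 x)) (tvec_of A c x w c1)"
    using DT_compose[of c c1 c2 x w] assms by (simp add: tvec_of_apply) (simp add: DT_def)
qed (auto simp: tvec_of_def)

lemma tvec_of_same [simp]: "c \<in> A \<Longrightarrow> x \<in> fst c \<Longrightarrow> tvec_of A c x w c = w"
  by (simp add: tvec_of_apply)

lemma tvec_of_coord:
  assumes "v \<in> T x" "c \<in> A" "x \<in> fst c" shows "tvec_of A c x (v c) = v"
  by (rule tangent_eqI[OF _ assms]) (use assms in auto)

lemma tvec_of_add: 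
  assumes "c \<in> A" "x \<in> fst c" shows "tvec_of A c x (u + w) = tadd (tvec_of A c x u) (tvec_of A c x w)"
proof
  fix c'
  show "tvec_of A c x (u + w) c' = tadd (tvec_of A c x u) (tvec_of A c x w) c'"
    using linear_add[OF DT_linear[OF assms(1) _ assms(2)], of c'] by (auto simp: tvec_of_def tadd_def DT_def)
qed

lemma tvec_of_scale: 
  assumes "c \<in> A" "x \<in> fst c" shows "tvec_of A c x (r *\<^sub>R u) = tscale r (tvec_of A c x u)"
proof
  fix c'
  show "tvec_of A c x (r *\<^sub>R u) c' = tscale r (tvec_of A c x u) c'"
    using linear_cmul[OF DT_linear[OF assms(1) _ assms(2)], of c'] by (auto simp: tvec_of_def tscale_def DT_def)
qed

lemma tscale_tangent [simp]: assumes "v \<in> T x" shows "tscale r v \<in> T x"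
proof -
  obtain c where c: "c \<in> A" "x \<in> fst c" by (rule chart_at)
  have "tscale r v = tvec_of A c x (r *\<^sub>R v c)" using tvec_of_scale[OF c] tvec_of_coord[OF assms c] by simp
  then show ?thesis using c by simp
qed

lemma tzero_tangent [simp]: "tzero \<in> T x"
proof -
  obtain c where c: "c \<in> A" "x \<in> fst c" by (rule chart_at)
  have "tscale 0 (tvec_of A c x 0) \<in> T x" using c by simp
  then show ?thesis by (simp add: tscale_def tzero_def)
qed

lemma tscale_tscale [simp]: "tscale r (tscale s v) = tscale (r * s) v" by (simp add: tscale_def)
lemma tscale_1 [simp]: "tscale 1 v = v" by (simp add: tscale_def)
lemma tscale_0 [simp]: "tscale 0 v = tzero" by (simp add: tscale_def tzero_def)
lemma metric_facts:
  assumes "u \<in> T x" "v \<in> T x" "w \<in> T x"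
  shows "g x u v = g x v u" "g x (tadd u v) w = g x u w + g x v w" "g x (tscale r u) v = r * g x u v"
    "u \<noteq> tzero \<Longrightarrow> g x u u > 0"
proof -
  have "riemannian_metric A g" using hadamard unfolding hadamard_manifold_def by (elim conjE)
  note * = conjunct1[OF this[unfolded riemannian_metric_def]]
    conjunct1[OF conjunct2[OF this[unfolded riemannian_metric_def]]]
  show "g x u v = g x v u" "g x (tadd u v) w = g x u w + g x v w" "g x (tscale r u) v = r * g x u v"
    using *(1)[rule_format, OF assms, of r] by simp_all
  show "g x u u > 0" if "u \<noteq> tzero" using *(2) assms(1) that by blast
qed

lemma metric_smooth: "c \<in> A \<Longrightarrow> smooth_on (dom c) (\<lambda>y. metric_coord A g c y u w)"
  using hadamard unfolding hadamard_manifold_def riemannian_metric_def by (elim conjE) blast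

lemma metric_coord_apply:
  assumes "c \<in> A" "x \<in> fst c" "v \<in> T x" "w \<in> T x"
  shows "metric_coord A g c (snd c x) (v c) (w c) = g x v w"
  using assms by (simp add: metric_coord_def tvec_of_coord)

lemma metric_coord_facts:
  assumes "c \<in> A" "y \<in> dom c"
  shows "metric_coord A g c y u w = metric_coord A g c y w u"
    "metric_coord A g c y (u + v) w = metric_coord A g c y u w + metric_coord A g c y v w"
    "metric_coord A g c y (r *\<^sub>R u) w = r * metric_coord A g c y u w"
    "u \<noteq> 0 \<Longrightarrow> metric_coord A g c y u u > 0"
proof -
  have x: "chart_inv c y \<in> fst c" using assms by simp
  note m = metric_facts[OF tvec_of_tangent[OF assms(1) x] tvec_of_tangent[OF assms(1) x] tvec_of_tangent[OF assms(1) x]]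
  show "metric_coord A g c y u w = metric_coord A g c y w u"
    "metric_coord A g c y (u + v) w = metric_coord A g c y u w + metric_coord A g c y v w"
    "metric_coord A g c y (r *\<^sub>R u) w = r * metric_coord A g c y u w"
    unfolding metric_coord_def using m(1-3) assms by (simp_all add: tvec_of_add tvec_of_scale)
  show "metric_coord A g c y u u > 0" if "u \<noteq> 0"
    unfolding metric_coord_def
  proof (rule m(4))
    show "tvec_of A c (chart_inv c y) u \<noteq> tzero"
      using tvec_of_same[OF assms(1) x, of u] that by (metis tzero_def)
  qed
qed

lemma tnorm_scale: assumes "v \<in> T x" shows "tnorm g x (tscale r v) = \<bar>r\<bar> * tnorm g x v"
proof -
  have "g x (tscale r v) (tscale r v) = r\<^sup>2 * g x v v"
    using metric_facts(3)[of v x "tscale r v" v r] metric_facts(1)[of v x "tscale r v" v]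
      metric_facts(3)[of v x v v r] assms by (simp add: power2_eq_square)
  then show ?thesis by (simp add: tnorm_def real_sqrt_mult)
qed

lemma tnorm_pos: "v \<in> T x \<Longrightarrow> v \<noteq> tzero \<Longrightarrow> tnorm g x v > 0"
  using metric_facts(4)[of v x v v] by (simp add: tnorm_def)

lemma tnorm_zero [simp]: "tnorm g x tzero = 0"
  using tnorm_scale[of tzero x 0] by simp

lemma tnorm_nonneg: "v \<in> T x \<Longrightarrow> tnorm g x v \<ge> 0"
  using tnorm_pos[of v x] by (cases "v = tzero") auto

end

section \<open>Christoffel symbols\<close>

context hadamard begin

lemma metric_blinfun:
  assumes c: "c \<in> A"
  shows "\<exists>(B :: 'e \<Rightarrow> 'e \<Rightarrow>\<^sub>L 'e \<Rightarrow>\<^sub>L real) (DB :: 'e \<Rightarrow> 'e \<Rightarrow>\<^sub>L 'e \<Rightarrow>\<^sub>L 'e \<Rightarrow>\<^sub>L real).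
    (\<forall>y\<in>dom c. \<forall>u w. blinfun_apply (blinfun_apply (B y) u) w = metric_coord A g c y u w) \<and>
    (\<forall>y\<in>dom c. (B has_derivative blinfun_apply (DB y)) (at y)) \<and>
    (\<forall>y\<in>dom c. \<forall>u w z. frechet_derivative (\<lambda>y. metric_coord A g c y w z) (at y) u = blinfun_apply (blinfun_apply (blinfun_apply (DB y) u) w) z) \<and>
    c1_fun (dom c) B \<and> (\<forall>u w z. c1_fun (dom c) (\<lambda>y. blinfun_apply (blinfun_apply (blinfun_apply (DB y) u) w) z))"
proof -
  note m = metric_coord_facts[OF c] and op = chart_open(2)[OF c]
  have "\<And>y u. y \<in> dom c \<Longrightarrow> linear (metric_coord A g c y u)"
  proof (rule linearI)
    fix y u v w and r :: real assume y: "y \<in> dom c"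
    show "metric_coord A g c y u (v + w) = metric_coord A g c y u v + metric_coord A g c y u w"
      using m(2)[OF y, of v w u] m(1)[OF y, of u] by simp
    show "metric_coord A g c y u (r *\<^sub>R v) = r *\<^sub>R metric_coord A g c y u v"
      using m(3)[OF y, of r v u] m(1)[OF y, of u] by simp
  qed
  moreover have "\<And>y w. y \<in> dom c \<Longrightarrow> linear (\<lambda>u. metric_coord A g c y u w)"
    by (rule linearI) (simp_all add: m(2,3))
  ultimately obtain B :: "'e \<Rightarrow> 'e \<Rightarrow>\<^sub>L 'e \<Rightarrow>\<^sub>L real" where
    B: "c1_fun (dom c) B" "\<And>y u w. y \<in> dom c \<Longrightarrow> B y u w = metric_coord A g c y u w"
    using c1_fun_blinfun2I[of "dom c" "metric_coord A g c"] op smooth_on_c1_fun[OF metric_smooth[OF c]] by blast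
  obtain DB where DB: "\<And>y. y \<in> dom c \<Longrightarrow> (B has_derivative blinfun_apply (DB y)) (at y)" "continuous_on (dom c) DB"
    using c1_fun_blinfun_derivative[OF B(1)] by blast
  have fr: "frechet_derivative (\<lambda>y. metric_coord A g c y w z) (at y) u = DB y u w z" if y: "y \<in> dom c" for y u w z
  proof -
    have "((\<lambda>y. B y w z) has_derivative (\<lambda>u. DB y u w z)) (at y)"
      using DB(1)[OF y] by (auto intro!: derivative_eq_intros simp: blinfun.bilinear_simps)
    then have "((\<lambda>y. metric_coord A g c y w z) has_derivative (\<lambda>u. DB y u w z)) (at y)"
      by (rule has_derivative_transform_within_open[OF _ op y]) (simp add: B)
    then show ?thesis using frechet_derivative_at by metis
  qed
  have c1D: "c1_fun (dom c) (\<lambda>y. DB y u w z)" for u w z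
    by (rule c1_fun_cong[OF smooth_on_c1_fun[OF smooth_on_derivative[OF metric_smooth[OF c]]] op]) (rule fr)
  show ?thesis using B DB(1) fr c1D by (intro exI[of _ B] exI[of _ DB]) simp
qed

text \<open>Nondegeneracy of the metric makes the Koszul formula determine the Christoffel symbols.
  Writing them as the inverse Gram operator applied to a C1 right-hand side shows that they are C1.
  The tuple allows all four maps to be chosen at once.\<close>

lemma chart_geometry:
  assumes c: "c \<in> A"
  shows "\<exists>q. case q of (G, DG, \<Gamma>, D\<Gamma>) \<Rightarrow> local_geometry (dom c) G DG \<Gamma> D\<Gamma> \<and>
     (\<forall>y u w. y \<in> dom c \<longrightarrow> blinfun_apply (blinfun_apply (G y) u) w = metric_coord A g c y u w) \<and>
     (\<forall>y u w. y \<in> dom c \<longrightarrow> blinfun_apply (blinfun_apply (\<Gamma> y) u) w = christoffel A g c y u w)"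
proof -
  note m = metric_coord_facts[OF c] and op = chart_open(2)[OF c]
  obtain B :: "'e \<Rightarrow> 'e \<Rightarrow>\<^sub>L 'e \<Rightarrow>\<^sub>L real" and DB :: "'e \<Rightarrow> 'e \<Rightarrow>\<^sub>L 'e \<Rightarrow>\<^sub>L 'e \<Rightarrow>\<^sub>L real"
    where *: "\<forall>y\<in>dom c. \<forall>u w. blinfun_apply (blinfun_apply (B y) u) w = metric_coord A g c y u w"
    "\<forall>y\<in>dom c. (B has_derivative blinfun_apply (DB y)) (at y)"
    "\<forall>y\<in>dom c. \<forall>u w z. frechet_derivative (\<lambda>y. metric_coord A g c y w z) (at y) u = blinfun_apply (blinfun_apply (blinfun_apply (DB y) u) w) z"
    "c1_fun (dom c) B" "\<forall>u w z. c1_fun (dom c) (\<lambda>y. blinfun_apply (blinfun_apply (blinfun_apply (DB y) u) w) z)"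
    using metric_blinfun[OF c] by (elim exE conjE)
  note B = *(1)[rule_format] and DB = *(2)[rule_format] and fr = *(3)[rule_format]
    and c1B = *(4) and c1DB = *(5)[rule_format]
  have Bsym: "B y u w = B y w u" and Bpos: "u \<noteq> 0 \<Longrightarrow> B y u u > 0" if "y \<in> dom c" for y u w
    using m[OF that] by (auto simp: B that)
  have DBsym: "DB y z u w = DB y z w u" if y: "y \<in> dom c" for y z u w
  proof -
    have 1: "((\<lambda>y. B y u w) has_derivative (\<lambda>z. DB y z u w)) (at y)" for u w
      using DB(1)[OF y] by (auto intro!: derivative_eq_intros simp: blinfun.bilinear_simps)
    have "((\<lambda>y. B y w u) has_derivative (\<lambda>z. DB y z u w)) (at y)"
      by (rule has_derivative_transform_within_open[OF 1 op y]) (simp add: Bsym)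
    from has_derivative_unique[OF this 1] show ?thesis by metis
  qed
  have repr: "f w = (\<Sum>j\<in>Basis. f j *\<^sub>R j) \<bullet> w" if "linear f" for f :: "'e \<Rightarrow> real" and w
  proof -
    have "f w = f (\<Sum>j\<in>Basis. (w \<bullet> j) *\<^sub>R j)" by (simp add: euclidean_representation)
    also have "\<dots> = (\<Sum>j\<in>Basis. (w \<bullet> j) * f j)" by (simp add: linear_sum[OF that] linear_cmul[OF that])
    also have "\<dots> = (\<Sum>j\<in>Basis. f j *\<^sub>R j) \<bullet> w" by (simp add: inner_sum_left inner_commute[of w] mult.commute)
    finally show ?thesis .
  qed
  have lin: "linear (blinfun_apply f)" for f :: "'e \<Rightarrow>\<^sub>L 'h::real_normed_vector"
    by (rule bounded_linear.linear) (rule blinfun.bounded_linear_right)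
  \<comment> \<open>The Gram operator: it represents the metric through the standard inner product,
    \<open>L y u \<bullet> w = B y u w\<close>, and its inverse raises indices.\<close>
  obtain L :: "'e \<Rightarrow> 'e \<Rightarrow>\<^sub>L 'e" where L: "c1_fun (dom c) L" "\<And>y u. y \<in> dom c \<Longrightarrow> L y u = (\<Sum>j\<in>Basis. B y u j *\<^sub>R j)"
  proof (rule c1_fun_blinfunI[of "dom c" "\<lambda>y u. \<Sum>j\<in>Basis. B y u j *\<^sub>R j"])
    show "linear (\<lambda>u. \<Sum>j\<in>Basis. B y u j *\<^sub>R j)" for y
      by (rule linearI) (simp_all add: blinfun.bilinear_simps sum.distrib scaleR_left_distrib scaleR_sum_right)
    show "c1_fun (dom c) (\<lambda>y. \<Sum>j\<in>Basis. B y u j *\<^sub>R j)" for u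
      by (intro c1_fun_sum c1_fun_linear[OF c1_fun_linear[OF c1_fun_linear[OF c1B]]] bounded_linear_scaleR_left
         bounded_bilinear.bounded_linear_left[OF bounded_bilinear_blinfun_apply])
  qed blast
  have Li: "L y u \<bullet> w = B y u w" if "y \<in> dom c" for y u w
    using repr[OF lin, of "B y u" w] L(2)[OF that] by simp
  have "inj (blinfun_apply (L y))" if y: "y \<in> dom c" for y
    unfolding linear_injective_0[OF lin]
  proof (intro allI impI)
    fix u assume "L y u = 0"
    then have "B y u u = 0" using Li[OF y, of u u] by simp
    then show "u = 0" using Bpos[OF y, of u] by force
  qed
  then obtain M where M: "c1_fun (dom c) M" "\<And>y u. y \<in> dom c \<Longrightarrow> blinfun_apply (M y) (L y u) = u"
     "\<And>y u. y \<in> dom c \<Longrightarrow> blinfun_apply (L y) (M y u) = u"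
    using c1_fun_blinfun_inverse[OF op L(1)] by blast
  \<comment> \<open>Half of the right-hand side of the Koszul formula, turned from a linear form in
    \<open>z\<close> into a vector by the standard inner product.\<close>
  define l where "l y u w = (\<Sum>z\<in>Basis. ((DB y u w z + DB y w u z - DB y z u w) / 2) *\<^sub>R z)" for y u w
  define K where "K y u w = M y (l y u w)" for y u w
  have BK: "2 * B y (K y u w) z = DB y u w z + DB y w u z - DB y z u w" if y: "y \<in> dom c" for y u w z
  proof -
    have "linear (\<lambda>z. (DB y u w z + DB y w u z - DB y z u w) / 2)"
      by (rule linearI) (simp_all add: blinfun.bilinear_simps field_simps)
    from repr[OF this, of z] have "l y u w \<bullet> z = (DB y u w z + DB y w u z - DB y z u w) / 2"
      by (simp add: l_def)
    moreover have "B y (K y u w) z = l y u w \<bullet> z"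
      by (simp add: Li[OF y, symmetric] K_def M(2,3)[OF y])
    ultimately show ?thesis by simp
  qed
  have nondeg: "k = k'" if y: "y \<in> dom c" and "\<And>z. B y k z = B y k' z" for y k k'
  proof (rule ccontr)
    assume "k \<noteq> k'"
    then have "B y (k - k') (k - k') > 0" using Bpos[OF y] by simp
    then show False using that(2) by (simp add: blinfun.bilinear_simps)
  qed
  have chr: "christoffel A g c y u w = K y u w" if y: "y \<in> dom c" for y u w
    unfolding christoffel_def
  proof (rule the_equality)
    show "\<forall>z. 2 * metric_coord A g c y (K y u w) z =
       frechet_derivative (\<lambda>y. metric_coord A g c y w z) (at y) u + frechet_derivative (\<lambda>y. metric_coord A g c y u z) (at y) w
       - frechet_derivative (\<lambda>y. metric_coord A g c y u w) (at y) z"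
      using BK[OF y] by (simp add: fr y B[OF y])
    show "k = K y u w" if "\<forall>z. 2 * metric_coord A g c y k z =
       frechet_derivative (\<lambda>y. metric_coord A g c y w z) (at y) u + frechet_derivative (\<lambda>y. metric_coord A g c y u z) (at y) w
       - frechet_derivative (\<lambda>y. metric_coord A g c y u w) (at y) z" for k
    proof (rule nondeg[OF y])
      show "B y k z = B y (K y u w) z" for z
        using that[rule_format, of z] BK[OF y, of u w z] by (simp add: fr[OF y] B[OF y])
    qed
  qed
  have lin_l: "l y (u + u') w = l y u w + l y u' w" "l y (r *\<^sub>R u) w = r *\<^sub>R l y u w"
     "l y w (u + u') = l y w u + l y w u'" "l y w (r *\<^sub>R u) = r *\<^sub>R l y w u" for y u u' w r
    unfolding l_def scaleR_sum_right sum.distrib[symmetric]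
    by (auto intro!: sum.cong simp: blinfun.bilinear_simps field_simps scaleR_add_left[symmetric])
  have l1: "linear (K y u)" "linear (\<lambda>u. K y u w)" for y u w
    by (rule linearI; simp add: K_def lin_l blinfun.bilinear_simps)+
  have c1K: "c1_fun (dom c) (\<lambda>y. K y u w)" for u w
    unfolding K_def l_def divide_inverse
    by (intro c1_fun_bilinear[OF M(1) _ bounded_bilinear_blinfun_apply] c1_fun_sum
       c1_fun_linear[where L="\<lambda>r. r *\<^sub>R _", OF _ bounded_linear_scaleR_left]
       c1_fun_linear[where L="\<lambda>r. r * _", OF _ bounded_linear_mult_left] c1_fun_add c1_fun_diff c1DB)
  obtain \<Gamma> :: "'e \<Rightarrow> 'e \<Rightarrow>\<^sub>L 'e \<Rightarrow>\<^sub>L 'e" where \<Gamma>: "c1_fun (dom c) \<Gamma>" "\<And>y u w. y \<in> dom c \<Longrightarrow> \<Gamma> y u w = K y u w"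
    using c1_fun_blinfun2I[of "dom c" K] l1 op c1K by metis
  obtain D\<Gamma> where D\<Gamma>: "\<And>y. y \<in> dom c \<Longrightarrow> (\<Gamma> has_derivative blinfun_apply (D\<Gamma> y)) (at y)" "continuous_on (dom c) D\<Gamma>"
    using c1_fun_blinfun_derivative[OF \<Gamma>(1)] by blast
  have \<Gamma>sym: "\<Gamma> y u w = \<Gamma> y w u" if "y \<in> dom c" for y u w
    using DBsym[OF that] by (simp add: \<Gamma> that K_def l_def algebra_simps)
  have d1: "((\<lambda>y. \<Gamma> y u w) has_derivative (\<lambda>z. D\<Gamma> y z u w)) (at y)" if "y \<in> dom c" for u w y
      using D\<Gamma>(1)[OF that] by (auto intro!: derivative_eq_intros simp: blinfun.bilinear_simps)
  have D\<Gamma>sym: "D\<Gamma> y z u w = D\<Gamma> y z w u" if y: "y \<in> dom c" for y z u w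
  proof -
    have "((\<lambda>y. \<Gamma> y w u) has_derivative (\<lambda>z. D\<Gamma> y z u w)) (at y)"
      by (rule has_derivative_transform_within_open[OF d1[OF y] op y]) (simp add: \<Gamma>sym)
    from has_derivative_unique[OF this d1[OF y]] show ?thesis by metis
  qed
  have fr\<Gamma>: "frechet_derivative (\<lambda>y. christoffel A g c y u w) (at y) z = D\<Gamma> y z u w" if y: "y \<in> dom c" for y u w z
  proof -
    have "((\<lambda>y. christoffel A g c y u w) has_derivative (\<lambda>z. D\<Gamma> y z u w)) (at y)"
      by (rule has_derivative_transform_within_open[OF d1[OF y] op y]) (simp add: \<Gamma> chr)
    then show ?thesis using frechet_derivative_at by metis
  qed
  have "local_geometry (dom c) B DB \<Gamma> D\<Gamma>"
    proof
      show "DB y z u w = B y (\<Gamma> y z u) w + B y u (\<Gamma> y z w)" if y: "y \<in> dom c" for y z u w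
        using BK[OF y, of z u w] BK[OF y, of z w u] DBsym[OF y] Bsym[OF y, of u "K y z w"] by (simp add: \<Gamma> y)
      fix y v h assume y: "y \<in> dom c"
      let ?R = "D\<Gamma> y v v h - D\<Gamma> y h v v + \<Gamma> y v (\<Gamma> y h v) - \<Gamma> y h (\<Gamma> y v v)"
      show "0 \<le> B y ?R h"
      \<comment> \<open>The curvature assumption speaks of independent pairs; for dependent ones the
        expression is zero by the symmetries of \<open>\<Gamma>\<close> and
        \<open>D\<Gamma>\<close>.\<close>
      proof (cases "h \<noteq> v \<and> independent {h, v}")
        case False
        then have "(\<exists>r. h = r *\<^sub>R v) \<or> (\<exists>r. v = r *\<^sub>R h)"
        proof (cases "h = v")
          case False
          with \<open>\<not> (h \<noteq> v \<and> independent {h, v})\<close> have "h \<in> span ({h, v} - {h}) \<or> v \<in> span ({h, v} - {v})"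
            unfolding dependent_def by blast
          moreover have "{h, v} - {h} = {v}" "{h, v} - {v} = {h}" using False by auto
          ultimately show ?thesis by (auto simp: span_singleton)
        qed (auto intro: exI[of _ 1])
        then have "?R = 0" using \<Gamma>sym[OF y] D\<Gamma>sym[OF y] by (auto simp: blinfun.bilinear_simps)
        then show ?thesis by (simp add: blinfun.bilinear_simps)
      next
        case True
        have hv: "v \<noteq> 0" "\<forall>r. h \<noteq> r *\<^sub>R v"
        proof -
          show "v \<noteq> 0" using True dependent_zero[of "{h, v}"] by auto
          show "\<forall>r. h \<noteq> r *\<^sub>R v"
          proof (intro allI notI)
            fix r assume "h = r *\<^sub>R v"
            then have "h \<in> span ({h, v} - {h})" using True by (auto simp: span_singleton insert_Diff_if)
            then show False using True unfolding dependent_def by blast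
          qed
        qed
        have den: "B y h h * B y v v - (B y h v)\<^sup>2 > 0"
          using pos_bilinear_Cauchy_Schwarz(2)[of "\<lambda>u w. B y u w", OF Bsym[OF y] _ _ Bpos[OF y] hv]
          by (simp add: blinfun.bilinear_simps)
        have "sectional_curvature A g c y h v \<le> 0"
          using hadamard c y True unfolding hadamard_manifold_def nonpositive_curvature_def by blast
        then have "metric_coord A g c y (curvature_coord A g c y h v v) h \<le> 0"
          using den by (simp add: sectional_curvature_def B y divide_le_0_iff)
        moreover have "curvature_coord A g c y h v v = - ?R"
          by (simp add: curvature_coord_def fr\<Gamma> y chr \<Gamma> D\<Gamma>sym[OF y, of v v h])
        ultimately show ?thesis by (simp add: B[OF y, symmetric] blinfun.bilinear_simps)
      qed
    qed (use op Bsym Bpos DB \<Gamma>sym D\<Gamma> in auto)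
  then show ?thesis by (intro exI[of _ "(B, DB, \<Gamma>, D\<Gamma>)"]) (simp add: B \<Gamma> chr)
qed

text \<open>On \<open>dom c\<close> the four maps are determined by the metric, so the choice
  concerns only their values elsewhere.\<close>

definition geom where
  "geom c = (SOME q. case q of (G, DG, \<Gamma>, D\<Gamma>) \<Rightarrow> local_geometry (dom c) G DG \<Gamma> D\<Gamma> \<and>
     (\<forall>y u w. y \<in> dom c \<longrightarrow> blinfun_apply (blinfun_apply (G y) u) w = metric_coord A g c y u w) \<and>
     (\<forall>y u w. y \<in> dom c \<longrightarrow> blinfun_apply (blinfun_apply (\<Gamma> y) u) w = christoffel A g c y u w))"

definition Gc where "Gc c = fst (geom c)"
definition DGc where "DGc c = fst (snd (geom c))"
definition \<Gamma>c where "\<Gamma>c c = fst (snd (snd (geom c)))"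
definition D\<Gamma>c where "D\<Gamma>c c = snd (snd (snd (geom c)))"

lemma geom:
  assumes c: "c \<in> A"
  shows local_geometry: "local_geometry (dom c) (Gc c) (DGc c) (\<Gamma>c c) (D\<Gamma>c c)"
    and Gc_apply: "y \<in> dom c \<Longrightarrow> Gc c y u w = metric_coord A g c y u w"
    and \<Gamma>c_apply: "y \<in> dom c \<Longrightarrow> \<Gamma>c c y u w = christoffel A g c y u w"
proof -
  from someI_ex[OF chart_geometry[OF c], folded geom_def] show "local_geometry (dom c) (Gc c) (DGc c) (\<Gamma>c c) (D\<Gamma>c c)"
    "y \<in> dom c \<Longrightarrow> Gc c y u w = metric_coord A g c y u w" "y \<in> dom c \<Longrightarrow> \<Gamma>c c y u w = christoffel A g c y u w"
    by (auto simp: Gc_def DGc_def \<Gamma>c_def D\<Gamma>c_def split: prod.splits)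
qed

section \<open>Change of coordinates for the metric and the connection\<close>

lemma metric_transform:
  assumes c: "c \<in> A" "c' \<in> A" and x: "x \<in> fst c" "x \<in> fst c'"
  shows "Gc c (snd c x) u w = Gc c' (snd c' x) (DT c c' x u) (DT c c' x w)"
proof -
  have *: "tvec_of A c x u = tvec_of A c' x (DT c c' x u)" for u
    by (rule tangent_eqI[OF _ _ c(2) x(2)]) (simp_all add: c x tvec_of_apply)
  show ?thesis using c x by (simp add: Gc_apply metric_coord_def * )
qed

text \<open>Differentiate the transformation rule of the metric and insert the result into the
  Koszul formulas of both charts. The second derivative of the transition map is symmetric and
  survives as the inhomogeneous term. Both arguments are equal, as in the geodesic equation.\<close>

lemma christoffel_transform:
  assumes c: "c \<in> A" "c' \<in> A" and x: "x \<in> fst c" "x \<in> fst c'"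
  shows "DT c c' x (\<Gamma>c c (snd c x) v v) = \<Gamma>c c' (snd c' x) (DT c c' x v) (DT c c' x v) +
    frechet_derivative (\<lambda>y. frechet_derivative (transition c c') (at y) v) (at (snd c x)) v"
proof -
  interpret G: local_geometry "dom c" "Gc c" "DGc c" "\<Gamma>c c" "D\<Gamma>c c" by (rule local_geometry[OF c(1)])
  interpret G': local_geometry "dom c'" "Gc c'" "DGc c'" "\<Gamma>c c'" "D\<Gamma>c c'" by (rule local_geometry[OF c(2)])
  let ?W = "snd c ` (fst c \<inter> fst c')" and ?y = "snd c x" and ?y' = "snd c' x"
  let ?D = "\<lambda>y u. frechet_derivative (transition c c') (at y) u"
  define D2 where "D2 a u = frechet_derivative (\<lambda>y. ?D y u) (at ?y) a" for a u
  have y: "?y \<in> dom c" "?y' \<in> dom c'" "?y \<in> ?W" using x by auto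
  have W: "open ?W" "smooth_on ?W (transition c c')" using overlap_open transition_smooth c by auto
  have D2sym: "D2 a u = D2 u a" for a u
    unfolding D2_def by (rule mixed_derivative_commute[OF W(1) y(3) W(2)])
  have D0: "?D ?y = DT c c' x" by (simp add: DT_def)
  have dD: "((\<lambda>y. ?D y u) has_derivative (\<lambda>a. D2 a u)) (at ?y)" for u
    unfolding D2_def by (rule c1_fun_has_derivative[OF smooth_on_c1_fun[OF smooth_on_derivative[OF W(2)]] y(3)])
  have rel: "DGc c ?y a u w = DGc c' ?y' (DT c c' x a) (DT c c' x u) (DT c c' x w) +
     Gc c' ?y' (D2 a u) (DT c c' x w) + Gc c' ?y' (DT c c' x u) (D2 a w)" for a u w
  proof -
    have 1: "((\<lambda>y. Gc c' (transition c c' y)) has_derivative (\<lambda>a. DGc c' ?y' (DT c c' x a))) (at ?y)"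
      by (rule has_derivative_compose[OF DT_derivative[OF c x]]) (simp add: transition_apply c x G'.G_der y)
    note 2 = bounded_bilinear.FDERIV[OF bounded_bilinear_blinfun_apply 1 dD[of u]]
    note 3 = bounded_bilinear.FDERIV[OF bounded_bilinear_blinfun_apply 2 dD[of w]]
    have 4: "((\<lambda>y. Gc c y u w) has_derivative (\<lambda>a. DGc c ?y a u w)) (at ?y)"
      using G.G_der[OF y(1)] by (auto intro!: derivative_eq_intros simp: blinfun.bilinear_simps)
    have "((\<lambda>y. Gc c' (transition c c' y) (?D y u) (?D y w)) has_derivative (\<lambda>a. DGc c ?y a u w)) (at ?y)"
    proof (rule has_derivative_transform_within_open[OF 4 W(1) y(3)])
      fix z assume "z \<in> ?W"
      then obtain q where q: "z = snd c q" "q \<in> fst c" "q \<in> fst c'" by auto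
      then show "Gc c z u w = Gc c' (transition c c' z) (?D z u) (?D z w)"
        using metric_transform[OF c q(2,3)] by (simp add: transition_apply c DT_def)
    qed
    from has_derivative_unique[OF this 3] have "DGc c ?y a u w =
       blinfun_apply (blinfun_apply (Gc c' (transition c c' ?y)) (?D ?y u)) (D2 a w) +
       blinfun_apply (blinfun_apply (Gc c' (transition c c' ?y)) (D2 a u) + blinfun_apply (DGc c' ?y' (DT c c' x a)) (?D ?y u)) (?D ?y w)"
      by metis
    then show ?thesis by (simp add: D0 transition_apply c x blinfun.bilinear_simps)
  qed
  \<comment> \<open>The Koszul formula with equal lower arguments. It involves first derivatives of
    the metric only, which \<open>rel\<close> carries from one chart to the other.\<close>
  have kz: "2 * Gc c ?y (\<Gamma>c c ?y v v) z = 2 * DGc c ?y v v z - DGc c ?y z v v" for z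
    using G.compat[OF y(1)] G.\<Gamma>_sym[OF y(1)] G.G_sym[OF y(1)] by (simp add: G.compat[OF y(1)])
  have kz': "2 * Gc c' ?y' (\<Gamma>c c' ?y' v v) z = 2 * DGc c' ?y' v v z - DGc c' ?y' z v v" for v z
    using G'.compat[OF y(2)] G'.\<Gamma>_sym[OF y(2)] G'.G_sym[OF y(2)] by (simp add: G'.compat[OF y(2)])
  let ?d = "DT c c' x (\<Gamma>c c ?y v v) - (\<Gamma>c c' ?y' (DT c c' x v) (DT c c' x v) + D2 v v)"
  have "Gc c' ?y' ?d (DT c c' x z) = 0" for z
  proof -
    have "2 * Gc c' ?y' (DT c c' x (\<Gamma>c c ?y v v)) (DT c c' x z) = 2 * Gc c ?y (\<Gamma>c c ?y v v) z"
      by (simp add: metric_transform[OF c x])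
    also have "\<dots> = 2 * Gc c' ?y' (\<Gamma>c c' ?y' (DT c c' x v) (DT c c' x v)) (DT c c' x z) + 2 * Gc c' ?y' (D2 v v) (DT c c' x z)"
      unfolding kz kz' rel using D2sym[of v z] G'.G_sym[OF y(2), of "DT c c' x v" "D2 z v"] by simp
    finally show ?thesis by (simp add: blinfun.bilinear_simps)
  qed
  \<comment> \<open>The defect is tested against itself, through its preimage under the isomorphism
    \<open>DT c c' x\<close>.\<close>
  from this[of "DT c' c x ?d"] have "Gc c' ?y' ?d ?d = 0" by (simp add: DT_inverse c x)
  then have "?d = 0" using G'.G_pos[OF y(2), of ?d] by force
  then show ?thesis by (simp add: D2_def)
qed

end

section \<open>Geodesics\<close>

context hadamard begin

definition csol where "csol c J x v = local_geometry.sol (dom c) (\<Gamma>c c) J x v"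

lemma csol_iff:
  "c \<in> A \<Longrightarrow> csol c J x v \<longleftrightarrow> (\<forall>t\<in>J. x t \<in> dom c \<and> (x has_vector_derivative v t) (at t) \<and>
     (v has_vector_derivative - \<Gamma>c c (x t) (v t) (v t)) (at t))"
  unfolding csol_def by (rule local_geometry.sol_def[OF local_geometry])

lemma csolD:
  assumes "csol c J x v" "c \<in> A" "t \<in> J"
  shows "x t \<in> dom c" "(x has_vector_derivative v t) (at t)"
    "(v has_vector_derivative - \<Gamma>c c (x t) (v t) (v t)) (at t)"
  using assms by (auto simp: csol_iff)

lemma csol_cong:
  assumes "csol c J x v" "open J" "c \<in> A" "\<And>t. t \<in> J \<Longrightarrow> x t = x' t" "\<And>t. t \<in> J \<Longrightarrow> v t = v' t"
  shows "csol c J x' v'"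
  unfolding csol_iff[OF assms(3)]
proof
  fix t assume t: "t \<in> J"
  note d = csolD[OF assms(1,3) t]
  show "x' t \<in> dom c \<and> (x' has_vector_derivative v' t) (at t) \<and>
     (v' has_vector_derivative - \<Gamma>c c (x' t) (v' t) (v' t)) (at t)"
    using d has_vector_derivative_transform_within_open[OF d(2) assms(2) t, of x']
      has_vector_derivative_transform_within_open[OF d(3) assms(2) t, of v'] assms(4,5) t by force
qed

lemma csol_scale:
  assumes "csol c J x v" "c \<in> A" "\<And>t. t \<in> I \<Longrightarrow> a * t + b \<in> J"
  shows "csol c I (\<lambda>t. x (a * t + b)) (\<lambda>t. a *\<^sub>R v (a * t + b))"
  using local_geometry.sol_scale[OF local_geometry[OF assms(2)], of J x v I a b] assms unfolding csol_def by blast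

lemma velocity_coord: "c \<in> A \<Longrightarrow> \<gamma> t \<in> fst c \<Longrightarrow> velocity A \<gamma> t c = vector_derivative (snd c \<circ> \<gamma>) (at t)"
  by (simp add: velocity_def)

lemma geodesic_on_subset: "geodesic_on A g J \<gamma> \<Longrightarrow> I \<subseteq> J \<Longrightarrow> geodesic_on A g I \<gamma>"
  unfolding geodesic_on_def by (meson continuous_on_subset subset_iff)

lemma geodesic_csol:
  assumes "geodesic_on A g J \<gamma>" and c: "c \<in> A" and I: "open I" "I \<subseteq> J" "\<gamma> ` I \<subseteq> fst c"
  shows "csol c I (snd c \<circ> \<gamma>) (\<lambda>t. velocity A \<gamma> t c)"
  unfolding csol_iff[OF c]
proof
  fix t assume t: "t \<in> I"
  then have tc: "\<gamma> t \<in> fst c" "t \<in> J" using I by auto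
  have 1: "(snd c \<circ> \<gamma>) differentiable (at t)"
    and 2: "((\<lambda>s. vector_derivative (snd c \<circ> \<gamma>) (at s)) has_vector_derivative
           - christoffel A g c (snd c (\<gamma> t)) (vector_derivative (snd c \<circ> \<gamma>) (at t)) (vector_derivative (snd c \<circ> \<gamma>) (at t)))
          (at t)"
    using assms(1) c tc unfolding geodesic_on_def by blast+
  have "((\<lambda>t. velocity A \<gamma> t c) has_vector_derivative
      - christoffel A g c (snd c (\<gamma> t)) (vector_derivative (snd c \<circ> \<gamma>) (at t)) (vector_derivative (snd c \<circ> \<gamma>) (at t))) (at t)"
    by (rule has_vector_derivative_transform_within_open[OF 2 I(1) t]) (use I c in \<open>auto simp: velocity_def\<close>)
  then show "(snd c \<circ> \<gamma>) t \<in> dom c \<and> (snd c \<circ> \<gamma> has_vector_derivative velocity A \<gamma> t c) (at t) \<and>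
    ((\<lambda>t. velocity A \<gamma> t c) has_vector_derivative - \<Gamma>c c ((snd c \<circ> \<gamma>) t) (velocity A \<gamma> t c) (velocity A \<gamma> t c)) (at t)"
    using 1 tc c by (auto simp: velocity_def \<Gamma>c_apply vector_derivative_works[symmetric])
qed

lemma geodesic_onI:
  assumes "continuous_on J \<gamma>"
    and "\<And>c t. c \<in> A \<Longrightarrow> t \<in> J \<Longrightarrow> \<gamma> t \<in> fst c \<Longrightarrow> \<exists>I v. open I \<and> t \<in> I \<and> csol c I (snd c \<circ> \<gamma>) v"
  shows "geodesic_on A g J \<gamma>"
  unfolding geodesic_on_def
proof (intro conjI ballI impI assms(1))
  fix c t assume c: "c \<in> A" and t: "t \<in> J" "\<gamma> t \<in> fst c"
  obtain I v where I: "open I" "t \<in> I" "csol c I (snd c \<circ> \<gamma>) v" using assms(2)[OF c t] by blast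
  note d = csolD[OF I(3) c]
  have vd: "vector_derivative (snd c \<circ> \<gamma>) (at s) = v s" if "s \<in> I" for s
    using d(2)[OF that] by (rule vector_derivative_at)
  show "(snd c \<circ> \<gamma>) differentiable (at t)" using d(2)[OF I(2)] differentiableI_vector by blast
  show "((\<lambda>s. vector_derivative (snd c \<circ> \<gamma>) (at s)) has_vector_derivative
           - christoffel A g c (snd c (\<gamma> t)) (vector_derivative (snd c \<circ> \<gamma>) (at t)) (vector_derivative (snd c \<circ> \<gamma>) (at t)))
          (at t)"
    by (rule has_vector_derivative_transform_within_open[OF _ I(1,2)])
      (use d(1,3)[OF I(2)] c I in \<open>auto simp: vd \<Gamma>c_apply\<close>)
qed

text \<open>The geodesic equation is invariant under change of chart: the inhomogeneous term of
  \<open>christoffel_transform\<close> is cancelled by the derivative of \<open>DT\<close> along the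
  curve.\<close>

lemma csol_transfer:
  assumes c: "c \<in> A" "c' \<in> A" and I: "open I" "\<And>s. s \<in> I \<Longrightarrow> \<gamma> s \<in> fst c" "\<And>s. s \<in> I \<Longrightarrow> \<gamma> s \<in> fst c'"
    and s: "csol c I (snd c \<circ> \<gamma>) v"
  shows "csol c' I (snd c' \<circ> \<gamma>) (\<lambda>s. DT c c' (\<gamma> s) (v s))"
proof -
  let ?W = "snd c ` (fst c \<inter> fst c')" and ?D = "\<lambda>y u. frechet_derivative (transition c c') (at y) u"
  have W: "open ?W" "smooth_on ?W (transition c c')" using overlap_open transition_smooth c by auto
  note c1 = smooth_on_c1_fun[OF W(2)] smooth_on_c1_fun[OF smooth_on_derivative[OF W(2)]]
  have lin: "linear (?D y)" if "y \<in> ?W" for y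
    using c1_fun_has_derivative[OF c1(1) that] by (rule has_derivative_linear)
  obtain B :: "'e \<Rightarrow> 'e \<Rightarrow>\<^sub>L 'e" where B: "c1_fun ?W B" "\<And>y u. y \<in> ?W \<Longrightarrow> B y u = ?D y u"
    using c1_fun_blinfunI[of ?W ?D] lin c1(2) by blast
  obtain DB where DB: "\<And>y. y \<in> ?W \<Longrightarrow> (B has_derivative blinfun_apply (DB y)) (at y)"
    using c1_fun_blinfun_derivative[OF B(1)] by blast
  have DBD: "DB y a u = frechet_derivative (\<lambda>y. ?D y u) (at y) a" if "y \<in> ?W" for y a u
  proof -
    have "((\<lambda>y. B y u) has_derivative (\<lambda>a. DB y a u)) (at y)"
      using DB[OF that] by (auto intro!: derivative_eq_intros simp: blinfun.bilinear_simps)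
    then have "((\<lambda>y. ?D y u) has_derivative (\<lambda>a. DB y a u)) (at y)"
      by (rule has_derivative_transform_within_open[OF _ W(1) that]) (simp add: B)
    then show ?thesis using frechet_derivative_at by metis
  qed
  show ?thesis
    unfolding csol_iff[OF c(2)]
  proof
    fix t assume t: "t \<in> I"
    note d = csolD[OF s c(1)] and gc = I(2,3)[OF t]
    have W0: "(snd c \<circ> \<gamma>) s \<in> ?W" if "s \<in> I" for s using I that by auto
    have 1: "((transition c c' \<circ> (snd c \<circ> \<gamma>)) has_vector_derivative DT c c' (\<gamma> t) (v t)) (at t)"
      using has_derivative_compose[OF d(2)[OF t, unfolded has_vector_derivative_def], of "transition c c'" "DT c c' (\<gamma> t)"]
        DT_derivative[OF c gc] linear_cmul[OF DT_linear[OF c gc]]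
      by (simp add: has_vector_derivative_def o_def)
    have "(snd c' \<circ> \<gamma> has_vector_derivative DT c c' (\<gamma> t) (v t)) (at t)"
      by (rule has_vector_derivative_transform_within_open[OF 1 I(1) t]) (use I c in \<open>simp add: transition_apply\<close>)
    moreover
    have 2: "((\<lambda>s. B ((snd c \<circ> \<gamma>) s)) has_vector_derivative DB (snd c (\<gamma> t)) (v t)) (at t)"
      using has_derivative_compose[OF d(2)[OF t, unfolded has_vector_derivative_def] DB[OF W0[OF t]]]
      by (simp add: has_vector_derivative_def blinfun.scaleR_right)
    have 3: "((\<lambda>s. blinfun_apply (B ((snd c \<circ> \<gamma>) s)) (v s)) has_vector_derivative
       B ((snd c \<circ> \<gamma>) t) (- \<Gamma>c c ((snd c \<circ> \<gamma>) t) (v t) (v t)) + blinfun_apply (DB (snd c (\<gamma> t)) (v t)) (v t)) (at t)"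
      by (rule bounded_bilinear.has_vector_derivative[OF bounded_bilinear_blinfun_apply 2 d(3)[OF t]])
    have Wt: "snd c (\<gamma> t) \<in> ?W" using gc by auto
    have "B ((snd c \<circ> \<gamma>) t) (- \<Gamma>c c ((snd c \<circ> \<gamma>) t) (v t) (v t)) + blinfun_apply (DB (snd c (\<gamma> t)) (v t)) (v t)
      = - \<Gamma>c c' ((snd c' \<circ> \<gamma>) t) (DT c c' (\<gamma> t) (v t)) (DT c c' (\<gamma> t) (v t))"
      using christoffel_transform[OF c gc, of "v t"] linear_neg[OF DT_linear[OF c gc]]
      by (simp add: B(2)[OF Wt] DBD[OF Wt] DT_def)
    then have "((\<lambda>s. DT c c' (\<gamma> s) (v s)) has_vector_derivative
       - \<Gamma>c c' ((snd c' \<circ> \<gamma>) t) (DT c c' (\<gamma> t) (v t)) (DT c c' (\<gamma> t) (v t))) (at t)"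
      using has_vector_derivative_transform_within_open[OF 3 I(1) t, of "\<lambda>s. DT c c' (\<gamma> s) (v s)"]
        B(2)[OF W0] by (simp add: DT_def)
    ultimately show "(snd c' \<circ> \<gamma>) t \<in> dom c' \<and> (snd c' \<circ> \<gamma> has_vector_derivative DT c c' (\<gamma> t) (v t)) (at t) \<and>
      ((\<lambda>s. DT c c' (\<gamma> s) (v s)) has_vector_derivative - \<Gamma>c c' ((snd c' \<circ> \<gamma>) t) (DT c c' (\<gamma> t) (v t)) (DT c c' (\<gamma> t) (v t))) (at t)"
      using gc by simp
  qed
qed

text \<open>A geodesic must satisfy its equation in all charts that it meets.
  \<open>csol_transfer\<close> derives this from the equation in a single chart and identifies the
  invariant velocity.\<close>

lemma chart_geodesic:
  assumes c: "c \<in> A" and I: "open I" and s: "csol c I x v"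
  defines "\<gamma> \<equiv> chart_inv c \<circ> x"
  shows "geodesic_on A g I \<gamma>" "t \<in> I \<Longrightarrow> \<gamma> t \<in> fst c" "t \<in> I \<Longrightarrow> snd c (\<gamma> t) = x t"
    "t \<in> I \<Longrightarrow> velocity A \<gamma> t = tvec_of A c (\<gamma> t) (v t)"
proof -
  note d = csolD[OF s c]
  show in_c: "\<gamma> t \<in> fst c" if "t \<in> I" for t using d(1)[OF that] c by (simp add: \<gamma>_def)
  show co: "snd c (\<gamma> t) = x t" if "t \<in> I" for t using d(1)[OF that] c by (simp add: \<gamma>_def)
  have s': "csol c I (snd c \<circ> \<gamma>) v" by (rule csol_cong[OF s I c]) (simp_all add: co)
  have "continuous_on I x" using d(2) by (meson continuous_at_imp_continuous_on has_vector_derivative_continuous)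
  then have cont: "continuous_on I \<gamma>" unfolding \<gamma>_def
    by (rule continuous_on_compose) (rule continuous_on_subset[OF chart_cont(2)[OF c]], use d(1) in auto)
  have other: "\<exists>I'. open I' \<and> t \<in> I' \<and> I' \<subseteq> I \<and> csol c' I' (snd c' \<circ> \<gamma>) (\<lambda>s. DT c c' (\<gamma> s) (v s))"
    if c': "c' \<in> A" and t: "t \<in> I" "\<gamma> t \<in> fst c'" for c' t
  proof -
    let ?I = "I \<inter> \<gamma> -` fst c'"
    have "open ?I" using continuous_open_preimage[OF cont I chart_open(1)[OF c']] .
    moreover have "csol c' ?I (snd c' \<circ> \<gamma>) (\<lambda>s. DT c c' (\<gamma> s) (v s))"
    proof (rule csol_transfer[OF c c' \<open>open ?I\<close>])
      show "csol c ?I (snd c \<circ> \<gamma>) v" using s' by (simp add: csol_iff[OF c])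
    qed (use in_c in auto)
    ultimately show ?thesis using t by (intro exI[of _ ?I]) auto
  qed
  then show "geodesic_on A g I \<gamma>" by (intro geodesic_onI[OF cont]) blast
  show "velocity A \<gamma> t = tvec_of A c (\<gamma> t) (v t)" if "t \<in> I"
  proof
    fix c'
    show "velocity A \<gamma> t c' = tvec_of A c (\<gamma> t) (v t) c'"
    proof (cases "c' \<in> A \<and> \<gamma> t \<in> fst c'")
      case True
      then obtain I' where "t \<in> I'" "csol c' I' (snd c' \<circ> \<gamma>) (\<lambda>s. DT c c' (\<gamma> s) (v s))" using other \<open>t \<in> I\<close> by blast
      from csolD(2)[OF this(2) _ this(1)] True have "vector_derivative (snd c' \<circ> \<gamma>) (at t) = DT c c' (\<gamma> t) (v t)"
        by (simp add: vector_derivative_at)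
      then show ?thesis using True by (simp add: velocity_coord tvec_of_apply)
    next
      case False then show ?thesis by (auto simp: velocity_def tvec_of_def)
    qed
  qed
qed

lemma velocity_cong:
  assumes "open I" "t \<in> I" "\<And>s. s \<in> I \<Longrightarrow> \<gamma> s = \<sigma> s" shows "velocity A \<gamma> t = velocity A \<sigma> t"
proof
  fix c :: "('a, 'e) chart"
  have "vector_derivative (snd c \<circ> \<gamma>) (at t) = vector_derivative (snd c \<circ> \<sigma>) (at t)"
  proof (rule vector_derivative_cong_eq)
    have "\<forall>\<^sub>F s in nhds t. s \<in> I" using assms(1,2) by (rule eventually_nhds_in_open)
    then show "\<forall>\<^sub>F s in nhds t. s \<in> UNIV \<longrightarrow> (snd c \<circ> \<gamma>) s = (snd c \<circ> \<sigma>) s"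
      by (rule eventually_mono) (simp add: assms(3))
  qed auto
  then show "velocity A \<gamma> t c = velocity A \<sigma> t c" using assms by (simp add: velocity_def)
qed

lemma geodesic_on_cong:
  assumes "geodesic_on A g J \<gamma>" "open J" "\<And>s. s \<in> J \<Longrightarrow> \<gamma> s = \<sigma> s" shows "geodesic_on A g J \<sigma>"
proof (rule geodesic_onI)
  show cont: "continuous_on J \<sigma>" using assms unfolding geodesic_on_def by (metis continuous_on_cong)
  fix c t assume c: "c \<in> A" "t \<in> J" "\<sigma> t \<in> fst c"
  let ?I = "J \<inter> \<sigma> -` fst c"
  have I: "open ?I" by (rule continuous_open_preimage[OF cont assms(2) chart_open(1)[OF c(1)]])
  have "csol c ?I (snd c \<circ> \<gamma>) (\<lambda>t. velocity A \<gamma> t c)"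
    by (rule geodesic_csol[OF assms(1) c(1) I]) (use assms(3) in auto)
  then have "csol c ?I (snd c \<circ> \<sigma>) (\<lambda>t. velocity A \<gamma> t c)"
    by (rule csol_cong[OF _ I c(1)]) (use assms(3) in auto)
  then show "\<exists>I v. open I \<and> t \<in> I \<and> csol c I (snd c \<circ> \<sigma>) v" using I c by blast
qed

lemma geodesic_on_local:
  assumes "\<And>t. t \<in> J \<Longrightarrow> \<exists>I. open I \<and> t \<in> I \<and> geodesic_on A g I \<gamma>"
  shows "geodesic_on A g J \<gamma>"
proof (rule geodesic_onI)
  have "isCont \<gamma> t" if "t \<in> J" for t
    using assms[OF that] unfolding geodesic_on_def by (meson continuous_on_eq_continuous_at)
  then show "continuous_on J \<gamma>" by (simp add: continuous_at_imp_continuous_on)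
  fix c t assume c: "c \<in> A" "t \<in> J" "\<gamma> t \<in> fst c"
  obtain I where I: "open I" "t \<in> I" "geodesic_on A g I \<gamma>" using assms[OF c(2)] by blast
  have "open (I \<inter> \<gamma> -` fst c)"
    using I chart_open(1)[OF c(1)] unfolding geodesic_on_def by (meson continuous_open_preimage)
  moreover have "csol c (I \<inter> \<gamma> -` fst c) (snd c \<circ> \<gamma>) (\<lambda>t. velocity A \<gamma> t c)"
    by (rule geodesic_csol[OF I(3) c(1) calculation]) auto
  ultimately show "\<exists>I v. open I \<and> t \<in> I \<and> csol c I (snd c \<circ> \<gamma>) v" using I c by blast
qed

lemma geodesic_chart_nbhd:
  assumes g: "geodesic_on A g J \<gamma>" and J: "open J" "t \<in> J" and c: "c \<in> A" "\<gamma> t \<in> fst c"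
  shows "\<exists>\<delta>>0. {t-\<delta><..<t+\<delta>} \<subseteq> J \<and> \<gamma> ` {t-\<delta><..<t+\<delta>} \<subseteq> fst c \<and>
    csol c {t-\<delta><..<t+\<delta>} (snd c \<circ> \<gamma>) (\<lambda>t. velocity A \<gamma> t c)"
proof -
  have "open (J \<inter> \<gamma> -` fst c)"
    using g chart_open(1)[OF c(1)] J(1) unfolding geodesic_on_def by (meson continuous_open_preimage)
  then obtain \<delta> where \<delta>: "\<delta> > 0" "ball t \<delta> \<subseteq> J \<inter> \<gamma> -` fst c"
    using J c unfolding open_contains_ball by blast
  have b: "{t-\<delta><..<t+\<delta>} = ball t \<delta>" by (auto simp: dist_real_def)
  show ?thesis
    using \<delta> by (intro exI[of _ \<delta>]) (auto simp: b intro!: geodesic_csol[OF g c(1)])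
qed

lemma velocity_tangent:
  assumes g: "geodesic_on A g J \<gamma>" and J: "open J" "t \<in> J" shows "velocity A \<gamma> t \<in> T (\<gamma> t)"
proof -
  obtain c where c: "c \<in> A" "\<gamma> t \<in> fst c" by (rule chart_at)
  obtain \<delta> where \<delta>: "\<delta> > 0" "{t-\<delta><..<t+\<delta>} \<subseteq> J" "\<gamma> ` {t-\<delta><..<t+\<delta>} \<subseteq> fst c"
    "csol c {t-\<delta><..<t+\<delta>} (snd c \<circ> \<gamma>) (\<lambda>t. velocity A \<gamma> t c)"
    using geodesic_chart_nbhd[OF g J c] by blast
  let ?\<sigma> = "chart_inv c \<circ> (snd c \<circ> \<gamma>)"
  have "velocity A ?\<sigma> t = tvec_of A c (?\<sigma> t) (velocity A \<gamma> t c)"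
    by (rule chart_geodesic(4)[OF c(1) _ \<delta>(4)]) (use \<delta> in auto)
  moreover have "velocity A \<gamma> t = velocity A ?\<sigma> t"
    by (rule velocity_cong[of "{t-\<delta><..<t+\<delta>}"]) (use \<delta> c in \<open>auto simp: image_subset_iff\<close>)
  ultimately have "velocity A \<gamma> t = tvec_of A c (?\<sigma> t) (velocity A \<gamma> t c)" by (rule trans[rotated])
  moreover have "?\<sigma> t = \<gamma> t" using c by simp
  ultimately show ?thesis using tvec_of_tangent[OF c] by metis
qed

lemma geodesic_affine:
  assumes g: "geodesic_on A g J \<gamma>" and J: "open J" and I: "open I" "\<And>t. t \<in> I \<Longrightarrow> a * t + b \<in> J"
  shows "geodesic_on A g I (\<lambda>t. \<gamma> (a * t + b))"
    "t \<in> I \<Longrightarrow> velocity A (\<lambda>t. \<gamma> (a * t + b)) t = tscale a (velocity A \<gamma> (a * t + b))"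
proof -
  have ex: "\<exists>I' \<subseteq> I. open I' \<and> t \<in> I' \<and> csol c I' (snd c \<circ> (\<lambda>t. \<gamma> (a * t + b))) (\<lambda>t. a *\<^sub>R velocity A \<gamma> (a * t + b) c)"
    if c: "c \<in> A" and t: "t \<in> I" "\<gamma> (a * t + b) \<in> fst c" for c t
  proof -
    obtain \<delta> where \<delta>: "\<delta> > 0" "{a*t+b-\<delta><..<a*t+b+\<delta>} \<subseteq> J"
      "csol c {a*t+b-\<delta><..<a*t+b+\<delta>} (snd c \<circ> \<gamma>) (\<lambda>t. velocity A \<gamma> t c)"
      using geodesic_chart_nbhd[OF g J I(2)[OF t(1)] c t(2)] by blast
    let ?I = "I \<inter> (\<lambda>t. a * t + b) -` {a*t+b-\<delta><..<a*t+b+\<delta>}"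
    have "open ?I" by (rule continuous_open_preimage) (auto intro!: continuous_intros I)
    moreover have "csol c ?I (\<lambda>t. (snd c \<circ> \<gamma>) (a * t + b)) (\<lambda>t. a *\<^sub>R velocity A \<gamma> (a * t + b) c)"
      by (rule csol_scale[OF \<delta>(3) c]) auto
    ultimately show ?thesis using t \<delta>(1) by (intro exI[of _ ?I]) (auto simp: o_def)
  qed
  have "continuous_on I (\<lambda>t. \<gamma> (a * t + b))"
    by (rule continuous_on_compose2[of J \<gamma>]) (use g I in \<open>auto simp: geodesic_on_def intro!: continuous_intros\<close>)
  then show G: "geodesic_on A g I (\<lambda>t. \<gamma> (a * t + b))" by (rule geodesic_onI) (use ex in blast)
  show "velocity A (\<lambda>t. \<gamma> (a * t + b)) t = tscale a (velocity A \<gamma> (a * t + b))" if t: "t \<in> I"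
  proof -
    obtain c where c: "c \<in> A" "\<gamma> (a * t + b) \<in> fst c" by (rule chart_at)
    obtain I' where "t \<in> I'" "csol c I' (snd c \<circ> (\<lambda>t. \<gamma> (a * t + b))) (\<lambda>t. a *\<^sub>R velocity A \<gamma> (a * t + b) c)"
      using ex[OF c(1) t c(2)] by blast
    from csolD(2)[OF this(2) c(1) this(1)] have "velocity A (\<lambda>t. \<gamma> (a * t + b)) t c = a *\<^sub>R velocity A \<gamma> (a * t + b) c"
      using velocity_coord[of c "\<lambda>t. \<gamma> (a * t + b)" t] c by (simp add: vector_derivative_at)
    then show ?thesis
      by (intro tangent_eqI[OF velocity_tangent[OF G I(1) t] tscale_tangent[OF velocity_tangent[OF g J I(2)[OF t]]] c])
         (simp add: tscale_def)
  qed
qed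

lemma tnorm_coord:
  assumes "c \<in> A" "x \<in> fst c" "v \<in> T x"
  shows "tnorm g x v = local_geometry.N (Gc c) (snd c x) (v c)"
  using assms by (simp add: tnorm_def local_geometry.N_def[OF local_geometry] Gc_apply metric_coord_apply)

text \<open>The squared speed has derivative zero in every chart by metric compatibility;
  connectedness makes the constant global.\<close>

lemma geodesic_speed:
  assumes g: "geodesic_on A g J \<gamma>" and J: "open J" "connected J" and st: "s \<in> J" "t \<in> J"
  shows "tnorm g (\<gamma> s) (velocity A \<gamma> s) = tnorm g (\<gamma> t) (velocity A \<gamma> t)"
proof -
  define q where "q t = g (\<gamma> t) (velocity A \<gamma> t) (velocity A \<gamma> t)" for t
  have d0: "(q has_real_derivative 0) (at t)" if t: "t \<in> J" for t
  proof -
    obtain c where c: "c \<in> A" "\<gamma> t \<in> fst c" by (rule chart_at)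
    interpret G: local_geometry "dom c" "Gc c" "DGc c" "\<Gamma>c c" "D\<Gamma>c c" by (rule local_geometry[OF c(1)])
    obtain \<delta> where \<delta>: "\<delta> > 0" "{t-\<delta><..<t+\<delta>} \<subseteq> J" "\<gamma> ` {t-\<delta><..<t+\<delta>} \<subseteq> fst c"
      "csol c {t-\<delta><..<t+\<delta>} (snd c \<circ> \<gamma>) (\<lambda>t. velocity A \<gamma> t c)"
      using geodesic_chart_nbhd[OF g J(1) t c] by blast
    have "((\<lambda>t. Gc c ((snd c \<circ> \<gamma>) t) (velocity A \<gamma> t c) (velocity A \<gamma> t c)) has_real_derivative 0) (at t)"
      by (rule G.sol_speed_derivative[OF \<delta>(4)[unfolded csol_def]]) (use \<delta> in auto)
    then show ?thesis
    proof (rule has_field_derivative_transform_within_open)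
      show "open {t-\<delta><..<t+\<delta>}" "t \<in> {t-\<delta><..<t+\<delta>}" using \<delta> by auto
      fix s assume s: "s \<in> {t-\<delta><..<t+\<delta>}"
      then have "s \<in> J" "\<gamma> s \<in> fst c" using \<delta> by auto
      then show "Gc c ((snd c \<circ> \<gamma>) s) (velocity A \<gamma> s c) (velocity A \<gamma> s c) = q s"
        using velocity_tangent[OF g J(1)] c by (simp add: q_def Gc_apply metric_coord_apply)
    qed
  qed
  have "(q has_derivative (\<lambda>h. 0)) (at t within J)" if "t \<in> J" for t
    using d0[OF that] unfolding has_field_derivative_def lambda_zero[symmetric] by (rule has_derivative_at_withinI)
  moreover have "continuous_on J q" using d0 by (meson DERIV_isCont continuous_at_imp_continuous_on)
  ultimately have "q constant_on J"
    by (intro has_derivative_zero_connected_constant_on[OF J(2,1), of "{}"]) auto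
  then have "q s = q t" using st by (auto simp: constant_on_def)
  then show ?thesis by (simp add: tnorm_def q_def)
qed

end

lemma isCont_eventually_dist: "isCont f a \<Longrightarrow> e > 0 \<Longrightarrow> \<forall>\<^sub>F t in nhds a. dist (f t) (f a) < e"
  unfolding continuous_at tendsto_at_iff_tendsto_nhds by (rule tendstoD)

context hadamard begin

section \<open>Local existence and uniqueness of geodesics\<close>

abbreviation "cbounds c \<equiv> local_geometry.bounds (dom c) (Gc c) (\<Gamma>c c)"
abbreviation "csmall c \<equiv> local_geometry.small_sol (dom c) (\<Gamma>c c)"
abbreviation "cN c \<equiv> local_geometry.N (Gc c)"

lemma csmall_iff:
  assumes "c \<in> A"
  shows "csmall c K \<rho> x v \<longleftrightarrow> csol c {0..1} x v \<and> (\<forall>t\<in>{0..1}. x t \<in> K \<and> norm (v t) \<le> \<rho>)"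
  unfolding csol_def by (rule local_geometry.small_sol_def[OF local_geometry[OF assms]])

lemma cbounds_at:
  assumes c: "c \<in> A" "x \<in> fst c"
  shows "\<exists>R>0. \<exists>C. cbounds c (cball (snd c x) R) C"
proof -
  interpret G: local_geometry "dom c" "Gc c" "DGc c" "\<Gamma>c c" "D\<Gamma>c c" by (rule local_geometry[OF c(1)])
  obtain R where R: "R > 0" "cball (snd c x) R \<subseteq> dom c"
    using open_contains_cball chart_open(2)[OF c(1)] c(2) by blast
  obtain C where "G.bounds (cball (snd c x) R) C"
    using G.bounds_exist[OF compact_cball convex_cball R(2)] by blast
  then show ?thesis using R(1) by blast
qed

lemma cboundsD:
  assumes "cbounds c K C" "c \<in> A"
  shows "C \<ge> 1" "K \<subseteq> dom c" "compact K" "convex K" "y \<in> K \<Longrightarrow> cN c y u \<le> C * norm u" "y \<in> K \<Longrightarrow> norm u \<le> C * cN c y u"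
  using assms(1) unfolding local_geometry.bounds_def[OF local_geometry[OF assms(2)]] by blast+

lemma csol_continuous:
  assumes "csol c J x v" "c \<in> A" "t \<in> J" shows "isCont x t" "isCont v t"
  using csolD[OF assms] has_vector_derivative_continuous by blast+

text \<open>Rescaling time by a small factor, positive for the future and negative for the past,
  turns both geodesics into small solutions on \<open>{0..1}\<close>. Their difference is bounded by
  its initial data, which vanish.\<close>

lemma geodesic_local_unique:
  assumes g: "geodesic_on A g J \<gamma>" "open J" "t0 \<in> J" and s: "geodesic_on A g J \<sigma>"
    and eq: "\<gamma> t0 = \<sigma> t0" "velocity A \<gamma> t0 = velocity A \<sigma> t0"
  shows "\<exists>\<delta>>0. \<forall>t. \<bar>t - t0\<bar> < \<delta> \<longrightarrow> \<gamma> t = \<sigma> t"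
proof -
  obtain c where c: "c \<in> A" "\<gamma> t0 \<in> fst c" by (rule chart_at)
  interpret G: local_geometry "dom c" "Gc c" "DGc c" "\<Gamma>c c" "D\<Gamma>c c" by (rule local_geometry[OF c(1)])
  obtain R C where R: "R > 0" "cbounds c (cball (snd c (\<gamma> t0)) R) C" using cbounds_at[OF c] by blast
  let ?K = "cball (snd c (\<gamma> t0)) R"
  note C = cboundsD[OF R(2) c(1)]
  define \<rho> where "\<rho> = 1 / (32 * C)"
  have \<rho>: "\<rho> > 0" "\<rho> \<le> 1" "32 * C * \<rho> \<le> 1" using C(1) by (auto simp: \<rho>_def divide_le_eq)
  obtain \<delta>1 where \<delta>1: "\<delta>1 > 0" "\<gamma> ` {t0-\<delta>1<..<t0+\<delta>1} \<subseteq> fst c"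
    "csol c {t0-\<delta>1<..<t0+\<delta>1} (snd c \<circ> \<gamma>) (\<lambda>t. velocity A \<gamma> t c)"
    using geodesic_chart_nbhd[OF g c] by blast
  obtain \<delta>2 where \<delta>2: "\<delta>2 > 0" "\<sigma> ` {t0-\<delta>2<..<t0+\<delta>2} \<subseteq> fst c"
    "csol c {t0-\<delta>2<..<t0+\<delta>2} (snd c \<circ> \<sigma>) (\<lambda>t. velocity A \<sigma> t c)"
    using geodesic_chart_nbhd[OF s g(2,3) c(1)] c(2) eq by auto
  define V where "V = norm (velocity A \<gamma> t0 c) + 1"
  have V: "V > 0" by (simp add: V_def add_nonneg_pos)
  have good: "\<forall>\<^sub>F t in nhds t0. (snd c \<circ> \<beta>) t \<in> ?K \<and> norm (velocity A \<beta> t c) \<le> V"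
    if "csol c {t0-\<delta><..<t0+\<delta>} (snd c \<circ> \<beta>) (\<lambda>t. velocity A \<beta> t c)" "\<delta> > 0" "\<beta> t0 = \<gamma> t0"
      "velocity A \<beta> t0 = velocity A \<gamma> t0" for \<beta> \<delta>
  proof -
    have ct: "isCont (snd c \<circ> \<beta>) t0" "isCont (\<lambda>t. velocity A \<beta> t c) t0"
      using csol_continuous[OF that(1) c(1), of t0] that(2) by auto
    have "\<forall>\<^sub>F t in nhds t0. dist ((snd c \<circ> \<beta>) t) ((snd c \<circ> \<beta>) t0) < R"
      using isCont_eventually_dist[OF ct(1) R(1)] .
    moreover have "\<forall>\<^sub>F t in nhds t0. dist (velocity A \<beta> t c) (velocity A \<beta> t0 c) < 1"
      using isCont_eventually_dist[OF ct(2) zero_less_one] .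
    ultimately show ?thesis
    proof eventually_elim
      case (elim t)
      have "norm (velocity A \<beta> t c) \<le> V"
        using elim(2) that(4) norm_triangle_sub[of "velocity A \<beta> t c" "velocity A \<beta> t0 c"]
        by (simp add: V_def dist_norm)
      then show ?case using elim(1) that(3) by (simp add: dist_commute)
    qed
  qed
  have "\<forall>\<^sub>F t in nhds t0. ((snd c \<circ> \<gamma>) t \<in> ?K \<and> norm (velocity A \<gamma> t c) \<le> V) \<and>
      ((snd c \<circ> \<sigma>) t \<in> ?K \<and> norm (velocity A \<sigma> t c) \<le> V)"
    by (rule eventually_conj[OF good[OF \<delta>1(3,1) refl refl] good[OF \<delta>2(3,1) eq[symmetric]]])
  then obtain \<delta>3 where \<delta>3: "\<delta>3 > 0" "\<And>t. dist t t0 < \<delta>3 \<Longrightarrow> ((snd c \<circ> \<gamma>) t \<in> ?K \<and> norm (velocity A \<gamma> t c) \<le> V) \<and>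
      ((snd c \<circ> \<sigma>) t \<in> ?K \<and> norm (velocity A \<sigma> t c) \<le> V)"
    unfolding eventually_nhds_metric by blast
  \<comment> \<open>Keeps both geodesics inside the chart box and makes the rescaled speed at most
    \<open>\<rho>\<close>; halving it afterwards gives strict inequalities with the three
    radii.\<close>
  define X where "X = min (min \<delta>1 \<delta>2) (min \<delta>3 (\<rho> / V))"
  have X: "X > 0" "X \<le> \<delta>1" "X \<le> \<delta>2" "X \<le> \<delta>3" "X \<le> \<rho> / V"
    using \<delta>1 \<delta>2 \<delta>3 \<rho> V by (auto simp: X_def)
  define a where "a = X / 2"
  have a: "a > 0" "a < \<delta>1" "a < \<delta>2" "a < \<delta>3" "a * V \<le> \<rho>"
  proof -
    show "a > 0" "a < \<delta>1" "a < \<delta>2" "a < \<delta>3" using X by (auto simp: a_def)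
    have "a \<le> X" using X by (simp add: a_def)
    then have "a \<le> \<rho> / V" using X by linarith
    then show "a * V \<le> \<rho>" using V by (simp add: pos_le_divide_eq)
  qed
  have small: "csmall c ?K \<rho> (\<lambda>t. (snd c \<circ> \<beta>) (s * t + t0)) (\<lambda>t. s *\<^sub>R velocity A \<beta> (s * t + t0) c)"
    if "csol c {t0-\<delta><..<t0+\<delta>} (snd c \<circ> \<beta>) (\<lambda>t. velocity A \<beta> t c)" "a < \<delta>" "\<bar>s\<bar> = a"
      "\<And>t. dist t t0 < \<delta>3 \<Longrightarrow> (snd c \<circ> \<beta>) t \<in> ?K \<and> norm (velocity A \<beta> t c) \<le> V" for \<beta> \<delta> s
    unfolding csmall_iff[OF c(1)]
  proof
    have abs: "\<bar>s * t\<bar> \<le> a" if "t \<in> {0..1}" for t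
      using that a(1) \<open>\<bar>s\<bar> = a\<close> by (simp add: abs_mult mult_left_le)
    show "csol c {0..1} (\<lambda>t. (snd c \<circ> \<beta>) (s * t + t0)) (\<lambda>t. s *\<^sub>R velocity A \<beta> (s * t + t0) c)"
      by (rule csol_scale[OF that(1) c(1)]) (use abs that(2) in \<open>force simp: abs_le_iff\<close>)
    show "\<forall>t\<in>{0..1}. (snd c \<circ> \<beta>) (s * t + t0) \<in> ?K \<and> norm (s *\<^sub>R velocity A \<beta> (s * t + t0) c) \<le> \<rho>"
    proof
      fix t :: real assume "t \<in> {0..1}"
      then have "dist (s * t + t0) t0 < \<delta>3" using abs a(4) by (force simp: dist_real_def)
      from that(4)[OF this] a(1,5) that(3)
      show "(snd c \<circ> \<beta>) (s * t + t0) \<in> ?K \<and> norm (s *\<^sub>R velocity A \<beta> (s * t + t0) c) \<le> \<rho>"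
        by (auto intro: order_trans[OF mult_left_mono])
    qed
  qed
  have half: "\<gamma> (s * t + t0) = \<sigma> (s * t + t0)" if s: "\<bar>s\<bar> = a" and t: "t \<in> {0..1}" for s t
  proof -
    have "norm ((snd c \<circ> \<sigma>) (s * t + t0) - (snd c \<circ> \<gamma>) (s * t + t0)) +
        norm (s *\<^sub>R velocity A \<sigma> (s * t + t0) c - s *\<^sub>R velocity A \<gamma> (s * t + t0) c)
      \<le> 4 * (norm ((snd c \<circ> \<sigma>) (s * 0 + t0) - (snd c \<circ> \<gamma>) (s * 0 + t0)) +
        norm (s *\<^sub>R velocity A \<sigma> (s * 0 + t0) c - s *\<^sub>R velocity A \<gamma> (s * 0 + t0) c))"
      by (rule G.small_sol_difference(3)[OF R(2) \<rho>(2,3) small[OF \<delta>1(3) a(2) s] small[OF \<delta>2(3) a(3) s] t])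
        (use \<delta>3 in auto)
    also have "\<dots> = 0" using eq by simp
    finally have "norm ((snd c \<circ> \<sigma>) (s * t + t0) - (snd c \<circ> \<gamma>) (s * t + t0)) \<le> 0"
      using norm_ge_zero[of "s *\<^sub>R velocity A \<sigma> (s * t + t0) c - s *\<^sub>R velocity A \<gamma> (s * t + t0) c"] by linarith
    then have "snd c (\<sigma> (s * t + t0)) = snd c (\<gamma> (s * t + t0))" by simp
    moreover have "\<bar>s * t\<bar> \<le> a" using that a(1) by (simp add: abs_mult mult_left_le)
    then have "\<gamma> (s * t + t0) \<in> fst c" "\<sigma> (s * t + t0) \<in> fst c"
      using \<delta>1(2) \<delta>2(2) a by (force simp: abs_le_iff image_subset_iff)+
    ultimately show ?thesis using chart_inv_chart[OF c(1)] by metis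
  qed
  show ?thesis
  proof (intro exI[of _ a] conjI allI impI a(1))
    fix t assume t: "\<bar>t - t0\<bar> < a"
    show "\<gamma> t = \<sigma> t"
    proof (cases "t \<ge> t0")
      case True
      then show ?thesis using half[of a "(t - t0) / a"] a(1) t by simp
    next
      case False
      then show ?thesis using half[of "- a" "(t0 - t) / a"] a(1) t by simp
    qed
  qed
qed

text \<open>Agreement of position and velocity is an open and closed condition. It is closed because
  distinct positions separate by continuity, and where the positions agree, distinct velocities are
  separated in a common chart.\<close>

lemma geodesic_unique:
  assumes g: "geodesic_on A g J \<gamma>" and s: "geodesic_on A g J \<sigma>" and J: "open J" "connected J" and t0: "t0 \<in> J"
    and eq: "\<gamma> t0 = \<sigma> t0" "velocity A \<gamma> t0 = velocity A \<sigma> t0" and t: "t \<in> J"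
  shows "\<gamma> t = \<sigma> t" "velocity A \<gamma> t = velocity A \<sigma> t"
proof -
  define P where "P t \<longleftrightarrow> \<gamma> t = \<sigma> t \<and> velocity A \<gamma> t = velocity A \<sigma> t" for t
  have cont: "continuous_on J \<gamma>" "continuous_on J \<sigma>" using g s by (auto simp: geodesic_on_def)
  have "\<exists>W. open W \<and> t \<in> W \<and> (\<forall>s\<in>W\<inter>J. P s)" if tP: "t \<in> J" "P t" for t
  proof -
    obtain \<delta> where \<delta>: "\<delta> > 0" "\<forall>r. \<bar>r - t\<bar> < \<delta> \<longrightarrow> \<gamma> r = \<sigma> r"
      using geodesic_local_unique[OF g J(1) tP(1) s] tP(2) unfolding P_def by blast
    show ?thesis
    proof (intro exI[of _ "ball t \<delta>"] conjI ballI)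
      fix r assume "r \<in> ball t \<delta> \<inter> J"
      then show "P r" unfolding P_def using velocity_cong[of "ball t \<delta>" r \<gamma> \<sigma>] \<delta>
        by (auto simp: dist_real_def abs_minus_commute)
    qed (use \<delta> in auto)
  qed
  then obtain W1 where W1: "\<And>t. t \<in> J \<Longrightarrow> P t \<Longrightarrow> open (W1 t) \<and> t \<in> W1 t \<and> (\<forall>s\<in>W1 t\<inter>J. P s)" by metis
  have "\<exists>W. open W \<and> t \<in> W \<and> (\<forall>s\<in>W\<inter>J. \<not> P s)" if tJ: "t \<in> J" and nP: "\<not> P t" for t
  proof (cases "\<gamma> t = \<sigma> t")
    case False
    have ct: "isCont \<gamma> t" "isCont \<sigma> t" using cont J(1) tJ continuous_on_eq_continuous_at by blast+
    then have "isCont (\<lambda>t. dist (\<gamma> t) (\<sigma> t)) t" by (intro continuous_intros)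
    then have "\<forall>\<^sub>F s in nhds t. dist (dist (\<gamma> s) (\<sigma> s)) (dist (\<gamma> t) (\<sigma> t)) < dist (\<gamma> t) (\<sigma> t)"
      by (rule isCont_eventually_dist) (use False in simp)
    then have "\<forall>\<^sub>F s in nhds t. dist (\<gamma> s) (\<sigma> s) > 0"
      by (rule eventually_mono) (smt (verit) dist_real_def)
    then obtain W where "open W" "t \<in> W" "\<forall>s\<in>W. dist (\<gamma> s) (\<sigma> s) > 0" unfolding eventually_nhds by blast
    then show ?thesis by (intro exI[of _ W]) (auto simp: P_def)
  next
    case True
    obtain c where c: "c \<in> A" "\<gamma> t \<in> fst c" by (rule chart_at)
    have ne: "velocity A \<gamma> t c \<noteq> velocity A \<sigma> t c"
      using tangent_eqI[OF velocity_tangent[OF g J(1) tJ] _ c, of "velocity A \<sigma> t"]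
        velocity_tangent[OF s J(1) tJ] nP True by (auto simp: P_def)
    obtain \<delta>1 where \<delta>1: "\<delta>1 > 0" "csol c {t-\<delta>1<..<t+\<delta>1} (snd c \<circ> \<gamma>) (\<lambda>t. velocity A \<gamma> t c)"
      using geodesic_chart_nbhd[OF g J(1) tJ c] by blast
    obtain \<delta>2 where \<delta>2: "\<delta>2 > 0" "csol c {t-\<delta>2<..<t+\<delta>2} (snd c \<circ> \<sigma>) (\<lambda>t. velocity A \<sigma> t c)"
      using geodesic_chart_nbhd[OF s J(1) tJ c(1)] c(2) True by auto
    have "isCont (\<lambda>t. dist (velocity A \<gamma> t c) (velocity A \<sigma> t c)) t"
      using csol_continuous(2)[OF \<delta>1(2) c(1), of t] csol_continuous(2)[OF \<delta>2(2) c(1), of t] \<delta>1(1) \<delta>2(1)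
      by (intro continuous_intros) auto
    then have "\<forall>\<^sub>F s in nhds t. dist (dist (velocity A \<gamma> s c) (velocity A \<sigma> s c)) (dist (velocity A \<gamma> t c) (velocity A \<sigma> t c))
        < dist (velocity A \<gamma> t c) (velocity A \<sigma> t c)"
      by (rule isCont_eventually_dist) (use ne in simp)
    then have "\<forall>\<^sub>F s in nhds t. dist (velocity A \<gamma> s c) (velocity A \<sigma> s c) > 0"
      by (rule eventually_mono) (smt (verit) dist_real_def)
    then obtain W where "open W" "t \<in> W" "\<forall>s\<in>W. dist (velocity A \<gamma> s c) (velocity A \<sigma> s c) > 0"
      unfolding eventually_nhds by blast
    then show ?thesis by (intro exI[of _ W]) (auto simp: P_def)
  qed
  then obtain W2 where W2: "\<And>t. t \<in> J \<Longrightarrow> \<not> P t \<Longrightarrow> open (W2 t) \<and> t \<in> W2 t \<and> (\<forall>s\<in>W2 t\<inter>J. \<not> P s)" by metis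
  have "P t"
  proof (rule ccontr)
    assume n: "\<not> P t"
    have "\<not> connected J"
    proof -
      let ?A = "\<Union>t\<in>{t\<in>J. P t}. W1 t" and ?B = "\<Union>t\<in>{t\<in>J. \<not> P t}. W2 t"
      have "open ?A" "open ?B" using W1 W2 by auto
      moreover have "J \<subseteq> ?A \<union> ?B" using W1 W2 by blast
      moreover have "?A \<inter> ?B \<inter> J = {}" using W1 W2 by blast
      moreover have "t0 \<in> ?A \<inter> J" using W1[OF t0] t0 eq by (auto simp: P_def)
      moreover have "t \<in> ?B \<inter> J" using W2[OF t n] t n by auto
      ultimately show ?thesis unfolding connected_def by blast
    qed
    then show False using J(2) by simp
  qed
  then show "\<gamma> t = \<sigma> t" "velocity A \<gamma> t = velocity A \<sigma> t" by (auto simp: P_def)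
qed

text \<open>The existence time is uniform over a ball and over all speeds up to 1. This uniformity
  later carries a geodesic past a finite end of its interval.\<close>

lemma geodesic_local_exists:
  "\<exists>r>0. \<exists>\<tau>>0. \<forall>x\<in>ball x0 r. \<forall>v\<in>T x. tnorm g x v \<le> 1 \<longrightarrow>
     (\<exists>\<gamma>. geodesic_on A g {-\<tau><..<\<tau>} \<gamma> \<and> \<gamma> 0 = x \<and> velocity A \<gamma> 0 = v)"
proof -
  obtain c where c: "c \<in> A" "x0 \<in> fst c" by (rule chart_at)
  interpret G: local_geometry "dom c" "Gc c" "DGc c" "\<Gamma>c c" "D\<Gamma>c c" by (rule local_geometry[OF c(1)])
  obtain R C where R: "R > 0" "cbounds c (cball (snd c x0) R) C" using cbounds_at[OF c] by blast
  note C = cboundsD[OF R(2) c(1)]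
  have "\<exists>r>0. \<exists>\<rho>>0. \<forall>a\<in>cball (snd c x0) r. \<forall>v0. norm v0 \<le> \<rho> \<longrightarrow> (\<exists>x v. G.sol {-2<..<2} x v \<and> x 0 = a \<and> v 0 = v0)"
    using G.initial_value_problem[OF C(2) R(1)] by metis
  then obtain r1 \<rho>1 where r1: "r1 > 0" "\<rho>1 > 0" and ivp: "\<And>a v0. a \<in> cball (snd c x0) r1 \<Longrightarrow> norm v0 \<le> \<rho>1 \<Longrightarrow>
     \<exists>x v. csol c {-2<..<2} x v \<and> x 0 = a \<and> v 0 = v0" unfolding csol_def by blast
  have "open (fst c \<inter> snd c -` ball (snd c x0) (min r1 R))"
    by (rule continuous_open_preimage[OF chart_cont(1)[OF c(1)] chart_open(1)[OF c(1)]]) simp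
  then obtain r where r: "r > 0" "ball x0 r \<subseteq> fst c \<inter> snd c -` ball (snd c x0) (min r1 R)"
    unfolding open_contains_ball using c(2) r1 R(1) by force
  \<comment> \<open>A vector of Riemannian norm at most 1 has coordinate norm at most
    \<open>C\<close>, so multiplication by \<open>k\<close> makes it an admissible velocity. Undoing
    the rescaling turns the time interval \<open>{-2<..<2}\<close> into
    \<open>{-(2*k)<..<2*k}\<close>.\<close>
  define k where "k = \<rho>1 / C"
  have k: "k > 0" "k * C = \<rho>1" using r1 C(1) by (auto simp: k_def)
  show ?thesis
  proof (rule exI[of _ r], rule conjI, rule r(1), rule exI[of _ "2 * k"], rule conjI, use k in simp, intro ballI impI)
    fix x v assume x: "x \<in> ball x0 r" and v: "v \<in> T x" "tnorm g x v \<le> 1"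
    have xc: "x \<in> fst c" "snd c x \<in> cball (snd c x0) r1" "snd c x \<in> cball (snd c x0) R" using x r by auto
    have "norm (v c) \<le> C * cN c (snd c x) (v c)" by (rule C(6)[OF xc(3)])
    also have "\<dots> \<le> C * 1" using v tnorm_coord[OF c(1) xc(1) v(1)] C(1) by (intro mult_left_mono) auto
    finally have "k * norm (v c) \<le> \<rho>1" using k by (metis mult.right_neutral mult_le_cancel_left_pos)
    then have "norm (k *\<^sub>R v c) \<le> \<rho>1" using k by simp
    then obtain y w where y: "csol c {-2<..<2} y w" "y 0 = snd c x" "w 0 = k *\<^sub>R v c" using ivp[OF xc(2)] by blast
    have "(1 / k) * t + 0 \<in> {-2<..<2}" if "t \<in> {-(2*k)<..<2*k}" for t
      using that k by (auto simp: field_simps)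
    then have s: "csol c {-(2*k)<..<2*k} (\<lambda>t. y ((1 / k) * t + 0)) (\<lambda>t. (1 / k) *\<^sub>R w ((1 / k) * t + 0))"
      by (rule csol_scale[OF y(1) c(1)])
    have 0: "0 \<in> {-(2*k)<..<2*k}" using k by auto
    note cg = chart_geodesic[OF c(1) open_greaterThanLessThan s]
    let ?\<gamma> = "chart_inv c \<circ> (\<lambda>t. y ((1 / k) * t + 0))"
    have "?\<gamma> 0 = x" using y xc c by simp
    moreover have "velocity A ?\<gamma> 0 = tvec_of A c (?\<gamma> 0) ((1 / k) *\<^sub>R w ((1 / k) * 0 + 0))"
      by (rule cg(4)[OF 0])
    then have "velocity A ?\<gamma> 0 = v" using y xc c k tvec_of_coord[OF v(1) c(1) xc(1)] by simp
    ultimately show "\<exists>\<gamma>. geodesic_on A g {-(2*k)<..<2*k} \<gamma> \<and> \<gamma> 0 = x \<and> velocity A \<gamma> 0 = v"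
      using cg(1) by blast
  qed
qed

end

section \<open>Lengths of curves\<close>

lemma has_integral_le_finite:
  fixes f g :: "real \<Rightarrow> real"
  assumes f: "(f has_integral i) I" and g: "(g has_integral j) I" and S: "finite S" and le: "\<And>t. t \<in> I - S \<Longrightarrow> f t \<le> g t"
  shows "i \<le> j"
proof (rule has_integral_le)
  show "((\<lambda>t. if t \<in> S then 0 else f t) has_integral i) I" "((\<lambda>t. if t \<in> S then 0 else g t) has_integral j) I"
    by (rule has_integral_spike_finite[OF S _ f], simp, rule has_integral_spike_finite[OF S _ g], simp)
qed (use le in auto)

context hadamard begin

definition speed where "speed \<gamma> t = tnorm g (\<gamma> t) (velocity A \<gamma> t)"

text \<open>Singles out the times at which \<open>velocity\<close> is meaningful: at a break point
  of the curve the two-sided derivative behind it may fail to exist.\<close>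

definition regular_at where
  "regular_at \<gamma> t \<longleftrightarrow> velocity A \<gamma> t \<in> T (\<gamma> t) \<and>
     (\<forall>c\<in>A. \<gamma> t \<in> fst c \<longrightarrow> (snd c \<circ> \<gamma> has_vector_derivative velocity A \<gamma> t c) (at t))"

lemma speed_nonneg: "regular_at \<gamma> t \<Longrightarrow> speed \<gamma> t \<ge> 0"
  by (simp add: regular_at_def speed_def tnorm_nonneg)

lemma speed_coord: "regular_at \<gamma> t \<Longrightarrow> c \<in> A \<Longrightarrow> \<gamma> t \<in> fst c \<Longrightarrow> speed \<gamma> t = cN c (snd c (\<gamma> t)) (velocity A \<gamma> t c)"
  by (simp add: regular_at_def speed_def tnorm_coord)

lemma regular_atI:
  assumes I: "open I" "t \<in> I" "continuous_on I \<gamma>"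
    and d: "\<And>c. c \<in> A \<Longrightarrow> \<gamma> t \<in> fst c \<Longrightarrow> (snd c \<circ> \<gamma>) differentiable (at t)"
  shows "regular_at \<gamma> t"
proof -
  have hd: "(snd c \<circ> \<gamma> has_vector_derivative velocity A \<gamma> t c) (at t)" if "c \<in> A" "\<gamma> t \<in> fst c" for c
    using d[OF that] that by (simp add: velocity_coord vector_derivative_works)
  have "velocity A \<gamma> t c' = DT c c' (\<gamma> t) (velocity A \<gamma> t c)"
    if c: "c \<in> A" "\<gamma> t \<in> fst c" and c': "c' \<in> A" "\<gamma> t \<in> fst c'" for c c'
  proof -
    have op: "open (I \<inter> \<gamma> -` fst c)" by (rule continuous_open_preimage[OF I(3,1) chart_open(1)[OF c(1)]])
    have 1: "((transition c c' \<circ> (snd c \<circ> \<gamma>)) has_vector_derivative DT c c' (\<gamma> t) (velocity A \<gamma> t c)) (at t)"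
      using has_derivative_compose[OF hd[OF c, unfolded has_vector_derivative_def], of "transition c c'" "DT c c' (\<gamma> t)"]
        DT_derivative[OF c(1) c'(1) c(2) c'(2)] linear_cmul[OF DT_linear[OF c(1) c'(1) c(2) c'(2)]]
      by (simp add: has_vector_derivative_def o_def)
    have "(snd c' \<circ> \<gamma> has_vector_derivative DT c c' (\<gamma> t) (velocity A \<gamma> t c)) (at t)"
      by (rule has_vector_derivative_transform_within_open[OF 1 op])
        (use I(2) c in \<open>simp_all add: transition_apply\<close>)
    with hd[OF c'] show ?thesis by (rule vector_derivative_unique_at)
  qed
  then have "\<forall>c\<in>A. \<forall>c'\<in>A. \<gamma> t \<in> fst c \<and> \<gamma> t \<in> fst c' \<longrightarrow>
      velocity A \<gamma> t c' = frechet_derivative (transition c c') (at (snd c (\<gamma> t))) (velocity A \<gamma> t c)"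
    unfolding DT_def by blast
  moreover have "\<forall>c. \<not> (c \<in> A \<and> \<gamma> t \<in> fst c) \<longrightarrow> velocity A \<gamma> t c = 0" by (simp add: velocity_def)
  ultimately have "velocity A \<gamma> t \<in> T (\<gamma> t)" unfolding tangent_space_def by blast
  with hd show ?thesis by (simp add: regular_at_def)
qed

lemma c1_curveD:
  assumes "c1_curve A a b \<gamma>"
  shows "continuous_on {a..b} \<gamma>"
    "c \<in> A \<Longrightarrow> t \<in> {a..b} \<Longrightarrow> \<gamma> t \<in> fst c \<Longrightarrow> (snd c \<circ> \<gamma>) differentiable (at t within {a..b})"
    "c \<in> A \<Longrightarrow> continuous_on ({a..b} \<inter> \<gamma> -` fst c) (\<lambda>t. vector_derivative (snd c \<circ> \<gamma>) (at t within {a..b}))"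
  using assms unfolding c1_curve_def by blast+

lemma c1_curve_regular:
  assumes "c1_curve A a b \<gamma>" "t \<in> {a<..<b}"
  shows "regular_at \<gamma> t"
  by (rule regular_atI[of "{a<..<b}"])
    (use c1_curveD[OF assms(1)] assms(2) in \<open>auto intro: continuous_on_subset simp: at_within_Icc_at[of a t b, symmetric]\<close>)

text \<open>With one-sided derivatives the coordinate speed is continuous up to the ends of the
  interval. It differs from \<open>speed\<close> at the end points at most, which do not affect
  integrability.\<close>

lemma c1_curve_locally_integrable:
  assumes c1: "c1_curve A a b \<gamma>" and t0: "t0 \<in> {a..b}"
  shows "\<exists>\<delta>>0. \<forall>a' b'. a \<le> a' \<longrightarrow> b' \<le> b \<longrightarrow> t0 - \<delta> < a' \<longrightarrow> b' < t0 + \<delta> \<longrightarrow> speed \<gamma> integrable_on {a'..b'}"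
proof -
  obtain c where c: "c \<in> A" "\<gamma> t0 \<in> fst c" by (rule chart_at)
  interpret G: local_geometry "dom c" "Gc c" "DGc c" "\<Gamma>c c" "D\<Gamma>c c" by (rule local_geometry[OF c(1)])
  note D = c1_curveD[OF c1]
  obtain W where W: "open W" "t0 \<in> W" "\<forall>t\<in>{a..b}. t \<in> W \<longrightarrow> \<gamma> t \<in> fst c"
    using D(1) t0 c chart_open(1)[OF c(1)] unfolding continuous_on_topological by metis
  obtain \<delta> where \<delta>: "\<delta> > 0" "ball t0 \<delta> \<subseteq> W" using W openE by blast
  show ?thesis
  proof (intro exI[of _ \<delta>] conjI \<delta>(1) allI impI)
    fix a' b' assume ab: "a \<le> a'" "b' \<le> b" "t0 - \<delta> < a'" "b' < t0 + \<delta>"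
    have sub: "{a'..b'} \<subseteq> {a..b} \<inter> \<gamma> -` fst c"
    proof
      fix t assume "t \<in> {a'..b'}"
      then have "t \<in> {a..b}" "t \<in> ball t0 \<delta>" using ab by (auto simp: dist_real_def)
      then show "t \<in> {a..b} \<inter> \<gamma> -` fst c" using W(3) \<delta>(2) by blast
    qed
    let ?w = "\<lambda>t. vector_derivative (snd c \<circ> \<gamma>) (at t within {a..b})"
    have "continuous_on {a'..b'} (\<lambda>t. snd c (\<gamma> t))"
      by (rule continuous_on_compose2[OF chart_cont(1)[OF c(1)] continuous_on_subset[OF D(1)]]) (use sub in auto)
    moreover have "continuous_on {a'..b'} ?w"
      using continuous_on_subset[OF D(3)[OF c(1)] sub] .
    ultimately have "continuous_on {a'..b'} (\<lambda>t. G.N (snd c (\<gamma> t)) (?w t))"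
      unfolding G.N_def by (intro continuous_intros continuous_on_compose2[OF G.G_cont]) (use sub in auto)
    then have "(\<lambda>t. G.N (snd c (\<gamma> t)) (?w t)) integrable_on {a'..b'}" by (rule integrable_continuous_real)
    then show "speed \<gamma> integrable_on {a'..b'}"
    proof (rule integrable_spike_finite[of "{a, b}", rotated 2])
      fix t assume t: "t \<in> {a'..b'} - {a, b}"
      then have "t \<in> {a<..<b}" using ab by auto
      moreover have "\<gamma> t \<in> fst c" using t sub by auto
      ultimately show "speed \<gamma> t = G.N (snd c (\<gamma> t)) (?w t)"
        using speed_coord[OF c1_curve_regular[OF c1] c(1)] c(1)
        by (simp add: velocity_coord at_within_Icc_at)
    qed simp
  qed
qed

text \<open>Integrability is collected by continuous induction over single C1 pieces, entered from
  the right of a time in the step case and from its left in the limit case. The end points 0 and 1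
  count as exceptional times since \<open>velocity\<close> is two-sided.\<close>

lemma piecewise_c1_facts:
  assumes "piecewise_c1_curve A \<gamma>"
  shows "continuous_on {0..1} \<gamma>" "speed \<gamma> integrable_on {0..1}" "\<exists>S. finite S \<and> (\<forall>t\<in>{0..1} - S. regular_at \<gamma> t)"
proof -
  obtain S where S: "finite S" "\<And>a b. 0 \<le> a \<Longrightarrow> a < b \<Longrightarrow> b \<le> 1 \<Longrightarrow> {a<..<b} \<inter> S = {} \<Longrightarrow> c1_curve A a b \<gamma>"
    using assms unfolding piecewise_c1_curve_def by blast
  show "continuous_on {0..1} \<gamma>" using assms by (simp add: piecewise_c1_curve_def)
  \<comment> \<open>Every time has one-sided punctured neighbourhoods free of break points, so a
    single C1 piece lies on either side of it.\<close>
  have sep: "\<exists>d>0. {t-d<..<t} \<inter> S = {} \<and> {t<..<t+d} \<inter> S = {}" for t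
  proof -
    obtain d where "d > 0" "\<forall>x\<in>S. x \<noteq> t \<longrightarrow> d \<le> dist t x" using finite_set_avoid[OF S(1)] by blast
    then show ?thesis by (intro exI[of _ d]) (force simp: dist_real_def)
  qed
  have "\<forall>t\<in>{0..1} - (S \<union> {0, 1}). regular_at \<gamma> t"
  proof
    fix t assume t: "t \<in> {0..1} - (S \<union> {0, 1})"
    obtain d where d: "d > 0" "{t-d<..<t} \<inter> S = {}" "{t<..<t+d} \<inter> S = {}" using sep by blast
    have "c1_curve A (max 0 (t - d)) (min 1 (t + d)) \<gamma>"
    proof (rule S(2))
      show "{max 0 (t - d)<..<min 1 (t + d)} \<inter> S = {}"
      proof (rule ccontr)
        assume "{max 0 (t - d)<..<min 1 (t + d)} \<inter> S \<noteq> {}"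
        then obtain s where "s \<in> S" "t - d < s" "s < t + d" by auto
        then have "s \<in> {t-d<..<t} \<inter> S \<or> s \<in> {t<..<t+d} \<inter> S \<or> s = t" by auto
        then show False using d t \<open>s \<in> S\<close> by blast
      qed
    qed (use t d in auto)
    then show "regular_at \<gamma> t" by (rule c1_curve_regular) (use t d in auto)
  qed
  then show "\<exists>S. finite S \<and> (\<forall>t\<in>{0..1} - S. regular_at \<gamma> t)"
    using S(1) by (intro exI[of _ "S \<union> {0, 1}"]) simp
  have "speed \<gamma> integrable_on {0..t}" if "t \<in> {0..1}" for t
    using zero_le_one
  proof (induction rule: real_induct)
    case base
    show ?case using integrable_on_refl[of "speed \<gamma>" 0] by simp
  next
    case (step t)
    obtain d where d: "d > 0" "{t<..<t+d} \<inter> S = {}" using sep by blast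
    have "c1_curve A t (min 1 (t + d)) \<gamma>" by (rule S(2)) (use step d in auto)
    then obtain \<delta> where \<delta>: "\<delta> > 0" "\<forall>a' b'. t \<le> a' \<longrightarrow> b' \<le> min 1 (t + d) \<longrightarrow> t - \<delta> < a' \<longrightarrow> b' < t + \<delta> \<longrightarrow> speed \<gamma> integrable_on {a'..b'}"
      using c1_curve_locally_integrable[of t "min 1 (t + d)" \<gamma> t] step d by auto
    show ?case
    proof (intro exI[of _ "t + min d \<delta>"] conjI allI impI)
      fix s assume s: "t < s \<and> s < t + min d \<delta> \<and> s \<le> 1"
      then have "speed \<gamma> integrable_on {t..s}" using \<delta> by auto
      moreover have "speed \<gamma> integrable_on {0..t}" using step by auto
      ultimately show "speed \<gamma> integrable_on {0..s}" using Henstock_Kurzweil_Integration.integrable_combine[where a=0 and c=t and b=s] step s by auto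
    qed (use d \<delta> in auto)
  next
    case (lim t)
    obtain d where d: "d > 0" "{t-d<..<t} \<inter> S = {}" using sep by blast
    have "c1_curve A (max 0 (t - d)) t \<gamma>" by (rule S(2)) (use lim d in auto)
    then obtain \<delta> where \<delta>: "\<delta> > 0" "\<forall>a' b'. max 0 (t - d) \<le> a' \<longrightarrow> b' \<le> t \<longrightarrow> t - \<delta> < a' \<longrightarrow> b' < t + \<delta> \<longrightarrow> speed \<gamma> integrable_on {a'..b'}"
      using c1_curve_locally_integrable[of "max 0 (t - d)" t \<gamma> t] lim d by auto
    define s where "s = max (max 0 (t - d)) (t - \<delta> / 2)"
    have s: "0 \<le> s" "s < t" using lim d \<delta> by (auto simp: s_def)
    have "max 0 (t - d) \<le> s" "t - \<delta> < s" using \<delta> by (auto simp: s_def)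
    then have "speed \<gamma> integrable_on {s..t}" using \<delta>(1) \<delta>(2)[rule_format, of s t] by simp
    moreover have "speed \<gamma> integrable_on {0..s}" using lim s by auto
    ultimately show ?case using Henstock_Kurzweil_Integration.integrable_combine[where a=0 and c=s and b=t] s by auto
  qed (use that in simp)
  then show "speed \<gamma> integrable_on {0..1}" by simp
qed

lemma curve_length_speed: "curve_length A g \<gamma> = integral {0..1} (speed \<gamma>)"
  by (simp add: curve_length_def speed_def[abs_def])

lemma speed_integral_nonneg:
  assumes "piecewise_c1_curve A \<gamma>" "0 \<le> s" "t \<le> 1"
  shows "integral {s..t} (speed \<gamma>) \<ge> 0"
proof -
  obtain S where S: "finite S" "\<forall>t\<in>{0..1} - S. regular_at \<gamma> t" using piecewise_c1_facts(3)[OF assms(1)] by blast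
  have "speed \<gamma> integrable_on {s..t}"
    by (rule integrable_subinterval_real[OF piecewise_c1_facts(2)[OF assms(1)]]) (use assms in auto)
  then have "(speed \<gamma> has_integral integral {s..t} (speed \<gamma>)) {s..t}" by (rule integrable_integral)
  from has_integral_le_finite[OF has_integral_0 this S(1)] show ?thesis
    using S(2) assms speed_nonneg by auto
qed

lemma dist_le_curve_length:
  assumes "piecewise_c1_curve A \<gamma>" shows "dist (\<gamma> 0) (\<gamma> 1) \<le> curve_length A g \<gamma>"
proof -
  have "dist (\<gamma> 0) (\<gamma> 1) = riemannian_distance A g (\<gamma> 0) (\<gamma> 1)"
    using hadamard unfolding hadamard_manifold_def by blast
  also have "\<dots> \<le> curve_length A g \<gamma>"
    unfolding riemannian_distance_def
  proof (rule cInf_lower)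
    show "bdd_below {curve_length A g \<gamma>' |\<gamma>'. piecewise_c1_curve A \<gamma>' \<and> \<gamma>' 0 = \<gamma> 0 \<and> \<gamma>' 1 = \<gamma> 1}"
      by (rule bdd_belowI[of _ 0]) (use speed_integral_nonneg in \<open>auto simp: curve_length_speed\<close>)
  qed (use assms in blast)
  finally show ?thesis .
qed

section \<open>Reparametrization, arcs of curves and geodesic segments\<close>

lemma c1_curve_affine:
  assumes c1: "c1_curve A (p * a + q) (p * b + q) \<gamma>" and p: "p > 0" "a < b"
  shows "c1_curve A a b (\<lambda>t. \<gamma> (p * t + q))"
  unfolding c1_curve_def
proof (intro conjI ballI)
  note D = c1_curveD[OF c1]
  have im: "(\<lambda>t. p * t + q) ` {a..b} = {p * a + q..p * b + q}"
    using image_affinity_atLeastAtMost[of p q a b] p by simp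
  show "continuous_on {a..b} (\<lambda>t. \<gamma> (p * t + q))"
    by (rule continuous_on_compose2[OF D(1)]) (use im in \<open>auto intro!: continuous_intros\<close>)
  fix c assume c: "c \<in> A"
  have vd: "((snd c \<circ> (\<lambda>t. \<gamma> (p * t + q))) has_vector_derivative
      p *\<^sub>R vector_derivative (snd c \<circ> \<gamma>) (at (p * t + q) within {p * a + q..p * b + q})) (at t within {a..b})"
    if t: "t \<in> {a..b}" "\<gamma> (p * t + q) \<in> fst c" for t
  proof -
    have 1: "((\<lambda>t. p * t + q) has_vector_derivative p) (at t within {a..b})"
      by (auto intro!: derivative_eq_intros)
    have "p * t + q \<in> {p * a + q..p * b + q}" using im t by blast
    then have "((snd c \<circ> \<gamma>) has_vector_derivative vector_derivative (snd c \<circ> \<gamma>) (at (p * t + q) within {p * a + q..p * b + q}))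
       (at (p * t + q) within (\<lambda>t. p * t + q) ` {a..b})"
      using D(2)[OF c _ t(2)] unfolding im by (simp add: vector_derivative_works)
    from vector_diff_chain_within[OF 1 this] show ?thesis by (simp add: o_def)
  qed
  show "(snd c \<circ> (\<lambda>t. \<gamma> (p * t + q))) differentiable (at t within {a..b})"
    if "t \<in> {a..b} \<inter> (\<lambda>t. \<gamma> (p * t + q)) -` fst c" for t
    using vd[of t] that differentiableI_vector by blast
  have eq: "vector_derivative (snd c \<circ> (\<lambda>t. \<gamma> (p * t + q))) (at t within {a..b}) =
     p *\<^sub>R vector_derivative (snd c \<circ> \<gamma>) (at (p * t + q) within {p * a + q..p * b + q})"
    if t: "t \<in> {a..b} \<inter> (\<lambda>t. \<gamma> (p * t + q)) -` fst c" for t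
    using vector_derivative_within_cbox[of a b t "snd c \<circ> (\<lambda>t. \<gamma> (p * t + q))"] vd[of t] t p by simp
  have "continuous_on ({a..b} \<inter> (\<lambda>t. \<gamma> (p * t + q)) -` fst c)
     (\<lambda>t. p *\<^sub>R vector_derivative (snd c \<circ> \<gamma>) (at (p * t + q) within {p * a + q..p * b + q}))"
    by (intro continuous_intros continuous_on_compose2[OF D(3)[OF c]]) (use im in auto)
  then show "continuous_on ({a..b} \<inter> (\<lambda>t. \<gamma> (p * t + q)) -` fst c)
     (\<lambda>t. vector_derivative (snd c \<circ> (\<lambda>t. \<gamma> (p * t + q))) (at t within {a..b}))"
    by (rule continuous_on_eq) (use eq in simp)
qed

lemma c1_curve_cong:
  assumes c1: "c1_curve A a b \<gamma>" and eq: "\<And>t. t \<in> {a..b} \<Longrightarrow> \<gamma> t = \<sigma> t" and ab: "a < b"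
  shows "c1_curve A a b \<sigma>"
  unfolding c1_curve_def
proof (intro conjI ballI)
  note D = c1_curveD[OF c1]
  show "continuous_on {a..b} \<sigma>" using D(1) eq by (metis continuous_on_cong)
  fix c assume c: "c \<in> A"
  have vd: "(snd c \<circ> \<sigma> has_vector_derivative vector_derivative (snd c \<circ> \<gamma>) (at t within {a..b})) (at t within {a..b})"
    if t: "t \<in> {a..b}" "\<sigma> t \<in> fst c" for t
  proof -
    have "(snd c \<circ> \<gamma> has_vector_derivative vector_derivative (snd c \<circ> \<gamma>) (at t within {a..b})) (at t within {a..b})"
      using D(2)[OF c t(1)] eq t by (simp add: vector_derivative_works)
    then show ?thesis
      by (rule has_vector_derivative_transform[rotated 2]) (use t eq in auto)
  qed
  show "(snd c \<circ> \<sigma>) differentiable (at t within {a..b})" if "t \<in> {a..b} \<inter> \<sigma> -` fst c" for t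
    using vd[of t] that differentiableI_vector by blast
  have "{a..b} \<inter> \<sigma> -` fst c = {a..b} \<inter> \<gamma> -` fst c" using eq by auto
  moreover have "vector_derivative (snd c \<circ> \<gamma>) (at t within {a..b}) = vector_derivative (snd c \<circ> \<sigma>) (at t within {a..b})"
    if "t \<in> {a..b} \<inter> \<sigma> -` fst c" for t
    using vector_derivative_within_cbox[of a b t "snd c \<circ> \<sigma>"] vd[of t] that ab by simp
  ultimately show "continuous_on ({a..b} \<inter> \<sigma> -` fst c) (\<lambda>t. vector_derivative (snd c \<circ> \<sigma>) (at t within {a..b}))"
    using continuous_on_eq[OF D(3)[OF c]] by metis
qed

lemma speed_affine:
  assumes r: "regular_at \<gamma> (p * t + q)"
    and I: "open I" "t \<in> I" "continuous_on I (\<lambda>t. \<gamma> (p * t + q))"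
  shows "speed (\<lambda>t. \<gamma> (p * t + q)) t = \<bar>p\<bar> * speed \<gamma> (p * t + q)"
proof -
  have hd: "(snd c \<circ> (\<lambda>t. \<gamma> (p * t + q)) has_vector_derivative p *\<^sub>R velocity A \<gamma> (p * t + q) c) (at t)"
    if c: "c \<in> A" "\<gamma> (p * t + q) \<in> fst c" for c
  proof -
    have 1: "((\<lambda>t. p * t + q) has_vector_derivative p) (at t)" by (auto intro!: derivative_eq_intros)
    have 2: "(snd c \<circ> \<gamma> has_vector_derivative velocity A \<gamma> (p * t + q) c) (at (p * t + q))"
      using r c by (simp add: regular_at_def)
    from vector_diff_chain_at[OF 1 2] show ?thesis by (simp add: o_def)
  qed
  have r': "regular_at (\<lambda>t. \<gamma> (p * t + q)) t"
    by (rule regular_atI[OF I]) (use hd differentiableI_vector in blast)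
  obtain c where c: "c \<in> A" "\<gamma> (p * t + q) \<in> fst c" by (rule chart_at)
  interpret G: local_geometry "dom c" "Gc c" "DGc c" "\<Gamma>c c" "D\<Gamma>c c" by (rule local_geometry[OF c(1)])
  have "velocity A (\<lambda>t. \<gamma> (p * t + q)) t c = p *\<^sub>R velocity A \<gamma> (p * t + q) c"
    using velocity_coord[of c "\<lambda>t. \<gamma> (p * t + q)" t] c hd[OF c] by (simp add: vector_derivative_at)
  then show ?thesis
    using speed_coord[OF r' c] speed_coord[OF r c] by (simp add: G.N_scale)
qed

text \<open>An arc, reparametrized over the unit interval, is an admissible curve for the distance,
  and substitution identifies its length with the integral over the arc.\<close>

lemma dist_le_speed_integral:
  assumes pc: "piecewise_c1_curve A \<gamma>" and st: "0 \<le> s" "s \<le> t" "t \<le> 1"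
  shows "dist (\<gamma> s) (\<gamma> t) \<le> integral {s..t} (speed \<gamma>)"
proof (cases "s = t")
  case True then show ?thesis using speed_integral_nonneg[OF pc st(1,3)] by simp
next
  case False
  define p where "p = t - s"
  have p: "p > 0" using False st by (simp add: p_def)
  let ?\<beta> = "\<lambda>\<tau>. \<gamma> (p * \<tau> + s)"
  note F = piecewise_c1_facts[OF pc]
  have in01: "p * \<tau> + s \<in> {s..t}" if "\<tau> \<in> {0..1}" for \<tau>
  proof -
    have "0 \<le> p * \<tau>" "p * \<tau> \<le> p" using that p mult_left_le[of \<tau> p] by auto
    then show ?thesis unfolding atLeastAtMost_iff using p_def by linarith
  qed
  then have in01': "p * \<tau> + s \<in> {0..1}" if "\<tau> \<in> {0..1}" for \<tau> using that st by force
  obtain S where S: "finite S" "\<And>a b. 0 \<le> a \<Longrightarrow> a < b \<Longrightarrow> b \<le> 1 \<Longrightarrow> {a<..<b} \<inter> S = {} \<Longrightarrow> c1_curve A a b \<gamma>"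
    using pc unfolding piecewise_c1_curve_def by blast
  let ?h = "\<lambda>\<sigma>. (\<sigma> - s) / p"
  have hin: "?h (p * \<tau> + s) = \<tau>" for \<tau> using p by simp
  have cont: "continuous_on {0..1} ?\<beta>"
    by (rule continuous_on_compose2[OF F(1)]) (use in01' in \<open>auto intro!: continuous_intros\<close>)
  have pc\<beta>: "piecewise_c1_curve A ?\<beta>"
    unfolding piecewise_c1_curve_def
  proof (intro conjI exI[of _ "?h ` S"] allI impI)
    fix a b assume ab: "0 \<le> a \<and> a < b \<and> b \<le> 1 \<and> {a<..<b} \<inter> ?h ` S = {}"
    have "c1_curve A (p * a + s) (p * b + s) \<gamma>"
    proof (rule S(2))
      show "0 \<le> p * a + s" "p * b + s \<le> 1" using in01'[of a] in01'[of b] ab by auto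
      show "p * a + s < p * b + s" using ab p by simp
      show "{p * a + s<..<p * b + s} \<inter> S = {}"
      proof (rule ccontr)
        assume "{p * a + s<..<p * b + s} \<inter> S \<noteq> {}"
        then obtain \<sigma> where "\<sigma> \<in> S" "p * a + s < \<sigma>" "\<sigma> < p * b + s" by auto
        then have "?h \<sigma> \<in> {a<..<b} \<inter> ?h ` S" using p by (auto simp: field_simps)
        then show False using ab by blast
      qed
    qed
    then show "c1_curve A a b ?\<beta>" by (rule c1_curve_affine) (use p ab in auto)
  qed (use cont S in auto)
  obtain S' where S': "finite S'" "\<forall>t\<in>{0..1} - S'. regular_at \<gamma> t" using F(3) by blast
  have "speed \<gamma> integrable_on {s..t}" by (rule integrable_subinterval_real[OF F(2)]) (use st in auto)
  then have "(speed \<gamma> has_integral integral {s..t} (speed \<gamma>)) (cbox s t)" by (simp add: integrable_integral)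
  from has_integral_affinity'[OF this p, of s]
  have "((\<lambda>\<tau>. speed \<gamma> (p * \<tau> + s)) has_integral integral {s..t} (speed \<gamma>) / p) {0..1}"
    using p by (simp add: p_def divide_inverse mult.commute)
  from has_integral_mult_right[OF this, of p]
  have 1: "((\<lambda>\<tau>. p * speed \<gamma> (p * \<tau> + s)) has_integral integral {s..t} (speed \<gamma>)) {0..1}" using p by simp
  have "(speed ?\<beta> has_integral integral {s..t} (speed \<gamma>)) {0..1}"
  proof (rule has_integral_spike_finite[of "?h ` S' \<union> {0, 1}", OF _ _ 1])
    fix \<tau> assume \<tau>: "\<tau> \<in> {0..1} - (?h ` S' \<union> {0, 1})"
    then have "p * \<tau> + s \<notin> S'" using hin by (metis DiffD2 UnI1 image_eqI)
    then have "regular_at \<gamma> (p * \<tau> + s)" using S'(2) in01'[of \<tau>] \<tau> by auto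
    then have "speed ?\<beta> \<tau> = \<bar>p\<bar> * speed \<gamma> (p * \<tau> + s)"
      by (rule speed_affine[of _ _ _ _ "{0<..<1}"]) (use \<tau> cont in \<open>auto intro: continuous_on_subset\<close>)
    then show "speed ?\<beta> \<tau> = p * speed \<gamma> (p * \<tau> + s)" using p by simp
  qed (use S' in auto)
  then have "curve_length A g ?\<beta> = integral {s..t} (speed \<gamma>)" by (simp add: curve_length_speed integral_unique)
  then show ?thesis using dist_le_curve_length[OF pc\<beta>] by (simp add: p_def)
qed

lemma geodesic_c1:
  assumes g: "geodesic_on A g J \<gamma>" and J: "open J" "{0..1} \<subseteq> J"
  shows "piecewise_c1_curve A \<gamma>"
  unfolding piecewise_c1_curve_def
proof (intro conjI exI[of _ "{}"] allI impI)
  have "continuous_on J \<gamma>" using g by (simp add: geodesic_on_def)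
  then show cont: "continuous_on {0..1} \<gamma>" using J(2) continuous_on_subset by blast
  fix a b :: real assume ab: "0 \<le> a \<and> a < b \<and> b \<le> 1 \<and> {a<..<b} \<inter> {} = {}"
  show "c1_curve A a b \<gamma>"
    unfolding c1_curve_def
  proof (intro conjI ballI)
    show "continuous_on {a..b} \<gamma>" by (rule continuous_on_subset[OF cont]) (use ab in auto)
    fix c assume c: "c \<in> A"
    have vd: "(snd c \<circ> \<gamma> has_vector_derivative velocity A \<gamma> t c) (at t)" "isCont (\<lambda>t. velocity A \<gamma> t c) t"
      if t: "t \<in> {a..b} \<inter> \<gamma> -` fst c" for t
    proof -
      have tJ: "t \<in> J" "\<gamma> t \<in> fst c" using t J ab by auto
      obtain \<delta> where \<delta>: "\<delta> > 0" "csol c {t-\<delta><..<t+\<delta>} (snd c \<circ> \<gamma>) (\<lambda>t. velocity A \<gamma> t c)"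
        using geodesic_chart_nbhd[OF g J(1) tJ(1) c tJ(2)] by blast
      show "(snd c \<circ> \<gamma> has_vector_derivative velocity A \<gamma> t c) (at t)" "isCont (\<lambda>t. velocity A \<gamma> t c) t"
        using csolD(2)[OF \<delta>(2) c] csol_continuous(2)[OF \<delta>(2) c] \<delta>(1) by auto
    qed
    show "(snd c \<circ> \<gamma>) differentiable at t within {a..b}" if "t \<in> {a..b} \<inter> \<gamma> -` fst c" for t
      using vd(1)[OF that] has_vector_derivative_at_within differentiableI_vector by blast
    have "vector_derivative (snd c \<circ> \<gamma>) (at t within {a..b}) = velocity A \<gamma> t c" if "t \<in> {a..b} \<inter> \<gamma> -` fst c" for t
      using vector_derivative_within_cbox[of a b t "snd c \<circ> \<gamma>"] has_vector_derivative_at_within[OF vd(1)[OF that]] that ab by simp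
    moreover have "continuous_on ({a..b} \<inter> \<gamma> -` fst c) (\<lambda>t. velocity A \<gamma> t c)"
      using vd(2) by (simp add: continuous_at_imp_continuous_on)
    ultimately show "continuous_on ({a..b} \<inter> \<gamma> -` fst c) (\<lambda>t. vector_derivative (snd c \<circ> \<gamma>) (at t within {a..b}))"
      by (metis (no_types, lifting) continuous_on_cong)
  qed
qed simp

text \<open>The segment is one competitor of constant speed, hence only an upper bound; that it is
  attained follows in \<open>dist_exp_map\<close> from the expansion property.\<close>

lemma geodesic_dist:
  assumes g: "geodesic_on A g J \<gamma>" and J: "open J" "connected J" "s \<in> J" "t \<in> J"
  shows "dist (\<gamma> s) (\<gamma> t) \<le> tnorm g (\<gamma> s) (velocity A \<gamma> s) * \<bar>t - s\<bar>"
proof -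
  let ?I = "(\<lambda>\<tau>. (t - s) * \<tau> + s) -` J" and ?\<beta> = "\<lambda>\<tau>. \<gamma> ((t - s) * \<tau> + s)"
  have I: "open ?I" by (rule open_vimage[OF J(1)]) (intro continuous_intros)
  have seg: "(t - s) * \<tau> + s \<in> J" if "\<tau> \<in> {0..1}" for \<tau>
  proof -
    have "closed_segment s t \<subseteq> J" using J(2-4) by (metis closed_segment_subset is_interval_connected_1 is_interval_convex_1)
    moreover have "(t - s) * \<tau> + s \<in> closed_segment s t"
      using that by (auto simp: closed_segment_def algebra_simps intro!: exI[of _ \<tau>])
    ultimately show ?thesis by blast
  qed
  note b = geodesic_affine[OF g J(1) I, of "t - s" s]
  have gb: "geodesic_on A g ?I ?\<beta>" by (rule b(1)) simp
  have pc: "piecewise_c1_curve A ?\<beta>" by (rule geodesic_c1[OF gb I]) (use seg in auto)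
  have "speed ?\<beta> \<tau> = tnorm g (\<gamma> s) (velocity A \<gamma> s) * \<bar>t - s\<bar>" if \<tau>: "\<tau> \<in> {0..1}" for \<tau>
  proof -
    have "velocity A ?\<beta> \<tau> = tscale (t - s) (velocity A \<gamma> ((t - s) * \<tau> + s))"
      by (rule b(2)) (use seg[OF \<tau>] in auto)
    then show ?thesis
      using geodesic_speed[OF g J(1,2) seg[OF \<tau>] J(3)] tnorm_scale[OF velocity_tangent[OF g J(1) seg[OF \<tau>]]]
      by (simp add: speed_def mult.commute)
  qed
  then have "integral {0..1} (speed ?\<beta>) = integral {0..1::real} (\<lambda>\<tau>. tnorm g (\<gamma> s) (velocity A \<gamma> s) * \<bar>t - s\<bar>)"
    by (intro integral_cong) auto
  then have "curve_length A g ?\<beta> = tnorm g (\<gamma> s) (velocity A \<gamma> s) * \<bar>t - s\<bar>"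
    by (simp add: curve_length_speed)
  then show ?thesis using dist_le_curve_length[OF pc] by simp
qed

end

text \<open>Closeness of \<open>G\<close> within \<open>\<eta> / C^2\<close> is a relative error
  \<open>\<eta>\<close> for the quadratic form, because \<open>norm u \<le> C * N y0 u\<close>.
  Taking roots preserves the factors since \<open>(1 - \<eta>)^2 \<le> 1 - \<eta>\<close> and
  \<open>1 + \<eta> \<le> (1 + \<eta>)^2\<close>.\<close>

lemma (in local_geometry) N_near:
  assumes y0: "y0 \<in> U" and \<eta>: "0 < \<eta>" "\<eta> \<le> 1"
  shows "\<exists>\<delta>>0. \<forall>y. dist y y0 < \<delta> \<longrightarrow> y \<in> U \<and> (\<forall>u. (1 - \<eta>) * N y0 u \<le> N y u \<and> N y u \<le> (1 + \<eta>) * N y0 u)"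
proof -
  obtain C where C: "bounds {y0} C" using bounds_exist[of "{y0}"] y0 by auto
  have "isCont G y0" using G_cont openU y0 continuous_on_eq_continuous_at by blast
  have "\<eta> / C^2 > 0" using C \<eta> by (auto simp: bounds_def)
  have "\<forall>\<^sub>F y in nhds y0. dist (G y) (G y0) < \<eta> / C^2" by (rule isCont_eventually_dist) fact+
  moreover have "\<forall>\<^sub>F y in nhds y0. y \<in> U" using openU y0 by (rule eventually_nhds_in_open)
  ultimately have "\<forall>\<^sub>F y in nhds y0. y \<in> U \<and> (\<forall>u. (1 - \<eta>) * N y0 u \<le> N y u \<and> N y u \<le> (1 + \<eta>) * N y0 u)"
  proof eventually_elim
    case (elim y)
    have "(1 - \<eta>) * N y0 u \<le> N y u \<and> N y u \<le> (1 + \<eta>) * N y0 u" for u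
    proof -
      have "\<bar>G y u u - G y0 u u\<bar> = \<bar>(G y - G y0) u u\<bar>" by (simp add: blinfun.bilinear_simps)
      also have "\<dots> \<le> norm (G y - G y0) * norm u * norm u"
        using norm_blinfun[of "(G y - G y0) u" u] norm_blinfun[of "G y - G y0" u]
        by (smt (verit) mult_right_mono norm_ge_zero real_norm_def)
      also have "\<dots> \<le> \<eta> / C^2 * norm u * norm u"
        using elim(1) by (intro mult_right_mono) (auto simp: dist_norm)
      also have "\<dots> = \<eta> * (norm u / C)^2" by (simp add: power2_eq_square)
      also have "\<dots> \<le> \<eta> * (N y0 u)^2"
      proof (intro mult_left_mono power_mono)
        show "norm u / C \<le> N y0 u" using C by (auto simp: bounds_def divide_le_eq mult.commute)
      qed (use \<eta> C in \<open>auto simp: bounds_def\<close>)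
      finally have d: "\<bar>(N y u)^2 - (N y0 u)^2\<bar> \<le> \<eta> * (N y0 u)^2" using elim(2) y0 by (simp add: N_sq)
      have n0: "(N y0 u)^2 \<ge> 0" by simp
      have "(1 - \<eta>)^2 * (N y0 u)^2 \<le> (1 - \<eta>) * (N y0 u)^2"
        using \<eta> n0 by (intro mult_right_mono) (auto simp: power2_eq_square mult_left_le)
      moreover have "(1 - \<eta>) * (N y0 u)^2 = (N y0 u)^2 - \<eta> * (N y0 u)^2" by (simp add: left_diff_distrib)
      ultimately have lo: "((1 - \<eta>) * N y0 u)^2 \<le> (N y u)^2" using d unfolding power_mult_distrib by linarith
      have "(1 + \<eta>) * (N y0 u)^2 \<le> (1 + \<eta>)^2 * (N y0 u)^2"
        using \<eta> n0 by (intro mult_right_mono) (auto simp: power2_eq_square)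
      moreover have "(1 + \<eta>) * (N y0 u)^2 = (N y0 u)^2 + \<eta> * (N y0 u)^2" by (simp add: distrib_right)
      ultimately have "(N y u)^2 \<le> ((1 + \<eta>) * N y0 u)^2" using d unfolding power_mult_distrib by linarith
      with lo show ?thesis
        using elim(2) y0 \<eta> by (auto intro!: power2_le_imp_le)
    qed
    then show ?case using elim(2) by blast
  qed
  then show ?thesis unfolding eventually_nhds_metric by blast
qed

context hadamard begin

section \<open>Short geodesics and joining points by admissible curves\<close>

lemma dist_eq: "dist x y = riemannian_distance A g x y"
  using hadamard unfolding hadamard_manifold_def by blast

lemma local_geodesics:
  assumes c: "c \<in> A" "x0 \<in> fst c" and b: "cbounds c K C" and \<rho>: "0 < \<rho>" "\<rho> \<le> 1" "32 * C * \<rho> \<le> 1"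
    and K: "cball (snd c x0) \<epsilon> \<subseteq> K" "\<epsilon> > 0"
  shows "\<exists>r>0. r \<le> \<epsilon> \<and> (\<forall>x\<in>fst c. \<forall>y\<in>fst c. dist (snd c x) (snd c x0) \<le> r \<longrightarrow> dist (snd c y) (snd c x0) \<le> r \<longrightarrow>
     (\<exists>\<gamma>. geodesic_on A g {-2<..<2} \<gamma> \<and> \<gamma> 0 = x \<and> \<gamma> 1 = y \<and> \<gamma> ` {0..1} \<subseteq> fst c \<and>
        csmall c K \<rho> (snd c \<circ> \<gamma>) (\<lambda>t. velocity A \<gamma> t c)))"
proof -
  interpret G: local_geometry "dom c" "Gc c" "DGc c" "\<Gamma>c c" "D\<Gamma>c c" by (rule local_geometry[OF c(1)])
  have "\<exists>r>0. r \<le> \<epsilon> \<and> (\<forall>a\<in>cball (snd c x0) r. \<forall>b\<in>cball (snd c x0) r.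
     \<exists>x v. G.sol {-2<..<2} x v \<and> x 0 = a \<and> x 1 = b \<and> G.small_sol K \<rho> x v)"
    using G.boundary_value_problem[OF b \<rho> K] by metis
  then obtain r where r: "r > 0" "r \<le> \<epsilon>" and bvp: "\<forall>a\<in>cball (snd c x0) r. \<forall>b\<in>cball (snd c x0) r.
     \<exists>x v. csol c {-2<..<2} x v \<and> x 0 = a \<and> x 1 = b \<and> csmall c K \<rho> x v"
    unfolding csol_def by blast
  have "\<exists>\<gamma>. geodesic_on A g {-2<..<2} \<gamma> \<and> \<gamma> 0 = p \<and> \<gamma> 1 = q \<and> \<gamma> ` {0..1} \<subseteq> fst c \<and>
        csmall c K \<rho> (snd c \<circ> \<gamma>) (\<lambda>t. velocity A \<gamma> t c)"
    if pq: "p \<in> fst c" "q \<in> fst c" "dist (snd c p) (snd c x0) \<le> r" "dist (snd c q) (snd c x0) \<le> r" for p q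
  proof -
    have "snd c p \<in> cball (snd c x0) r" "snd c q \<in> cball (snd c x0) r" using pq by (auto simp: dist_commute)
    then obtain x v where x: "csol c {-2<..<2} x v" "x 0 = snd c p" "x 1 = snd c q" "csmall c K \<rho> x v"
      using bvp by blast
    let ?\<gamma> = "chart_inv c \<circ> x"
    note cg = chart_geodesic[OF c(1) open_greaterThanLessThan x(1)]
    have vel: "velocity A ?\<gamma> t c = v t" if "t \<in> {-2<..<2}" for t
      using cg(4)[OF that] cg(2)[OF that] c(1) by simp
    have "csol c {-2<..<2} (snd c \<circ> ?\<gamma>) (\<lambda>t. velocity A ?\<gamma> t c)"
      by (rule csol_cong[OF x(1) open_greaterThanLessThan c(1)]) (use cg(3) vel in auto)
    then have s: "csol c {0..1} (snd c \<circ> ?\<gamma>) (\<lambda>t. velocity A ?\<gamma> t c)" using c(1) by (simp add: csol_iff)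
    have "csmall c K \<rho> (snd c \<circ> ?\<gamma>) (\<lambda>t. velocity A ?\<gamma> t c)"
      unfolding csmall_iff[OF c(1)]
    proof (intro conjI s ballI)
      fix t :: real assume t: "t \<in> {0..1}"
      then have t2: "t \<in> {-2<..<2}" by auto
      have "x t \<in> K \<and> norm (v t) \<le> \<rho>" using x(4) t by (simp add: csmall_iff[OF c(1)])
      then show "(snd c \<circ> ?\<gamma>) t \<in> K" "norm (velocity A ?\<gamma> t c) \<le> \<rho>" using cg(3)[OF t2] vel[OF t2] by auto
    qed
    moreover have "?\<gamma> ` {0..1} \<subseteq> fst c" using cg(2) by force
    moreover have "?\<gamma> 0 = p" "?\<gamma> 1 = q" using x pq c by auto
    ultimately show ?thesis using cg(1) by blast
  qed
  then show ?thesis using r by blast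
qed

text \<open>The distance is an \<open>Inf\<close>, which carries information only over a nonempty
  set of curves; this predicate is shown to hold for all pairs of points.\<close>

definition joined where "joined x y \<longleftrightarrow> (\<exists>\<gamma>. piecewise_c1_curve A \<gamma> \<and> \<gamma> 0 = x \<and> \<gamma> 1 = y)"

lemma joined_trans:
  assumes "joined x y" "joined y z" shows "joined x z"
proof -
  obtain \<gamma>1 \<gamma>2 where p: "piecewise_c1_curve A \<gamma>1" "\<gamma>1 0 = x" "\<gamma>1 1 = y"
    "piecewise_c1_curve A \<gamma>2" "\<gamma>2 0 = y" "\<gamma>2 1 = z" using assms unfolding joined_def by blast
  obtain S1 where S1: "finite S1" "\<And>a b. 0 \<le> a \<Longrightarrow> a < b \<Longrightarrow> b \<le> 1 \<Longrightarrow> {a<..<b} \<inter> S1 = {} \<Longrightarrow> c1_curve A a b \<gamma>1"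
    using p(1) unfolding piecewise_c1_curve_def by blast
  obtain S2 where S2: "finite S2" "\<And>a b. 0 \<le> a \<Longrightarrow> a < b \<Longrightarrow> b \<le> 1 \<Longrightarrow> {a<..<b} \<inter> S2 = {} \<Longrightarrow> c1_curve A a b \<gamma>2"
    using p(4) unfolding piecewise_c1_curve_def by blast
  define \<gamma> where "\<gamma> t = (if t \<le> 1/2 then \<gamma>1 (2 * t + 0) else \<gamma>2 (2 * t + (-1)))" for t :: real
  have left: "\<gamma> t = \<gamma>1 (2 * t + 0)" if "t \<le> 1/2" for t using that by (simp add: \<gamma>_def)
  have right: "\<gamma> t = \<gamma>2 (2 * t + (-1))" if "t \<ge> 1/2" for t 
  proof (cases "t = 1/2")
    case True
    show ?thesis unfolding True \<gamma>_def using p by simp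
  qed (use that in \<open>simp add: \<gamma>_def\<close>)
  \<comment> \<open>The junction \<open>1/2\<close> is made a break point, so an interval without
    break points lies in one of the two halves.\<close>
  define S where "S = (\<lambda>s. s / 2) ` S1 \<union> (\<lambda>s. (s + 1) / 2) ` S2 \<union> {1/2}"
  have "piecewise_c1_curve A \<gamma>"
    unfolding piecewise_c1_curve_def
  proof (intro conjI exI[of _ S] allI impI)
    show "finite S" using S1 S2 by (simp add: S_def)
    have "continuous_on {0..1/2} \<gamma>"
    proof (rule continuous_on_eq)
      show "continuous_on {0..1/2} (\<lambda>t. \<gamma>1 (2 * t + 0))"
        by (rule continuous_on_compose2[OF piecewise_c1_facts(1)[OF p(1)]]) (auto intro!: continuous_intros)
    qed (simp add: left)
    moreover have "continuous_on {1/2..1} \<gamma>"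
    proof (rule continuous_on_eq)
      show "continuous_on {1/2..1} (\<lambda>t. \<gamma>2 (2 * t + (-1)))"
        by (rule continuous_on_compose2[OF piecewise_c1_facts(1)[OF p(4)]]) (auto intro!: continuous_intros)
    qed (simp add: right)
    ultimately have "continuous_on ({0..1/2} \<union> {1/2..1}) \<gamma>" by (intro continuous_on_closed_Un) auto
    moreover have "{0..1/2} \<union> {1/2..1} = {0..1::real}" by auto
    ultimately show "continuous_on {0..1} \<gamma>" by simp
    fix a b assume ab: "0 \<le> a \<and> a < b \<and> b \<le> 1 \<and> {a<..<b} \<inter> S = {}"
    then have "1/2 \<notin> {a<..<b}" unfolding S_def by blast
    then consider "b \<le> 1/2" | "a \<ge> 1/2" by force
    then show "c1_curve A a b \<gamma>"
    proof cases
      case 1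
      have "c1_curve A (2 * a + 0) (2 * b + 0) \<gamma>1"
      proof (rule S1(2))
        show "{2 * a + 0<..<2 * b + 0} \<inter> S1 = {}"
        proof (rule ccontr)
          assume "{2 * a + 0<..<2 * b + 0} \<inter> S1 \<noteq> {}"
          then obtain s where s: "s \<in> S1" "2 * a < s" "s < 2 * b" by auto
          then have "s / 2 \<in> {a<..<b} \<inter> S" by (auto simp: S_def)
          with ab show False by blast
        qed
      qed (use ab 1 in auto)
      then have "c1_curve A a b (\<lambda>t. \<gamma>1 (2 * t + 0))" by (rule c1_curve_affine) (use ab in auto)
      then show ?thesis by (rule c1_curve_cong) (use ab 1 left in auto)
    next
      case 2
      have "c1_curve A (2 * a + (-1)) (2 * b + (-1)) \<gamma>2"
      proof (rule S2(2))
        show "{2 * a + (-1)<..<2 * b + (-1)} \<inter> S2 = {}"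
        proof (rule ccontr)
          assume "{2 * a + (-1)<..<2 * b + (-1)} \<inter> S2 \<noteq> {}"
          then obtain s where s: "s \<in> S2" "2 * a - 1 < s" "s < 2 * b - 1" by auto
          then have "(s + 1) / 2 \<in> {a<..<b} \<inter> S" by (auto simp: S_def)
          with ab show False by blast
        qed
      qed (use ab 2 in auto)
      then have "c1_curve A a b (\<lambda>t. \<gamma>2 (2 * t + (-1)))" by (rule c1_curve_affine) (use ab in auto)
      then show ?thesis by (rule c1_curve_cong) (use ab 2 right in auto)
    qed
  qed
  moreover have "\<gamma> 0 = x" "\<gamma> 1 = z" using p by (simp_all add: \<gamma>_def)
  ultimately show ?thesis unfolding joined_def by blast
qed

lemma chart_ball_nbhd:
  assumes c: "c \<in> A" "x0 \<in> fst c" and "r > 0"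
  shows "open {x \<in> fst c. dist (snd c x) (snd c x0) < r}" "x0 \<in> {x \<in> fst c. dist (snd c x) (snd c x0) < r}"
proof -
  have "{x \<in> fst c. dist (snd c x) (snd c x0) < r} = fst c \<inter> snd c -` ball (snd c x0) r"
    by (auto simp: dist_commute)
  then show "open {x \<in> fst c. dist (snd c x) (snd c x0) < r}"
    using continuous_open_preimage[OF chart_cont(1)[OF c(1)] chart_open(1)[OF c(1)] open_ball] by simp
qed (use assms in auto)

lemma locally_joined: "\<exists>W. open W \<and> x0 \<in> W \<and> (\<forall>x\<in>W. \<forall>y\<in>W. joined x y)"
proof -
  obtain c where c: "c \<in> A" "x0 \<in> fst c" by (rule chart_at)
  obtain R C where R: "R > 0" "cbounds c (cball (snd c x0) R) C" using cbounds_at[OF c] by blast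
  have C: "C \<ge> 1" by (rule cboundsD(1)[OF R(2) c(1)])
  obtain r where r: "r > 0" "\<forall>x\<in>fst c. \<forall>y\<in>fst c. dist (snd c x) (snd c x0) \<le> r \<longrightarrow> dist (snd c y) (snd c x0) \<le> r \<longrightarrow>
     (\<exists>\<gamma>. geodesic_on A g {-2<..<2} \<gamma> \<and> \<gamma> 0 = x \<and> \<gamma> 1 = y \<and> \<gamma> ` {0..1} \<subseteq> fst c \<and>
        csmall c (cball (snd c x0) R) (1 / (32 * C)) (snd c \<circ> \<gamma>) (\<lambda>t. velocity A \<gamma> t c))"
    using local_geodesics[OF c R(2) _ _ _ subset_refl R(1), of "1 / (32 * C)"] C by (auto simp: divide_le_eq)
  have "joined x y" if xy: "x \<in> fst c" "dist (snd c x) (snd c x0) < r" "y \<in> fst c" "dist (snd c y) (snd c x0) < r" for x y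
  proof -
    have "dist (snd c x) (snd c x0) \<le> r" "dist (snd c y) (snd c x0) \<le> r" using xy by simp_all
    then obtain \<gamma> where "geodesic_on A g {-2<..<2} \<gamma>" "\<gamma> 0 = x" "\<gamma> 1 = y" using r(2) xy(1,3) by blast
    moreover have "piecewise_c1_curve A \<gamma>" by (rule geodesic_c1[OF \<open>geodesic_on A g {-2<..<2} \<gamma>\<close>]) auto
    ultimately show ?thesis unfolding joined_def by blast
  qed
  then show ?thesis using chart_ball_nbhd[OF c r(1)] by blast
qed

text \<open>\<open>simply_connected\<close> compares arbitrary loops freely; a homotopy between two
  constant loops contains a path between the two points.\<close>

lemma connected_UNIV_manifold: "connected (UNIV :: 'a set)"
proof -
  have sc: "simply_connected (UNIV :: 'a set)" using hadamard unfolding hadamard_manifold_def by blast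
  have "\<exists>f. path f \<and> path_image f \<subseteq> UNIV \<and> pathstart f = x \<and> pathfinish f = y" for x y :: 'a
  proof -
    have "homotopic_loops UNIV (\<lambda>_. x) (\<lambda>_. y)"
      using sc unfolding simply_connected_def by (simp add: path_def pathfinish_def pathstart_def)
    then obtain h where h: "continuous_on ({0..1::real} \<times> {0..1::real}) h" "\<forall>t\<in>{0..1}. h (0, t) = x" "\<forall>t\<in>{0..1}. h (1, t) = y"
      unfolding homotopic_loops by blast
    have "continuous_on {0..1} (\<lambda>s. h (s, 0))"
      by (rule continuous_on_compose2[OF h(1)]) (auto intro!: continuous_intros)
    then show ?thesis using h(2,3)
      by (intro exI[of _ "\<lambda>s. h (s, 0)"]) (auto simp: path_def pathstart_def pathfinish_def)
  qed
  then have "path_connected (UNIV :: 'a set)" unfolding path_connected_def by simp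
  then show ?thesis by (rule path_connected_imp_connected)
qed

text \<open>The points joined to \<open>x\<close> form an open set with open complement, because
  nearby points are joined by a geodesic, and the space is connected.\<close>

lemma joined: "joined x y"
proof -
  obtain W where W: "\<And>x. open (W x)" "\<And>x. x \<in> W x" "\<And>x y z. y \<in> W x \<Longrightarrow> z \<in> W x \<Longrightarrow> joined y z"
    using locally_joined by metis
  define R where "R = Collect (joined x)"
  have 1: "W z \<subseteq> R" if "z \<in> R" for z
  proof
    fix y assume "y \<in> W z"
    then have "joined z y" by (rule W(3)[OF W(2)])
    then show "y \<in> R" using that joined_trans by (auto simp: R_def)
  qed
  have 2: "W z \<subseteq> - R" if "z \<in> - R" for z
  proof
    fix y assume "y \<in> W z"
    then have "joined y z" by (rule W(3)[OF _ W(2)])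
    then show "y \<in> - R" using that joined_trans by (auto simp: R_def)
  qed
  have "R = (\<Union>z\<in>R. W z)" using 1 W(2) by auto
  moreover have "open (\<Union>z\<in>R. W z)" using W(1) by (intro open_UN ballI)
  ultimately have "open R" by metis
  have "- R = (\<Union>z\<in>-R. W z)" using 2 W(2) by auto
  moreover have "open (\<Union>z\<in>-R. W z)" using W(1) by (intro open_UN ballI)
  ultimately have "open (- R)" by metis
  moreover have "x \<in> R" using W(3)[OF W(2) W(2)] by (simp add: R_def)
  ultimately have "R = UNIV"
    using connected_UNIV_manifold \<open>open R\<close> unfolding connected_clopen by (auto simp: closed_def)
  then show ?thesis by (auto simp: R_def)
qed

text \<open>\<^term>\<open>l t\<close> is the length of the curve up to time \<^term>\<open>t\<close>.\<close>

lemma almost_minimizing_curve: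
  assumes "\<epsilon> > 0"
  shows "\<exists>(\<gamma> :: real \<Rightarrow> 'a) l. continuous_on {0..1} \<gamma> \<and> continuous_on {0..1} l \<and> \<gamma> 0 = x \<and> \<gamma> 1 = y \<and> l 0 = 0 \<and> l 1 \<le> dist x y + \<epsilon> \<and>
    (\<forall>s t. 0 \<le> s \<longrightarrow> s \<le> t \<longrightarrow> t \<le> 1 \<longrightarrow> dist (\<gamma> s) (\<gamma> t) \<le> l t - l s)"
proof -
  let ?X = "{curve_length A g \<gamma> |\<gamma>. piecewise_c1_curve A \<gamma> \<and> \<gamma> 0 = x \<and> \<gamma> 1 = y}"
  have "?X \<noteq> {}" using joined[of x y] unfolding joined_def by blast
  moreover have "Inf ?X < dist x y + \<epsilon>" using assms dist_eq[of x y] by (simp add: riemannian_distance_def)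
  ultimately obtain \<gamma> where \<gamma>: "piecewise_c1_curve A \<gamma>" "\<gamma> 0 = x" "\<gamma> 1 = y" "curve_length A g \<gamma> < dist x y + \<epsilon>"
    using cInf_lessD[of ?X "dist x y + \<epsilon>"] by blast
  note F = piecewise_c1_facts[OF \<gamma>(1)]
  let ?l = "\<lambda>t. integral {0..t} (speed \<gamma>)"
  have "dist (\<gamma> s) (\<gamma> t) \<le> ?l t - ?l s" if st: "0 \<le> s" "s \<le> t" "t \<le> 1" for s t
  proof -
    have "speed \<gamma> integrable_on {0..t}" by (rule integrable_subinterval_real[OF F(2)]) (use st in auto)
    from Henstock_Kurzweil_Integration.integral_combine[OF st(1,2) this] dist_le_speed_integral[OF \<gamma>(1) st]
    show ?thesis by simp
  qed
  moreover have "continuous_on {0..1} ?l" by (rule indefinite_integral_continuous_1[OF F(2)])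
  ultimately show ?thesis using F(1) \<gamma> by (intro exI[of _ \<gamma>] exI[of _ ?l]) (auto simp: curve_length_speed)
qed

section \<open>The distance in a chart\<close>

text \<open>The velocity is paired with the total displacement \<open>a\<close> in the fixed inner
  product at \<open>x0\<close>. Integration gives the squared norm of \<open>a\<close>, and
  Cauchy-Schwarz bounds the integrand by the norm of \<open>a\<close> times the speed, up to the
  factor \<open>1 - \<eta>\<close>.\<close>

lemma chart_displacement_le_length:
  assumes c: "c \<in> A" "x0 \<in> fst c" and pc: "piecewise_c1_curve A \<gamma>" and T: "0 \<le> b" "b \<le> 1" and \<eta>: "0 < \<eta>" "\<eta> < 1"
    and near: "\<And>t. t \<in> {0..b} \<Longrightarrow> \<gamma> t \<in> fst c \<and> (\<forall>u. (1 - \<eta>) * cN c (snd c x0) u \<le> cN c (snd c (\<gamma> t)) u)"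
  shows "(1 - \<eta>) * cN c (snd c x0) (snd c (\<gamma> b) - snd c (\<gamma> 0)) \<le> integral {0..b} (speed \<gamma>)"
proof -
  interpret G: local_geometry "dom c" "Gc c" "DGc c" "\<Gamma>c c" "D\<Gamma>c c" by (rule local_geometry[OF c(1)])
  let ?y = "snd c x0"
  have y: "?y \<in> dom c" using c by auto
  define a where "a = snd c (\<gamma> b) - snd c (\<gamma> 0)"
  note F = piecewise_c1_facts[OF pc]
  obtain S where S: "finite S" "\<forall>t\<in>{0..1} - S. regular_at \<gamma> t" using F(3) by blast
  have nn: "integral {0..b} (speed \<gamma>) \<ge> 0" by (rule speed_integral_nonneg[OF pc]) (use T in auto)
  show ?thesis
  proof (cases "G.N ?y a = 0")
    case True then show ?thesis using nn by (simp add: a_def[symmetric])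
  next
    case False
    then have Na: "G.N ?y a > 0" using G.N_nonneg[OF y, of a] by linarith
    have "((\<lambda>t. Gc c ?y (velocity A \<gamma> t c) a) has_integral (Gc c ?y (snd c (\<gamma> b)) a - Gc c ?y (snd c (\<gamma> 0)) a)) {0..b}"
    proof (rule fundamental_theorem_of_calculus_interior_strong[OF S(1) T(1)])
      fix t assume t: "t \<in> {0<..<b} - S"
      then have "regular_at \<gamma> t" "\<gamma> t \<in> fst c" using S(2) T near by auto
      then have "(snd c \<circ> \<gamma> has_vector_derivative velocity A \<gamma> t c) (at t)" using c by (simp add: regular_at_def)
      then have "((\<lambda>t. (snd c \<circ> \<gamma>) t ) has_vector_derivative velocity A \<gamma> t c) (at t)" by (simp add: o_def)
      moreover have "bounded_linear (\<lambda>u. Gc c ?y u a)"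
        by (rule bounded_linear_compose[OF bounded_bilinear.bounded_linear_left[OF bounded_bilinear_blinfun_apply]])
           (rule blinfun.bounded_linear_right)
      ultimately show "((\<lambda>t. Gc c ?y (snd c (\<gamma> t)) a) has_vector_derivative Gc c ?y (velocity A \<gamma> t c) a) (at t)"
        using bounded_linear.has_vector_derivative by fastforce
    next
      have "continuous_on {0..b} (\<lambda>t. snd c (\<gamma> t))"
        by (rule continuous_on_compose2[OF chart_cont(1)[OF c(1)] continuous_on_subset[OF F(1)]])
          (use near T in auto)
      then show "continuous_on {0..b} (\<lambda>t. Gc c ?y (snd c (\<gamma> t)) a)"
        by (intro continuous_intros)
    qed
    moreover have e: "Gc c ?y (snd c (\<gamma> b) - snd c (\<gamma> 0)) w = Gc c ?y (snd c (\<gamma> b)) w - Gc c ?y (snd c (\<gamma> 0)) w" for w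
      by (simp add: blinfun.bilinear_simps)
    ultimately have 1: "((\<lambda>t. Gc c ?y (velocity A \<gamma> t c) a) has_integral (G.N ?y a)^2) {0..b}"
      using e[of a, folded a_def] by (simp add: G.N_sq[OF y])
    have "speed \<gamma> integrable_on {0..b}" by (rule integrable_subinterval_real[OF F(2)]) (use T in auto)
    then have 2: "((\<lambda>t. (G.N ?y a / (1 - \<eta>)) * speed \<gamma> t) has_integral (G.N ?y a / (1 - \<eta>)) * integral {0..b} (speed \<gamma>)) {0..b}"
      by (intro has_integral_mult_right integrable_integral)
    have "(G.N ?y a)^2 \<le> (G.N ?y a / (1 - \<eta>)) * integral {0..b} (speed \<gamma>)"
    proof (rule has_integral_le_finite[OF 1 2 S(1)])
      fix t assume t: "t \<in> {0..b} - S"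
      then have r: "regular_at \<gamma> t" "\<gamma> t \<in> fst c" "(1 - \<eta>) * G.N ?y (velocity A \<gamma> t c) \<le> speed \<gamma> t"
        using S(2) T near[of t] speed_coord[OF _ c(1)] by auto
      have "Gc c ?y (velocity A \<gamma> t c) a \<le> G.N ?y (velocity A \<gamma> t c) * G.N ?y a"
        using G.G_le_N[OF y, of "velocity A \<gamma> t c" a] by linarith
      also have "\<dots> \<le> (speed \<gamma> t / (1 - \<eta>)) * G.N ?y a"
        using r(3) \<eta> Na by (intro mult_right_mono) (auto simp: pos_le_divide_eq mult.commute)
      finally show "Gc c ?y (velocity A \<gamma> t c) a \<le> (G.N ?y a / (1 - \<eta>)) * speed \<gamma> t" by (simp add: mult.commute)
    qed
    then have "G.N ?y a * ((1 - \<eta>) * G.N ?y a) \<le> G.N ?y a * integral {0..b} (speed \<gamma>)"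
      using \<eta> by (simp add: power2_eq_square pos_le_divide_eq mult_ac)
    then show ?thesis using Na by (simp add: a_def[symmetric])
  qed
qed

text \<open>Lower bound: a competing curve either stays in the chart ball, where the displacement
  bounds its length, or has to travel so far out that it is long enough anyway. Upper bound: the
  short geodesic from \<open>x\<close> to \<open>y\<close> has an initial velocity close to the
  coordinate difference.\<close>

lemma dist_comparison:
  assumes c: "c \<in> A" "x0 \<in> fst c" and \<epsilon>: "0 < \<epsilon>"
  shows "\<exists>\<delta>>0. \<forall>x\<in>fst c. \<forall>y\<in>fst c. dist (snd c x) (snd c x0) < \<delta> \<longrightarrow> dist (snd c y) (snd c x0) < \<delta> \<longrightarrow>
    (1 - \<epsilon>) * cN c (snd c x0) (snd c y - snd c x) \<le> dist x y \<and> dist x y \<le> (1 + \<epsilon>) * cN c (snd c x0) (snd c y - snd c x)"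
proof -
  interpret G: local_geometry "dom c" "Gc c" "DGc c" "\<Gamma>c c" "D\<Gamma>c c" by (rule local_geometry[OF c(1)])
  let ?y0 = "snd c x0"
  have y0: "?y0 \<in> dom c" using c by auto
  define \<eta> where "\<eta> = min (\<epsilon> / 4) (1 / 4)"
  have \<eta>: "0 < \<eta>" "\<eta> \<le> \<epsilon> / 4" "\<eta> \<le> 1 / 4" using \<epsilon> by (auto simp: \<eta>_def)
  obtain r1 where r1: "r1 > 0" "\<forall>y. dist y ?y0 < r1 \<longrightarrow> y \<in> dom c \<and> (\<forall>u. (1 - \<eta>) * G.N ?y0 u \<le> G.N y u \<and> G.N y u \<le> (1 + \<eta>) * G.N ?y0 u)"
    using G.N_near[OF y0, of \<eta>] \<eta> by auto
  obtain R C where R: "R > 0" "cbounds c (cball ?y0 R) C" using cbounds_at[OF c] by blast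
  note C = cboundsD[OF R(2) c(1)]
  have y0K: "?y0 \<in> cball ?y0 R" using R by simp
  \<comment> \<open>The second entry makes the relative error \<open>8 * C^3 * \<rho>\<close>
    between initial velocity and displacement at most \<open>\<eta>\<close>.\<close>
  define \<rho> where "\<rho> = min (1 / (32 * C)) (\<eta> / (8 * C^3))"
  have "1 / (32 * C) > 0" "\<eta> / (8 * C^3) > 0" using C(1) \<eta> by simp_all
  then have \<rho>: "0 < \<rho>" "\<rho> \<le> 1 / (32 * C)" "\<rho> \<le> \<eta> / (8 * C^3)" unfolding \<rho>_def by auto
  have "1 / (32 * C) \<le> 1" using C(1) by (simp add: divide_le_eq)
  then have \<rho>': "\<rho> \<le> 1" "32 * C * \<rho> \<le> 1" "8 * C^3 * \<rho> \<le> \<eta>"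
    using \<rho> C(1) by linarith (use \<rho> C(1) in \<open>simp_all add: pos_le_divide_eq mult_ac\<close>)
  obtain r2 where r2: "r2 > 0" "\<forall>x\<in>fst c. \<forall>y\<in>fst c. dist (snd c x) ?y0 \<le> r2 \<longrightarrow> dist (snd c y) ?y0 \<le> r2 \<longrightarrow>
     (\<exists>\<gamma>. geodesic_on A g {-2<..<2} \<gamma> \<and> \<gamma> 0 = x \<and> \<gamma> 1 = y \<and> \<gamma> ` {0..1} \<subseteq> fst c \<and>
        csmall c (cball ?y0 R) \<rho> (snd c \<circ> \<gamma>) (\<lambda>t. velocity A \<gamma> t c))"
    using local_geodesics[OF c R(2) \<rho>(1) \<rho>'(1,2) subset_refl R(1)] by blast
  \<comment> \<open>Chosen so that \<open>C * (C * (2 * \<delta>)) \<le> r1 / 2 - \<delta>\<close>: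
    a curve that starts within \<open>\<delta>\<close> of the centre and reaches coordinate distance
    \<open>r1 / 2\<close> has a larger displacement than that between any two points of the small
    ball.\<close>
  define \<delta> where "\<delta> = min (min r1 r2) (min R (r1 / (2 * (1 + 2 * C^2))))"
  have "r1 / (2 * (1 + 2 * C^2)) > 0" using r1 C(1) by (intro divide_pos_pos mult_pos_pos add_pos_nonneg) auto
  then have \<delta>: "\<delta> > 0" "\<delta> \<le> r1" "\<delta> \<le> r2" "\<delta> \<le> R" "\<delta> \<le> r1 / (2 * (1 + 2 * C^2))" using r1 r2 R by (auto simp: \<delta>_def)
  have C2: "1 + 2 * C^2 > 0" by (simp add: add_pos_nonneg)
  have \<delta>C: "\<delta> * (1 + 2 * C^2) \<le> r1 / 2"
    using \<delta>(5) C2 by (simp add: pos_le_divide_eq mult_ac)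
  have "\<delta> * 1 \<le> \<delta> * (1 + 2 * C^2)" using \<delta>(1) by (intro mult_left_mono) auto
  then have \<delta>r: "\<delta> \<le> r1 / 2" using \<delta>C by linarith
  \<comment> \<open>Compact, hence closed in the whole space. A curve can therefore not leave the
    chart in the limit without first passing the coordinate radius \<open>r1 / 2\<close>.\<close>
  define K' where "K' = {x \<in> fst c. dist (snd c x) ?y0 \<le> r1 / 2}"
  have cbd: "cball ?y0 (r1 / 2) \<subseteq> dom c" using r1 by (auto simp: dist_commute)
  have "K' = chart_inv c ` cball ?y0 (r1 / 2)"
  proof
    show "K' \<subseteq> chart_inv c ` cball ?y0 (r1 / 2)"
    proof
      fix x assume "x \<in> K'"
      then have "x = chart_inv c (snd c x)" "snd c x \<in> cball ?y0 (r1 / 2)"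
        using c(1) by (auto simp: K'_def dist_commute)
      then show "x \<in> chart_inv c ` cball ?y0 (r1 / 2)" by blast
    qed
    show "chart_inv c ` cball ?y0 (r1 / 2) \<subseteq> K'"
    proof clarify
      fix y assume y: "y \<in> cball ?y0 (r1 / 2)"
      then have "y \<in> dom c" using cbd by blast
      then show "chart_inv c y \<in> K'" using y c(1) by (auto simp: K'_def dist_commute)
    qed
  qed
  then have "compact K'"
    using compact_continuous_image[OF continuous_on_subset[OF chart_cont(2)[OF c(1)] cbd] compact_cball] by simp
  then have closedK: "closed K'" by (rule compact_imp_closed)
  have lower: "(1 - \<eta>) * G.N ?y0 (snd c y - snd c x) \<le> curve_length A g \<gamma>"
    if x: "x \<in> fst c" "dist (snd c x) ?y0 < \<delta>" and y: "y \<in> fst c" "dist (snd c y) ?y0 < \<delta>"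
      and \<gamma>: "piecewise_c1_curve A \<gamma>" "\<gamma> 0 = x" "\<gamma> 1 = y" for x y \<gamma>
  proof -
    note F = piecewise_c1_facts[OF \<gamma>(1)]
    have near: "\<gamma> t \<in> fst c \<and> (\<forall>u. (1 - \<eta>) * G.N ?y0 u \<le> G.N (snd c (\<gamma> t)) u)"
      if "\<gamma> t \<in> fst c" "dist (snd c (\<gamma> t)) ?y0 < r1" for t
      using r1(2) that by blast
    show ?thesis
    \<comment> \<open>Either the curve exceeds \<open>r1 / 2\<close> at a time up to which it lies
      in the ball of radius \<open>r1\<close>, or continuous induction confines all of it to
      \<open>K'\<close>.\<close>
    proof (cases "\<exists>b\<in>{0..1}. (\<forall>t\<in>{0..b}. \<gamma> t \<in> fst c \<and> dist (snd c (\<gamma> t)) ?y0 < r1) \<and> dist (snd c (\<gamma> b)) ?y0 > r1 / 2")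
      case True
      then obtain b where b: "b \<in> {0..1}" "\<forall>t\<in>{0..b}. \<gamma> t \<in> fst c \<and> dist (snd c (\<gamma> t)) ?y0 < r1" "dist (snd c (\<gamma> b)) ?y0 > r1 / 2"
        by blast
      have 1: "(1 - \<eta>) * G.N ?y0 (snd c (\<gamma> b) - snd c (\<gamma> 0)) \<le> integral {0..b} (speed \<gamma>)"
        by (rule chart_displacement_le_length[OF c \<gamma>(1)]) (use b \<eta> near in auto)
      have "integral {0..b} (speed \<gamma>) + integral {b..1} (speed \<gamma>) = integral {0..1} (speed \<gamma>)"
        by (rule Henstock_Kurzweil_Integration.integral_combine) (use b F in auto)
      then have 2: "integral {0..b} (speed \<gamma>) \<le> curve_length A g \<gamma>"
        using speed_integral_nonneg[OF \<gamma>(1), of b 1] b by (simp add: curve_length_speed)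
      have "r1 / 2 - \<delta> \<le> dist (snd c (\<gamma> b)) (snd c x)"
        using b(3) x(2) dist_triangle[of "snd c (\<gamma> b)" ?y0 "snd c x"] by linarith
      also have "\<dots> \<le> C * G.N ?y0 (snd c (\<gamma> b) - snd c x)" using C(6)[OF y0K] by (simp add: dist_norm)
      finally have 3: "r1 / 2 - \<delta> \<le> C * G.N ?y0 (snd c (\<gamma> b) - snd c x)" .
      have "norm (snd c y - snd c x) \<le> 2 * \<delta>"
        using x(2) y(2) dist_triangle2[of "snd c y" "snd c x" ?y0] by (simp add: dist_norm)
      then have "C * norm (snd c y - snd c x) \<le> C * (2 * \<delta>)" using C(1) by (intro mult_left_mono) auto
      then have "G.N ?y0 (snd c y - snd c x) \<le> C * (2 * \<delta>)" using C(5)[OF y0K] order_trans by blast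
      then have "C * G.N ?y0 (snd c y - snd c x) \<le> C * (C * (2 * \<delta>))" using C(1) by (intro mult_left_mono) auto
      also have "\<dots> \<le> r1 / 2 - \<delta>" using \<delta>C by (simp add: power2_eq_square algebra_simps)
      finally have "C * G.N ?y0 (snd c y - snd c x) \<le> C * G.N ?y0 (snd c (\<gamma> b) - snd c x)" using 3 by linarith
      then have "G.N ?y0 (snd c y - snd c x) \<le> G.N ?y0 (snd c (\<gamma> b) - snd c x)" using C(1) by simp
      then have "(1 - \<eta>) * G.N ?y0 (snd c y - snd c x) \<le> (1 - \<eta>) * G.N ?y0 (snd c (\<gamma> b) - snd c (\<gamma> 0))"
        using \<eta> \<gamma>(2) by (intro mult_left_mono) auto
      then show ?thesis using 1 2 by linarith
    next
      case False
      have in_K: "\<gamma> t \<in> K'" if "t \<in> {0..b}" "\<forall>t\<in>{0..b}. \<gamma> t \<in> fst c \<and> dist (snd c (\<gamma> t)) ?y0 < r1" "b \<le> 1" for t b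
      proof -
        have "t \<in> {0..1}" "\<forall>s\<in>{0..t}. \<gamma> s \<in> fst c \<and> dist (snd c (\<gamma> s)) ?y0 < r1" "\<gamma> t \<in> fst c" using that by auto
        then have "\<not> dist (snd c (\<gamma> t)) ?y0 > r1 / 2" using False by blast
        then show ?thesis using \<open>\<gamma> t \<in> fst c\<close> by (simp add: K'_def)
      qed
      have all: "\<gamma> t \<in> K'" if "t \<in> {0..1}" for t
        using zero_le_one
      proof (induction rule: real_induct)
        case base
        show ?case using x \<delta>r \<gamma>(2) by (simp add: K'_def)
      next
        case (step t)
        let ?B = "{x \<in> fst c. dist (snd c x) ?y0 < r1}"
        have B: "open ?B" by (rule chart_ball_nbhd(1)[OF c r1(1)])
        have tB: "\<gamma> t \<in> ?B" using step(3)[of t] step(1) r1(1) by (auto simp: K'_def)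
        have t01: "t \<in> {0..1}" using step by auto
        obtain W where W: "open W" "t \<in> W" "\<forall>s\<in>{0..1}. s \<in> W \<longrightarrow> \<gamma> s \<in> ?B"
          using F(1)[unfolded continuous_on_topological, rule_format, OF t01 B tB] by blast
        obtain d where d: "d > 0" "ball t d \<subseteq> W" using W openE by blast
        show ?case
        proof (intro exI[of _ "t + d"] conjI allI impI)
          fix s assume s: "t < s \<and> s < t + d \<and> s \<le> 1"
          have "\<gamma> r \<in> fst c \<and> dist (snd c (\<gamma> r)) ?y0 < r1" if r: "r \<in> {0..s}" for r
          proof (cases "r \<le> t")
            case True
            then show ?thesis using step(3)[of r] r r1(1) by (auto simp: K'_def)
          next
            case False
            then have "r \<in> ball t d" "r \<in> {0..1}" using r s step(1) by (auto simp: dist_real_def)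
            then show ?thesis using W(3) d(2) by blast
          qed
          then show "\<gamma> s \<in> K'" using in_K[of s s] s step(1) by simp
        qed (use d in simp)
      next
        case (lim t)
        have "continuous_on {0..t} \<gamma>" by (rule continuous_on_subset[OF F(1)]) (use lim in auto)
        moreover have "{0..t} \<subseteq> closure {0..<t}" using lim(1) by simp
        ultimately have "\<gamma> ` {0..t} \<subseteq> K'"
          using image_closure_subset[of "{0..<t}" \<gamma> K'] lim closedK by (auto simp: image_subset_iff)
        then show ?case using lim(1) by auto
      qed (use that in simp)
      have "(1 - \<eta>) * G.N ?y0 (snd c (\<gamma> 1) - snd c (\<gamma> 0)) \<le> integral {0..1} (speed \<gamma>)"
      proof (rule chart_displacement_le_length[OF c \<gamma>(1)])
        show "\<gamma> t \<in> fst c \<and> (\<forall>u. (1 - \<eta>) * G.N ?y0 u \<le> G.N (snd c (\<gamma> t)) u)" if "t \<in> {0..1}" for t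
          by (rule near) (use all[OF that] r1(1) in \<open>auto simp: K'_def\<close>)
      qed (use \<eta> in auto)
      then show ?thesis using \<gamma> by (simp add: curve_length_speed)
    qed
  qed
  show ?thesis
  proof (rule exI[of _ \<delta>], rule conjI, rule \<delta>(1), intro ballI impI conjI)
    fix x y assume x: "x \<in> fst c" and y: "y \<in> fst c" and xd: "dist (snd c x) ?y0 < \<delta>" and yd: "dist (snd c y) ?y0 < \<delta>"
    let ?w = "snd c y - snd c x"
    let ?X = "{curve_length A g \<gamma> |\<gamma>. piecewise_c1_curve A \<gamma> \<and> \<gamma> 0 = x \<and> \<gamma> 1 = y}"
    have "?X \<noteq> {}" using joined[of x y] unfolding joined_def by blast
    then have "(1 - \<eta>) * G.N ?y0 ?w \<le> Inf ?X"
      by (rule cInf_greatest) (use lower[OF x xd y yd] in blast)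
    then have "(1 - \<eta>) * G.N ?y0 ?w \<le> dist x y" by (simp add: dist_eq riemannian_distance_def)
    moreover have "(1 - \<epsilon>) * G.N ?y0 ?w \<le> (1 - \<eta>) * G.N ?y0 ?w" using \<eta> y0 by (intro mult_right_mono) auto
    ultimately show "(1 - \<epsilon>) * G.N ?y0 ?w \<le> dist x y" by linarith
    have "dist (snd c x) ?y0 \<le> r2" "dist (snd c y) ?y0 \<le> r2" using xd yd \<delta> by linarith+
    then obtain \<gamma> where \<gamma>: "geodesic_on A g {-2<..<2} \<gamma>" "\<gamma> 0 = x" "\<gamma> 1 = y"
      "csmall c (cball ?y0 R) \<rho> (snd c \<circ> \<gamma>) (\<lambda>t. velocity A \<gamma> t c)" using r2(2) x y by blast
    let ?v = "velocity A \<gamma> 0 c"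
    have xK: "snd c x \<in> cball ?y0 R" "snd c x \<in> dom c" using xd \<delta> x by (auto simp: dist_commute)
    \<comment> \<open>The geodesic is compared with the constant one at \<open>x\<close>, so its
      displacement nearly equals its initial velocity.\<close>
    have "norm (((snd c \<circ> \<gamma>) 1 - snd c x) - ((snd c \<circ> \<gamma>) 0 - snd c x) - (?v - 0))
        \<le> 4 * C * \<rho> * (norm ((snd c \<circ> \<gamma>) 0 - snd c x) + 2 * norm (?v - 0))"
      using G.small_sol_difference(1)[OF R(2) \<rho>'(1,2) G.small_sol_const[OF xK] \<gamma>(4)] \<rho> by simp
    then have "norm (?w - ?v) \<le> 8 * C * \<rho> * norm ?v" using \<gamma> by simp
    also have "\<dots> \<le> 8 * C * \<rho> * (C * G.N ?y0 ?v)"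
      using C(6)[OF y0K] C(1) \<rho> by (intro mult_left_mono) auto
    finally have "C * norm (?v - ?w) \<le> C * (8 * C * \<rho> * (C * G.N ?y0 ?v))"
      using C(1) by (intro mult_left_mono) (auto simp: norm_minus_commute)
    then have "G.N ?y0 (?v - ?w) \<le> (8 * C^3 * \<rho>) * G.N ?y0 ?v"
      using C(5)[OF y0K, of "?v - ?w"] by (simp add: power3_eq_cube mult_ac)
    also have "\<dots> \<le> \<eta> * G.N ?y0 ?v" using \<rho>'(3) y0 by (intro mult_right_mono) auto
    finally have "G.N ?y0 ?v \<le> G.N ?y0 ?w + \<eta> * G.N ?y0 ?v"
      using G.N_triangle[OF y0, of "?v - ?w" ?w] by simp
    then have Nv: "(1 - \<eta>) * G.N ?y0 ?v \<le> G.N ?y0 ?w" by (simp add: algebra_simps)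
    have "dist x y \<le> tnorm g (\<gamma> 0) (velocity A \<gamma> 0) * \<bar>1 - 0\<bar>"
      using geodesic_dist[OF \<gamma>(1), of 0 1] \<gamma> by simp
    also have "\<dots> = G.N (snd c x) ?v"
      using tnorm_coord[OF c(1) x velocity_tangent[OF \<gamma>(1), of 0, unfolded \<gamma>(2)]] \<gamma>(2) by simp
    also have "\<dots> \<le> (1 + \<eta>) * G.N ?y0 ?v" using r1(2) xd \<delta>(2) by auto
    also have "\<dots> \<le> (1 + \<epsilon>) * (1 - \<eta>) * G.N ?y0 ?v"
    proof (intro mult_right_mono)
      have "\<epsilon> * \<eta> \<le> \<epsilon> * (1 / 4)" using \<eta> \<epsilon> by (intro mult_left_mono) auto
      moreover have "(1 + \<epsilon>) * (1 - \<eta>) = 1 + \<epsilon> - \<eta> - \<epsilon> * \<eta>" by (simp add: algebra_simps)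
      ultimately show "1 + \<eta> \<le> (1 + \<epsilon>) * (1 - \<eta>)" using \<eta> by linarith
    qed (use y0 in simp)
    also have "\<dots> \<le> (1 + \<epsilon>) * G.N ?y0 ?w" using Nv \<epsilon> by (simp add: mult.assoc)
    finally show "dist x y \<le> (1 + \<epsilon>) * G.N ?y0 ?w" .
  qed
qed

section \<open>Completeness and the exponential map\<close>

lemma geodesic_glue:
  assumes g: "geodesic_on A g J1 \<gamma>1" "open J1" "geodesic_on A g J2 \<gamma>2" "open J2"
    and eq: "\<And>t. t \<in> J1 \<Longrightarrow> t \<in> J2 \<Longrightarrow> \<gamma>1 t = \<gamma>2 t"
  shows "geodesic_on A g (J1 \<union> J2) (\<lambda>t. if t \<in> J1 then \<gamma>1 t else \<gamma>2 t)" (is "geodesic_on A g _ ?\<sigma>")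
proof (rule geodesic_on_local)
  fix t assume "t \<in> J1 \<union> J2"
  then consider "t \<in> J1" | "t \<in> J2" by blast
  then show "\<exists>I. open I \<and> t \<in> I \<and> geodesic_on A g I ?\<sigma>"
  proof cases
    case 1
    have "geodesic_on A g J1 ?\<sigma>" by (rule geodesic_on_cong[OF g(1,2)]) simp
    then show ?thesis using 1 g(2) by blast
  next
    case 2
    have "geodesic_on A g J2 ?\<sigma>" by (rule geodesic_on_cong[OF g(3,4)]) (use eq in auto)
    then show ?thesis using 2 g(4) by blast
  qed
qed

text \<open>Bounded speed makes the geodesic Lipschitz, so it has a limit at \<open>b\<close>. A new
  geodesic is started from a late time \<open>t1\<close>; its existence time is uniform near the
  limit and thus reaches beyond \<open>b\<close>. Uniqueness glues the two.\<close>

lemma geodesic_extend_right: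
  assumes g: "geodesic_on A g {a<..<b} \<gamma>" and ab: "a < b"
    and sp: "\<And>t. t \<in> {a<..<b} \<Longrightarrow> tnorm g (\<gamma> t) (velocity A \<gamma> t) \<le> 1"
  shows "\<exists>b'>b. \<exists>\<sigma>. geodesic_on A g {a<..<b'} \<sigma> \<and> (\<forall>t\<in>{a<..<b}. \<sigma> t = \<gamma> t)"
proof -
  have lip: "dist (\<gamma> s) (\<gamma> t) \<le> \<bar>t - s\<bar>" if "s \<in> {a<..<b}" "t \<in> {a<..<b}" for s t
  proof -
    have "dist (\<gamma> s) (\<gamma> t) \<le> tnorm g (\<gamma> s) (velocity A \<gamma> s) * \<bar>t - s\<bar>"
      by (rule geodesic_dist[OF g _ _ that]) auto
    also have "\<dots> \<le> 1 * \<bar>t - s\<bar>" using sp[OF that(1)] by (intro mult_right_mono) auto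
    finally show ?thesis by simp
  qed
  have "uniformly_continuous_on {a<..<b} \<gamma>"
    unfolding uniformly_continuous_on_def
  proof (intro allI impI)
    fix e :: real assume "e > 0"
    then show "\<exists>d>0. \<forall>x\<in>{a<..<b}. \<forall>x'\<in>{a<..<b}. dist x' x < d \<longrightarrow> dist (\<gamma> x') (\<gamma> x) < e"
      using lip by (intro exI[of _ e]) (force simp: dist_real_def abs_minus_commute)
  qed
  moreover have "b \<in> closure {a<..<b}" using ab by simp
  \<comment> \<open>Completeness of the space enters here.\<close>
  ultimately obtain p where p: "(\<gamma> \<longlongrightarrow> p) (at b within {a<..<b})"
    using uniformly_continuous_on_extension_at_closure by blast
  obtain r \<tau> where r: "r > 0" "\<tau> > 0" "\<forall>x\<in>ball p r. \<forall>v\<in>T x. tnorm g x v \<le> 1 \<longrightarrow>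
     (\<exists>\<gamma>. geodesic_on A g {-\<tau><..<\<tau>} \<gamma> \<and> \<gamma> 0 = x \<and> velocity A \<gamma> 0 = v)"
    using geodesic_local_exists[of p] by blast
  have "\<not> trivial_limit (at b within {a<..<b})"
    using ab by (simp add: trivial_limit_within islimpt_greaterThanLessThan2)
  moreover have "\<forall>\<^sub>F t in at b within {a<..<b}. dist (\<gamma> t) p < r" using p r(1) by (rule tendstoD)
  moreover have "\<forall>\<^sub>F t in at b within {a<..<b}. dist t b < \<tau>"
    using tendsto_ident_at[of b "{a<..<b}"] r(2) by (rule tendstoD)
  moreover have "\<forall>\<^sub>F t in at b within {a<..<b}. t \<in> {a<..<b}" by (simp add: eventually_at_filter)
  ultimately obtain t1 where t1: "dist (\<gamma> t1) p < r" "dist t1 b < \<tau>" "t1 \<in> {a<..<b}"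
    using eventually_happens'[of "at b within {a<..<b}" "\<lambda>t. dist (\<gamma> t) p < r \<and> dist t b < \<tau> \<and> t \<in> {a<..<b}"]
    by (auto simp: eventually_conj_iff)
  have "velocity A \<gamma> t1 \<in> T (\<gamma> t1)" by (rule velocity_tangent[OF g _ t1(3)]) auto
  moreover have "\<gamma> t1 \<in> ball p r" using t1(1) by (simp add: dist_commute)
  ultimately obtain \<sigma> where s: "geodesic_on A g {-\<tau><..<\<tau>} \<sigma>" "\<sigma> 0 = \<gamma> t1" "velocity A \<sigma> 0 = velocity A \<gamma> t1"
    using r(3) sp[OF t1(3)] by blast
  define \<sigma>' where "\<sigma>' t = \<sigma> (1 * t + (- t1))" for t
  let ?J2 = "{t1-\<tau><..<t1+\<tau>}"
  have af: "1 * t + (- t1) \<in> {-\<tau><..<\<tau>}" if "t \<in> ?J2" for t using that by auto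
  have g2: "geodesic_on A g ?J2 \<sigma>'"
    unfolding \<sigma>'_def[abs_def] by (rule geodesic_affine(1)[OF s(1) _ _ af]) auto
  have t1J: "t1 \<in> ?J2" using r(2) by auto
  have "velocity A \<sigma>' t1 = tscale 1 (velocity A \<sigma> (1 * t1 + (- t1)))"
    unfolding \<sigma>'_def[abs_def] by (rule geodesic_affine(2)[OF s(1) _ _ af t1J]) auto
  then have v2: "velocity A \<sigma>' t1 = velocity A \<gamma> t1" using s(3) by simp
  have J: "{a<..<b} \<inter> ?J2 = {max a (t1-\<tau>)<..<min b (t1+\<tau>)}" by auto
  have eq: "\<gamma> t = \<sigma>' t" if "t \<in> {a<..<b}" "t \<in> ?J2" for t
  proof (rule geodesic_unique(1)[of "{a<..<b} \<inter> ?J2" \<gamma> \<sigma>' t1])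
    show "geodesic_on A g ({a<..<b} \<inter> ?J2) \<gamma>" "geodesic_on A g ({a<..<b} \<inter> ?J2) \<sigma>'"
      by (rule geodesic_on_subset[OF g], blast, rule geodesic_on_subset[OF g2], blast)
    show "connected ({a<..<b} \<inter> ?J2)" unfolding J by simp
  qed (use t1 t1J s v2 that in \<open>auto simp: \<sigma>'_def open_Int\<close>)
  have gl: "geodesic_on A g ({a<..<b} \<union> ?J2) (\<lambda>t. if t \<in> {a<..<b} then \<gamma> t else \<sigma>' t)"
    by (rule geodesic_glue[OF g _ g2 _ eq]) auto
  have "{a<..<t1+\<tau>} \<subseteq> {a<..<b} \<union> ?J2" using t1 by (auto simp: dist_real_def)
  from geodesic_on_subset[OF gl this] show ?thesis
    using t1 by (intro exI[of _ "t1 + \<tau>"]) (auto simp: dist_real_def)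
qed

lemma geodesic_extend_left:
  assumes g: "geodesic_on A g {a<..<b} \<gamma>" and ab: "a < b"
    and sp: "\<And>t. t \<in> {a<..<b} \<Longrightarrow> tnorm g (\<gamma> t) (velocity A \<gamma> t) \<le> 1"
  shows "\<exists>a'<a. \<exists>\<sigma>. geodesic_on A g {a'<..<b} \<sigma> \<and> (\<forall>t\<in>{a<..<b}. \<sigma> t = \<gamma> t)"
proof -
  let ?\<beta> = "\<lambda>t. \<gamma> ((-1) * t + 0)"
  have im: "(-1) * t + 0 \<in> {a<..<b}" if "t \<in> {-b<..<-a}" for t using that by auto
  note b = geodesic_affine[OF g open_greaterThanLessThan open_greaterThanLessThan im]
  have "tnorm g (?\<beta> t) (velocity A ?\<beta> t) \<le> 1" if t: "t \<in> {-b<..<-a}" for t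
  proof -
    have "velocity A ?\<beta> t = tscale (-1) (velocity A \<gamma> ((-1) * t + 0))" by (rule b(2)[OF _ t])
    moreover have "velocity A \<gamma> ((-1) * t + 0) \<in> T (?\<beta> t)"
      by (rule velocity_tangent[OF g open_greaterThanLessThan im[OF t]])
    ultimately show ?thesis using sp[OF im[OF t]] tnorm_scale by simp
  qed
  then obtain b' \<sigma> where s: "b' > -a" "geodesic_on A g {-b<..<b'} \<sigma>" "\<forall>t\<in>{-b<..<-a}. \<sigma> t = ?\<beta> t"
    using geodesic_extend_right[OF b(1), of "-b" "-a"] ab by auto
  have im': "(-1) * t + 0 \<in> {-b<..<b'}" if "t \<in> {-b'<..<b}" for t using that by auto
  have "geodesic_on A g {-b'<..<b} (\<lambda>t. \<sigma> ((-1) * t + 0))"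
    by (rule geodesic_affine(1)[OF s(2) open_greaterThanLessThan open_greaterThanLessThan im'])
  then show ?thesis using s by (intro exI[of _ "-b'"] conjI exI[of _ "\<lambda>t. \<sigma> ((-1) * t + 0)"]) auto
qed

text \<open>By uniqueness the chosen geodesics agree on overlaps, so evaluating any one that is
  defined at \<open>t\<close> gives a well-defined geodesic.\<close>

lemma geodesic_union:
  assumes D: "D \<noteq> {}" "\<And>\<tau>. \<tau> \<in> D \<Longrightarrow> \<tau> > 0"
    and ex: "\<And>\<tau>. \<tau> \<in> D \<Longrightarrow> \<exists>\<gamma>. geodesic_on A g {-\<tau><..<\<tau>} \<gamma> \<and> \<gamma> 0 = x \<and> velocity A \<gamma> 0 = v"
  shows "\<exists>\<gamma>. geodesic_on A g (\<Union>\<tau>\<in>D. {-\<tau><..<\<tau>}) \<gamma> \<and> \<gamma> 0 = x \<and> velocity A \<gamma> 0 = v"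
proof -
  obtain G where G: "\<And>\<tau>. \<tau> \<in> D \<Longrightarrow> geodesic_on A g {-\<tau><..<\<tau>} (G \<tau>) \<and> G \<tau> 0 = x \<and> velocity A (G \<tau>) 0 = v"
    using ex by metis
  have agree: "G \<tau> t = G \<tau>' t" if "\<tau> \<in> D" "\<tau>' \<in> D" "t \<in> {-\<tau><..<\<tau>}" "t \<in> {-\<tau>'<..<\<tau>'}" for \<tau> \<tau>' t
  proof -
    let ?J = "{-min \<tau> \<tau>'<..<min \<tau> \<tau>'}"
    show ?thesis
    proof (rule geodesic_unique(1)[of ?J _ _ 0])
      show "geodesic_on A g ?J (G \<tau>)" "geodesic_on A g ?J (G \<tau>')"
        by (rule geodesic_on_subset[of "{-\<tau><..<\<tau>}"], use G that in auto)
          (rule geodesic_on_subset[of "{-\<tau>'<..<\<tau>'}"], use G that in auto)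
    qed (use G D(2) that in auto)
  qed
  define \<gamma> where "\<gamma> t = G (SOME \<tau>. \<tau> \<in> D \<and> t \<in> {-\<tau><..<\<tau>}) t" for t
  have \<gamma>: "\<gamma> t = G \<tau> t" if "\<tau> \<in> D" "t \<in> {-\<tau><..<\<tau>}" for t \<tau>
  proof -
    have "(SOME \<tau>. \<tau> \<in> D \<and> t \<in> {-\<tau><..<\<tau>}) \<in> D \<and> t \<in> {-(SOME \<tau>. \<tau> \<in> D \<and> t \<in> {-\<tau><..<\<tau>})<..<(SOME \<tau>. \<tau> \<in> D \<and> t \<in> {-\<tau><..<\<tau>})}"
      by (rule someI[of "\<lambda>\<tau>. \<tau> \<in> D \<and> t \<in> {-\<tau><..<\<tau>}"]) (use that in blast)
    then show ?thesis unfolding \<gamma>_def using agree that by blast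
  qed
  have "geodesic_on A g (\<Union>\<tau>\<in>D. {-\<tau><..<\<tau>}) \<gamma>"
  proof (rule geodesic_on_local)
    fix t assume "t \<in> (\<Union>\<tau>\<in>D. {-\<tau><..<\<tau>})"
    then obtain \<tau> where t: "\<tau> \<in> D" "t \<in> {-\<tau><..<\<tau>}" by blast
    have "geodesic_on A g {-\<tau><..<\<tau>} \<gamma>"
      by (rule geodesic_on_cong[of _ "G \<tau>"]) (use G[OF t(1)] \<gamma>[OF t(1)] in auto)
    then show "\<exists>I. open I \<and> t \<in> I \<and> geodesic_on A g I \<gamma>"
      using t(2) by (intro exI[of _ "{-\<tau><..<\<tau>}"]) auto
  qed
  moreover obtain \<tau> where \<tau>: "\<tau> \<in> D" using D(1) by blast
  have "\<gamma> 0 = x" using \<gamma>[OF \<tau>, of 0] D(2)[OF \<tau>] G[OF \<tau>] by simp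
  moreover have "velocity A \<gamma> 0 = velocity A (G \<tau>) 0"
    by (rule velocity_cong[of "{-\<tau><..<\<tau>}"]) (use \<gamma>[OF \<tau>] D(2)[OF \<tau>] in auto)
  ultimately show ?thesis using G[OF \<tau>] by auto
qed

text \<open>Symmetric existence intervals are used. If their radii had a supremum, the union would
  extend beyond it on the right and then on the left, since speed is conserved and stays at most
  1.\<close>

lemma geodesic_complete_unit:
  assumes v: "v \<in> T x" "tnorm g x v \<le> 1"
  shows "\<exists>\<gamma>. geodesic_on A g UNIV \<gamma> \<and> \<gamma> 0 = x \<and> velocity A \<gamma> 0 = v"
proof -
  define D where "D = {\<tau>. \<tau> > 0 \<and> (\<exists>\<gamma>. geodesic_on A g {-\<tau><..<\<tau>} \<gamma> \<and> \<gamma> 0 = x \<and> velocity A \<gamma> 0 = v)}"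
  obtain r \<tau>0 where "r > 0" "\<tau>0 > 0" "\<forall>x'\<in>ball x r. \<forall>v\<in>T x'. tnorm g x' v \<le> 1 \<longrightarrow>
     (\<exists>\<gamma>. geodesic_on A g {-\<tau>0<..<\<tau>0} \<gamma> \<and> \<gamma> 0 = x' \<and> velocity A \<gamma> 0 = v)"
    using geodesic_local_exists[of x] by blast
  then have \<tau>0: "\<tau>0 \<in> D" using v by (auto simp: D_def)
  have U: "\<exists>\<gamma>. geodesic_on A g (\<Union>\<tau>\<in>D. {-\<tau><..<\<tau>}) \<gamma> \<and> \<gamma> 0 = x \<and> velocity A \<gamma> 0 = v"
    by (rule geodesic_union) (use \<tau>0 in \<open>auto simp: D_def\<close>)
  have "\<not> bdd_above D"
  proof
    assume bdd: "bdd_above D"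
    define b where "b = Sup D"
    have b: "b > 0" using cSup_upper[OF \<tau>0 bdd] \<tau>0 by (auto simp: b_def D_def)
    have "{-b<..<b} \<subseteq> (\<Union>\<tau>\<in>D. {-\<tau><..<\<tau>})"
    proof
      fix t assume "t \<in> {-b<..<b}"
      then have "\<bar>t\<bar> < Sup D" by (auto simp: b_def)
      then obtain \<tau> where "\<tau> \<in> D" "\<bar>t\<bar> < \<tau>" using less_cSup_iff[OF _ bdd] \<tau>0 by blast
      then show "t \<in> (\<Union>\<tau>\<in>D. {-\<tau><..<\<tau>})" by (intro UN_I[of \<tau>]) auto
    qed
    then obtain \<gamma> where \<gamma>: "geodesic_on A g {-b<..<b} \<gamma>" "\<gamma> 0 = x" "velocity A \<gamma> 0 = v"
      using U geodesic_on_subset by blast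
    have 0: "0 \<in> {-b<..<b}" using b by auto
    have "tnorm g (\<gamma> t) (velocity A \<gamma> t) = tnorm g (\<gamma> 0) (velocity A \<gamma> 0)" if "t \<in> {-b<..<b}" for t
      by (rule geodesic_speed[OF \<gamma>(1) _ _ that 0]) auto
    then have sp: "tnorm g (\<gamma> t) (velocity A \<gamma> t) \<le> 1" if "t \<in> {-b<..<b}" for t using \<gamma> v that by simp
    obtain b' \<sigma> where s: "b' > b" "geodesic_on A g {-b<..<b'} \<sigma>" "\<forall>t\<in>{-b<..<b}. \<sigma> t = \<gamma> t"
      using geodesic_extend_right[OF \<gamma>(1) _ sp] b by auto
    have s0: "\<sigma> 0 = x" "velocity A \<sigma> 0 = v"
      using s(3) 0 \<gamma> velocity_cong[of "{-b<..<b}" 0 \<sigma> \<gamma>] by auto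
    have z0: "0 \<in> {-b<..<b'}" using b s by auto
    have "tnorm g (\<sigma> t) (velocity A \<sigma> t) = tnorm g (\<sigma> 0) (velocity A \<sigma> 0)" if "t \<in> {-b<..<b'}" for t
      by (rule geodesic_speed[OF s(2) _ _ that z0]) auto
    then have sp': "tnorm g (\<sigma> t) (velocity A \<sigma> t) \<le> 1" if "t \<in> {-b<..<b'}" for t using s0 v that by simp
    obtain a' \<rho> where \<rho>: "a' < -b" "geodesic_on A g {a'<..<b'} \<rho>" "\<forall>t\<in>{-b<..<b'}. \<rho> t = \<sigma> t"
      using geodesic_extend_left[OF s(2) _ sp'] b s(1) by auto
    have \<rho>0: "\<rho> 0 = x" "velocity A \<rho> 0 = v"
      using \<rho>(3) z0 s0 velocity_cong[of "{-b<..<b'}" 0 \<rho> \<sigma>] by auto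
    define m where "m = min b' (-a')"
    have "m > b" using s \<rho> by (auto simp: m_def)
    have "geodesic_on A g {-m<..<m} \<rho>" by (rule geodesic_on_subset[OF \<rho>(2)]) (auto simp: m_def)
    then have "m \<in> D" using \<rho>0 \<open>m > b\<close> b by (auto simp: D_def)
    then have "m \<le> b" using cSup_upper[OF _ bdd] by (simp add: b_def)
    then show False using \<open>m > b\<close> by simp
  qed
  then have "(\<Union>\<tau>\<in>D. {-\<tau><..<\<tau>}) = UNIV"
  proof (intro equalityI subsetI)
    fix t :: real
    obtain \<tau> where "\<tau> \<in> D" "\<tau> > \<bar>t\<bar>" using \<open>\<not> bdd_above D\<close> unfolding bdd_above_def by (meson not_le)
    then show "t \<in> (\<Union>\<tau>\<in>D. {-\<tau><..<\<tau>})" by (intro UN_I[of \<tau>]) auto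
  qed simp
  then show ?thesis using U by simp
qed

lemma geodesic_complete:
  assumes v: "v \<in> T x"
  shows "\<exists>\<gamma>. geodesic_on A g UNIV \<gamma> \<and> \<gamma> 0 = x \<and> velocity A \<gamma> 0 = v"
proof -
  define s where "s = tnorm g x v + 1"
  have s: "s > 0" "tnorm g x v \<le> s" using tnorm_nonneg[OF v] by (auto simp: s_def)
  have "tnorm g x (tscale (1 / s) v) \<le> 1" using s by (simp add: tnorm_scale[OF v])
  then obtain \<gamma> where \<gamma>: "geodesic_on A g UNIV \<gamma>" "\<gamma> 0 = x" "velocity A \<gamma> 0 = tscale (1 / s) v"
    using geodesic_complete_unit v by (metis tscale_tangent)
  note a = geodesic_affine[OF \<gamma>(1) open_UNIV open_UNIV, of s 0]
  have "velocity A (\<lambda>t. \<gamma> (s * t + 0)) 0 = tscale s (velocity A \<gamma> (s * 0 + 0))" by (rule a(2)) auto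
  then have "velocity A (\<lambda>t. \<gamma> (s * t + 0)) 0 = v" using \<gamma> s by simp
  moreover have "geodesic_on A g UNIV (\<lambda>t. \<gamma> (s * t + 0))" by (rule a(1)) auto
  ultimately show ?thesis using \<gamma> by (intro exI[of _ "\<lambda>t. \<gamma> (s * t + 0)"]) auto
qed

section \<open>Complete geodesics and the exponential map\<close>

abbreviation geo :: "(real \<Rightarrow> 'a) \<Rightarrow> bool" where "geo \<equiv> geodesic_on A g UNIV"

lemma geo_velocity: "geo \<gamma> \<Longrightarrow> velocity A \<gamma> t \<in> T (\<gamma> t)"
  by (rule velocity_tangent) auto

lemma geo_affine:
  assumes "geo \<gamma>"
  shows "geo (\<lambda>t. \<gamma> (a * t + b))" "velocity A (\<lambda>t. \<gamma> (a * t + b)) t = tscale a (velocity A \<gamma> (a * t + b))"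
  by (rule geodesic_affine(1)[OF assms open_UNIV open_UNIV], simp)
    (rule geodesic_affine(2)[OF assms open_UNIV open_UNIV], simp_all)

text \<open>Uniqueness on every connected open set containing \<open>{0..1}\<close> makes the
  description in \<open>exp_map\<close> definite and identifies its value.\<close>

lemma exp_map_geo:
  assumes g: "geo \<gamma>" shows "exp_map A g (\<gamma> 0) (tscale t (velocity A \<gamma> 0)) = \<gamma> t"
  unfolding exp_map_def
proof (rule the_equality)
  let ?\<beta> = "\<lambda>s. \<gamma> (t * s + 0)"
  have b: "geo ?\<beta>" "velocity A ?\<beta> 0 = tscale t (velocity A \<gamma> 0)" using geo_affine(1)[OF g, of t 0] geo_affine(2)[OF g, of t 0 0] by auto
  show "\<exists>J \<gamma>'. open J \<and> connected J \<and> {0..1} \<subseteq> J \<and> geodesic_on A g J \<gamma>' \<and> \<gamma>' 0 = \<gamma> 0 \<and>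
     velocity A \<gamma>' 0 = tscale t (velocity A \<gamma> 0) \<and> \<gamma>' 1 = \<gamma> t"
    using b by (intro exI[of _ UNIV] exI[of _ ?\<beta>]) auto
  fix y assume "\<exists>J \<gamma>'. open J \<and> connected J \<and> {0..1} \<subseteq> J \<and> geodesic_on A g J \<gamma>' \<and> \<gamma>' 0 = \<gamma> 0 \<and>
     velocity A \<gamma>' 0 = tscale t (velocity A \<gamma> 0) \<and> \<gamma>' 1 = y"
  then obtain J \<gamma>' where J: "open J" "connected J" "{0..1} \<subseteq> J" "geodesic_on A g J \<gamma>'" "\<gamma>' 0 = \<gamma> 0"
     "velocity A \<gamma>' 0 = tscale t (velocity A \<gamma> 0)" "\<gamma>' 1 = y" by blast
  have "?\<beta> 1 = \<gamma>' 1"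
    by (rule geodesic_unique(1)[OF geodesic_on_subset[OF b(1) subset_UNIV] J(4,1,2), of 0]) (use J b in auto)
  then show "y = \<gamma> t" using J by simp
qed

lemma exp_geodesic:
  assumes v: "v \<in> T x"
  shows "geo (\<lambda>t. exp_map A g x (tscale t v))" "velocity A (\<lambda>t. exp_map A g x (tscale t v)) 0 = v"
    "exp_map A g x tzero = x"
proof -
  obtain \<gamma> where \<gamma>: "geo \<gamma>" "\<gamma> 0 = x" "velocity A \<gamma> 0 = v" using geodesic_complete[OF v] by blast
  have "(\<lambda>t. exp_map A g x (tscale t v)) = \<gamma>" using exp_map_geo[OF \<gamma>(1)] \<gamma> by auto
  then show "geo (\<lambda>t. exp_map A g x (tscale t v))" "velocity A (\<lambda>t. exp_map A g x (tscale t v)) 0 = v"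
    using \<gamma> by auto
  show "exp_map A g x tzero = x" using exp_map_geo[OF \<gamma>(1), of 0] \<gamma> by simp
qed

lemma geo_speed: "geo \<gamma> \<Longrightarrow> tnorm g (\<gamma> t) (velocity A \<gamma> t) = tnorm g (\<gamma> 0) (velocity A \<gamma> 0)"
  by (rule geodesic_speed[OF _ open_UNIV connected_UNIV]) auto

lemma geo_dist: "geo \<gamma> \<Longrightarrow> dist (\<gamma> s) (\<gamma> t) \<le> tnorm g (\<gamma> 0) (velocity A \<gamma> 0) * \<bar>t - s\<bar>"
  using geodesic_dist[OF _ open_UNIV connected_UNIV, of \<gamma> s t] geo_speed[of \<gamma> s] by simp

text \<open>Smallness at time 0 confines a geodesic on all of \<open>{0..1}\<close>: the chart
  solution with the same initial data stays in the box, and uniqueness identifies it with the given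
  geodesic.\<close>

lemma geo_in_box:
  assumes c: "c \<in> A" "x0 \<in> fst c" and K: "cball (snd c x0) R \<subseteq> K" "R > 0" "K \<subseteq> dom c" and \<rho>: "\<rho> > 0"
  shows "\<exists>r>0. \<exists>\<rho>'>0. \<forall>\<beta>. geo \<beta> \<longrightarrow> \<beta> 0 \<in> fst c \<longrightarrow> dist (snd c (\<beta> 0)) (snd c x0) \<le> r \<longrightarrow> norm (velocity A \<beta> 0 c) \<le> \<rho>' \<longrightarrow>
     \<beta> ` {0..1} \<subseteq> fst c \<and> csmall c K \<rho> (snd c \<circ> \<beta>) (\<lambda>t. velocity A \<beta> t c)"
proof -
  interpret G: local_geometry "dom c" "Gc c" "DGc c" "\<Gamma>c c" "D\<Gamma>c c" by (rule local_geometry[OF c(1)])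
  define \<epsilon> where "\<epsilon> = min R \<rho>"
  have \<epsilon>: "\<epsilon> > 0" "cball (snd c x0) \<epsilon> \<subseteq> dom c" "cball (snd c x0) \<epsilon> \<subseteq> K" "\<epsilon> \<le> \<rho>" using K \<rho> by (auto simp: \<epsilon>_def)
  have "\<exists>r>0. \<exists>\<rho>'>0. \<forall>a\<in>cball (snd c x0) r. \<forall>v0. norm v0 \<le> \<rho>' \<longrightarrow> (\<exists>x v. G.sol {-2<..<2} x v \<and> x 0 = a \<and> v 0 = v0 \<and>
     (\<forall>t\<in>{-2<..<2}. x t \<in> cball (snd c x0) \<epsilon> \<and> norm (v t) \<le> \<epsilon>))"
    using G.initial_value_problem[OF \<epsilon>(2,1)] by metis
  then obtain r \<rho>' where r: "r > 0" "\<rho>' > 0" and ivp: "\<And>a v0. a \<in> cball (snd c x0) r \<Longrightarrow> norm v0 \<le> \<rho>' \<Longrightarrow>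
     \<exists>x v. csol c {-2<..<2} x v \<and> x 0 = a \<and> v 0 = v0 \<and> (\<forall>t\<in>{-2<..<2}. x t \<in> cball (snd c x0) \<epsilon> \<and> norm (v t) \<le> \<epsilon>)"
    unfolding csol_def by blast
  have "\<beta> ` {0..1} \<subseteq> fst c \<and> csmall c K \<rho> (snd c \<circ> \<beta>) (\<lambda>t. velocity A \<beta> t c)"
    if \<beta>: "geo \<beta>" "\<beta> 0 \<in> fst c" "dist (snd c (\<beta> 0)) (snd c x0) \<le> r" "norm (velocity A \<beta> 0 c) \<le> \<rho>'" for \<beta>
  proof -
    have "snd c (\<beta> 0) \<in> cball (snd c x0) r" using \<beta> by (simp add: dist_commute)
    from ivp[OF this \<beta>(4)] obtain x v where x: "csol c {-2<..<2} x v" "x 0 = snd c (\<beta> 0)" "v 0 = velocity A \<beta> 0 c"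
      "\<forall>t\<in>{-2<..<2}. x t \<in> cball (snd c x0) \<epsilon> \<and> norm (v t) \<le> \<epsilon>" by blast
    let ?\<gamma> = "chart_inv c \<circ> x"
    have 0: "(0::real) \<in> {-2<..<2}" by simp
    note cg = chart_geodesic[OF c(1) open_greaterThanLessThan x(1)]
    have g0: "?\<gamma> 0 = \<beta> 0" using x(2) \<beta>(2) c by simp
    have v0: "velocity A ?\<gamma> 0 = velocity A \<beta> 0"
      using cg(4)[OF 0] g0 x(3) tvec_of_coord[OF geo_velocity[OF \<beta>(1)] c(1) \<beta>(2)] by simp
    have eq: "?\<gamma> t = \<beta> t" "velocity A ?\<gamma> t = velocity A \<beta> t" if "t \<in> {-2<..<2}" for t
      using geodesic_unique[OF cg(1) geodesic_on_subset[OF \<beta>(1) subset_UNIV] open_greaterThanLessThan _ 0 g0 v0 that] by auto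
    have in01: "t \<in> {-2<..<2}" if "t \<in> {0..1}" for t :: real using that by auto
    have sub: "\<beta> t \<in> fst c" if "t \<in> {-2<..<2}" for t using cg(2)[OF that] eq(1)[OF that] by simp
    have xe: "snd c (\<beta> t) = x t" "velocity A \<beta> t c = v t" if "t \<in> {-2<..<2}" for t
      using cg(3)[OF that] cg(4)[OF that] cg(2)[OF that] eq[OF that] c(1) by auto
    have "csol c {-2<..<2} (snd c \<circ> \<beta>) (\<lambda>t. velocity A \<beta> t c)"
      by (rule csol_cong[OF x(1) open_greaterThanLessThan c(1)]) (use xe in auto)
    then have "csol c {0..1} (snd c \<circ> \<beta>) (\<lambda>t. velocity A \<beta> t c)" using c(1) in01 by (simp add: csol_iff)
    moreover have "(snd c \<circ> \<beta>) t \<in> K \<and> norm (velocity A \<beta> t c) \<le> \<rho>" if "t \<in> {0..1}" for t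
      using x(4)[rule_format, OF in01[OF that]] xe[OF in01[OF that]] \<epsilon> by auto
    ultimately show ?thesis using sub in01 by (auto simp: csmall_iff[OF c(1)])
  qed
  then show ?thesis using r by blast
qed

section \<open>Continuity of the exponential map\<close>

lemma chart_isCont: "c \<in> A \<Longrightarrow> x \<in> fst c \<Longrightarrow> isCont (snd c) x"
  using chart_cont(1)[of c] continuous_on_eq_continuous_at[OF chart_open(1)[of c], of "snd c"] by simp

lemma chart_inv_isCont: "c \<in> A \<Longrightarrow> y \<in> dom c \<Longrightarrow> isCont (chart_inv c) y"
  by (metis chart_cont(2) chart_open(2) continuous_on_eq_continuous_at)

text \<open>The derivative of a transition map is continuous for each fixed vector; expansion over
  the basis makes it jointly continuous in point and vector.\<close>

lemma DT_tendsto: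
  assumes c: "c \<in> A" "c' \<in> A" and x: "x \<in> fst c" "x \<in> fst c'" and X: "X \<longlonglongrightarrow> x" and u: "u \<longlonglongrightarrow> u0"
  shows "(\<lambda>n. DT c c' (X n) (u n)) \<longlonglongrightarrow> DT c c' x u0"
proof -
  let ?W = "snd c ` (fst c \<inter> fst c')"
  have lin: "DT c c' y u = (\<Sum>i\<in>Basis. (u \<bullet> i) *\<^sub>R DT c c' y i)" if "y \<in> fst c" "y \<in> fst c'" for y u
  proof -
    have "DT c c' y u = DT c c' y (\<Sum>i\<in>Basis. (u \<bullet> i) *\<^sub>R i)" by (simp add: euclidean_representation)
    also have "\<dots> = (\<Sum>i\<in>Basis. (u \<bullet> i) *\<^sub>R DT c c' y i)"
      by (simp add: linear_sum[OF DT_linear[OF c that]] linear_cmul[OF DT_linear[OF c that]])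
    finally show ?thesis .
  qed
  have cX: "(\<lambda>n. snd c (X n)) \<longlonglongrightarrow> snd c x" using isCont_tendsto_compose[OF chart_isCont[OF c(1) x(1)] X] .
  have "(\<lambda>n. DT c c' (X n) i) \<longlonglongrightarrow> DT c c' x i" for i
  proof -
    have "isCont (\<lambda>y. frechet_derivative (transition c c') (at y) i) (snd c x)"
      using c1_fun_continuous_derivative[OF smooth_on_c1_fun[OF transition_smooth[OF c]]] overlap_open[OF c] x
        continuous_on_eq_continuous_at by blast
    from isCont_tendsto_compose[OF this cX] show ?thesis by (simp add: DT_def)
  qed
  then have 1: "(\<lambda>n. \<Sum>i\<in>Basis. (u n \<bullet> i) *\<^sub>R DT c c' (X n) i) \<longlonglongrightarrow> (\<Sum>i\<in>Basis. (u0 \<bullet> i) *\<^sub>R DT c c' x i)"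
    by (intro tendsto_intros u)
  have "open (fst c \<inter> fst c')" using chart_open(1) c by blast
  then have "\<forall>\<^sub>F n in sequentially. X n \<in> fst c \<inter> fst c'" using X x by (auto dest: topological_tendstoD)
  then have "\<forall>\<^sub>F n in sequentially. (\<Sum>i\<in>Basis. (u n \<bullet> i) *\<^sub>R DT c c' (X n) i) = DT c c' (X n) (u n)"
    by (rule eventually_mono) (rule lin[symmetric], auto)
  from Lim_transform_eventually[OF 1 this] show ?thesis unfolding lin[OF x, of u0, symmetric] .
qed

text \<open>Convergence in the tangent bundle. One chart around the limit is enough, since
  \<open>state_conv_chart\<close> transfers the velocities to any other.\<close>

definition state_conv :: "(nat \<Rightarrow> real \<Rightarrow> 'a) \<Rightarrow> (real \<Rightarrow> 'a) \<Rightarrow> real \<Rightarrow> bool" where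
  "state_conv X \<gamma> t \<longleftrightarrow> (\<lambda>n. X n t) \<longlonglongrightarrow> \<gamma> t \<and>
     (\<exists>c\<in>A. \<gamma> t \<in> fst c \<and> (\<lambda>n. velocity A (X n) t c) \<longlonglongrightarrow> velocity A \<gamma> t c)"

lemma state_conv_chart:
  assumes s: "state_conv X \<gamma> t" and X: "\<And>n. geo (X n)" "geo \<gamma>" and c': "c' \<in> A" "\<gamma> t \<in> fst c'"
  shows "(\<lambda>n. velocity A (X n) t c') \<longlonglongrightarrow> velocity A \<gamma> t c'"
proof -
  obtain c where c: "c \<in> A" "\<gamma> t \<in> fst c" "(\<lambda>n. velocity A (X n) t c) \<longlonglongrightarrow> velocity A \<gamma> t c"
    and x: "(\<lambda>n. X n t) \<longlonglongrightarrow> \<gamma> t" using s by (auto simp: state_conv_def)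
  have "open (fst c \<inter> fst c')" using chart_open(1) c c' by blast
  then have "\<forall>\<^sub>F n in sequentially. X n t \<in> fst c \<inter> fst c'" using x c c' by (auto dest: topological_tendstoD)
  then have "\<forall>\<^sub>F n in sequentially. DT c c' (X n t) (velocity A (X n) t c) = velocity A (X n) t c'"
  proof (rule eventually_mono)
    fix n assume n: "X n t \<in> fst c \<inter> fst c'"
    show "DT c c' (X n t) (velocity A (X n) t c) = velocity A (X n) t c'"
      by (rule tangent_chart[OF geo_velocity[OF X(1)] c(1) c'(1), symmetric]) (use n in auto)
  qed
  from Lim_transform_eventually[OF DT_tendsto[OF c(1) c'(1) c(2) c'(2) x c(3)] this]
  show ?thesis using tangent_chart[OF geo_velocity[OF X(2)] c(1) c'(1) c(2) c'(2)] by simp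
qed

text \<open>Between two times near \<open>t1\<close> the parameter is rescaled by
  \<open>a = t - s\<close>, of either sign, and Lipschitz dependence on initial data is applied in
  one chart. The radius depends on \<open>\<gamma>\<close> and \<open>t1\<close> only, so continuous
  induction can reach \<open>t1\<close> from before and continue after it.\<close>

lemma state_conv_local:
  assumes \<gamma>: "geo \<gamma>"
  shows "\<exists>\<tau>>0. \<forall>s t X. \<bar>s - t1\<bar> < \<tau> \<longrightarrow> \<bar>t - t1\<bar> < \<tau> \<longrightarrow> (\<forall>n. geo (X n)) \<longrightarrow> state_conv X \<gamma> s \<longrightarrow> state_conv X \<gamma> t"
proof -
  obtain c where c: "c \<in> A" "\<gamma> t1 \<in> fst c" by (rule chart_at)
  interpret G: local_geometry "dom c" "Gc c" "DGc c" "\<Gamma>c c" "D\<Gamma>c c" by (rule local_geometry[OF c(1)])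
  obtain R C where R: "R > 0" "cbounds c (cball (snd c (\<gamma> t1)) R) C" using cbounds_at[OF c] by blast
  let ?K = "cball (snd c (\<gamma> t1)) R"
  note C = cboundsD[OF R(2) c(1)]
  define \<rho> where "\<rho> = 1 / (32 * C)"
  have \<rho>: "\<rho> > 0" "\<rho> \<le> 1" "32 * C * \<rho> \<le> 1" using C(1) by (auto simp: \<rho>_def divide_le_eq)
  obtain r \<rho>' where r: "r > 0" "\<rho>' > 0" and box: "\<And>\<beta>. geo \<beta> \<Longrightarrow> \<beta> 0 \<in> fst c \<Longrightarrow> dist (snd c (\<beta> 0)) (snd c (\<gamma> t1)) \<le> r \<Longrightarrow>
     norm (velocity A \<beta> 0 c) \<le> \<rho>' \<Longrightarrow> \<beta> ` {0..1} \<subseteq> fst c \<and> csmall c ?K \<rho> (snd c \<circ> \<beta>) (\<lambda>t. velocity A \<beta> t c)"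
    using geo_in_box[OF c subset_refl R(1) C(2) \<rho>(1)] by blast
  define V where "V = norm (velocity A \<gamma> t1 c) + 1"
  have V: "V > 0" by (simp add: V_def add_nonneg_pos)
  obtain \<delta> where \<delta>: "\<delta> > 0" "\<gamma> ` {t1-\<delta><..<t1+\<delta>} \<subseteq> fst c" "csol c {t1-\<delta><..<t1+\<delta>} (snd c \<circ> \<gamma>) (\<lambda>t. velocity A \<gamma> t c)"
    using geodesic_chart_nbhd[OF \<gamma> open_UNIV UNIV_I c] by blast
  have ic: "isCont (snd c \<circ> \<gamma>) t1" "isCont (\<lambda>t. velocity A \<gamma> t c) t1"
    using csol_continuous[OF \<delta>(3) c(1), of t1] \<delta>(1) by auto
  have "\<forall>\<^sub>F s in nhds t1. dist ((snd c \<circ> \<gamma>) s) ((snd c \<circ> \<gamma>) t1) < r \<and> dist (velocity A \<gamma> s c) (velocity A \<gamma> t1 c) < 1"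
    by (rule eventually_conj[OF isCont_eventually_dist[OF ic(1) r(1)] isCont_eventually_dist[OF ic(2) zero_less_one]])
  then obtain \<delta>' where \<delta>': "\<delta>' > 0" "\<And>s. dist s t1 < \<delta>' \<Longrightarrow> dist (snd c (\<gamma> s)) (snd c (\<gamma> t1)) < r \<and>
      dist (velocity A \<gamma> s c) (velocity A \<gamma> t1 c) < 1"
    unfolding eventually_nhds_metric by auto
  define k where "k = \<rho>' / V"
  have k: "k > 0" "k * V = \<rho>'" using r V by (auto simp: k_def)
  \<comment> \<open>Two times within \<open>\<tau>\<close> of \<open>t1\<close> differ by less than
    \<open>k\<close>, which keeps the rescaled speed at most \<open>k * V = \<rho>'\<close>.\<close>
  define \<tau> where "\<tau> = min (min \<delta> \<delta>') (k / 2)"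
  have \<tau>: "\<tau> > 0" "\<tau> \<le> \<delta>" "\<tau> \<le> \<delta>'" "\<tau> \<le> k / 2" using \<delta> \<delta>' k by (auto simp: \<tau>_def)
  show ?thesis
  proof (rule exI[of _ \<tau>], rule conjI, rule \<tau>(1), intro allI impI)
    fix s t X assume st: "\<bar>s - t1\<bar> < \<tau>" "\<bar>t - t1\<bar> < \<tau>" and X: "\<forall>n. geo (X n)" and conv: "state_conv X \<gamma> s"
    show "state_conv X \<gamma> t"
    proof (cases "t = s")
      case False
      define a where "a = t - s"
      have a: "a \<noteq> 0" "\<bar>a\<bar> \<le> k" using False st \<tau>(4) by (auto simp: a_def)
      have s_in: "\<gamma> s \<in> fst c" "dist (snd c (\<gamma> s)) (snd c (\<gamma> t1)) < r" "norm (velocity A \<gamma> s c) < V"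
      proof -
        show "\<gamma> s \<in> fst c" using \<delta>(2) st \<tau>(2) by (auto simp: image_subset_iff abs_less_iff)
        have d: "dist s t1 < \<delta>'" using st \<tau>(3) by (simp add: dist_real_def)
        then show "dist (snd c (\<gamma> s)) (snd c (\<gamma> t1)) < r" using \<delta>'(2) by blast
        show "norm (velocity A \<gamma> s c) < V"
          using \<delta>'(2)[OF d] norm_triangle_sub[of "velocity A \<gamma> s c" "velocity A \<gamma> t1 c"] by (simp add: V_def dist_norm)
      qed
      have bx: "(\<lambda>u. \<beta> (a * u + s)) ` {0..1} \<subseteq> fst c \<and>
          csmall c ?K \<rho> (snd c \<circ> (\<lambda>u. \<beta> (a * u + s))) (\<lambda>u. velocity A (\<lambda>u. \<beta> (a * u + s)) u c)"
        if "geo \<beta>" "\<beta> s \<in> fst c" "dist (snd c (\<beta> s)) (snd c (\<gamma> t1)) < r" "norm (velocity A \<beta> s c) < V" for \<beta>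
      proof (rule box)
        show "geo (\<lambda>u. \<beta> (a * u + s))" by (rule geo_affine(1)[OF that(1)])
        have "\<bar>a\<bar> * norm (velocity A \<beta> s c) \<le> k * V" using a that(4) by (intro mult_mono) auto
        then show "norm (velocity A (\<lambda>u. \<beta> (a * u + s)) 0 c) \<le> \<rho>'"
          using geo_affine(2)[OF that(1), of a s 0] k by (simp add: tscale_def)
      qed (use that in auto)
      have xs: "(\<lambda>n. X n s) \<longlonglongrightarrow> \<gamma> s" using conv by (simp add: state_conv_def)
      have cxs: "(\<lambda>n. snd c (X n s)) \<longlonglongrightarrow> snd c (\<gamma> s)"
        using isCont_tendsto_compose[OF chart_isCont[OF c(1) s_in(1)] xs] .
      have vs: "(\<lambda>n. velocity A (X n) s c) \<longlonglongrightarrow> velocity A \<gamma> s c"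
        by (rule state_conv_chart[OF conv _ \<gamma> c(1) s_in(1)]) (use X in blast)
      have ev: "\<forall>\<^sub>F n in sequentially. X n s \<in> fst c \<and> dist (snd c (X n s)) (snd c (\<gamma> t1)) < r \<and> norm (velocity A (X n) s c) < V"
      proof (intro eventually_conj)
        show "\<forall>\<^sub>F n in sequentially. X n s \<in> fst c"
          using topological_tendstoD[OF xs chart_open(1)[OF c(1)] s_in(1)] .
        show "\<forall>\<^sub>F n in sequentially. dist (snd c (X n s)) (snd c (\<gamma> t1)) < r"
          by (rule order_tendstoD(2)[OF _ s_in(2)]) (intro tendsto_intros cxs)
        show "\<forall>\<^sub>F n in sequentially. norm (velocity A (X n) s c) < V"
          by (rule order_tendstoD(2)[OF _ s_in(3)]) (intro tendsto_intros vs)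
      qed
      let ?e = "\<lambda>n. norm (snd c (X n s) - snd c (\<gamma> s)) + \<bar>a\<bar> * norm (velocity A (X n) s c - velocity A \<gamma> s c)"
      have e0: "(\<lambda>n. 4 * ?e n) \<longlonglongrightarrow> 0"
      proof -
        have "(\<lambda>n. 4 * ?e n) \<longlonglongrightarrow> 4 * (norm (snd c (\<gamma> s) - snd c (\<gamma> s)) + \<bar>a\<bar> * norm (velocity A \<gamma> s c - velocity A \<gamma> s c))"
          by (intro tendsto_intros cxs vs)
        then show ?thesis by simp
      qed
      have va: "velocity A (\<lambda>u. \<beta> (a * u + s)) u c = a *\<^sub>R velocity A \<beta> (a * u + s) c" if "geo \<beta>" for \<beta> u
        using geo_affine(2)[OF that, of a s u] by (simp add: tscale_def)
      have est: "\<forall>\<^sub>F n in sequentially. X n t \<in> fst c \<and> norm (snd c (X n t) - snd c (\<gamma> t)) +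
          \<bar>a\<bar> * norm (velocity A (X n) t c - velocity A \<gamma> t c) \<le> 4 * ?e n"
        using ev
      proof eventually_elim
        case (elim n)
        have Xn: "geo (X n)" using X by blast
        note b1 = bx[OF Xn] and b2 = bx[OF \<gamma> s_in]
        have "norm ((snd c \<circ> (\<lambda>u. X n (a * u + s))) 1 - (snd c \<circ> (\<lambda>u. \<gamma> (a * u + s))) 1) +
          norm (velocity A (\<lambda>u. X n (a * u + s)) 1 c - velocity A (\<lambda>u. \<gamma> (a * u + s)) 1 c)
          \<le> 4 * (norm ((snd c \<circ> (\<lambda>u. X n (a * u + s))) 0 - (snd c \<circ> (\<lambda>u. \<gamma> (a * u + s))) 0) +
          norm (velocity A (\<lambda>u. X n (a * u + s)) 0 c - velocity A (\<lambda>u. \<gamma> (a * u + s)) 0 c))"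
          by (rule G.small_sol_difference(3)[OF R(2) \<rho>(2,3) conjunct2[OF b2] conjunct2[OF b1]]) (use elim in auto)
        moreover have "norm (a *\<^sub>R x - a *\<^sub>R y) = \<bar>a\<bar> * norm (x - y)" for x y :: 'e
          by (metis norm_scaleR scaleR_right_diff_distrib)
        moreover have "a * 1 + s = t" by (simp add: a_def)
        moreover have "X n t \<in> fst c"
        proof -
          have "X n (a * 1 + s) \<in> fst c"
            by (rule subsetD[OF conjunct1[OF b1]]) (use elim in \<open>auto intro!: image_eqI[of _ _ 1]\<close>)
          then show ?thesis using \<open>a * 1 + s = t\<close> by simp
        qed
        ultimately show ?case by (simp add: va[OF Xn] va[OF \<gamma>])
      qed
      have tc: "\<gamma> t \<in> fst c" using \<delta>(2) st \<tau>(2) by (auto simp: image_subset_iff abs_less_iff)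
      have "(\<lambda>n. snd c (X n t)) \<longlonglongrightarrow> snd c (\<gamma> t)"
      proof (rule LIM_zero_cancel, rule Lim_null_comparison[OF _ e0])
        show "\<forall>\<^sub>F n in sequentially. norm (snd c (X n t) - snd c (\<gamma> t)) \<le> 4 * ?e n"
          using est
        proof (rule eventually_mono)
          fix n assume n: "X n t \<in> fst c \<and> norm (snd c (X n t) - snd c (\<gamma> t)) +
            \<bar>a\<bar> * norm (velocity A (X n) t c - velocity A \<gamma> t c) \<le> 4 * ?e n"
          have "0 \<le> \<bar>a\<bar> * norm (velocity A (X n) t c - velocity A \<gamma> t c)" by simp
          then show "norm (snd c (X n t) - snd c (\<gamma> t)) \<le> 4 * ?e n" using n by linarith
        qed
      qed
      then have "(\<lambda>n. chart_inv c (snd c (X n t))) \<longlonglongrightarrow> chart_inv c (snd c (\<gamma> t))"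
        by (rule isCont_tendsto_compose[OF chart_inv_isCont[OF c(1)], rotated]) (use tc in simp)
      moreover have "\<forall>\<^sub>F n in sequentially. chart_inv c (snd c (X n t)) = X n t"
        using est by (rule eventually_mono) (use c(1) in simp)
      ultimately have x: "(\<lambda>n. X n t) \<longlonglongrightarrow> \<gamma> t" using Lim_transform_eventually[of "\<lambda>n. chart_inv c (snd c (X n t))"] tc c(1) by simp
      have "(\<lambda>n. velocity A (X n) t c) \<longlonglongrightarrow> velocity A \<gamma> t c"
      proof (rule LIM_zero_cancel, rule Lim_null_comparison)
        show "(\<lambda>n. 4 * ?e n / \<bar>a\<bar>) \<longlonglongrightarrow> 0" using tendsto_divide[OF e0 tendsto_const[of "\<bar>a\<bar>"]] a(1) by simp
        show "\<forall>\<^sub>F n in sequentially. norm (velocity A (X n) t c - velocity A \<gamma> t c) \<le> 4 * ?e n / \<bar>a\<bar>"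
          using est
        proof (rule eventually_mono)
          fix n assume n: "X n t \<in> fst c \<and> norm (snd c (X n t) - snd c (\<gamma> t)) +
            \<bar>a\<bar> * norm (velocity A (X n) t c - velocity A \<gamma> t c) \<le> 4 * ?e n"
          have "0 \<le> norm (snd c (X n t) - snd c (\<gamma> t))" by simp
          then have "\<bar>a\<bar> * norm (velocity A (X n) t c - velocity A \<gamma> t c) \<le> 4 * ?e n" using n by linarith
          then show "norm (velocity A (X n) t c - velocity A \<gamma> t c) \<le> 4 * ?e n / \<bar>a\<bar>"
            using a(1) by (simp add: pos_le_divide_eq mult.commute)
        qed
      qed
      then show ?thesis using x tc c(1) by (auto simp: state_conv_def)
    qed (use conv in simp)
  qed
qed

lemma state_conv_forward:
  assumes \<gamma>: "geo \<gamma>" and X: "\<And>n. geo (X n)" and 0: "state_conv X \<gamma> 0" and t: "t \<in> {0..1}"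
  shows "state_conv X \<gamma> t"
  using zero_le_one
proof (induction rule: real_induct)
  case base show ?case by (rule 0)
next
  case (step t)
  obtain \<tau> where \<tau>: "\<tau> > 0" "\<forall>s r X. \<bar>s - t\<bar> < \<tau> \<longrightarrow> \<bar>r - t\<bar> < \<tau> \<longrightarrow> (\<forall>n. geo (X n)) \<longrightarrow> state_conv X \<gamma> s \<longrightarrow> state_conv X \<gamma> r"
    using state_conv_local[OF \<gamma>, of t] by blast
  have "state_conv X \<gamma> t" using step by auto
  have "state_conv X \<gamma> s" if "t < s" "s < t + \<tau>" for s
    by (rule \<tau>(2)[rule_format, of t s X]) (use that \<tau>(1) X \<open>state_conv X \<gamma> t\<close> in auto)
  then show ?case using \<tau>(1) by (intro exI[of _ "t + \<tau>"]) auto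
next
  case (lim t)
  obtain \<tau> where \<tau>: "\<tau> > 0" "\<forall>s r X. \<bar>s - t\<bar> < \<tau> \<longrightarrow> \<bar>r - t\<bar> < \<tau> \<longrightarrow> (\<forall>n. geo (X n)) \<longrightarrow> state_conv X \<gamma> s \<longrightarrow> state_conv X \<gamma> r"
    using state_conv_local[OF \<gamma>, of t] by blast
  define s where "s = max 0 (t - \<tau> / 2)"
  have s: "s \<in> {0..<t}" "\<bar>s - t\<bar> < \<tau>" using lim \<tau> by (auto simp: s_def)
  show ?case by (rule \<tau>(2)[rule_format, of s t X]) (use s lim(3)[OF s(1)] \<tau>(1) X in auto)
qed (use t in simp)

lemma exp_continuous:
  assumes c: "c \<in> A" "z \<in> fst c"
  shows "continuous_on UNIV (\<lambda>w. exp_map A g z (tvec_of A c z w))"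
  unfolding continuous_on_sequentially
proof (intro allI impI ballI)
  fix w and W :: "nat \<Rightarrow> 'e" assume "w \<in> UNIV" and "(\<forall>n. W n \<in> UNIV) \<and> W \<longlonglongrightarrow> w"
  then have W: "W \<longlonglongrightarrow> w" by blast
  let ?X = "\<lambda>n t. exp_map A g z (tscale t (tvec_of A c z (W n)))" and ?\<gamma> = "\<lambda>t. exp_map A g z (tscale t (tvec_of A c z w))"
  note e = exp_geodesic[OF tvec_of_tangent[OF c]]
  have "state_conv ?X ?\<gamma> 0"
    unfolding state_conv_def using c W by (auto simp: e intro!: bexI[of _ c])
  then have "state_conv ?X ?\<gamma> 1" using state_conv_forward[of ?\<gamma> ?X 1] e(1) by simp
  then show "((\<lambda>w. exp_map A g z (tvec_of A c z w)) \<circ> W) \<longlonglongrightarrow> exp_map A g z (tvec_of A c z w)"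
    by (simp add: state_conv_def o_def)
qed

section \<open>Convexity of the distance between geodesics\<close>

text \<open>Around each centre, \<open>dist_comparison\<close> holds with the norm at the centre,
  and \<open>N_near\<close> replaces it by the norm at \<open>x\<close>. A Lebesgue number of the
  resulting cover of \<open>K\<close> gives one radius for all points.\<close>

lemma dist_comparison_uniform:
  assumes c: "c \<in> A" and K: "compact K" "K \<subseteq> dom c" and \<epsilon>: "0 < \<epsilon>" "\<epsilon> \<le> 1"
  shows "\<exists>\<delta>>0. \<forall>x\<in>fst c. \<forall>y\<in>fst c. snd c x \<in> K \<longrightarrow> dist (snd c x) (snd c y) < \<delta> \<longrightarrow>
    (1 - \<epsilon>) * cN c (snd c x) (snd c y - snd c x) \<le> dist x y \<and> dist x y \<le> (1 + \<epsilon>) * cN c (snd c x) (snd c y - snd c x)"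
proof -
  interpret G: local_geometry "dom c" "Gc c" "DGc c" "\<Gamma>c c" "D\<Gamma>c c" by (rule local_geometry[OF c])
  define good where "good k \<delta> \<longleftrightarrow> \<delta> > 0 \<and> (\<forall>x\<in>fst c. \<forall>y\<in>fst c. snd c x \<in> ball k \<delta> \<longrightarrow> snd c y \<in> ball k \<delta> \<longrightarrow>
    (1 - \<epsilon>) * cN c (snd c x) (snd c y - snd c x) \<le> dist x y \<and> dist x y \<le> (1 + \<epsilon>) * cN c (snd c x) (snd c y - snd c x))" for k \<delta>
  have ex: "\<exists>\<delta>. good k \<delta>" if k: "k \<in> K" for k
  proof -
    define \<eta> where "\<eta> = \<epsilon> / 4"
    have \<eta>: "0 < \<eta>" "\<eta> \<le> 1" using \<epsilon> by (auto simp: \<eta>_def)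
    have kd: "k \<in> dom c" using k K by blast
    obtain \<delta>1 where \<delta>1: "\<delta>1 > 0" "\<forall>x\<in>fst c. \<forall>y\<in>fst c. dist (snd c x) k < \<delta>1 \<longrightarrow> dist (snd c y) k < \<delta>1 \<longrightarrow>
      (1 - \<eta>) * cN c k (snd c y - snd c x) \<le> dist x y \<and> dist x y \<le> (1 + \<eta>) * cN c k (snd c y - snd c x)"
      using dist_comparison[OF c chart_inv_in[OF c kd] \<eta>(1)] unfolding chart_chart_inv[OF c kd] by blast
    obtain \<delta>2 where \<delta>2: "\<delta>2 > 0" "\<forall>y. dist y k < \<delta>2 \<longrightarrow> y \<in> dom c \<and> (\<forall>u. (1 - \<eta>) * cN c k u \<le> cN c y u \<and> cN c y u \<le> (1 + \<eta>) * cN c k u)"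
      using G.N_near[OF kd \<eta>] by blast
    have "good k (min \<delta>1 \<delta>2)" unfolding good_def
    proof (intro conjI ballI impI)
      show "0 < min \<delta>1 \<delta>2" using \<delta>1 \<delta>2 by simp
      fix x y assume xy: "x \<in> fst c" "y \<in> fst c" "snd c x \<in> ball k (min \<delta>1 \<delta>2)" "snd c y \<in> ball k (min \<delta>1 \<delta>2)"
      define n where "n = cN c k (snd c y - snd c x)"
      define m where "m = cN c (snd c x) (snd c y - snd c x)"
      have n: "n \<ge> 0" unfolding n_def by (rule G.N_nonneg[OF kd])
      have d: "(1 - \<eta>) * n \<le> dist x y" "dist x y \<le> (1 + \<eta>) * n"
        using \<delta>1(2) xy by (auto simp: n_def dist_commute)
      have nm: "(1 - \<eta>) * n \<le> m" "m \<le> (1 + \<eta>) * n"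
        using \<delta>2(2) xy(3) by (auto simp: n_def m_def dist_commute)
      have e: "(1 - \<epsilon>) * (1 + \<eta>) \<le> 1 - \<eta>" "1 + \<eta> \<le> (1 + \<epsilon>) * (1 - \<eta>)"
        using \<epsilon> mult_nonneg_nonneg[of \<epsilon> "1 - \<epsilon>"] by (auto simp: \<eta>_def field_simps power2_eq_square)
      have "(1 - \<epsilon>) * m \<le> (1 - \<epsilon>) * ((1 + \<eta>) * n)" using nm(2) \<epsilon> by (intro mult_left_mono) auto
      also have "\<dots> \<le> (1 - \<eta>) * n" using mult_right_mono[OF e(1) n] by (simp add: mult.assoc)
      finally show "(1 - \<epsilon>) * cN c (snd c x) (snd c y - snd c x) \<le> dist x y" using d(1) by (simp add: m_def)
      have "(1 + \<eta>) * n \<le> (1 + \<epsilon>) * ((1 - \<eta>) * n)" using mult_right_mono[OF e(2) n] by (simp add: mult.assoc)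
      also have "\<dots> \<le> (1 + \<epsilon>) * m" using nm(1) \<epsilon> by (intro mult_left_mono) auto
      finally show "dist x y \<le> (1 + \<epsilon>) * cN c (snd c x) (snd c y - snd c x)" using d(2) by (simp add: m_def)
    qed
    then show ?thesis by blast
  qed
  then obtain \<delta> where \<delta>: "\<And>k. k \<in> K \<Longrightarrow> good k (\<delta> k)" by metis
  have cov: "K \<subseteq> \<Union> ((\<lambda>k. ball k (\<delta> k)) ` K)" using \<delta> by (auto simp: good_def)
  have op: "open G" if "G \<in> (\<lambda>k. ball k (\<delta> k)) ` K" for G using that by auto
  obtain e where e: "e > 0" "\<And>x. x \<in> K \<Longrightarrow> \<exists>G\<in>(\<lambda>k. ball k (\<delta> k)) ` K. ball x e \<subseteq> G"
    using Heine_Borel_lemma[OF K(1) cov op] by blast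
  show ?thesis
  proof (intro exI[of _ e] conjI e(1) ballI impI)
    fix x y assume xy: "x \<in> fst c" "y \<in> fst c" "snd c x \<in> K" "dist (snd c x) (snd c y) < e"
    obtain k where k: "k \<in> K" "ball (snd c x) e \<subseteq> ball k (\<delta> k)" using e(2)[OF xy(3)] by blast
    have "snd c x \<in> ball k (\<delta> k)" "snd c y \<in> ball k (\<delta> k)" using subsetD[OF k(2)] xy(4) e(1) by auto
    then show "(1 - \<epsilon>) * cN c (snd c x) (snd c y - snd c x) \<le> dist x y"
      "dist x y \<le> (1 + \<epsilon>) * cN c (snd c x) (snd c y - snd c x)"
      using \<delta>[OF k(1)] xy by (auto simp: good_def)
  qed
qed

text \<open>The intermediate value theorem, applied to the length function of an almost minimizing
  curve, cuts it into arcs of equal length. The last clause keeps the chain in a controlled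
  neighbourhood of \<open>x\<close>.\<close>

lemma equidistant_chain:
  assumes "\<epsilon> > 0" "N > 0"
  shows "\<exists>a :: nat \<Rightarrow> 'a. a 0 = x \<and> a N = y \<and> (\<forall>i<N. dist (a i) (a (Suc i)) \<le> (dist x y + \<epsilon>) / N) \<and>
    (\<forall>i\<le>N. dist x (a i) \<le> dist x y + \<epsilon>)"
proof -
  obtain \<gamma> :: "real \<Rightarrow> 'a" and l where \<gamma>: "continuous_on {0..1} l" "\<gamma> 0 = x" "\<gamma> 1 = y" "l 0 = 0" "l 1 \<le> dist x y + \<epsilon>"
    "\<forall>s t. 0 \<le> s \<longrightarrow> s \<le> t \<longrightarrow> t \<le> 1 \<longrightarrow> dist (\<gamma> s) (\<gamma> t) \<le> l t - l s"
    using almost_minimizing_curve[OF assms(1), of x y] by blast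
  have mono: "l s \<le> l t" if "0 \<le> s" "s \<le> t" "t \<le> 1" for s t
    using \<gamma>(6)[rule_format, OF that] zero_le_dist[of "\<gamma> s" "\<gamma> t"] by linarith
  have l1: "0 \<le> l 1" using mono[of 0 1] \<gamma>(4) by simp
  have "\<exists>s\<in>{0..1}. l s = real i / N * l 1" if "i \<le> N" for i
  proof -
    have q: "0 \<le> real i / N" "real i / N \<le> 1" using that assms(2) by (auto simp: divide_le_eq)
    have "real i / N * l 1 \<le> 1 * l 1" using q l1 by (intro mult_right_mono) auto
    then have "l 0 \<le> real i / N * l 1" "real i / N * l 1 \<le> l 1" using q l1 \<gamma>(4) by auto
    from IVT'[OF this _ \<gamma>(1)] show ?thesis by auto
  qed
  then obtain \<tau> where \<tau>: "\<And>i. i \<le> N \<Longrightarrow> \<tau> i \<in> {0..1} \<and> l (\<tau> i) = real i / N * l 1" by metis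
  define a where "a i = (if i = 0 then x else if i = N then y else \<gamma> (\<tau> i))" for i
  have ta: "\<exists>t\<in>{0..1}. a i = \<gamma> t \<and> l t = real i / N * l 1" if i: "i \<le> N" for i
  proof (cases "i = 0 \<or> i = N")
    case True
    then show ?thesis
    proof
      assume "i = 0" then show ?thesis using \<gamma> by (intro bexI[of _ 0]) (auto simp: a_def)
    next
      assume "i = N" then show ?thesis using \<gamma> assms(2) by (intro bexI[of _ 1]) (auto simp: a_def)
    qed
  next
    case False then show ?thesis using \<tau>[OF i] by (auto simp: a_def)
  qed
  have dl: "dist (\<gamma> s) (\<gamma> t) \<le> \<bar>l t - l s\<bar>" if "s \<in> {0..1}" "t \<in> {0..1}" for s t
    using \<gamma>(6)[rule_format, of s t] \<gamma>(6)[rule_format, of t s] that by (cases "s \<le> t") (auto simp: dist_commute)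
  show ?thesis
  proof (intro exI[of _ a] conjI allI impI)
    fix i assume i: "i < N"
    obtain s t where st: "s \<in> {0..1}" "t \<in> {0..1}" "a i = \<gamma> s" "l s = real i / N * l 1" "a (Suc i) = \<gamma> t" "l t = real (Suc i) / N * l 1"
      using ta[of i] ta[of "Suc i"] i by auto
    have "l t - l s = l 1 / N" using st(4,6) by (simp add: add_divide_distrib distrib_right)
    then have "dist (a i) (a (Suc i)) \<le> l 1 / N" using dl[OF st(1,2)] st(3,5) l1 by simp
    also have "\<dots> \<le> (dist x y + \<epsilon>) / N" using \<gamma>(5) by (intro divide_right_mono) auto
    finally show "dist (a i) (a (Suc i)) \<le> (dist x y + \<epsilon>) / N" .
  next
    fix i assume i: "i \<le> N"
    obtain t where t: "t \<in> {0..1}" "a i = \<gamma> t" using ta[OF i] by blast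
    have "dist (\<gamma> 0) (\<gamma> t) \<le> l t - l 0" using \<gamma>(6) t(1) by simp
    also have "\<dots> \<le> l 1" using mono[of t 1] t(1) \<gamma>(4) by simp
    finally show "dist x (a i) \<le> dist x y + \<epsilon>" using \<gamma> t(2) by simp
  qed (use assms in \<open>auto simp: a_def\<close>)
qed

text \<open>The starting points and the end points are each subdivided into N steps, and
  corresponding points are joined by short geodesics. The midpoints of neighbouring ones satisfy the
  inequality up to an error of \<open>\<epsilon>\<close> times \<open>M / N\<close>, so the whole
  chain loses a multiple of \<open>\<epsilon>\<close> independent of N. Convexity at the midpoint is
  enough for \<open>midpoint_convex_imp_below_chord\<close>.\<close>

lemma local_convexity:
  "\<exists>r>0. \<forall>\<gamma> \<sigma>. geo \<gamma> \<longrightarrow> geo \<sigma> \<longrightarrow> dist (\<gamma> 0) q \<le> r \<longrightarrow> dist (\<sigma> 0) q \<le> r \<longrightarrow>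
     tnorm g (\<gamma> 0) (velocity A \<gamma> 0) \<le> r \<longrightarrow> tnorm g (\<sigma> 0) (velocity A \<sigma> 0) \<le> r \<longrightarrow>
     dist (\<gamma> (1/2)) (\<sigma> (1/2)) \<le> (dist (\<gamma> 0) (\<sigma> 0) + dist (\<gamma> 1) (\<sigma> 1)) / 2"
proof -
  obtain c where c: "c \<in> A" "q \<in> fst c" by (rule chart_at)
  interpret G: local_geometry "dom c" "Gc c" "DGc c" "\<Gamma>c c" "D\<Gamma>c c" by (rule local_geometry[OF c(1)])
  obtain R C where R: "R > 0" "cbounds c (cball (snd c q) R) C" using cbounds_at[OF c] by blast
  let ?K = "cball (snd c q) R"
  note C = cboundsD[OF R(2) c(1)]
  define \<rho> where "\<rho> = 1 / (32 * C)"
  have \<rho>: "\<rho> > 0" "\<rho> \<le> 1" "32 * C * \<rho> \<le> 1" using C(1) by (auto simp: \<rho>_def divide_le_eq)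
  obtain r1 where r1: "r1 > 0" "r1 \<le> R" and loc: "\<forall>x\<in>fst c. \<forall>y\<in>fst c. dist (snd c x) (snd c q) \<le> r1 \<longrightarrow> dist (snd c y) (snd c q) \<le> r1 \<longrightarrow>
     (\<exists>\<gamma>. geodesic_on A g {-2<..<2} \<gamma> \<and> \<gamma> 0 = x \<and> \<gamma> 1 = y \<and> \<gamma> ` {0..1} \<subseteq> fst c \<and>
        csmall c ?K \<rho> (snd c \<circ> \<gamma>) (\<lambda>t. velocity A \<gamma> t c))"
    using local_geodesics[OF c R(2) \<rho> subset_refl R(1)] by blast
  obtain r2 \<rho>' where r2: "r2 > 0" "\<rho>' > 0" and box: "\<forall>\<beta>. geo \<beta> \<longrightarrow> \<beta> 0 \<in> fst c \<longrightarrow> dist (snd c (\<beta> 0)) (snd c q) \<le> r2 \<longrightarrow>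
     norm (velocity A \<beta> 0 c) \<le> \<rho>' \<longrightarrow> \<beta> ` {0..1} \<subseteq> fst c \<and> csmall c ?K \<rho> (snd c \<circ> \<beta>) (\<lambda>t. velocity A \<beta> t c)"
    using geo_in_box[OF c subset_refl R(1) C(2) \<rho>(1)] by blast
  have half: "(0::real) < 1 / 2" by simp
  obtain d1 where d1: "d1 > 0" and cmp: "\<forall>x\<in>fst c. \<forall>y\<in>fst c. dist (snd c x) (snd c q) < d1 \<longrightarrow> dist (snd c y) (snd c q) < d1 \<longrightarrow>
    (1 - 1 / 2) * cN c (snd c q) (snd c y - snd c x) \<le> dist x y \<and> dist x y \<le> (1 + 1 / 2) * cN c (snd c q) (snd c y - snd c x)"
    using dist_comparison[OF c half] by blast
  define r0 where "r0 = min (min r1 r2) (min d1 R)"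
  have r0: "r0 > 0" "r0 \<le> r1" "r0 \<le> r2" "r0 \<le> d1" "r0 \<le> R" using r1 r2 d1 R by (auto simp: r0_def)
  obtain r' where r': "r' > 0" "ball q r' \<subseteq> {x \<in> fst c. dist (snd c x) (snd c q) < r0}"
    using chart_ball_nbhd[OF c r0(1)] by (meson open_contains_ball)
  have nb: "x \<in> fst c \<and> dist (snd c x) (snd c q) < r0" if "dist q x < r'" for x
    using subsetD[OF r'(2), of x] that by simp
  \<comment> \<open>The chain at time 1 starts within \<open>2 * r\<close> of \<open>q\<close> and
    extends at most \<open>D' + \<epsilon> \<le> 5 * r\<close> further, which stays below
    \<open>r'\<close>. The second entry keeps initial coordinate velocities at most
    \<open>\<rho>'\<close>.\<close>
  define r where "r = min (r' / 8) (\<rho>' / C)"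
  have Cp: "C > 0" using C(1) by simp
  have "r > 0" using r'(1) r2 Cp by (simp add: r_def)
  moreover have "r \<le> r' / 8" unfolding r_def by (rule min.cobounded1)
  ultimately have r: "r > 0" "r \<le> r' / 8" .
  have "r \<le> \<rho>' / C" unfolding r_def by (rule min.cobounded2)
  then have Cr: "C * r \<le> \<rho>'" using Cp by (simp add: field_simps)
  show ?thesis
  proof (rule exI[of _ r], intro conjI r(1) allI impI)
    fix \<gamma> \<sigma> assume geo: "geo \<gamma>" "geo \<sigma>" and q: "dist (\<gamma> 0) q \<le> r" "dist (\<sigma> 0) q \<le> r"
      and sp: "tnorm g (\<gamma> 0) (velocity A \<gamma> 0) \<le> r" "tnorm g (\<sigma> 0) (velocity A \<sigma> 0) \<le> r"
    define D where "D = dist (\<gamma> 0) (\<sigma> 0)"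
    define D' where "D' = dist (\<gamma> 1) (\<sigma> 1)"
    have q1: "dist (\<gamma> 1) q \<le> 2 * r" "dist (\<sigma> 1) q \<le> 2 * r"
      using geo_dist[OF geo(1), of 0 1] geo_dist[OF geo(2), of 0 1] sp q
        dist_triangle[of "\<gamma> 1" q "\<gamma> 0"] dist_triangle[of "\<sigma> 1" q "\<sigma> 0"] by (auto simp: dist_commute)
    have DD: "D \<le> 2 * r" "D' \<le> 4 * r"
      using dist_triangle[of "\<gamma> 0" "\<sigma> 0" q] dist_triangle[of "\<gamma> 1" "\<sigma> 1" q] q q1 by (auto simp: D_def D'_def dist_commute)
    have bx: "\<beta> ` {0..1} \<subseteq> fst c \<and> csmall c ?K \<rho> (snd c \<circ> \<beta>) (\<lambda>t. velocity A \<beta> t c)"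
      if "geo \<beta>" "dist (\<beta> 0) q \<le> r" "tnorm g (\<beta> 0) (velocity A \<beta> 0) \<le> r" for \<beta>
    proof -
      have "dist q (\<beta> 0) < r'" using that(2) r r' by (auto simp: dist_commute)
      note n = nb[OF this]
      have "snd c (\<beta> 0) \<in> ?K" using n r0(5) by (simp add: dist_commute)
      then have "norm (velocity A \<beta> 0 c) \<le> C * cN c (snd c (\<beta> 0)) (velocity A \<beta> 0 c)" by (rule C(6))
      also have "\<dots> = C * tnorm g (\<beta> 0) (velocity A \<beta> 0)" using tnorm_coord[OF c(1) _ geo_velocity[OF that(1)]] n by simp
      also have "\<dots> \<le> C * r" using that(3) Cp by simp
      finally show ?thesis using box that(1) n Cr r0(3) by auto
    qed
    \<comment> \<open>The bound obtained for a fixed \<open>\<epsilon>\<close>: the factors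
      \<open>1 + \<epsilon>\<close> and \<open>1 - \<epsilon>\<close> come from exchanging distances
      and norms, the last summand from the failure of exact convexity. At 0 it is the mean of the
      two distances.\<close>
    define B where "B \<epsilon> = (1 + \<epsilon>) * ((D + D' + 2 * \<epsilon>) / (2 * (1 - \<epsilon>)) + \<epsilon> * (16 * C * (D + D' + 2 * \<epsilon>)))" for \<epsilon>
    have main: "dist (\<gamma> (1/2)) (\<sigma> (1/2)) \<le> B \<epsilon>" if \<epsilon>: "0 < \<epsilon>" "\<epsilon> \<le> 1 / 2" "\<epsilon> \<le> r" for \<epsilon>
    proof -
      have \<epsilon>1: "\<epsilon> \<le> 1" using \<epsilon> by simp
      obtain \<eta> where \<eta>: "\<eta> > 0" and acd: "\<forall>\<gamma> v \<sigma> w \<rho> \<kappa> t. csmall c ?K \<rho> \<gamma> v \<longrightarrow> csmall c ?K \<rho> \<sigma> w \<longrightarrow> \<rho> \<le> 1 \<longrightarrow> \<kappa> \<le> \<eta> \<longrightarrow>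
         (\<forall>t\<in>{0..1}. norm (\<sigma> t - \<gamma> t) + norm (w t - v t) \<le> \<kappa>) \<longrightarrow> t \<in> {0..1} \<longrightarrow>
         cN c (\<gamma> t) (\<sigma> t - \<gamma> t) \<le> (1 - t) * cN c (\<gamma> 0) (\<sigma> 0 - \<gamma> 0) + t * cN c (\<gamma> 1) (\<sigma> 1 - \<gamma> 1) + \<epsilon> * \<kappa>"
        using G.almost_convex_difference[OF R(2) \<epsilon>(1)] by blast
      obtain \<delta> where \<delta>: "\<delta> > 0" and ucmp: "\<forall>x\<in>fst c. \<forall>y\<in>fst c. snd c x \<in> ?K \<longrightarrow> dist (snd c x) (snd c y) < \<delta> \<longrightarrow>
        (1 - \<epsilon>) * cN c (snd c x) (snd c y - snd c x) \<le> dist x y \<and> dist x y \<le> (1 + \<epsilon>) * cN c (snd c x) (snd c y - snd c x)"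
        using dist_comparison_uniform[OF c(1) C(3,2) \<epsilon>(1) \<epsilon>1] by blast
      \<comment> \<open>The gap between neighbouring geodesics is at most \<open>M / N\<close>: a
        factor 8 from the control by end values in \<open>small_sol_difference\<close> and a factor
        \<open>2 * C\<close> from distances to coordinates.\<close>
      define M where "M = 16 * C * (D + D' + 2 * \<epsilon>)"
      have M: "M > 0" using Cp \<epsilon>(1) by (auto simp: M_def D_def D'_def intro!: add_nonneg_pos mult_pos_pos)
      define e where "e = min \<eta> (\<delta> / 2)"
      have e: "e > 0" "e \<le> \<eta>" "e < \<delta>" using \<eta> \<delta> by (auto simp: e_def)
      obtain N0 :: nat where N0: "M / e < real N0" using reals_Archimedean2 by blast
      define N where "N = Suc N0"
      have N: "N > 0" "real N > 0" and "M / e < real N" using N0 by (auto simp: N_def)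
      then have "M / N \<le> e" using e(1) by (simp add: field_simps)
      then have \<kappa>: "M / N \<le> \<eta>" "M / N < \<delta>" using e by linarith+
      obtain a where a: "a 0 = \<gamma> 0" "a N = \<sigma> 0" "\<forall>i<N. dist (a i) (a (Suc i)) \<le> (D + \<epsilon>) / N" "\<forall>i\<le>N. dist (\<gamma> 0) (a i) \<le> D + \<epsilon>"
        using equidistant_chain[OF \<epsilon>(1) N(1), of "\<gamma> 0" "\<sigma> 0"] unfolding D_def by blast
      obtain b where b: "b 0 = \<gamma> 1" "b N = \<sigma> 1" "\<forall>i<N. dist (b i) (b (Suc i)) \<le> (D' + \<epsilon>) / N" "\<forall>i\<le>N. dist (\<gamma> 1) (b i) \<le> D' + \<epsilon>"
        using equidistant_chain[OF \<epsilon>(1) N(1), of "\<gamma> 1" "\<sigma> 1"] unfolding D'_def by blast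
      have near: "a i \<in> fst c \<and> dist (snd c (a i)) (snd c q) < r0" "b i \<in> fst c \<and> dist (snd c (b i)) (snd c q) < r0" if "i \<le> N" for i
      proof -
        show "a i \<in> fst c \<and> dist (snd c (a i)) (snd c q) < r0"
        proof (rule nb)
          have "dist q (a i) \<le> dist (\<gamma> 0) q + dist (\<gamma> 0) (a i)" using dist_triangle[of q "a i" "\<gamma> 0"] by (simp add: dist_commute)
          then show "dist q (a i) < r'" using a(4) that q(1) DD \<epsilon>(3) r by fastforce
        qed
        show "b i \<in> fst c \<and> dist (snd c (b i)) (snd c q) < r0"
        proof (rule nb)
          have "dist q (b i) \<le> dist (\<gamma> 1) q + dist (\<gamma> 1) (b i)" using dist_triangle[of q "b i" "\<gamma> 1"] by (simp add: dist_commute)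
          moreover have "dist (\<gamma> 1) (b i) \<le> D' + \<epsilon>" using b(4) that by blast
          ultimately show "dist q (b i) < r'" using q1(1) DD \<epsilon>(3) r by linarith
        qed
      qed
      define P where "P i \<beta> \<longleftrightarrow> \<beta> 0 = a i \<and> \<beta> 1 = b i \<and> \<beta> ` {0..1} \<subseteq> fst c \<and> csmall c ?K \<rho> (snd c \<circ> \<beta>) (\<lambda>t. velocity A \<beta> t c)" for i and \<beta> :: "real \<Rightarrow> 'a"
      \<comment> \<open>The extreme members of the family must be \<open>\<gamma>\<close> and
        \<open>\<sigma>\<close> themselves, so only the intermediate ones are taken from the
        boundary value problem.\<close>
      have "\<exists>\<beta>. i \<le> N \<longrightarrow> P i \<beta> \<and> (i = 0 \<longrightarrow> \<beta> = \<gamma>) \<and> (i = N \<longrightarrow> \<beta> = \<sigma>)" for i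
      proof -
        consider "i = 0" | "i = N" "i \<noteq> 0" | "i \<noteq> 0" "i \<noteq> N" "i \<le> N" | "\<not> i \<le> N" by linarith
        then show ?thesis
        proof cases
          case 1 then show ?thesis using bx[OF geo(1) q(1) sp(1)] a(1) b(1) N by (intro exI[of _ \<gamma>]) (auto simp: P_def)
        next
          case 2 then show ?thesis using bx[OF geo(2) q(2) sp(2)] a(2) b(2) by (intro exI[of _ \<sigma>]) (auto simp: P_def)
        next
          case 3
          have "dist (snd c (a i)) (snd c q) \<le> r1" "dist (snd c (b i)) (snd c q) \<le> r1" using near[OF 3(3)] r0(2) by auto
          then show ?thesis using loc near[OF 3(3)] 3 unfolding P_def by blast
        qed blast
      qed
      then obtain X where "\<forall>i. i \<le> N \<longrightarrow> P i (X i) \<and> (i = 0 \<longrightarrow> X i = \<gamma>) \<and> (i = N \<longrightarrow> X i = \<sigma>)" by metis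
      then have X: "\<And>i. i \<le> N \<Longrightarrow> P i (X i)" "X 0 = \<gamma>" "X N = \<sigma>" by auto
      have step: "dist (X i (1/2)) (X (Suc i) (1/2)) \<le> B \<epsilon> / N" if i: "i < N" for i
      proof -
        have le: "i \<le> N" "Suc i \<le> N" using i by auto
        note x = X(1)[OF le(1), unfolded P_def] and y = X(1)[OF le(2), unfolded P_def]
        have sx: "csmall c ?K \<rho> (snd c \<circ> X i) (\<lambda>t. velocity A (X i) t c)" and sy: "csmall c ?K \<rho> (snd c \<circ> X (Suc i)) (\<lambda>t. velocity A (X (Suc i)) t c)"
          using x y by auto
        have inc: "X i t \<in> fst c" "X (Suc i) t \<in> fst c" if "t \<in> {0..1}" for t
          using that x y by auto
        have inK: "snd c (X i t) \<in> ?K" if "t \<in> {0..1}" for t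
          using sx that unfolding csmall_iff[OF c(1)] by simp
        have coord: "norm (snd c y - snd c x) \<le> 2 * C * dist x y"
          if "x \<in> fst c \<and> dist (snd c x) (snd c q) < r0" "y \<in> fst c \<and> dist (snd c y) (snd c q) < r0" for x y
        proof -
          have "cN c (snd c q) (snd c y - snd c x) \<le> 2 * dist x y" using cmp that r0(4) by fastforce
          then have "C * cN c (snd c q) (snd c y - snd c x) \<le> C * (2 * dist x y)" using Cp by simp
          moreover have "norm (snd c y - snd c x) \<le> C * cN c (snd c q) (snd c y - snd c x)" using C(6) R(1) by simp
          ultimately show ?thesis by simp
        qed
        have "norm (snd c (a (Suc i)) - snd c (a i)) \<le> 2 * C * ((D + \<epsilon>) / N)"
          using coord[OF near(1)[OF le(1)] near(1)[OF le(2)]] a(3) i Cp by (smt (verit) mult_left_mono)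
        moreover have "norm (snd c (b (Suc i)) - snd c (b i)) \<le> 2 * C * ((D' + \<epsilon>) / N)"
          using coord[OF near(2)[OF le(1)] near(2)[OF le(2)]] b(3) i Cp by (smt (verit) mult_left_mono)
        ultimately have "8 * (norm (snd c (a (Suc i)) - snd c (a i)) + norm (snd c (b (Suc i)) - snd c (b i)))
            \<le> 8 * (2 * C * ((D + \<epsilon>) / N) + 2 * C * ((D' + \<epsilon>) / N))" by simp
        also have "\<dots> = M / N" using N(2) by (simp add: M_def field_simps)
        finally have s0: "8 * (norm (snd c (a (Suc i)) - snd c (a i)) + norm (snd c (b (Suc i)) - snd c (b i))) \<le> M / N" .
        have diff: "norm ((snd c \<circ> X (Suc i)) t - (snd c \<circ> X i) t) + norm (velocity A (X (Suc i)) t c - velocity A (X i) t c) \<le> M / N"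
          if "t \<in> {0..1}" for t
          using G.small_sol_difference(2)[OF R(2) \<rho>(2,3) sx sy that] s0 x y by simp
        have close: "dist (snd c (X i t)) (snd c (X (Suc i) t)) < \<delta>" if "t \<in> {0..1}" for t
        proof -
          have "norm (snd c (X (Suc i) t) - snd c (X i t)) \<le> M / N"
            using diff[OF that] norm_ge_zero[of "velocity A (X (Suc i)) t c - velocity A (X i) t c"] unfolding o_def by linarith
          then show ?thesis using \<kappa>(2) by (simp add: dist_norm norm_minus_commute)
        qed
        define n where "n t = cN c (snd c (X i t)) (snd c (X (Suc i) t) - snd c (X i t))" for t
        have uc: "(1 - \<epsilon>) * n t \<le> dist (X i t) (X (Suc i) t)" "dist (X i t) (X (Suc i) t) \<le> (1 + \<epsilon>) * n t" if "t \<in> {0..1}" for t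
          using ucmp inc[OF that] inK[OF that] close[OF that] unfolding n_def by blast+
        have n0: "n 0 \<le> (D + \<epsilon>) / N / (1 - \<epsilon>)" 
        proof -
          have "(1 - \<epsilon>) * n 0 \<le> (D + \<epsilon>) / N" using uc(1)[of 0] a(3) i x y by fastforce
          then show ?thesis by (subst pos_le_divide_eq) (use \<epsilon> in \<open>auto simp: mult.commute\<close>)
        qed
        have n1: "n 1 \<le> (D' + \<epsilon>) / N / (1 - \<epsilon>)" 
        proof -
          have "(1 - \<epsilon>) * n 1 \<le> (D' + \<epsilon>) / N" using uc(1)[of 1] b(3) i x y by fastforce
          then show ?thesis by (subst pos_le_divide_eq) (use \<epsilon> in \<open>auto simp: mult.commute\<close>)
        qed
        have "n (1/2) \<le> (1 - 1/2) * n 0 + 1/2 * n 1 + \<epsilon> * (M / N)"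
          using acd[rule_format, OF sx sy \<rho>(2) \<kappa>(1) diff, of "1/2"] by (simp add: n_def)
        also have "\<dots> \<le> ((D + \<epsilon>) / N / (1 - \<epsilon>) + (D' + \<epsilon>) / N / (1 - \<epsilon>)) / 2 + \<epsilon> * (M / N)" using n0 n1 by simp
        also have "\<dots> = ((D + D' + 2 * \<epsilon>) / (2 * (1 - \<epsilon>)) + \<epsilon> * M) / N"
        proof -
          define e1 where "e1 = 1 - \<epsilon>"
          have "e1 > 0" using \<epsilon> by (simp add: e1_def)
          then show ?thesis unfolding e1_def[symmetric] using N(2) by (simp add: field_simps)
        qed
        finally have "(1 + \<epsilon>) * n (1/2) \<le> (1 + \<epsilon>) * (((D + D' + 2 * \<epsilon>) / (2 * (1 - \<epsilon>)) + \<epsilon> * M) / N)" using \<epsilon> by (intro mult_left_mono) auto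
        then show ?thesis using uc(2)[of "1/2"] by (simp add: B_def M_def)
      qed
      \<comment> \<open>The triangle inequality adds N steps, each bounded by
        \<open>B \<epsilon> / N\<close>.\<close>
      have "i \<le> N \<Longrightarrow> dist (X 0 (1/2)) (X i (1/2)) \<le> i * (B \<epsilon> / N)" for i
      proof (induction i)
        case (Suc i)
        have "real (Suc i) * (B \<epsilon> / N) = i * (B \<epsilon> / N) + B \<epsilon> / N" by (simp add: add_divide_distrib distrib_right)
        then show ?case
          using Suc.IH Suc.prems step[of i] dist_triangle[of "X 0 (1/2)" "X (Suc i) (1/2)" "X i (1/2)"] by linarith
      qed simp
      from this[OF order_refl] show ?thesis using N X by simp
    qed
    have "isCont B 0" unfolding B_def by (intro continuous_intros) auto
    then have "(B \<longlongrightarrow> B 0) (at_right 0)" unfolding isCont_def by (rule filterlim_mono) (simp_all add: at_le)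
    moreover have "\<forall>\<^sub>F \<epsilon> in at_right 0. dist (\<gamma> (1/2)) (\<sigma> (1/2)) \<le> B \<epsilon>"
      unfolding eventually_at_right_field using main r(1) by (intro exI[of _ "min (1/2) r"]) auto
    ultimately have "dist (\<gamma> (1/2)) (\<sigma> (1/2)) \<le> B 0" by (rule tendsto_lowerbound) simp
    then show "dist (\<gamma> (1/2)) (\<sigma> (1/2)) \<le> (dist (\<gamma> 0) (\<sigma> 0) + dist (\<gamma> 1) (\<sigma> 1)) / 2" by (simp add: B_def D_def D'_def)
  qed
qed

end

section \<open>Locally expanding maps onto simply connected spaces\<close>

text \<open>The step \<open>d\<close> may depend on the point, since convexity is known only at
  small scale. A maximum point of the excess over the chord leads to a contradiction.\<close>

lemma midpoint_convex_imp_below_chord: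
  fixes f :: "real \<Rightarrow> real"
  assumes cont: "continuous_on {0..1} f" and t: "t \<in> {0..1}"
    and mid: "\<And>t. 0 < t \<Longrightarrow> t < 1 \<Longrightarrow> \<exists>d>0. d \<le> t \<and> d \<le> 1 - t \<and> f t \<le> (f (t - d) + f (t + d)) / 2"
  shows "f t \<le> (1 - t) * f 0 + t * f 1"
proof (rule ccontr)
  define \<phi> where "\<phi> s = f s - ((1 - s) * f 0 + s * f 1)" for s
  assume "\<not> ?thesis"
  then have pos: "\<phi> t > 0" by (simp add: \<phi>_def)
  have c\<phi>: "continuous_on {0..1} \<phi>" unfolding \<phi>_def by (intro continuous_intros cont)
  obtain m where m: "m \<in> {0..1}" "\<And>s. s \<in> {0..1} \<Longrightarrow> \<phi> s \<le> \<phi> m"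
    using continuous_attains_sup[OF compact_Icc _ c\<phi>] by auto
  define S where "S = {0..1} \<inter> \<phi> -` {\<phi> m}"
  have "closed S" unfolding S_def by (rule continuous_closed_preimage[OF c\<phi>]) auto
  then have "compact ({0..1} \<inter> S)" by (intro compact_Int_closed compact_Icc)
  then have "compact S" by (simp add: S_def)
  moreover have "S \<noteq> {}" using m(1) by (auto simp: S_def)
  \<comment> \<open>The leftmost maximum, so that the excess at \<open>s - d\<close> is strictly
    smaller while at \<open>s + d\<close> it is no larger.\<close>
  ultimately obtain s where s: "s \<in> S" "\<forall>r\<in>S. s \<le> r" using compact_attains_inf[of S] by blast
  have \<phi>s: "\<phi> s = \<phi> m" "s \<in> {0..1}" using s by (auto simp: S_def)
  have "\<phi> s > 0" using pos m(2)[OF t] \<phi>s by simp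
  then have "s \<noteq> 0" "s \<noteq> 1" by (auto simp: \<phi>_def)
  then have s01: "0 < s" "s < 1" using \<phi>s(2) by auto
  obtain d where d: "d > 0" "d \<le> s" "d \<le> 1 - s" "f s \<le> (f (s - d) + f (s + d)) / 2" using mid[OF s01] by blast
  have "\<phi> s \<le> (\<phi> (s - d) + \<phi> (s + d)) / 2" using d(4) by (simp add: \<phi>_def field_simps)
  moreover have "\<phi> (s + d) \<le> \<phi> s" using m(2)[of "s + d"] d s01 \<phi>s by auto
  moreover have "\<phi> (s - d) < \<phi> s"
  proof -
    have in01: "s - d \<in> {0..1}" using d s01 by auto
    have "s - d \<notin> S" using s(2) d(1) by force
    then show ?thesis using m(2)[OF in01] \<phi>s in01 by (auto simp: S_def)
  qed
  ultimately show False by simp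
qed

text \<open>A substitute for segments in a metric space: paths between the points of
  \<open>T\<close>, Lipschitz in the parameter and in the end point. These two bounds give lifts of
  the paths and the continuity of the lifts in the end point.\<close>

definition lines :: "'a::metric_space set \<Rightarrow> ('a \<Rightarrow> 'a \<Rightarrow> real \<Rightarrow> 'a) \<Rightarrow> real \<Rightarrow> bool" where
  "lines T lp L \<longleftrightarrow> L \<ge> 0 \<and> (\<forall>x\<in>T. \<forall>y\<in>T. lp x y 0 = x \<and> lp x y 1 = y \<and>
     (\<forall>s\<in>{0..1}. \<forall>t\<in>{0..1}. dist (lp x y s) (lp x y t) \<le> L * dist x y * \<bar>s - t\<bar>) \<and>
     (\<forall>y'\<in>T. \<forall>t\<in>{0..1}. dist (lp x y t) (lp x y' t) \<le> L * dist y y'))"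

text \<open>The radius of expansion may vary with the point, while the constant \<open>M\<close> is
  global. The global constant keeps lifts Lipschitz on their whole interval, so that they cannot
  escape in finite time.\<close>

locale expanding_map =
  fixes E :: "'e::banach \<Rightarrow> 'a::metric_space" and M :: real
  assumes M: "M > 0" and cont: "continuous_on UNIV E"
    and expanding: "\<exists>\<epsilon>>0. \<forall>u\<in>ball w \<epsilon>. \<forall>v\<in>ball w \<epsilon>. norm (u - v) \<le> M * dist (E u) (E v)"
    and open_map: "open V \<Longrightarrow> open (E ` V)"
begin

text \<open>The coincidence set of two lifts is closed by continuity and open because
  \<open>E\<close> is injective near each point.\<close>

lemma lift_unique:
  assumes T: "connected T" "continuous_on T f" "continuous_on T f'" "\<And>y. y \<in> T \<Longrightarrow> E (f y) = E (f' y)"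
    and y: "y0 \<in> T" "f y0 = f' y0" "y \<in> T"
  shows "f y = f' y"
proof -
  let ?S = "{y \<in> T. f y - f' y = 0}"
  have "closedin (top_of_set T) ?S"
    by (intro continuous_closedin_preimage_constant continuous_intros T)
  moreover have "openin (top_of_set T) ?S"
  proof (subst openin_subopen, intro ballI)
    fix y assume y: "y \<in> ?S"
    obtain \<epsilon> where \<epsilon>: "\<epsilon> > 0" "\<forall>u\<in>ball (f y) \<epsilon>. \<forall>v\<in>ball (f y) \<epsilon>. norm (u - v) \<le> M * dist (E u) (E v)"
      using expanding by blast
    let ?W = "(T \<inter> f -` ball (f y) \<epsilon>) \<inter> (T \<inter> f' -` ball (f y) \<epsilon>)"
    have "openin (top_of_set T) ?W"
      by (intro openin_Int continuous_openin_preimage_gen T) auto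
    moreover have "y \<in> ?W" using y \<epsilon>(1) by auto
    moreover have "?W \<subseteq> ?S"
    proof
      fix x assume x: "x \<in> ?W"
      then have "norm (f x - f' x) \<le> M * dist (E (f x)) (E (f' x))" using \<epsilon>(2) by blast
      then show "x \<in> ?S" using T(4)[of x] x by simp
    qed
    ultimately show "\<exists>W. openin (top_of_set T) W \<and> y \<in> W \<and> W \<subseteq> ?S" by blast
  qed
  ultimately have "?S = {} \<or> ?S = T" using T(1) unfolding connected_clopen by blast
  then show ?thesis using y by force
qed

text \<open>Continuous induction: openness of \<open>E\<close> continues a lift beyond a time, and
  completeness of the domain extends a lift with the fixed Lipschitz constant \<open>M * L\<close>
  to the end of a half-open interval.\<close>

lemma lift_lipschitz_path:
  assumes L: "L \<ge> 0" and \<beta>: "\<And>s t. s \<in> {0..1} \<Longrightarrow> t \<in> {0..1} \<Longrightarrow> dist (\<beta> s) (\<beta> t) \<le> L * \<bar>s - t\<bar>" and w: "E w = \<beta> 0"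
  shows "\<exists>l. l 0 = w \<and> (\<forall>t\<in>{0..1}. E (l t) = \<beta> t) \<and> (M * L)-lipschitz_on {0..1} l"
proof -
  define P where "P t \<longleftrightarrow> (\<exists>l. l 0 = w \<and> (\<forall>s\<in>{0..t}. E (l s) = \<beta> s) \<and> (M * L)-lipschitz_on {0..t} l)" for t
  have nn: "M * L \<ge> 0" using M L by simp
  have c\<beta>: "continuous_on {0..1} \<beta>"
    by (rule lipschitz_on_continuous_on[of L]) (use \<beta> L in \<open>auto intro!: lipschitz_onI simp: dist_real_def\<close>)
  have "P 1"
    using zero_le_one
  proof (induction rule: real_induct)
    case base
    show ?case unfolding P_def using w nn by (intro exI[of _ "\<lambda>_. w"]) (auto intro!: lipschitz_onI)
  next
    case (step t)
    then have "P t" by auto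
    then obtain l where l: "l 0 = w" "\<forall>s\<in>{0..t}. E (l s) = \<beta> s" "(M * L)-lipschitz_on {0..t} l" unfolding P_def by blast
    obtain \<epsilon> where \<epsilon>: "\<epsilon> > 0" "\<forall>u\<in>ball (l t) \<epsilon>. \<forall>v\<in>ball (l t) \<epsilon>. norm (u - v) \<le> M * dist (E u) (E v)"
      using expanding by blast
    have "open (E ` ball (l t) \<epsilon>)" "\<beta> t \<in> E ` ball (l t) \<epsilon>"
      using open_map l(2) step \<epsilon>(1) by (auto intro!: image_eqI[of _ _ "l t"])
    then obtain e where e: "e > 0" "ball (\<beta> t) e \<subseteq> E ` ball (l t) \<epsilon>" using open_contains_ball by blast
    define \<tau> where "\<tau> = e / (L + 1)"
    have \<tau>: "\<tau> > 0" "L * \<tau> < e" using e L by (auto simp: \<tau>_def field_simps)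
    \<comment> \<open>The lift by the local inverse of \<open>E\<close> on the ball around
      \<open>l t\<close>; expansion makes it unique there and gives it the Lipschitz constant
      \<open>M * L\<close>.\<close>
    define \<mu> where "\<mu> u = (SOME v. v \<in> ball (l t) \<epsilon> \<and> E v = \<beta> u)" for u
    have \<mu>: "\<mu> u \<in> ball (l t) \<epsilon>" "E (\<mu> u) = \<beta> u" if u: "t \<le> u" "u < t + \<tau>" "u \<le> 1" for u
    proof -
      have "dist (\<beta> t) (\<beta> u) \<le> L * \<bar>t - u\<bar>" using \<beta>[of t u] step u by auto
      also have "\<dots> \<le> L * \<tau>" using u L by (intro mult_left_mono) auto
      finally have "\<beta> u \<in> E ` ball (l t) \<epsilon>" using e(2) \<tau>(2) by auto
      then have "\<exists>v. v \<in> ball (l t) \<epsilon> \<and> E v = \<beta> u" by (metis imageE)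
      from someI_ex[OF this] show "\<mu> u \<in> ball (l t) \<epsilon>" "E (\<mu> u) = \<beta> u" by (auto simp: \<mu>_def)
    qed
    have \<mu>t: "l t = \<mu> t"
    proof -
      have "norm (\<mu> t - l t) \<le> M * dist (E (\<mu> t)) (E (l t))"
        by (rule \<epsilon>(2)[rule_format]) (use \<mu>(1)[of t] \<epsilon>(1) step \<tau>(1) in auto)
      then show ?thesis using \<mu>(2)[of t] l(2) step \<tau>(1) by auto
    qed
    have "P s" if s: "t < s" "s < t + \<tau>" "s \<le> 1" for s
    proof -
      have "(M * L)-lipschitz_on {t..s} \<mu>"
      proof (rule lipschitz_onI[OF _ nn])
        fix u v assume uv: "u \<in> {t..s}" "v \<in> {t..s}"
        have "norm (\<mu> u - \<mu> v) \<le> M * dist (E (\<mu> u)) (E (\<mu> v))" using \<epsilon>(2) \<mu>(1)[of u] \<mu>(1)[of v] uv s by auto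
        also have "\<dots> \<le> M * (L * \<bar>u - v\<bar>)"
          using M \<beta>[of u v] \<mu>(2)[of u] \<mu>(2)[of v] uv s step by (intro mult_left_mono) auto
        finally show "dist (\<mu> u) (\<mu> v) \<le> M * L * dist u v" by (simp add: dist_norm mult.assoc)
      qed
      from lipschitz_on_concat[OF l(3) this \<mu>t]
      show ?thesis unfolding P_def using l(1,2) step s \<mu>
        by (intro exI[of _ "\<lambda>u. if u \<le> t then l u else \<mu> u"]) auto
    qed
    then show ?case using \<tau>(1) by (intro exI[of _ "t + \<tau>"]) auto
  next
    case (lim t)
    from lim(3) have "\<forall>s\<in>{0..<t}. \<exists>l. l 0 = w \<and> (\<forall>s\<in>{0..s}. E (l s) = \<beta> s) \<and> (M * L)-lipschitz_on {0..s} l"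
      unfolding P_def by blast
    then obtain l where l: "\<And>s. s \<in> {0..<t} \<Longrightarrow> l s 0 = w \<and> (\<forall>u\<in>{0..s}. E (l s u) = \<beta> u) \<and> (M * L)-lipschitz_on {0..s} (l s)"
      by metis
    \<comment> \<open>The lifts on shorter intervals are restrictions of each other, so evaluating
      each at its own end defines one lift on \<open>{0..<t}\<close>.\<close>
    have same: "l u u = l v u" if uv: "0 \<le> u" "u \<le> v" "v < t" for u v
    proof (rule lift_unique[of "{0..u}" "l u" "l v" 0])
      have "(M * L)-lipschitz_on {0..u} (l v)" using l[of v] uv by (auto intro: lipschitz_on_subset)
      then show "continuous_on {0..u} (l v)" by (rule lipschitz_on_continuous_on)
      show "continuous_on {0..u} (l u)" using l[of u] uv by (auto intro: lipschitz_on_continuous_on)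
    qed (use l[of u] l[of v] uv in auto)
    have "(M * L)-lipschitz_on {0..<t} (\<lambda>u. l u u)"
    proof (rule lipschitz_onI[OF _ nn])
      have "dist (l u u) (l v v) \<le> M * L * dist u v" if uv: "0 \<le> u" "u \<le> v" "v < t" for u v
        using lipschitz_onD[of "M * L" "{0..v}" "l v" u v] l[of v] uv same[OF uv] by auto
      then show "dist (l u u) (l v v) \<le> M * L * dist u v" if "u \<in> {0..<t}" "v \<in> {0..<t}" for u v
        using that by (metis atLeastLessThan_iff dist_commute linear)
    qed
    from lipschitz_extend_closure[OF this] obtain k where
      k: "(M * L)-lipschitz_on (closure {0..<t}) k" "\<forall>x\<in>{0..<t}. k x = l x x" by blast
    have cl: "closure {0..<t} = {0..t}" using lim by simp
    have "dist (E (k s)) (\<beta> s) \<le> 0" if "s \<in> {0..t}" for s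
    proof (rule continuous_le_on_closure[where f = "\<lambda>s. dist (E (k s)) (\<beta> s)" and S = "{0..<t}"])
      have "continuous_on {0..t} k" using k(1) cl lipschitz_on_continuous_on by metis
      then have "continuous_on {0..t} (\<lambda>s. E (k s))" by (rule continuous_on_compose2[OF cont]) auto
      then show "continuous_on (closure {0..<t}) (\<lambda>s. dist (E (k s)) (\<beta> s))" unfolding cl
        by (intro continuous_intros) (use lim in \<open>auto intro: continuous_on_subset[OF c\<beta>]\<close>)
      show "s \<in> closure {0..<t}" using that cl by simp
      show "dist (E (k s)) (\<beta> s) \<le> 0" if "s \<in> {0..<t}" for s using k(2) l[OF that] that by auto
    qed
    moreover have "k 0 = w" using k(2) l[of 0] lim by auto
    ultimately show ?case unfolding P_def using k(1) cl by (intro exI[of _ k]) auto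
  qed simp
  then show ?thesis by (auto simp: P_def)
qed

text \<open>The section sends \<open>y\<close> to the end of the lifted path from \<open>E w\<close>
  to \<open>y\<close>. For its continuity, the lift for a nearby \<open>y'\<close> has to be shown
  to remain in the expansion range of the lift for \<open>y\<close>.\<close>

lemma section_exists:
  assumes T: "lines T lp L" and w: "E w \<in> T"
  shows "\<exists>f. continuous_on T f \<and> f (E w) = w \<and> (\<forall>y\<in>T. E (f y) = y)"
proof -
  have L: "L \<ge> 0" using T by (simp add: lines_def)
  let ?x = "E w"
  have "\<exists>l. l 0 = w \<and> (\<forall>t\<in>{0..1}. E (l t) = lp ?x y t) \<and> (M * (L * dist ?x y))-lipschitz_on {0..1} l" if y: "y \<in> T" for y
    by (rule lift_lipschitz_path) (use T y w L in \<open>auto simp: lines_def\<close>)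
  then obtain l where l0: "\<And>y. y \<in> T \<Longrightarrow> l y 0 = w" and l1: "\<And>y t. y \<in> T \<Longrightarrow> t \<in> {0..1} \<Longrightarrow> E (l y t) = lp ?x y t"
    and l2: "\<And>y. y \<in> T \<Longrightarrow> (M * (L * dist ?x y))-lipschitz_on {0..1} (l y)" by metis
  have lc: "continuous_on {0..1} (l y)" if "y \<in> T" for y using l2[OF that] by (rule lipschitz_on_continuous_on)
  have "continuous_on T (\<lambda>y. l y 1)"
    unfolding continuous_on_iff
  proof (intro ballI allI impI)
    fix y and e :: real assume y: "y \<in> T" and e: "e > 0"
    \<comment> \<open>Sets on which the expansion inequality holds; a Lebesgue number of this cover
      of the compact lifted path gives a uniform radius of expansion along it.\<close>
    define \<G> where "\<G> = {V. open V \<and> (\<forall>u\<in>V. \<forall>v\<in>V. norm (u - v) \<le> M * dist (E u) (E v))}"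
    have cov: "l y ` {0..1} \<subseteq> \<Union>\<G>"
    proof
      fix v assume "v \<in> l y ` {0..1}"
      obtain \<epsilon> where "\<epsilon> > 0" "\<forall>u\<in>ball v \<epsilon>. \<forall>v\<in>ball v \<epsilon>. norm (u - v) \<le> M * dist (E u) (E v)" using expanding by blast
      then have "ball v \<epsilon> \<in> \<G>" "v \<in> ball v \<epsilon>" by (auto simp: \<G>_def)
      then show "v \<in> \<Union>\<G>" by blast
    qed
    have op: "\<And>V. V \<in> \<G> \<Longrightarrow> open V" by (simp add: \<G>_def)
    obtain \<epsilon> where \<epsilon>: "\<epsilon> > 0" "\<And>v. v \<in> l y ` {0..1} \<Longrightarrow> \<exists>V\<in>\<G>. ball v \<epsilon> \<subseteq> V"
      using Heine_Borel_lemma[OF compact_continuous_image[OF lc[OF y] compact_Icc] cov op] by blast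
    have exp: "norm (l y t - v) \<le> M * dist (E (l y t)) (E v)" if t: "t \<in> {0..1}" "norm (l y t - v) < \<epsilon>" for t v
    proof -
      obtain V where V: "V \<in> \<G>" "ball (l y t) \<epsilon> \<subseteq> V" using \<epsilon>(2) t(1) by blast
      have "l y t \<in> V" "v \<in> V" using subsetD[OF V(2)] \<epsilon>(1) t(2) by (auto simp: dist_norm)
      then show ?thesis using V(1) by (simp add: \<G>_def)
    qed
    define k where "k = M * L + 1"
    define d where "d = min \<epsilon> e / (2 * k)"
    have k: "k > 0" using M L by (simp add: k_def add_nonneg_pos)
    have d: "d > 0" using \<epsilon>(1) e k by (simp add: d_def)
    have Md: "M * L * d < min \<epsilon> e"
    proof -
      have "M * L * d \<le> k * d" using d by (simp add: k_def distrib_right)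
      also have "\<dots> = min \<epsilon> e / 2" using k by (simp add: d_def)
      finally show ?thesis using \<epsilon>(1) e by linarith
    qed
    show "\<exists>d>0. \<forall>y'\<in>T. dist y' y < d \<longrightarrow> dist (l y' 1) (l y 1) < e"
    proof (intro exI[of _ d] conjI d ballI impI)
      fix y' assume y': "y' \<in> T" "dist y' y < d"
      define h where "h t = norm (l y t - l y' t)" for t
      have ch: "continuous_on {0..1} h" unfolding h_def by (intro continuous_intros lc y y')
      have small: "M * (L * dist y y') < min \<epsilon> e"
      proof -
        have "M * (L * dist y y') \<le> M * (L * d)" using y'(2) M L by (intro mult_left_mono) (auto simp: dist_commute)
        then show ?thesis using Md by (simp add: mult.assoc)
      qed
      \<comment> \<open>Bootstrap: as long as the lifts are closer than \<open>\<epsilon>\<close>,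
        the expansion inequality bounds their distance by a quantity that is itself below
        \<open>\<epsilon>\<close>.\<close>
      have "h t \<le> M * (L * dist y y')" if "t \<in> {0..1}" for t
        using zero_le_one
      proof (induction t rule: real_induct)
        case base
        show ?case using l0 y y' M L by (simp add: h_def)
      next
        case (step t)
        have "h t < \<epsilon>" using step(3)[of t] step(1) small by auto
        then obtain \<tau> where \<tau>: "\<tau> > 0" "\<And>s. s \<in> {0..1} \<Longrightarrow> dist s t < \<tau> \<Longrightarrow> dist (h s) (h t) < \<epsilon> - h t"
          using ch step(1,2) unfolding continuous_on_iff by (metis atLeastAtMost_iff diff_gt_0_iff_gt less_eq_real_def)
        have "h s \<le> M * (L * dist y y')" if s: "t < s" "s < t + \<tau>" "s \<le> 1" for s
        proof -
          have s01: "s \<in> {0..1}" using s step by auto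
          have "dist (h s) (h t) < \<epsilon> - h t" by (rule \<tau>(2)[OF s01]) (use s in \<open>auto simp: dist_real_def\<close>)
          then have "h s < \<epsilon>" by (simp add: dist_real_def abs_less_iff)
          then have "h s \<le> M * dist (E (l y s)) (E (l y' s))" using exp[OF s01, of "l y' s"] by (simp add: h_def)
          also have "\<dots> \<le> M * (L * dist y y')"
            using l1[OF y s01] l1[OF y'(1) s01] T y y' w s01 M by (intro mult_left_mono) (auto simp: lines_def)
          finally show ?thesis .
        qed
        then show ?case using \<tau>(1) by (intro exI[of _ "t + \<tau>"]) auto
      next
        case (lim t)
        show ?case
        proof (rule continuous_le_on_closure[where f = h and S = "{0..<t}"])
          show "continuous_on (closure {0..<t}) h" using lim by (auto intro: continuous_on_subset[OF ch])
        qed (use lim in auto)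
      qed (use that in simp)
      from this[of 1] show "dist (l y' 1) (l y 1) < e" using small by (simp add: h_def dist_norm norm_minus_commute)
    qed
  qed
  moreover have "l ?x 1 = w"
    using lipschitz_onD[OF l2[OF w], of 1 0] l0[OF w] by simp
  moreover have "E (l y 1) = y" if "y \<in> T" for y using l1[OF that, of 1] T w that by (auto simp: lines_def)
  ultimately show ?thesis by (intro exI[of _ "\<lambda>y. l y 1"]) auto
qed

text \<open>The sheets are the images of the sections. Sheets that meet coincide by uniqueness of
  lifts, and a sheet is open because near a point of it the expansion inequality forces
  \<open>f w (E z) = z\<close>.\<close>

lemma evenly_covered:
  assumes T: "open T" "connected T" "lines T lp L"
  shows "\<exists>v. \<Union>v = E -` T \<and> (\<forall>u\<in>v. open u) \<and> pairwise disjnt v \<and> (\<forall>u\<in>v. \<exists>q. homeomorphism u T E q)"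
proof -
  obtain f where f: "\<And>w. E w \<in> T \<Longrightarrow> continuous_on T (f w)" "\<And>w. E w \<in> T \<Longrightarrow> f w (E w) = w"
    "\<And>w y. E w \<in> T \<Longrightarrow> y \<in> T \<Longrightarrow> E (f w y) = y"
    using section_exists[OF T(3)] by metis
  define v where "v = (\<lambda>w. f w ` T) ` (E -` T)"
  have op: "open (f w ` T)" if w: "E w \<in> T" for w
  proof (subst open_subopen, intro ballI)
    fix x assume "x \<in> f w ` T"
    then obtain y where y: "y \<in> T" "x = f w y" by blast
    have Ex: "E x = y" using f(3)[OF w y(1)] y(2) by simp
    obtain \<epsilon> where \<epsilon>: "\<epsilon> > 0" "\<forall>u\<in>ball x \<epsilon>. \<forall>v\<in>ball x \<epsilon>. norm (u - v) \<le> M * dist (E u) (E v)" using expanding by blast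
    have opT: "open (E -` T)" using open_vimage[OF T(1) cont] .
    have "continuous_on (E -` T) (\<lambda>z. f w (E z))"
      by (rule continuous_on_compose2[OF f(1)[OF w] continuous_on_subset[OF cont]]) auto
    then have "open (E -` T \<inter> (\<lambda>z. f w (E z)) -` ball x \<epsilon>)" by (rule continuous_open_preimage[OF _ opT]) simp
    then have "open (E -` T \<inter> (\<lambda>z. f w (E z)) -` ball x \<epsilon> \<inter> ball x \<epsilon>)" by (rule open_Int) simp
    moreover have "x \<in> E -` T \<inter> (\<lambda>z. f w (E z)) -` ball x \<epsilon> \<inter> ball x \<epsilon>" using Ex y \<epsilon>(1) by simp
    moreover have "E -` T \<inter> (\<lambda>z. f w (E z)) -` ball x \<epsilon> \<inter> ball x \<epsilon> \<subseteq> f w ` T"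
    proof
      fix z assume z: "z \<in> E -` T \<inter> (\<lambda>z. f w (E z)) -` ball x \<epsilon> \<inter> ball x \<epsilon>"
      then have "norm (f w (E z) - z) \<le> M * dist (E (f w (E z))) (E z)" using \<epsilon>(2) by simp
      then have "f w (E z) = z" using f(3)[OF w, of "E z"] z by simp
      then show "z \<in> f w ` T" using z by (metis IntD1 imageI vimageD)
    qed
    ultimately show "\<exists>V. open V \<and> x \<in> V \<and> V \<subseteq> f w ` T" by blast
  qed
  have disj: "f w ` T = f w' ` T" if w: "E w \<in> T" "E w' \<in> T" and x: "x \<in> f w ` T" "x \<in> f w' ` T" for w w' x
  proof -
    obtain y y' where y: "y \<in> T" "x = f w y" "y' \<in> T" "x = f w' y'" using x by blast
    then have "y = y'" using f(3) w by metis
    then have eq: "f w y = f w' y" using y by simp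
    have "f w z = f w' z" if "z \<in> T" for z
      by (rule lift_unique[OF T(2) f(1)[OF w(1)] f(1)[OF w(2)] _ y(1) eq that]) (simp add: f(3) w)
    then show ?thesis by (intro image_cong) auto
  qed
  show ?thesis
  proof (intro exI[of _ v] conjI ballI)
    show "\<Union>v = E -` T"
    proof
      show "\<Union>v \<subseteq> E -` T" using f(3) by (auto simp: v_def)
      show "E -` T \<subseteq> \<Union>v"
      proof
        fix w assume w: "w \<in> E -` T"
        then have "w = f w (E w)" "E w \<in> T" using f(2)[of w] by auto
        then have "w \<in> f w ` T" by blast
        then show "w \<in> \<Union>v" using w unfolding v_def by blast
      qed
    qed
    show "pairwise disjnt v" unfolding pairwise_def disjnt_def v_def using disj by blast
    fix u assume "u \<in> v"
    then obtain w where w: "E w \<in> T" "u = f w ` T" by (auto simp: v_def)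
    show "open u" using op w by simp
    have "homeomorphism u T E (f w)" unfolding w(2)
      by (rule homeomorphismI) (use f(1)[OF w(1)] f(3)[OF w(1)] in \<open>auto intro: continuous_on_subset[OF cont]\<close>)
    then show "\<exists>q. homeomorphism u T E q" by blast
  qed
qed

end

text \<open>Needed because the library states the lifting theorems only for subsets of normed spaces.\<close>

lemma isometric_embedding:
  "\<exists>\<iota> :: 'a::metric_space \<Rightarrow> ('a \<Rightarrow>\<^sub>C real). \<forall>x y. dist (\<iota> x) (\<iota> y) = dist x y"
proof -
  fix x0 :: 'a
  \<comment> \<open>Kuratowski's embedding: subtracting the distance from a base point makes the
    distance functions bounded.\<close>
  define k where "k x y = dist x y - dist x0 y" for x y :: 'a
  have k: "k x \<in> bcontfun" for x
  proof (rule bcontfun_normI[where b = "dist x x0"])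
    show "continuous_on UNIV (k x)" unfolding k_def by (intro continuous_intros)
    show "norm (k x y) \<le> dist x x0" for y
      using dist_triangle[of x y x0] dist_triangle[of x0 y x] by (auto simp: k_def dist_commute abs_le_iff)
  qed
  define \<iota> where "\<iota> x = Bcontfun (k x)" for x
  have ap: "apply_bcontfun (\<iota> x) y = k x y" for x y by (simp add: \<iota>_def Bcontfun_inverse[OF k])
  have "dist (\<iota> x) (\<iota> y) = dist x y" for x y
  proof (rule antisym)
    show "dist (\<iota> x) (\<iota> y) \<le> dist x y"
    proof (rule dist_bound)
      fix z
      show "dist (apply_bcontfun (\<iota> x) z) (apply_bcontfun (\<iota> y) z) \<le> dist x y"
        using dist_triangle[of x z y] dist_triangle[of y z x] by (auto simp: ap k_def dist_real_def dist_commute abs_le_iff)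
    qed
    have "dist (apply_bcontfun (\<iota> x) y) (apply_bcontfun (\<iota> y) y) = dist x y" by (simp add: ap k_def dist_real_def)
    then show "dist x y \<le> dist (\<iota> x) (\<iota> y)" using dist_bounded[of "\<iota> x" y "\<iota> y"] by simp
  qed
  then show ?thesis by blast
qed

text \<open>Surjectivity: the range is open, and local sections show that its complement is open as
  well. Injectivity: \<open>E\<close> is a covering, so the monodromy theorem applies over a simply
  connected base.\<close>

theorem (in expanding_map) bijective:
  assumes sc: "simply_connected (UNIV :: 'a set)" "connected (UNIV :: 'a set)"
    and loc: "\<And>q :: 'a. \<exists>T lp L. open T \<and> q \<in> T \<and> connected T \<and> lines T lp L"
  shows "bij E"
proof (rule bijI)
  show surj: "surj E"
  proof -
    have "open (range E)" using open_map[OF open_UNIV] .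
    moreover have "open (- range E)"
    proof (subst open_subopen, intro ballI)
      fix q assume q: "q \<in> - range E"
      obtain T lp L where T: "open T" "q \<in> T" "connected T" "lines T lp L" using loc by blast
      have "T \<subseteq> - range E"
      proof (rule ccontr)
        assume "\<not> T \<subseteq> - range E"
        then obtain w where "E w \<in> T" by blast
        then obtain f where "\<forall>y\<in>T. E (f y) = y" using section_exists[OF T(4)] by blast
        then show False using q T(2) by (metis ComplD rangeI)
      qed
      then show "\<exists>V. open V \<and> q \<in> V \<and> V \<subseteq> - range E" using T by blast
    qed
    ultimately have "range E = {} \<or> range E = UNIV"
      using sc(2)[unfolded connected_clopen, rule_format, of "range E"] by (simp add: closed_def)
    then show ?thesis by blast
  qed
  obtain \<iota> :: "'a \<Rightarrow> ('a \<Rightarrow>\<^sub>C real)" where \<iota>: "\<And>x y. dist (\<iota> x) (\<iota> y) = dist x y" using isometric_embedding by blast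
  have inj: "\<iota> x = \<iota> y \<longleftrightarrow> x = y" for x y using \<iota>[of x y] by (metis dist_eq_0_iff)
  have c\<iota>: "continuous_on S \<iota>" for S unfolding continuous_on_iff using \<iota> by auto
  define \<kappa> where "\<kappa> = inv \<iota>"
  have \<kappa>: "\<kappa> (\<iota> x) = x" for x unfolding \<kappa>_def by (rule inv_f_f) (simp add: inj_def inj)
  have c\<kappa>: "continuous_on (range \<iota>) \<kappa>" unfolding continuous_on_iff using \<iota> \<kappa> by (auto intro!: exI)
  have hom: "homeomorphism T (\<iota> ` T) \<iota> \<kappa>" for T
    by (rule homeomorphismI) (auto simp: \<kappa> c\<iota> intro: continuous_on_subset[OF c\<kappa>])
  have cov: "covering_space UNIV (\<iota> \<circ> E) (range \<iota>)"
  proof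
    show "continuous_on UNIV (\<iota> \<circ> E)" by (intro continuous_on_compose cont c\<iota>)
    show "(\<iota> \<circ> E) ` UNIV = range \<iota>" using surj by (metis image_comp)
    fix x assume "x \<in> range \<iota>"
    then obtain q where q: "x = \<iota> q" by blast
    obtain T lp L where T: "open T" "q \<in> T" "connected T" "lines T lp L" using loc by blast
    obtain v where v: "\<Union>v = E -` T" "\<forall>u\<in>v. open u" "pairwise disjnt v" "\<forall>u\<in>v. \<exists>q. homeomorphism u T E q"
      using evenly_covered[OF T(1,3,4)] by blast
    have "openin (top_of_set (range \<iota>)) (\<iota> ` T)"
    proof -
      have "\<iota> ` T = range \<iota> \<inter> \<kappa> -` T" using \<kappa> by force
      then show ?thesis using continuous_openin_preimage_gen[OF c\<kappa> T(1)] by simp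
    qed
    moreover have "(\<iota> \<circ> E) -` (\<iota> ` T) = E -` T" using inj by auto
    moreover have "\<exists>q. homeomorphism u (\<iota> ` T) (\<iota> \<circ> E) q" if "u \<in> v" for u
      using v(4) that homeomorphism_compose[OF _ hom] by blast
    ultimately show "\<exists>T. x \<in> T \<and> openin (top_of_set (range \<iota>)) T \<and>
        (\<exists>v. \<Union>v = UNIV \<inter> (\<iota> \<circ> E) -` T \<and> (\<forall>u\<in>v. openin (top_of_set UNIV) u) \<and> pairwise disjnt v \<and>
          (\<forall>u\<in>v. \<exists>q. homeomorphism u T (\<iota> \<circ> E) q))"
      using q T(2) v by (intro exI[of _ "\<iota> ` T"] conjI exI[of _ v]) auto
  qed
  have sc': "simply_connected (range \<iota>)"
    using homeomorphic_simply_connected[of UNIV "range \<iota>"] hom[of UNIV] sc(1) by (auto simp: homeomorphic_def)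
  show "inj E"
  proof (rule injI)
    fix w w' assume eq: "E w = E w'"
    \<comment> \<open>The segment between two points of one fibre projects to a loop. The loop is
      contractible, so its lift from \<open>w\<close> has the same end as the constant lift, that
      is, \<open>w' = w\<close>.\<close>
    let ?g = "\<lambda>t. (\<iota> \<circ> E) (linepath w w' t)"
    let ?b = "\<iota> (E w)"
    have pg: "path ?g" unfolding path_def
      by (rule continuous_on_compose2[OF covering_space_imp_continuous[OF cov]]) (auto intro: continuous_on_linepath)
    have g: "path_image ?g \<subseteq> range \<iota>" "pathstart ?g = ?b" "pathfinish ?g = ?b"
      by (auto simp: path_image_def pathstart_def pathfinish_def linepath_def eq)
    have "homotopic_loops (range \<iota>) ?g (linepath ?b ?b)"
      by (rule sc'[unfolded simply_connected_def, rule_format]) (use pg g in auto)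
    then have "homotopic_paths (range \<iota>) ?g (linepath (pathstart ?g) (pathstart ?g))"
      by (rule homotopic_loops_imp_homotopic_paths_null)
    then have hp: "homotopic_paths (range \<iota>) ?g (linepath ?b ?b)" unfolding g(2) .
    have "pathfinish (linepath w w') = pathfinish (linepath w w)"
      by (rule covering_space_monodromy[OF cov pg g(1) _ _ hp]) (auto simp: linepath_refl linepath_0' path_def pathstart_def intro: continuous_on_linepath)
    then show "w = w'" by simp
  qed
qed

context hadamard begin

section \<open>The exponential map is an expanding bijection\<close>

text \<open>Reading tangent vectors at \<open>z\<close> in a chart gives the exponential map a
  Banach space as domain, as \<open>expanding_map\<close> requires.\<close>

definition expc :: "('a, 'e) chart \<Rightarrow> 'a \<Rightarrow> 'e \<Rightarrow> 'a" where
  "expc c z w = exp_map A g z (tvec_of A c z w)"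

lemma expc_geo:
  assumes c: "c \<in> A" "z \<in> fst c"
  shows "geo (\<lambda>t. expc c z (t *\<^sub>R w))" "velocity A (\<lambda>t. expc c z (t *\<^sub>R w)) 0 = tvec_of A c z w" "expc c z 0 = z"
    "tnorm g z (tvec_of A c z w) = cN c (snd c z) w"
proof -
  show "geo (\<lambda>t. expc c z (t *\<^sub>R w))" "velocity A (\<lambda>t. expc c z (t *\<^sub>R w)) 0 = tvec_of A c z w"
    using exp_geodesic[OF tvec_of_tangent[OF c]] unfolding expc_def tvec_of_scale[OF c] by auto
  have "tvec_of A c z 0 = tscale 0 (tvec_of A c z 0)" using tvec_of_scale[OF c, of 0 0] by simp
  then show "expc c z 0 = z" unfolding expc_def using exp_geodesic(3)[OF tzero_tangent] by simp
  show "tnorm g z (tvec_of A c z w) = cN c (snd c z) w"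
    using tnorm_coord[OF c tvec_of_tangent[OF c], of w] c by simp
qed

lemma expc_dist:
  assumes c: "c \<in> A" "z \<in> fst c"
  shows "dist (expc c z (s *\<^sub>R w)) (expc c z (t *\<^sub>R w)) \<le> cN c (snd c z) w * \<bar>s - t\<bar>"
  using geo_dist[OF expc_geo(1)[OF c, of w], of s t] expc_geo(2-4)[OF c] by (simp add: abs_minus_commute)

lemma expc_continuous:
  assumes c: "c \<in> A" "z \<in> fst c"
  shows "continuous_on S (expc c z)"
  using exp_continuous[OF c] unfolding expc_def[abs_def] by (rule continuous_on_subset) simp

text \<open>The distance between the two rays satisfies the midpoint inequality on short windows
  around every time, uniformly near the compact path of \<open>w0\<close>. It therefore lies below
  its chord, which starts at the value 0.\<close>

lemma expc_local_contraction:
  assumes c: "c \<in> A" "z \<in> fst c"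
  shows "\<exists>\<epsilon>>0. \<forall>w\<in>ball w0 \<epsilon>. \<forall>w'\<in>ball w0 \<epsilon>. \<forall>s\<in>{0..1}.
    dist (expc c z (s *\<^sub>R w)) (expc c z (s *\<^sub>R w')) \<le> s * dist (expc c z w) (expc c z w')"
proof -
  let ?E = "expc c z"
  interpret G: local_geometry "dom c" "Gc c" "DGc c" "\<Gamma>c c" "D\<Gamma>c c" by (rule local_geometry[OF c(1)])
  define good where "good q r \<longleftrightarrow> r > 0 \<and> (\<forall>\<gamma> \<sigma>. geo \<gamma> \<longrightarrow> geo \<sigma> \<longrightarrow> dist (\<gamma> 0) q \<le> r \<longrightarrow> dist (\<sigma> 0) q \<le> r \<longrightarrow>
     tnorm g (\<gamma> 0) (velocity A \<gamma> 0) \<le> r \<longrightarrow> tnorm g (\<sigma> 0) (velocity A \<sigma> 0) \<le> r \<longrightarrow>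
     dist (\<gamma> (1/2)) (\<sigma> (1/2)) \<le> (dist (\<gamma> 0) (\<sigma> 0) + dist (\<gamma> 1) (\<sigma> 1)) / 2)" for q r
  have "\<forall>q. \<exists>r. good q r" using local_convexity unfolding good_def by blast
  then obtain r where r: "\<And>q. good q (r q)" by metis
  let ?S = "(\<lambda>t. ?E (t *\<^sub>R w0)) ` {0..1}"
  have "continuous_on {0..1} (\<lambda>t. ?E (t *\<^sub>R w0))"
    by (rule continuous_on_compose2[OF expc_continuous[OF c, of UNIV]]) (auto intro!: continuous_intros)
  then have "compact ?S" by (rule compact_continuous_image) simp
  moreover have "open (ball q (r q / 2))" for q by simp
  moreover have "x \<in> ball x (r x / 2)" for x using r[of x] by (simp add: good_def)
  then have "?S \<subseteq> (\<Union>q\<in>UNIV. ball q (r q / 2))" by blast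
  ultimately obtain Q where Q: "finite Q" "?S \<subseteq> (\<Union>q\<in>Q. ball q (r q / 2))"
    using compactE_image[of ?S UNIV "\<lambda>q. ball q (r q / 2)"] by metis
  \<comment> \<open>A geodesic starting within \<open>e\<close> of the compact path starts within
    \<open>r q\<close> of some centre \<open>q\<close>: half of the radius comes from the cover and
    at most half from \<open>e\<close>. Inserting 1 keeps the minimum over a nonempty set.\<close>
  define e where "e = Min (insert 1 ((\<lambda>q. r q / 2) ` Q))"
  have fin: "finite (insert 1 ((\<lambda>q. r q / 2) ` Q))" using Q(1) by simp
  have rp: "r q > 0" for q using r[of q] by (simp add: good_def)
  have e: "e > 0" unfolding e_def using fin rp by (subst Min_gr_iff) auto
  have eQ: "e \<le> r q / 2" if "q \<in> Q" for q unfolding e_def using that by (intro Min_le fin) auto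
  have mid: "dist (\<gamma> (1/2)) (\<sigma> (1/2)) \<le> (dist (\<gamma> 0) (\<sigma> 0) + dist (\<gamma> 1) (\<sigma> 1)) / 2"
    if t: "t \<in> {0..1}" and gg: "geo \<gamma>" "geo \<sigma>" and le: "dist (\<gamma> 0) (?E (t *\<^sub>R w0)) \<le> e" "dist (\<sigma> 0) (?E (t *\<^sub>R w0)) \<le> e"
      "tnorm g (\<gamma> 0) (velocity A \<gamma> 0) \<le> e" "tnorm g (\<sigma> 0) (velocity A \<sigma> 0) \<le> e" for t \<gamma> \<sigma>
  proof -
    obtain q where q: "q \<in> Q" "dist q (?E (t *\<^sub>R w0)) < r q / 2" using subsetD[OF Q(2) imageI[OF t]] by auto
    have "dist (\<gamma> 0) q \<le> r q" "dist (\<sigma> 0) q \<le> r q" "tnorm g (\<gamma> 0) (velocity A \<gamma> 0) \<le> r q" "tnorm g (\<sigma> 0) (velocity A \<sigma> 0) \<le> r q"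
      using eQ[OF q(1)] q(2) le rp[of q] dist_triangle[of "\<gamma> 0" q "?E (t *\<^sub>R w0)"] dist_triangle[of "\<sigma> 0" q "?E (t *\<^sub>R w0)"]
      by (auto simp: dist_commute[of _ q])
    then show ?thesis using r[of q] gg unfolding good_def by blast
  qed
  obtain R C where R: "R > 0" "cbounds c (cball (snd c z) R) C" using cbounds_at[OF c] by blast
  note C = cboundsD[OF R(2) c(1)]
  define V where "V = C * (norm w0 + 1)"
  have V: "V > 0" using C(1) by (auto simp: V_def intro!: mult_pos_pos add_nonneg_pos)
  have NV: "cN c (snd c z) w \<le> V" if "dist w w0 \<le> 1" for w
  proof -
    have "norm w \<le> norm w0 + 1" using that norm_triangle_sub[of w w0] by (simp add: dist_norm)
    then have "C * norm w \<le> V" unfolding V_def using C(1) by (intro mult_left_mono) auto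
    then show ?thesis using C(5)[of "snd c z" w] R(1) by simp
  qed
  have "continuous_on ({0..1} \<times> cball w0 1) (\<lambda>x. ?E (fst x *\<^sub>R snd x))"
    by (rule continuous_on_compose2[OF expc_continuous[OF c, of UNIV]]) (auto intro!: continuous_intros)
  then have "uniformly_continuous_on ({0..1} \<times> cball w0 1) (\<lambda>x. ?E (fst x *\<^sub>R snd x))"
    by (rule compact_uniformly_continuous) (intro compact_Times compact_Icc compact_cball)
  then obtain d where d: "d > 0" "\<forall>x\<in>{0..1} \<times> cball w0 1. \<forall>x'\<in>{0..1} \<times> cball w0 1. dist x' x < d \<longrightarrow>
      dist (?E (fst x' *\<^sub>R snd x')) (?E (fst x *\<^sub>R snd x)) < e"
    unfolding uniformly_continuous_on_def using e by blast
  define \<epsilon> where "\<epsilon> = min d 1"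
  have \<epsilon>: "\<epsilon> > 0" "\<epsilon> \<le> d" "\<epsilon> \<le> 1" using d(1) by (auto simp: \<epsilon>_def)
  show ?thesis
  proof (intro exI[of _ \<epsilon>] conjI \<epsilon>(1) ballI)
    fix w w' and s :: real assume w: "w \<in> ball w0 \<epsilon>" "w' \<in> ball w0 \<epsilon>" and s: "s \<in> {0..1}"
    have near: "dist (?E (t *\<^sub>R v)) (?E (t *\<^sub>R w0)) \<le> e" if "t \<in> {0..1}" "v \<in> ball w0 \<epsilon>" for t v
    proof -
      have "dist (?E (fst (t, v) *\<^sub>R snd (t, v))) (?E (fst (t, w0) *\<^sub>R snd (t, w0))) < e"
        by (rule d(2)[rule_format]) (use that \<epsilon> in \<open>auto simp: dist_Pair_Pair dist_commute\<close>)
      then show ?thesis by simp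
    qed
    define f where "f t = dist (?E (t *\<^sub>R w)) (?E (t *\<^sub>R w'))" for t
    have cE: "continuous_on {0..1} (\<lambda>t. ?E (t *\<^sub>R v))" for v
      by (rule continuous_on_compose2[OF expc_continuous[OF c, of UNIV]]) (auto intro!: continuous_intros)
    have "f s \<le> (1 - s) * f 0 + s * f 1"
    proof (rule midpoint_convex_imp_below_chord[OF _ s])
      show "continuous_on {0..1} f" unfolding f_def by (intro continuous_intros cE)
      fix t :: real assume t: "0 < t" "t < 1"
      \<comment> \<open>Half the length of the window around \<open>t\<close>. Its piece of a ray,
        reparametrized over the unit interval as \<open>X\<close>, has speed at most
        \<open>2 * h * V \<le> e\<close>.\<close>
      define h where "h = min (min t (1 - t)) (e / (2 * V))"
      have h: "h > 0" "h \<le> t" "h \<le> 1 - t" "h \<le> e / (2 * V)" using t e V by (auto simp: h_def)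
      have hV: "2 * h * V \<le> e" using h(4) V by (simp add: pos_le_divide_eq mult_ac)
      define X where "X v u = ?E ((2 * h * u + (t - h)) *\<^sub>R v)" for v u
      have X: "geo (X v)" "tnorm g (X v 0) (velocity A (X v) 0) \<le> e" "dist (X v 0) (?E ((t - h) *\<^sub>R w0)) \<le> e"
        if v: "v \<in> ball w0 \<epsilon>" for v
      proof -
        note a = geo_affine[OF expc_geo(1)[OF c, of v], of "2 * h" "t - h"]
        show "geo (X v)" unfolding X_def[abs_def] by (rule a(1))
        have "tnorm g (X v 0) (velocity A (X v) 0) =
          tnorm g (?E ((t - h) *\<^sub>R v)) (tscale (2 * h) (velocity A (\<lambda>u. ?E (u *\<^sub>R v)) (t - h)))"
          unfolding X_def[abs_def] a(2) by simp
        also have "\<dots> = 2 * h * tnorm g (?E ((t - h) *\<^sub>R v)) (velocity A (\<lambda>u. ?E (u *\<^sub>R v)) (t - h))"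
          using tnorm_scale[OF geo_velocity[OF expc_geo(1)[OF c, of v]]] h(1) by simp
        also have "tnorm g (?E ((t - h) *\<^sub>R v)) (velocity A (\<lambda>u. ?E (u *\<^sub>R v)) (t - h)) = cN c (snd c z) v"
          using geo_speed[OF expc_geo(1)[OF c, of v], of "t - h"] expc_geo(2-4)[OF c] by simp
        also have "2 * h * cN c (snd c z) v \<le> 2 * h * V"
          using NV[of v] v \<epsilon>(3) h(1) by (intro mult_left_mono) (auto simp: dist_commute)
        finally show "tnorm g (X v 0) (velocity A (X v) 0) \<le> e" using hV by simp
        show "dist (X v 0) (?E ((t - h) *\<^sub>R w0)) \<le> e" unfolding X_def using near[OF _ v, of "t - h"] h t by simp
      qed
      have "dist (X w (1/2)) (X w' (1/2)) \<le> (dist (X w 0) (X w' 0) + dist (X w 1) (X w' 1)) / 2"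
        by (rule mid[of "t - h"]) (use X[OF w(1)] X[OF w(2)] h t in auto)
      then have "f t \<le> (f (t - h) + f (t + h)) / 2" by (simp add: X_def f_def add.commute)
      then show "\<exists>d>0. d \<le> t \<and> d \<le> 1 - t \<and> f t \<le> (f (t - d) + f (t + d)) / 2" using h by blast
    qed
    then show "dist (?E (s *\<^sub>R w)) (?E (s *\<^sub>R w')) \<le> s * dist (?E w) (?E w')" by (simp add: f_def)
  qed
qed

text \<open>The initial velocity of a single ray, taken one direction at a time; only right-hand
  limits enter the contraction argument.\<close>

lemma expc_coord_derivative:
  assumes c: "c \<in> A" "z \<in> fst c"
  shows "((\<lambda>s. (snd c (expc c z (s *\<^sub>R w)) - snd c z) /\<^sub>R s) \<longlongrightarrow> w) (at_right 0)"
proof -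
  let ?\<gamma> = "\<lambda>t. expc c z (t *\<^sub>R w)"
  have g0: "?\<gamma> 0 \<in> fst c" using expc_geo(3)[OF c] c by simp
  obtain \<delta> where \<delta>: "\<delta> > 0" "csol c {0-\<delta><..<0+\<delta>} (snd c \<circ> ?\<gamma>) (\<lambda>t. velocity A ?\<gamma> t c)"
    using geodesic_chart_nbhd[OF expc_geo(1)[OF c, of w] open_UNIV UNIV_I c(1) g0] by blast
  have "(snd c \<circ> ?\<gamma> has_vector_derivative velocity A ?\<gamma> 0 c) (at 0)"
    using csolD(2)[OF \<delta>(2) c(1), of 0] \<delta>(1) by simp
  moreover have "velocity A ?\<gamma> 0 c = w" using expc_geo(2)[OF c, of w] c by simp
  ultimately have lim: "(\<lambda>h. norm (snd c (?\<gamma> h) - snd c z - h *\<^sub>R w) / norm h) \<midarrow>0\<rightarrow> 0"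
    using expc_geo(3)[OF c] by (simp add: has_vector_derivative_def has_derivative_at)
  have "(\<lambda>h. norm ((snd c (?\<gamma> h) - snd c z) /\<^sub>R h - w)) \<midarrow>0\<rightarrow> 0"
  proof (rule Lim_transform_eventually[OF lim])
    have "norm (x - h *\<^sub>R w) / norm h = norm (x /\<^sub>R h - w)" if "h \<noteq> 0" for h :: real and x
    proof -
      have "x /\<^sub>R h - w = (x - h *\<^sub>R w) /\<^sub>R h" using that by (simp add: scaleR_diff_right)
      then show ?thesis by (simp add: divide_inverse mult.commute)
    qed
    then show "\<forall>\<^sub>F h in at 0. norm (snd c (?\<gamma> h) - snd c z - h *\<^sub>R w) / norm h = norm ((snd c (?\<gamma> h) - snd c z) /\<^sub>R h - w)"
      by (simp add: eventually_at_filter)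
  qed
  then have "((\<lambda>h. (snd c (?\<gamma> h) - snd c z) /\<^sub>R h) \<longlongrightarrow> w) (at 0)"
    by (rule LIM_zero_cancel[OF tendsto_norm_zero_cancel])
  then show ?thesis by (rule filterlim_mono) (simp_all add: at_le)
qed

text \<open>Divide the contraction inequality by \<open>s\<close> and let it tend to 0. Near
  \<open>z\<close> the distance is at least \<open>1 - \<epsilon>\<close> times the coordinate norm,
  and the difference quotients tend to \<open>w\<close> and \<open>w'\<close>.\<close>

lemma norm_diff_le_of_contraction:
  assumes c: "c \<in> A" "z \<in> fst c"
    and le: "\<And>s. s \<in> {0..1} \<Longrightarrow> dist (expc c z (s *\<^sub>R w)) (expc c z (s *\<^sub>R w')) \<le> s * D"
  shows "cN c (snd c z) (w - w') \<le> D"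
proof -
  interpret G: local_geometry "dom c" "Gc c" "DGc c" "\<Gamma>c c" "D\<Gamma>c c" by (rule local_geometry[OF c(1)])
  have bound: "(1 - \<epsilon>) * cN c (snd c z) (w - w') \<le> D" if \<epsilon>: "0 < \<epsilon>" for \<epsilon>
  proof -
    obtain \<delta> where \<delta>: "\<delta> > 0" "\<forall>x\<in>fst c. \<forall>y\<in>fst c. dist (snd c x) (snd c z) < \<delta> \<longrightarrow> dist (snd c y) (snd c z) < \<delta> \<longrightarrow>
      (1 - \<epsilon>) * cN c (snd c z) (snd c y - snd c x) \<le> dist x y \<and> dist x y \<le> (1 + \<epsilon>) * cN c (snd c z) (snd c y - snd c x)"
      using dist_comparison[OF c \<epsilon>] by blast
    have near: "\<forall>\<^sub>F s in at_right 0. expc c z (s *\<^sub>R v) \<in> {x \<in> fst c. dist (snd c x) (snd c z) < \<delta>}" for v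
    proof -
      have "continuous_on UNIV (\<lambda>s. expc c z (s *\<^sub>R v))"
        by (rule continuous_on_compose2[OF expc_continuous[OF c, of UNIV]]) (auto intro!: continuous_intros)
      then have "isCont (\<lambda>s. expc c z (s *\<^sub>R v)) 0" by (simp add: continuous_on_eq_continuous_at)
      then have "((\<lambda>s. expc c z (s *\<^sub>R v)) \<longlongrightarrow> z) (at 0)" using expc_geo(3)[OF c] by (simp add: isCont_def)
      then have "((\<lambda>s. expc c z (s *\<^sub>R v)) \<longlongrightarrow> z) (at_right 0)" by (rule filterlim_mono) (simp_all add: at_le)
      from topological_tendstoD[OF this chart_ball_nbhd[OF c \<delta>(1)]] show ?thesis .
    qed
    have s01: "\<forall>\<^sub>F s in at_right (0::real). s \<in> {0<..<1}"
      unfolding eventually_at_right_field by (intro exI[of _ 1]) auto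
    let ?q = "\<lambda>v s. (snd c (expc c z (s *\<^sub>R v)) - snd c z) /\<^sub>R s"
    have ev: "\<forall>\<^sub>F s in at_right 0. (1 - \<epsilon>) * cN c (snd c z) (?q w s - ?q w' s) \<le> D"
      using near[of w] near[of w'] s01
    proof eventually_elim
      case (elim s)
      define n where "n = cN c (snd c z) (snd c (expc c z (s *\<^sub>R w)) - snd c (expc c z (s *\<^sub>R w')))"
      have "(1 - \<epsilon>) * n \<le> s * D"
        using \<delta>(2) elim le[of s] unfolding n_def by (fastforce simp: dist_commute)
      moreover have "?q w s - ?q w' s = inverse s *\<^sub>R (snd c (expc c z (s *\<^sub>R w)) - snd c (expc c z (s *\<^sub>R w')))"
        by (simp add: scaleR_diff_right)
      then have "cN c (snd c z) (?q w s - ?q w' s) = n / s" using elim by (simp add: G.N_scale n_def divide_inverse)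
      ultimately show ?case using elim by (simp add: pos_divide_le_eq mult.commute)
    qed
    have "((\<lambda>s. (1 - \<epsilon>) * cN c (snd c z) (?q w s - ?q w' s)) \<longlongrightarrow> (1 - \<epsilon>) * cN c (snd c z) (w - w')) (at_right 0)"
      unfolding G.N_def by (intro tendsto_intros blinfun.tendsto expc_coord_derivative[OF c])
    then show ?thesis by (rule tendsto_upperbound[OF _ ev]) simp
  qed
  show ?thesis
  proof (rule field_le_mult_one_interval)
    fix x :: real assume "0 < x" "x < 1"
    then show "x * cN c (snd c z) (w - w') \<le> D" using bound[of "1 - x"] by simp
  qed
qed

text \<open>Expansion follows from the local contraction in the limit at 0 and implies local
  injectivity. Invariance of domain, applied in a chart around the image point, then yields
  openness.\<close>

lemma expc_expanding_map:
  assumes c: "c \<in> A" "z \<in> fst c"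
  shows "\<exists>M. expanding_map (expc c z) M"
proof -
  let ?E = "expc c z"
  obtain R C where R: "R > 0" "cbounds c (cball (snd c z) R) C" using cbounds_at[OF c] by blast
  note C = cboundsD[OF R(2) c(1)]
  have expanding: "\<exists>\<epsilon>>0. \<forall>u\<in>ball w \<epsilon>. \<forall>v\<in>ball w \<epsilon>. norm (u - v) \<le> C * dist (?E u) (?E v)" for w
  proof -
    obtain \<epsilon> where \<epsilon>: "\<epsilon> > 0" "\<forall>u\<in>ball w \<epsilon>. \<forall>v\<in>ball w \<epsilon>. \<forall>s\<in>{0..1}. dist (?E (s *\<^sub>R u)) (?E (s *\<^sub>R v)) \<le> s * dist (?E u) (?E v)"
      using expc_local_contraction[OF c] by blast
    have "norm (u - v) \<le> C * dist (?E u) (?E v)" if uv: "u \<in> ball w \<epsilon>" "v \<in> ball w \<epsilon>" for u v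
    proof -
      have "norm (u - v) \<le> C * cN c (snd c z) (u - v)" using C(6) R(1) by simp
      also have "\<dots> \<le> C * dist (?E u) (?E v)"
        using norm_diff_le_of_contraction[OF c, of u v "dist (?E u) (?E v)"] \<epsilon>(2) uv C(1) by (intro mult_left_mono) (blast, simp)
      finally show ?thesis .
    qed
    then show ?thesis using \<epsilon>(1) by blast
  qed
  have "open (?E ` V)" if V: "open V" for V
  proof (subst open_subopen, intro ballI)
    fix x assume "x \<in> ?E ` V"
    then obtain w where w: "w \<in> V" "x = ?E w" by blast
    obtain \<epsilon> where \<epsilon>: "\<epsilon> > 0" "\<forall>u\<in>ball w \<epsilon>. \<forall>v\<in>ball w \<epsilon>. norm (u - v) \<le> C * dist (?E u) (?E v)"
      using expanding by blast
    obtain c' where c': "c' \<in> A" "x \<in> fst c'" by (rule chart_at)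
    define U where "U = V \<inter> ball w \<epsilon> \<inter> ?E -` fst c'"
    have oU: "open U" unfolding U_def
      by (intro open_Int V open_ball open_vimage chart_open(1)[OF c'(1)] expc_continuous[OF c])
    have sub: "?E ` U \<subseteq> fst c'" by (auto simp: U_def)
    have "inj_on (snd c' \<circ> ?E) U"
    proof (rule inj_onI)
      fix u v assume uv: "u \<in> U" "v \<in> U" "(snd c' \<circ> ?E) u = (snd c' \<circ> ?E) v"
      then have "?E u = ?E v" using chart_inv_chart[OF c'(1)] sub by (metis comp_apply image_subset_iff)
      moreover have "norm (u - v) \<le> C * dist (?E u) (?E v)" using \<epsilon>(2) uv by (auto simp: U_def)
      ultimately show "u = v" by simp
    qed
    moreover have "continuous_on U (snd c' \<circ> ?E)"
      by (intro continuous_on_compose expc_continuous[OF c] continuous_on_subset[OF chart_cont(1)[OF c'(1)] sub])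
    ultimately have oW: "open ((snd c' \<circ> ?E) ` U)" using invariance_of_domain oU by blast
    have "?E ` U = fst c' \<inter> snd c' -` ((snd c' \<circ> ?E) ` U)"
    proof
      show "fst c' \<inter> snd c' -` (snd c' \<circ> ?E) ` U \<subseteq> ?E ` U"
      proof
        fix y assume "y \<in> fst c' \<inter> snd c' -` (snd c' \<circ> ?E) ` U"
        then obtain u where u: "y \<in> fst c'" "u \<in> U" "snd c' y = snd c' (?E u)" by auto
        then have "y = ?E u" using chart_inv_chart[OF c'(1)] sub by (metis image_subset_iff)
        then show "y \<in> ?E ` U" using u by blast
      qed
    qed (use sub in auto)
    then have "open (?E ` U)"
      using continuous_open_preimage[OF chart_cont(1)[OF c'(1)] chart_open(1)[OF c'(1)] oW] by simp
    moreover have "x \<in> ?E ` U" using w \<epsilon>(1) c'(2) by (auto simp: U_def)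
    ultimately show "\<exists>T. open T \<and> x \<in> T \<and> T \<subseteq> ?E ` V" by (intro exI[of _ "?E ` U"]) (auto simp: U_def)
  qed
  then have "expanding_map ?E C"
    using C(1) expc_continuous[OF c] expanding by unfold_locales auto
  then show ?thesis by blast
qed

text \<open>Coordinate segments in a small ball. Comparison of distance and norm with relative error
  1/2 costs the factors 3/2 and 2, hence the constant 3.\<close>

lemma local_lines: fixes q :: 'a shows "\<exists>T lp L. open T \<and> q \<in> T \<and> connected T \<and> lines T lp L"
proof -
  obtain c where c: "c \<in> A" "q \<in> fst c" by (rule chart_at)
  interpret G: local_geometry "dom c" "Gc c" "DGc c" "\<Gamma>c c" "D\<Gamma>c c" by (rule local_geometry[OF c(1)])
  obtain R C where R: "R > 0" "cbounds c (cball (snd c q) R) C" using cbounds_at[OF c] by blast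
  note C = cboundsD[OF R(2) c(1)]
  have half: "(0::real) < 1 / 2" by simp
  obtain \<delta> where \<delta>: "\<delta> > 0" and cmp: "\<forall>x\<in>fst c. \<forall>y\<in>fst c. dist (snd c x) (snd c q) < \<delta> \<longrightarrow> dist (snd c y) (snd c q) < \<delta> \<longrightarrow>
    (1 - 1 / 2) * cN c (snd c q) (snd c y - snd c x) \<le> dist x y \<and> dist x y \<le> (1 + 1 / 2) * cN c (snd c q) (snd c y - snd c x)"
    using dist_comparison[OF c half] by blast
  define r where "r = min \<delta> R"
  have r: "r > 0" "r \<le> \<delta>" "r \<le> R" using \<delta> R by (auto simp: r_def)
  let ?N = "cN c (snd c q)"
  have qd: "snd c q \<in> dom c" using c by simp
  define T where "T = {x \<in> fst c. dist (snd c x) (snd c q) < r}"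
  define B where "B = ball (snd c q) r"
  have BD: "B \<subseteq> dom c" using C(2) r by (auto simp: B_def subset_iff)
  have TB: "snd c x \<in> B" if "x \<in> T" for x using that by (auto simp: T_def B_def dist_commute)
  have BT: "chart_inv c u \<in> T \<and> snd c (chart_inv c u) = u" if "u \<in> B" for u
    using that BD c(1) by (auto simp: T_def B_def dist_commute subset_iff)
  have up: "dist x y \<le> 3 / 2 * ?N (snd c y - snd c x)" and lo: "?N (snd c y - snd c x) \<le> 2 * dist x y"
    if "x \<in> T" "y \<in> T" for x y using cmp that r by (fastforce simp: T_def)+
  have cx: "u + t *\<^sub>R (v - u) \<in> B" if "u \<in> B" "v \<in> B" "t \<in> {0..1}" for u v and t :: real
  proof -
    have "(1 - t) *\<^sub>R u + t *\<^sub>R v \<in> B" unfolding B_def by (rule convexD[OF convex_ball]) (use that in \<open>auto simp: B_def\<close>)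
    then show ?thesis by (simp add: algebra_simps)
  qed
  define lp where "lp x y t = chart_inv c (snd c x + t *\<^sub>R (snd c y - snd c x))" for x y and t :: real
  have lpT: "lp x y t \<in> T" "snd c (lp x y t) = snd c x + t *\<^sub>R (snd c y - snd c x)"
    if "x \<in> T" "y \<in> T" "t \<in> {0..1}" for x y t
    using BT[OF cx[OF TB[OF that(1)] TB[OF that(2)] that(3)]] by (auto simp: lp_def)
  have "lines T lp 3" unfolding lines_def
  proof (intro conjI ballI)
    fix x y assume xy: "x \<in> T" "y \<in> T"
    show "lp x y 0 = x" "lp x y 1 = y" using xy c(1) by (auto simp: lp_def T_def)
    fix t :: real assume t: "t \<in> {0..1}"
    {
      fix s :: real assume s: "s \<in> {0..1}"
      have "snd c (lp x y t) - snd c (lp x y s) = (t - s) *\<^sub>R (snd c y - snd c x)"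
        using lpT(2)[OF xy s] lpT(2)[OF xy t] by (simp add: algebra_simps)
      then have "dist (lp x y s) (lp x y t) \<le> 3 / 2 * (\<bar>t - s\<bar> * ?N (snd c y - snd c x))"
        using up[OF lpT(1)[OF xy s] lpT(1)[OF xy t]] by (simp add: G.N_scale)
      also have "\<dots> \<le> 3 / 2 * (\<bar>t - s\<bar> * (2 * dist x y))" using lo[OF xy] by (intro mult_left_mono) auto
      finally show "dist (lp x y s) (lp x y t) \<le> 3 * dist x y * \<bar>s - t\<bar>" by (simp add: mult_ac abs_minus_commute)
    }
    fix y' assume y': "y' \<in> T"
    have "snd c (lp x y' t) - snd c (lp x y t) = t *\<^sub>R (snd c y' - snd c y)"
      unfolding lpT(2)[OF xy t] lpT(2)[OF xy(1) y' t] by (simp add: algebra_simps)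
    then have "dist (lp x y t) (lp x y' t) \<le> 3 / 2 * (t * ?N (snd c y' - snd c y))"
      using up[OF lpT(1)[OF xy t] lpT(1)[OF xy(1) y' t]] t by (simp add: G.N_scale)
    also have "\<dots> \<le> 3 / 2 * (1 * (2 * dist y y'))" using lo[OF xy(2) y'] t G.N_nonneg[OF qd] by (intro mult_left_mono mult_mono) auto
    finally show "dist (lp x y t) (lp x y' t) \<le> 3 * dist y y'" by simp
  qed simp
  moreover have "open T" "q \<in> T" using chart_ball_nbhd[OF c r(1)] by (auto simp: T_def)
  moreover have "connected T"
  proof -
    have "T = chart_inv c ` B"
    proof
      show "T \<subseteq> chart_inv c ` B"
      proof
        fix x assume x: "x \<in> T"
        then have "x = chart_inv c (snd c x)" using c(1) by (simp add: T_def)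
        then show "x \<in> chart_inv c ` B" using TB[OF x] by blast
      qed
    qed (use BT in auto)
    then show ?thesis unfolding B_def[symmetric]
      using connected_continuous_image[OF continuous_on_subset[OF chart_cont(2)[OF c(1)] BD]] connected_ball by (metis B_def)
  qed
  ultimately show ?thesis by blast
qed

lemma expc_bij:
  assumes c: "c \<in> A" "z \<in> fst c" shows "bij (expc c z)" "continuous_on UNIV (inv (expc c z))"
proof -
  obtain M where "expanding_map (expc c z) M" using expc_expanding_map[OF c] by blast
  then interpret E: expanding_map "expc c z" M .
  show b: "bij (expc c z)"
    by (rule E.bijective) (use hadamard connected_UNIV_manifold local_lines in \<open>auto simp: hadamard_manifold_def\<close>)
  show "continuous_on UNIV (inv (expc c z))"
    unfolding continuous_on_open_vimage[OF open_UNIV]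
    using E.open_map bij_vimage_eq_inv_image[OF bij_imp_bij_inv[OF b]] inv_inv_eq[OF b] by simp
qed

text \<open>The local contraction holds on short arcs of a curve in the tangent space, with
  increments of the length function \<open>l\<close> on the right. Continuous induction telescopes
  them into \<open>s * l 1\<close>, and \<open>\<eta>\<close> is arbitrary.\<close>

lemma expc_contraction:
  assumes c: "c \<in> A" "z \<in> fst c" and s: "s \<in> {0..1}"
  shows "dist (expc c z (s *\<^sub>R w)) (expc c z (s *\<^sub>R w')) \<le> s * dist (expc c z w) (expc c z w')"
proof (rule field_le_epsilon)
  let ?E = "expc c z"
  fix \<eta> :: real assume \<eta>: "\<eta> > 0"
  obtain \<gamma> :: "real \<Rightarrow> 'a" and l where \<gamma>: "continuous_on {0..1} \<gamma>" "\<gamma> 0 = ?E w" "\<gamma> 1 = ?E w'" "l 0 = 0"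
    "l 1 \<le> dist (?E w) (?E w') + \<eta>" "\<forall>s t. 0 \<le> s \<longrightarrow> s \<le> t \<longrightarrow> t \<le> 1 \<longrightarrow> dist (\<gamma> s) (\<gamma> t) \<le> l t - l s"
    using almost_minimizing_curve[OF \<eta>, of "?E w" "?E w'"] by blast
  note bij = expc_bij[OF c]
  \<comment> \<open>The almost minimizing curve is pulled back by the inverse of the exponential
    map, which is continuous because that map is open.\<close>
  define k where "k t = inv ?E (\<gamma> t)" for t
  have Ek: "?E (k t) = \<gamma> t" for t unfolding k_def using bij(1) by (simp add: bij_is_surj surj_f_inv_f)
  have k: "k 0 = w" "k 1 = w'" unfolding k_def \<gamma>(2,3) using bij(1) by (simp_all add: bij_is_inj)
  have ck: "continuous_on {0..1} k" unfolding k_def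
    by (rule continuous_on_compose2[OF bij(2) \<gamma>(1)]) simp
  have loc: "\<exists>\<tau>>0. \<forall>u\<in>{0..1}. \<forall>v\<in>{0..1}. u \<le> v \<longrightarrow> \<bar>u - t\<bar> < \<tau> \<longrightarrow> \<bar>v - t\<bar> < \<tau> \<longrightarrow> dist (?E (s *\<^sub>R k u)) (?E (s *\<^sub>R k v)) \<le> s * (l v - l u)"
    if t: "t \<in> {0..1}" for t
  proof -
    obtain \<epsilon> where \<epsilon>: "\<epsilon> > 0" "\<forall>u\<in>ball (k t) \<epsilon>. \<forall>v\<in>ball (k t) \<epsilon>. \<forall>s\<in>{0..1}. dist (?E (s *\<^sub>R u)) (?E (s *\<^sub>R v)) \<le> s * dist (?E u) (?E v)"
      using expc_local_contraction[OF c] by blast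
    obtain \<tau> where \<tau>: "\<tau> > 0" "\<forall>u\<in>{0..1}. dist u t < \<tau> \<longrightarrow> dist (k u) (k t) < \<epsilon>"
      using ck t \<epsilon>(1) unfolding continuous_on_iff by blast
    show ?thesis
    proof (intro exI[of _ \<tau>] conjI \<tau>(1) ballI impI)
      fix u v :: real assume uv: "u \<in> {0..1}" "v \<in> {0..1}" "u \<le> v" "\<bar>u - t\<bar> < \<tau>" "\<bar>v - t\<bar> < \<tau>"
      have "dist (?E (s *\<^sub>R k u)) (?E (s *\<^sub>R k v)) \<le> s * dist (\<gamma> u) (\<gamma> v)"
        using \<epsilon>(2) \<tau>(2) uv s unfolding Ek[symmetric] by (auto simp: dist_real_def dist_commute[of "k t"])
      also have "\<dots> \<le> s * (l v - l u)" using \<gamma>(6) uv s by (intro mult_left_mono) auto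
      finally show "dist (?E (s *\<^sub>R k u)) (?E (s *\<^sub>R k v)) \<le> s * (l v - l u)" .
    qed
  qed
  have "dist (?E (s *\<^sub>R w)) (?E (s *\<^sub>R k t)) \<le> s * l t" if "t \<in> {0..1}" for t
    using zero_le_one
  proof (induction t rule: real_induct)
    case base
    show ?case using k \<gamma>(4) by simp
  next
    case (step t)
    then have t: "t \<in> {0..1}" and IH: "dist (?E (s *\<^sub>R w)) (?E (s *\<^sub>R k t)) \<le> s * l t" by auto
    obtain \<tau> where \<tau>: "\<tau> > 0" "\<forall>u\<in>{0..1}. \<forall>v\<in>{0..1}. u \<le> v \<longrightarrow> \<bar>u - t\<bar> < \<tau> \<longrightarrow> \<bar>v - t\<bar> < \<tau> \<longrightarrow>
      dist (?E (s *\<^sub>R k u)) (?E (s *\<^sub>R k v)) \<le> s * (l v - l u)" using loc[OF t] by blast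
    have "dist (?E (s *\<^sub>R w)) (?E (s *\<^sub>R k v)) \<le> s * l v" if v: "t < v" "v < t + \<tau>" "v \<le> 1" for v
    proof -
      have "dist (?E (s *\<^sub>R k t)) (?E (s *\<^sub>R k v)) \<le> s * (l v - l t)"
        by (rule \<tau>(2)[rule_format]) (use v t \<tau>(1) in auto)
      then show ?thesis using IH dist_triangle[of "?E (s *\<^sub>R w)" "?E (s *\<^sub>R k v)" "?E (s *\<^sub>R k t)"]
        by (simp add: right_diff_distrib)
    qed
    then show ?case using \<tau>(1) by (intro exI[of _ "t + \<tau>"]) auto
  next
    case (lim t)
    then have t: "t \<in> {0..1}" by simp
    obtain \<tau> where \<tau>: "\<tau> > 0" "\<forall>u\<in>{0..1}. \<forall>v\<in>{0..1}. u \<le> v \<longrightarrow> \<bar>u - t\<bar> < \<tau> \<longrightarrow> \<bar>v - t\<bar> < \<tau> \<longrightarrow>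
      dist (?E (s *\<^sub>R k u)) (?E (s *\<^sub>R k v)) \<le> s * (l v - l u)" using loc[OF t] by blast
    define u where "u = max 0 (t - \<tau> / 2)"
    have u: "u \<in> {0..<t}" "\<bar>u - t\<bar> < \<tau>" using lim(1,2) \<tau>(1) by (auto simp: u_def)
    have "dist (?E (s *\<^sub>R k u)) (?E (s *\<^sub>R k t)) \<le> s * (l t - l u)"
      by (rule \<tau>(2)[rule_format]) (use u t \<tau>(1) in auto)
    then show ?case using lim(3)[OF u(1)] dist_triangle[of "?E (s *\<^sub>R w)" "?E (s *\<^sub>R k t)" "?E (s *\<^sub>R k u)"]
      by (simp add: right_diff_distrib)
  qed (use that in simp)
  from this[of 1] have "dist (?E (s *\<^sub>R w)) (?E (s *\<^sub>R w')) \<le> s * l 1" using k by simp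
  also have "\<dots> \<le> s * (dist (?E w) (?E w') + \<eta>)" using \<gamma>(5) s by (intro mult_left_mono) auto
  also have "\<dots> \<le> s * dist (?E w) (?E w') + \<eta>" using s \<eta> mult_right_mono[of s 1 \<eta>] by (simp add: distrib_left)
  finally show "dist (?E (s *\<^sub>R w)) (?E (s *\<^sub>R w')) \<le> s * dist (?E w) (?E w') + \<eta>" .
qed

lemma expc_expansion:
  assumes c: "c \<in> A" "z \<in> fst c"
  shows "cN c (snd c z) (w - w') \<le> dist (expc c z w) (expc c z w')"
  using norm_diff_le_of_contraction[OF c expc_contraction[OF c]] .

section \<open>Consequences for the exponential map\<close>

lemma exp_map_expc: "c \<in> A \<Longrightarrow> x \<in> fst c \<Longrightarrow> v \<in> T x \<Longrightarrow> exp_map A g x (tscale t v) = expc c x (t *\<^sub>R v c)"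
  by (simp add: expc_def tvec_of_scale tvec_of_coord)

lemma exp_map_bij: "bij_betw (exp_map A g x) (T x) UNIV"
proof -
  obtain c where c: "c \<in> A" "x \<in> fst c" by (rule chart_at)
  have e: "exp_map A g x v = expc c x (v c)" if "v \<in> T x" for v using exp_map_expc[OF c that, of 1] by simp
  show ?thesis
    unfolding bij_betw_def
  proof
    show "inj_on (exp_map A g x) (T x)"
      by (rule inj_onI) (metis e bij_is_inj[OF expc_bij(1)[OF c]] injD tangent_eqI c)
    show "exp_map A g x ` T x = UNIV"
    proof -
      have "y \<in> exp_map A g x ` T x" for y
      proof -
        obtain w where "y = expc c x w" using bij_is_surj[OF expc_bij(1)[OF c]] by (metis surjD)
        then show ?thesis using tvec_of_tangent[OF c, of w] by (auto simp: expc_def)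
      qed
      then show ?thesis by blast
    qed
  qed
qed

lemma exp_inv_facts:
  "exp_inv A g x y \<in> T x" "exp_map A g x (exp_inv A g x y) = y"
  using exp_map_bij[of x] unfolding exp_inv_def bij_betw_def
  by (metis UNIV_I inv_into_into, metis UNIV_I f_inv_into_f)

text \<open>The lower bound is the expansion inequality against the zero vector, the upper bound the
  length of the geodesic. Thus geodesics from \<open>x\<close> are minimizing.\<close>

lemma dist_exp_map:
  assumes v: "v \<in> T x" shows "dist x (exp_map A g x v) = tnorm g x v"
proof -
  obtain c where c: "c \<in> A" "x \<in> fst c" by (rule chart_at)
  have t: "tnorm g x v = cN c (snd c x) (v c)" using tnorm_coord[OF c v] .
  have e: "exp_map A g x v = expc c x (v c)" using exp_map_expc[OF c v, of 1] by simp
  have "cN c (snd c x) (v c - 0) \<le> dist (expc c x (v c)) (expc c x 0)" by (rule expc_expansion[OF c])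
  moreover have "dist (expc c x (0 *\<^sub>R v c)) (expc c x (1 *\<^sub>R v c)) \<le> cN c (snd c x) (v c) * \<bar>0 - 1\<bar>"
    by (rule expc_dist[OF c])
  ultimately show ?thesis using expc_geo(3)[OF c] by (simp add: t e dist_commute)
qed

text \<open>Linear divergence of distinct rays from one point, the quantitative source of uniqueness
  of asymptotic rays.\<close>

lemma rays_diverge:
  assumes "u \<in> T x" "v \<in> T x" "u \<noteq> v"
  shows "\<exists>k>0. \<forall>t\<ge>0. t * k \<le> dist (ray A g x u t) (ray A g x v t)"
proof -
  obtain c where c: "c \<in> A" "x \<in> fst c" by (rule chart_at)
  interpret G: local_geometry "dom c" "Gc c" "DGc c" "\<Gamma>c c" "D\<Gamma>c c" by (rule local_geometry[OF c(1)])
  have xd: "snd c x \<in> dom c" using c by simp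
  define k where "k = cN c (snd c x) (u c - v c)"
  have "u c \<noteq> v c" using tangent_eqI[OF assms(1,2) c] assms(3) by blast
  then have "k > 0" unfolding k_def using G.N_nonneg[OF xd] G.N_zero_iff[OF xd] by (metis eq_iff_diff_eq_0 less_eq_real_def)
  moreover have "t * k \<le> dist (ray A g x u t) (ray A g x v t)" if "t \<ge> 0" for t
  proof -
    have "t * k = cN c (snd c x) (t *\<^sub>R u c - t *\<^sub>R v c)"
      using G.N_scale[of "snd c x" t "u c - v c"] that by (simp add: k_def scaleR_diff_right)
    also have "\<dots> \<le> dist (expc c x (t *\<^sub>R u c)) (expc c x (t *\<^sub>R v c))" by (rule expc_expansion[OF c])
    finally show ?thesis unfolding ray_def using exp_map_expc[OF c] assms(1,2) by simp
  qed
  ultimately show ?thesis by blast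
qed

lemma geo_contraction:
  assumes "geo \<alpha>" "geo \<beta>" "\<alpha> 0 = \<beta> 0" and s: "s \<in> {0..1}"
  shows "dist (\<alpha> s) (\<beta> s) \<le> s * dist (\<alpha> 1) (\<beta> 1)"
proof -
  obtain c where c: "c \<in> A" "\<alpha> 0 \<in> fst c" by (rule chart_at)
  have "\<alpha> t = expc c (\<alpha> 0) (t *\<^sub>R velocity A \<alpha> 0 c)" for t
    using exp_map_geo[OF assms(1), of t] exp_map_expc[OF c geo_velocity[OF assms(1)], of t] by simp
  moreover have "\<beta> t = expc c (\<alpha> 0) (t *\<^sub>R velocity A \<beta> 0 c)" for t
    using exp_map_geo[OF assms(2), of t] exp_map_expc[OF c, of "velocity A \<beta> 0" t] geo_velocity[OF assms(2), of 0] assms(3) by simp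
  ultimately show ?thesis using expc_contraction[OF c s, of "velocity A \<alpha> 0 c" "velocity A \<beta> 0 c"]
    by (metis scaleR_one)
qed

section \<open>Asymptotic rays\<close>

lemma ray_facts:
  assumes u: "u \<in> T x"
  shows "geo (ray A g x u)" "ray A g x u 0 = x" "dist (ray A g x u s) (ray A g x u t) \<le> tnorm g x u * \<bar>s - t\<bar>"
proof -
  note e = exp_geodesic[OF u]
  have r: "ray A g x u = (\<lambda>t. exp_map A g x (tscale t u))" by (simp add: ray_def fun_eq_iff)
  show "geo (ray A g x u)" unfolding r by (rule e(1))
  show 0: "ray A g x u 0 = x" by (simp add: r e(3))
  show "dist (ray A g x u s) (ray A g x u t) \<le> tnorm g x u * \<bar>s - t\<bar>"
    using geo_dist[OF e(1), of s t] 0 e(2) by (simp add: r abs_minus_commute)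
qed

lemma asymptotic_bound: "asymptotic \<alpha> \<beta> \<longleftrightarrow> (\<exists>B. \<forall>t\<ge>0. dist (\<alpha> t) (\<beta> t) \<le> B)"
  unfolding asymptotic_def bounded_iff by auto

text \<open>Two rays from \<open>x\<close> asymptotic to the same ray stay within bounded distance
  of each other, which contradicts their linear divergence.\<close>

lemma asymptotic_unique:
  assumes "u \<in> unit_vectors A g x" "v \<in> unit_vectors A g x" "asymptotic (ray A g x u) \<sigma>" "asymptotic (ray A g x v) \<sigma>"
  shows "u = v"
proof (rule ccontr)
  assume "u \<noteq> v"
  then obtain k where k: "k > 0" "\<forall>t\<ge>0. t * k \<le> dist (ray A g x u t) (ray A g x v t)"
    using rays_diverge assms(1,2) unfolding unit_vectors_def by blast
  obtain B B' where B: "\<forall>t\<ge>0. dist (ray A g x u t) (\<sigma> t) \<le> B" "\<forall>t\<ge>0. dist (ray A g x v t) (\<sigma> t) \<le> B'"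
    using assms(3,4) unfolding asymptotic_bound by blast
  have BB: "0 \<le> B + B'" using B[rule_format, of 0] zero_le_dist order_trans add_nonneg_nonneg by (meson order_refl)
  define t where "t = (B + B' + 1) / k"
  have t: "t \<ge> 0" "t * k = B + B' + 1" using BB k(1) by (auto simp: t_def)
  have "t * k \<le> B + B'"
    using k(2)[rule_format, OF t(1)] B[rule_format, OF t(1)] dist_triangle2[of "ray A g x u t" "ray A g x v t" "\<sigma> t"] by linarith
  then show False using t(2) by simp
qed

text \<open>The directions at \<open>x\<close> of the points of the given ray converge along a subsequence; two geodesics ending
  at a common point stay as close as their starting points.\<close>

lemma asymptotic_exists:
  assumes \<eta>: "\<eta> \<in> unit_vectors A g p"
  shows "\<exists>u\<in>unit_vectors A g x. asymptotic (ray A g p \<eta>) (ray A g x u)"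
proof -
  let ?\<sigma> = "ray A g p \<eta>"
  have \<eta>T: "\<eta> \<in> T p" "tnorm g p \<eta> = 1" using \<eta> by (auto simp: unit_vectors_def)
  note \<sigma> = ray_facts[OF \<eta>T(1), unfolded \<eta>T(2)]
  have \<sigma>dist: "dist p (?\<sigma> t) = t" if "t \<ge> 0" for t
    using dist_exp_map[OF tscale_tangent[OF \<eta>T(1), of t]] tnorm_scale[OF \<eta>T(1), of t] \<eta>T(2) that by (simp add: ray_def)
  define D where "D = dist p x"
  define d where "d n = dist x (?\<sigma> n)" for n :: real
  have d: "\<bar>d n - n\<bar> \<le> D" if "n \<ge> 0" for n
    using \<sigma>dist[OF that] dist_triangle[of x "?\<sigma> n" p] dist_triangle[of p "?\<sigma> n" x] by (auto simp: d_def D_def dist_commute abs_le_iff)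
  \<comment> \<open>The unit direction at \<open>x\<close> towards the point of the given ray at
    parameter \<open>n\<close>. It is a unit vector once \<open>n > D\<close>, which forces
    \<open>d n > 0\<close>.\<close>
  define e where "e n = tscale (1 / d n) (exp_inv A g x (?\<sigma> n))" for n
  have e: "e n \<in> unit_vectors A g x" "ray A g x (e n) (d n) = ?\<sigma> n" if n: "n > D" for n
  proof -
    have D0: "D \<ge> 0" by (simp add: D_def)
    then have dp: "d n > 0" using d[of n] n by (auto simp: abs_le_iff)
    note ei = exp_inv_facts[of x "?\<sigma> n"]
    have "tnorm g x (exp_inv A g x (?\<sigma> n)) = d n" using dist_exp_map[OF ei(1)] ei(2) by (simp add: d_def)
    then show "e n \<in> unit_vectors A g x" unfolding unit_vectors_def e_def using ei(1) tnorm_scale[OF ei(1)] dp by simp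
    show "ray A g x (e n) (d n) = ?\<sigma> n" using dp ei(2) by (simp add: ray_def[of A g x] e_def)
  qed
  have close: "dist (?\<sigma> t) (ray A g x (e n) t) \<le> 2 * D" if n: "n > D" and t: "0 \<le> t" "t \<le> n" for n t
  proof -
    have np: "n > 0" using n zero_le_dist[of p x] unfolding D_def by linarith
    have eT: "e n \<in> T x" "tnorm g x (e n) = 1" using e(1)[OF n] by (auto simp: unit_vectors_def)
    note r = ray_facts[OF eT(1), unfolded eT(2)]
    \<comment> \<open>Both geodesics are reversed and scaled to the unit interval: they start at the
      common point at parameter \<open>n\<close> and end at \<open>p\<close> and \<open>x\<close>,
      which are \<open>D\<close> apart.\<close>
    let ?\<alpha> = "\<lambda>s. ?\<sigma> (- n * s + n)" and ?\<beta> = "\<lambda>s. ray A g x (e n) (- d n * s + d n)"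
    define s where "s = 1 - t / n"
    have s: "s \<in> {0..1}" "- n * s + n = t" "- d n * s + d n = d n * t / n"
      using t np by (auto simp: s_def field_simps)
    have "dist (?\<alpha> s) (?\<beta> s) \<le> s * dist (?\<alpha> 1) (?\<beta> 1)"
      by (rule geo_contraction[OF geo_affine(1)[OF \<sigma>(1)] geo_affine(1)[OF r(1)] _ s(1)]) (use e(2)[OF n] in simp)
    also have "dist (?\<alpha> 1) (?\<beta> 1) = D" using \<sigma>(2) r(2) by (simp add: D_def)
    also have "s * D \<le> 1 * D" using s(1) by (intro mult_right_mono) (auto simp: D_def)
    finally have 1: "dist (?\<sigma> t) (ray A g x (e n) (d n * t / n)) \<le> D" unfolding s(2,3) by simp
    \<comment> \<open>The contraction compares proportional parameters. Returning to unit speed on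
      the second ray costs at most another \<open>D\<close>, since \<open>d n\<close> and
      \<open>n\<close> differ by at most \<open>D\<close>.\<close>
    have "dist (ray A g x (e n) (d n * t / n)) (ray A g x (e n) t) \<le> \<bar>d n * t / n - t\<bar>" using r(3)[of "d n * t / n" t] by simp
    also have "d n * t / n - t = (d n - n) * (t / n)" using np by (simp add: field_simps)
    also have "\<bar>(d n - n) * (t / n)\<bar> \<le> D * 1" unfolding abs_mult using d[of n] np t by (intro mult_mono) auto
    finally show ?thesis using 1 dist_triangle[of "?\<sigma> t" "ray A g x (e n) t" "ray A g x (e n) (d n * t / n)"] by simp
  qed
  obtain c where c: "c \<in> A" "x \<in> fst c" by (rule chart_at)
  interpret G: local_geometry "dom c" "Gc c" "DGc c" "\<Gamma>c c" "D\<Gamma>c c" by (rule local_geometry[OF c(1)])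
  obtain R C where R: "R > 0" "cbounds c (cball (snd c x) R) C" using cbounds_at[OF c] by blast
  note C = cboundsD[OF R(2) c(1)]
  \<comment> \<open>Parameters beyond \<open>D\<close>, so that all directions used are defined and
    of unit length.\<close>
  define m where "m n = D + 1 + real n" for n :: nat
  have m: "m n > D" for n by (simp add: m_def)
  have em: "e (m n) \<in> T x" "tnorm g x (e (m n)) = 1" for n using e(1)[OF m] by (auto simp: unit_vectors_def)
  \<comment> \<open>In a chart at \<open>x\<close> the unit directions are bounded vectors of a
    Euclidean space, so a subsequence converges; its limit is again a unit vector by continuity of
    the norm.\<close>
  define w where "w n = e (m n) c" for n
  have Nw: "cN c (snd c x) (w n) = 1" for n using tnorm_coord[OF c em(1)] em(2) by (simp add: w_def)
  have "bounded (range w)"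
  proof (rule boundedI)
    fix y assume "y \<in> range w"
    then obtain n where "y = w n" by blast
    then show "norm y \<le> C" using C(6)[of "snd c x" "w n"] R(1) Nw by simp
  qed
  then obtain w0 k where k: "strict_mono k" "(w \<circ> k) \<longlonglongrightarrow> w0"
    using bounded_imp_convergent_subsequence by blast
  have "(\<lambda>n. cN c (snd c x) ((w \<circ> k) n)) \<longlonglongrightarrow> cN c (snd c x) w0"
    unfolding G.N_def by (intro tendsto_intros blinfun.tendsto k(2))
  then have N0: "cN c (snd c x) w0 = 1" using Nw LIMSEQ_unique[OF _ tendsto_const] by (simp add: o_def)
  define u where "u = tvec_of A c x w0"
  have uT: "u \<in> T x" "u c = w0" using c by (auto simp: u_def)
  have "u \<in> unit_vectors A g x" using uT N0 tnorm_coord[OF c uT(1)] by (simp add: unit_vectors_def)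
  moreover have "dist (?\<sigma> t) (ray A g x u t) \<le> 2 * D" if t: "t \<ge> 0" for t
  proof -
    have "(\<lambda>n. expc c x (t *\<^sub>R (w \<circ> k) n)) \<longlonglongrightarrow> expc c x (t *\<^sub>R w0)"
      by (rule continuous_on_tendsto_compose[OF expc_continuous[OF c, of UNIV]]) (use k(2) in \<open>auto intro!: tendsto_intros simp: o_def\<close>)
    then have "(\<lambda>n. dist (?\<sigma> t) (expc c x (t *\<^sub>R (w \<circ> k) n))) \<longlonglongrightarrow> dist (?\<sigma> t) (expc c x (t *\<^sub>R w0))"
      by (intro tendsto_intros)
    moreover have "\<forall>\<^sub>F n in sequentially. dist (?\<sigma> t) (expc c x (t *\<^sub>R (w \<circ> k) n)) \<le> 2 * D"
    proof -
      obtain N :: nat where N: "t \<le> real N" using real_arch_simple by blast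
      have "dist (?\<sigma> t) (expc c x (t *\<^sub>R (w \<circ> k) n)) \<le> 2 * D" if n: "n \<ge> N" for n
      proof -
        have "real n \<le> real (k n)" using seq_suble[OF k(1)] by simp
        then have "t \<le> m (k n)" using N n zero_le_dist[of p x] unfolding m_def D_def by linarith
        from close[OF m t this] show ?thesis
          using exp_map_expc[OF c em(1), of t "k n"] by (simp add: ray_def w_def)
      qed
      then show ?thesis unfolding eventually_sequentially by blast
    qed
    ultimately have "dist (?\<sigma> t) (expc c x (t *\<^sub>R w0)) \<le> 2 * D" using tendsto_upperbound trivial_limit_sequentially by blast
    then show ?thesis using exp_map_expc[OF c uT(1), of t] uT(2) by (simp add: ray_def)
  qed
  ultimately show ?thesis unfolding asymptotic_bound by blast
qed

section \<open>Subgradients\<close>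

lemma asymptotic_commute: "asymptotic \<alpha> \<beta> \<longleftrightarrow> asymptotic \<beta> \<alpha>"
  by (simp add: asymptotic_bound dist_commute)

text \<open>\<open>u_dir\<close> and \<open>eta_dir\<close> are determined by the same relation
  between a ray from \<open>p\<close> and a reversed ray from \<open>x\<close>, so each undoes the
  other once rays asymptotic to a given one exist and are unique. The distance from \<open>p\<close>
  to \<open>y\<close> is carried along as the length of the vector.\<close>

lemma V_vec_Y_point: "V_vec A g p x y \<in> T x \<and> Y_point A g p x (V_vec A g p x y) = y"
proof (cases "y = p")
  \<comment> \<open>Both constructions use matching default values: the zero vector corresponds to
    the point \<open>p\<close>.\<close>
  case True
  then show ?thesis by (simp add: V_vec_def Y_point_def)
next
  case False
  define r where "r = dist p y"
  have r: "r > 0" using False by (simp add: r_def)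
  note ei = exp_inv_facts[of p y]
  have ti: "tnorm g p (exp_inv A g p y) = r" using dist_exp_map[OF ei(1)] ei(2) by (simp add: r_def)
  define \<eta> where "\<eta> = eta_point A g p y"
  have \<eta>: "\<eta> \<in> unit_vectors A g p" unfolding \<eta>_def eta_point_def unit_vectors_def r_def[symmetric]
    using ei(1) tnorm_scale[OF ei(1)] ti r by simp
  obtain u' where u': "u' \<in> unit_vectors A g x" "asymptotic (ray A g p \<eta>) (ray A g x u')"
    using asymptotic_exists[OF \<eta>] by blast
  define u where "u = u_dir A g p x y"
  have neg: "tscale (- 1) v \<in> unit_vectors A g x" if "v \<in> unit_vectors A g x" for v
    using that by (auto simp: unit_vectors_def tnorm_scale)
  have "\<exists>!u. u \<in> unit_vectors A g x \<and> asymptotic (ray A g p \<eta>) (ray A g x (tscale (- 1) u))"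
  proof (rule ex1I[of _ "tscale (- 1) u'"])
    show "tscale (- 1) u' \<in> unit_vectors A g x \<and> asymptotic (ray A g p \<eta>) (ray A g x (tscale (- 1) (tscale (- 1) u')))"
      using neg u' by simp
    fix v assume v: "v \<in> unit_vectors A g x \<and> asymptotic (ray A g p \<eta>) (ray A g x (tscale (- 1) v))"
    have "tscale (- 1) v = u'"
      by (rule asymptotic_unique[of _ x _ "ray A g p \<eta>"]) (use v u' neg asymptotic_commute in auto)
    then show "v = tscale (- 1) u'" by auto
  qed
  from theI'[OF this] have u: "u \<in> unit_vectors A g x" "asymptotic (ray A g p \<eta>) (ray A g x (tscale (- 1) u))"
    unfolding u_def u_dir_def \<eta>_def by auto
  have uT: "u \<in> T x" "tnorm g x u = 1" using u(1) by (auto simp: unit_vectors_def)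
  have V: "V_vec A g p x y = tscale r u" using False by (simp add: V_vec_def r_def u_def)
  have tV: "tnorm g x (tscale r u) = r" using tnorm_scale[OF uT(1)] uT(2) r by simp
  then have V0: "tscale r u \<noteq> tzero" using r by auto
  have "eta_dir A g p x (tscale r u) = \<eta>"
    unfolding eta_dir_def
  proof (rule the_equality)
    have n: "normalized g x (tscale r u) = u" unfolding normalized_def tV using r by simp
    show "\<eta> \<in> unit_vectors A g p \<and> asymptotic (ray A g p \<eta>) (ray A g x (tscale (- 1) (normalized g x (tscale r u))))"
      using \<eta> u(2) n by simp
    fix e assume e: "e \<in> unit_vectors A g p \<and> asymptotic (ray A g p e) (ray A g x (tscale (- 1) (normalized g x (tscale r u))))"
    show "e = \<eta>" by (rule asymptotic_unique) (use e \<eta> u(2) n in auto)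
  qed
  then have "Y_point A g p x (tscale r u) = exp_map A g p (tscale (- r) \<eta>)" using V0 tV by (simp add: Y_point_def)
  also have "tscale (- r) \<eta> = exp_inv A g p y" unfolding \<eta>_def eta_point_def r_def[symmetric] using r by simp
  finally show ?thesis using V uT(1) ei(2) by simp
qed

end

theorem corollary17:
  fixes A :: "('a::polish_space, 'e::euclidean_space) chart set"
    and g :: "('a, 'e) metric"
    and p :: 'a and m :: nat
    and y :: "nat \<Rightarrow> 'a" and a :: "nat \<Rightarrow> real"
    and f :: "'a \<Rightarrow> real"
  assumes hadamard: "hadamard_manifold A g"
    and m: "m \<ge> 1"
    and f: "\<And>z. f z = Max ((\<lambda>i. coupling A g p z (y i) - a i) ` {1..m})"
  shows "(\<forall>x. subdifferential A g p f x \<noteq> {}) \<and>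
    (\<forall>x. \<forall>i. is_arg_max (\<lambda>j. coupling A g p x (y j) - a j) (\<lambda>j. j \<in> {1..m}) i
        \<longrightarrow> V_vec A g p x (y i) \<in> subdifferential A g p f x)"
proof -
  interpret hadamard A g by unfold_locales (rule hadamard)
  have sub: "V_vec A g p x (y i) \<in> subdifferential A g p f x"
    if i: "is_arg_max (\<lambda>j. coupling A g p x (y j) - a j) (\<lambda>j. j \<in> {1..m}) i" for x i
  proof -
    have im: "i \<in> {1..m}" using i by (simp add: is_arg_max_def)
    have "f x \<le> coupling A g p x (y i) - a i" unfolding f
      using i im by (subst Max_le_iff) (auto simp: is_arg_max_linorder)
    moreover have "coupling A g p z (y i) - a i \<le> f z" for z unfolding f using im by (intro Max_ge) auto
    ultimately have "f x + coupling A g p z (y i) - coupling A g p x (y i) \<le> f z" for z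
      using add_mono[of "f x" "coupling A g p x (y i) - a i" "coupling A g p z (y i) - a i" "f z"] by simp
    then show ?thesis using V_vec_Y_point[of p x "y i"] by (simp add: subdifferential_def)
  qed
  moreover have "\<exists>i. is_arg_max (\<lambda>j. coupling A g p x (y j) - a j) (\<lambda>j. j \<in> {1..m}) i" for x
  proof -
    \<comment> \<open>A maximum over a finite nonempty set is attained, so an active index
      exists.\<close>
    have "f x \<in> (\<lambda>i. coupling A g p x (y i) - a i) ` {1..m}" unfolding f using m by (intro Max_in) auto
    then obtain i where i: "i \<in> {1..m}" "f x = coupling A g p x (y i) - a i" by blast
    have "coupling A g p x (y j) - a j \<le> f x" if "j \<in> {1..m}" for j unfolding f using that by (intro Max_ge) auto
    then show ?thesis using i by (auto simp: is_arg_max_linorder)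
  qed
  ultimately show ?thesis by blast
qed

end
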